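(* There is an absolute constant $C>0$, and for every $\beta>1$ there are constants $c_1,c_2>0$ depending only on $\beta$, such that the following holds. Let $\mathcal X\in\mathbb R^{n_1\times n_2\times n_3}$ be nonzero with $\operatorname{rank}_t(\mathcal X)=\mathbf r$, $\operatorname{rank}_{ct}(\mathcal X)=r$ and condition number $\kappa$, satisfying the tensor incoherence conditions with parameter $\mu_0$ and the tensor joint incoherence condition with constant $\mu_1$. Let $n=\max\{n_1,n_2,n_3\}\ge2$, $n_{(1)}=\max\{n_1,n_2\}$, $n_{(2)}=\min\{n_1,n_2\}$. Let $k_1,k_2\ge0$ and $0<\epsilon_0<1$ satisfy $(1-4\epsilon_0)-k_1(1+4\epsilon_0)>0$ and $\gamma_1+\gamma_2<1$, where $$\gamma_1=\frac{18\epsilon_0-10k_1\epsilon_0(1+4\epsilon_0)}{(1-4\epsilon_0)-k_1(1+4\epsilon_0)}+\frac{4k_2\epsilon_0+k_1k_2}{1-4\epsilon_0},\qquad \gamma_2=\frac{8k_2\epsilon_0+2k_1k_2}{1-4\epsilon_0}.$$ Let $\Omega$ consist of $m\le n_1n_2n_3$ indices sampled independently and uniformly with replacement from $\{1,\dots,n_1\}\times\{1,\dots,n_2\}\times\{1,\dots,n_3\}$, let $p=m/(n_1n_2n_3)$ and $\mathcal X_0=H_{\mathbf r}(p^{-1}R_\Omega(\mathcal X))$. If $$m\ \ge\ C\max\left\{\frac{\mu_0r}{\epsilon_0^2}\log^{1/2}(n_{(1)}n_3),\ \frac{\mu_1r(1+\epsilon_0)\kappa\beta^{1/2}}{\epsilon_0}\,n_{(2)}^{1/2}\log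 n\right\}\beta\, n_{(1)}n_3\log^{1/2}(n_{(1)}n_3),$$ then, with probability at least $1-c_1(n_{(1)}n_3)^{-c_2}$, the iterates of the restarted tensor Riemannian conjugate gradient descent method (with restart parameters $k_1,k_2$) started at $\mathcal X_0$ converge to $\mathcal X$.
   Context: Tensor notation. $\widehat{\mathcal A}$ is obtained from $\mathcal A\in\mathbb R^{n_1\times n_2\times n_3}$ by applying the orthonormal DCT (a real orthogonal $n_3\times n_3$ matrix) to every tube $\mathcal A(i,j,:)$; $\widehat{\mathcal A}^{(k)}$ is the $k$-th frontal slice of $\widehat{\mathcal A}$; $\overline{\mathcal A}$ is the block diagonal matrix with blocks $\widehat{\mathcal A}^{(1)},\dots,\widehat{\mathcal A}^{(n_3)}$. $\mathcal A*\mathcal B$ and $\mathcal A^T$ are defined slicewise: $\widehat{\mathcal A*\mathcal B}^{(k)}=\widehat{\mathcal A}^{(k)}\widehat{\mathcal B}^{(k)}$, $\widehat{\mathcal A^T}^{(k)}=(\widehat{\mathcal A}^{(k)})^T$. $\langle\cdot,\cdot\rangle$, $\|\cdot\|_F$: entrywise Euclidean inner product and norm; $\|\mathcal A\|_\infty$: maximal absolute entry; $\|\mathcal A\|$: matrix spectral norm of $\overline{\mathcal A}$. $\operatorname{rank}_t(\mathcal A)=(\operatorname{rank}\widehat{\mathcal A}^{(k)})_{k=1}^{n_3}$ and $\operatorname{rank}_{ct}(\mathcal A)=\max_k\operatorname{rank}\widehat{\mathcal A}^{(k)}$. $\kappa$ is the ratio of the largest to the smallest nonzero singular value of $\overline{\mathcal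 X}$. Skinny t$_c$-SVD. If $\operatorname{rank}_t(\mathcal A)=\mathbf r=(r_1,\dots,r_{n_3})$, $r=\max_kr_k$: $\mathcal A=\mathcal U*\mathcal S*\mathcal V^T$, $\mathcal U\in\mathbb R^{n_1\times r\times n_3}$, $\mathcal V\in\mathbb R^{n_2\times r\times n_3}$, $\mathcal U^T*\mathcal U=\mathcal V^T*\mathcal V=\mathcal I_{\mathbf r}$ with $\widehat{\mathcal I_{\mathbf r}}^{(k)}=\mathrm{diag}(I_{r_k},0)$, $\mathcal S$ with diagonal frontal slices (slicewise SVD in the DCT domain). Incoherence. $\vec{\mathbf e}_i$ (transformed column basis) is the tensor with one lateral slice (size $n_1\times1\times n_3$ or $n_2\times 1\times n_3$) whose DCT has $i$-th tube with all entries $1/\sqrt{n_3}$ and all other tubes zero. $\mathcal X=\mathcal U*\mathcal S*\mathcal V^T$ (skinny) satisfies the tensor incoherence conditions with parameter $\mu_0>0$ if $\max_{i\le n_1}\|\mathcal U^T*\vec{\mathbf e}_i\|_F\le\sqrt{\mu_0r/n_1}$ and $\max_{j\le n_2}\|\mathcal V^T*\vec{\mathbf e}_j\|_F\le\sqrt{\mu_0r/n_2}$. It satisfies the joint incoherence condition with $\mu_1>0$ if $\|\mathcal X\|_\infty\le\mu_1\sqrt{r/(n_1n_2n_3)}\,\|\mathcal X\|$. Manifold. $\mathcal M_{\mathbf r}=\{\mathcal Z:\operatorname{rank}_t(\mathcal Z)=\mathbf r\}$. The tangent space at a point with skinny t$_c$-SVD $\mathcal U*\mathcal S*\mathcal V^T$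 is $\{\mathcal U*\mathcal Z_1^T+\mathcal Z_2*\mathcal V^T\}$, $\mathcal Z_1\in\mathbb R^{n_2\times r\times n_3}$, $\mathcal Z_2\in\mathbb R^{n_1\times r\times n_3}$ arbitrary, with orthogonal projection $P(\mathcal A)=\mathcal U*\mathcal U^T*\mathcal A+\mathcal A*\mathcal V*\mathcal V^T-\mathcal U*\mathcal U^T*\mathcal A*\mathcal V*\mathcal V^T$. $H_{\mathbf r}$ replaces each $\widehat{\mathcal W}^{(k)}$ by its best rank-$r_k$ approximation (truncated SVD). Sampling operator. $R_\Omega(\mathcal Z)=\sum_{(i,j,k)\in\Omega}\langle\mathcal E_{ijk},\mathcal Z\rangle\mathcal E_{ijk}$, counted with multiplicity, where $\mathcal E_{ijk}$ has a $1$ at $(i,j,k)$ and zeros elsewhere. Restarted tensor Riemannian conjugate gradient descent. Start from $\mathcal X_0\in\mathcal M_{\mathbf r}$, $\mathcal Q_{-1}=0$, $\beta_0=0$. For $l=0,1,\dots$, with $\mathcal T_l$ the tangent space of $\mathcal M_{\mathbf r}$ at $\mathcal X_l$: (1) $\mathcal G_l=R_\Omega(\mathcal X-\mathcal X_l)$; (2) for $l\ge1$, $\beta_l=-\frac{\langle P_{\mathcal T_l}(\mathcal G_l),R_\Omega P_{\mathcal T_l}(\mathcal Q_{l-1})\rangle}{\langle P_{\mathcal T_l}(\mathcal Q_{l-1}),R_\Omega P_{\mathcal T_l}(\mathcal Q_{l-1})\rangle}$ if both $\frac{|\langle P_{\mathcal T_l}(\mathcal G_l),P_{\mathcal T_l}(\mathcal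 Q_{l-1})\rangle|}{\|P_{\mathcal T_l}(\mathcal G_l)\|_F\|P_{\mathcal T_l}(\mathcal Q_{l-1})\|_F}\le k_1$ and $\|P_{\mathcal T_l}(\mathcal G_l)\|_F\le k_2\|P_{\mathcal T_l}(\mathcal Q_{l-1})\|_F$ hold, and $\beta_l=0$ otherwise (also if the quotient is undefined); (3) $\mathcal Q_l=P_{\mathcal T_l}(\mathcal G_l)+\beta_lP_{\mathcal T_l}(\mathcal Q_{l-1})$; (4) $\alpha_l=\frac{\langle P_{\mathcal T_l}(\mathcal G_l),P_{\mathcal T_l}(\mathcal Q_l)\rangle}{\langle P_{\mathcal T_l}(\mathcal Q_l),R_\Omega P_{\mathcal T_l}(\mathcal Q_l)\rangle}$; (5) $\mathcal W_l=\mathcal X_l+\alpha_l\mathcal Q_l$; (6) $\mathcal X_{l+1}=H_{\mathbf r}(\mathcal W_l)$. If $P_{\mathcal T_l}(\mathcal G_l)=0$ the method stops and all later iterates are taken equal to $\mathcal X_l$. (These probabilistic events include that $\mathcal X_0\in\mathcal M_{\mathbf r}$ and that the iterates are well defined.) *)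

theory Defs
  imports
    "HOL-Analysis.Analysis"
    "HOL-Probability.Probability"
    "Jordan_Normal_Form.Char_Poly"
    "Jordan_Normal_Form.DL_Rank"
begin

section \<open>Real matrices of arbitrary size\<close>

definition mat_rank :: "real mat \<Rightarrow> nat" where
  "mat_rank A = vec_space.rank (dim_row A) A"

definition singular_values :: "real mat \<Rightarrow> real set" where
  "singular_values A = {sqrt e | e. eigenvalue (transpose_mat A * A) e}"

definition spectral_norm :: "real mat \<Rightarrow> real" where
  "spectral_norm A = Max (singular_values A)"

definition nonincreasing_diag :: "real mat \<Rightarrow> bool" where
  "nonincreasing_diag S \<longleftrightarrow>
     diagonal_mat S \<and>
     (\<forall>i < dim_row S. 0 \<le> S $$ (i,i)) \<and>
     (\<forall>j < dim_row S. \<forall>i \<le> j. S $$ (j,j) \<le> S $$ (i,i))"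

definition is_svd :: "real mat \<Rightarrow> real mat \<Rightarrow> real mat \<Rightarrow> real mat \<Rightarrow> bool" where
  "is_svd A U S V \<longleftrightarrow>
     (let q = min (dim_row A) (dim_col A) in
        U \<in> carrier_mat (dim_row A) q \<and> S \<in> carrier_mat q q \<and> V \<in> carrier_mat (dim_col A) q \<and>
        transpose_mat U * U = 1\<^sub>m q \<and> transpose_mat V * V = 1\<^sub>m q \<and>
        nonincreasing_diag S \<and> A = U * S * transpose_mat V)"

definition truncate_diag :: "nat \<Rightarrow> real mat \<Rightarrow> real mat" where
  "truncate_diag r S =
     mat (dim_row S) (dim_col S) (\<lambda>(i,j). if i = j \<and> i < r then S $$ (i,j) else 0)"

text \<open>A relation rather than a function: if the \<open>r\<close>-th and the next singular value of \<open>A\<close> coincide,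
  several matrices are truncated singular value decompositions (best rank-\<open>r\<close> approximations)
  of \<open>A\<close>.\<close>

definition is_truncated_svd :: "nat \<Rightarrow> real mat \<Rightarrow> real mat \<Rightarrow> bool" where
  "is_truncated_svd r A B \<longleftrightarrow>
     (\<exists>U S V. is_svd A U S V \<and> B = U * truncate_diag r S * transpose_mat V)"


section \<open>Third-order tensors\<close>

text \<open>A tensor is the list of its frontal slices; all indices start at 0, so the entry at
  \<open>(i,j,k)\<close> is \<open>A ! k $$ (i,j)\<close>. The operations below read off the first two dimensions from the
  slice \<open>A ! 0\<close>, so they are meaningful on elements of \<open>tensors n1 n2 n3\<close> with \<open>n3 > 0\<close>.\<close>

type_synonym tensor = "real mat list"

definition tensors :: "nat \<Rightarrow> nat \<Rightarrow> nat \<Rightarrow> tensor set" where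
  "tensors n1 n2 n3 = {A. length A = n3 \<and> set A \<subseteq> carrier_mat n1 n2}"

definition nrows :: "tensor \<Rightarrow> nat" where "nrows A = dim_row (A ! 0)"
definition ncols :: "tensor \<Rightarrow> nat" where "ncols A = dim_col (A ! 0)"

definition tzero :: "nat \<Rightarrow> nat \<Rightarrow> nat \<Rightarrow> tensor" where
  "tzero n1 n2 n3 = replicate n3 (0\<^sub>m n1 n2)"

definition tadd :: "tensor \<Rightarrow> tensor \<Rightarrow> tensor" where "tadd A B = map2 (+) A B"
definition tsub :: "tensor \<Rightarrow> tensor \<Rightarrow> tensor" where "tsub A B = map2 (-) A B"
definition tscale :: "real \<Rightarrow> tensor \<Rightarrow> tensor" where "tscale c A = map (\<lambda>M. c \<cdot>\<^sub>m M) A"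

definition tinner :: "tensor \<Rightarrow> tensor \<Rightarrow> real" where
  "tinner A B =
     (\<Sum>k<length A. \<Sum>i<nrows A. \<Sum>j<ncols A. (A ! k) $$ (i,j) * (B ! k) $$ (i,j))"

definition fnorm :: "tensor \<Rightarrow> real" where "fnorm A = sqrt (tinner A A)"

definition max_norm :: "tensor \<Rightarrow> real" where
  "max_norm A = Max {\<bar>(A ! k) $$ (i,j)\<bar> | i j k. i < nrows A \<and> j < ncols A \<and> k < length A}"


section \<open>The transform domain\<close>

text \<open>The orthonormal discrete cosine transform (DCT-II).\<close>

definition dct_mat :: "nat \<Rightarrow> real mat" where
  "dct_mat n = mat n n (\<lambda>(k,l).
     sqrt ((if k = 0 then 1 else 2) / real n) *
     cos (pi * (2 * real l + 1) * real k / (2 * real n)))"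

definition tube :: "tensor \<Rightarrow> nat \<Rightarrow> nat \<Rightarrow> real vec" where
  "tube A i j = vec (length A) (\<lambda>k. (A ! k) $$ (i,j))"

definition transform_tubes :: "real mat \<Rightarrow> tensor \<Rightarrow> tensor" where
  "transform_tubes M A =
     map (\<lambda>k. mat (nrows A) (ncols A) (\<lambda>(i,j). vec_index (M *\<^sub>v tube A i j) k)) [0..<length A]"

definition dct :: "tensor \<Rightarrow> tensor" where
  "dct A = transform_tubes (dct_mat (length A)) A"

text \<open>The DCT matrix is orthogonal, so its transpose inverts it.\<close>

definition idct :: "tensor \<Rightarrow> tensor" where
  "idct A = transform_tubes (transpose_mat (dct_mat (length A))) A"

definition tprod :: "tensor \<Rightarrow> tensor \<Rightarrow> tensor" (infixl "\<star>" 70) where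
  "A \<star> B = idct (map2 (*) (dct A) (dct B))"

definition ttranspose :: "tensor \<Rightarrow> tensor" where
  "ttranspose A = idct (map transpose_mat (dct A))"

definition block_diag :: "tensor \<Rightarrow> real mat" where
  "block_diag A = diag_block_mat (dct A)"

definition tspectral_norm :: "tensor \<Rightarrow> real" where
  "tspectral_norm A = spectral_norm (block_diag A)"

definition rank_t :: "tensor \<Rightarrow> nat list" where
  "rank_t A = map mat_rank (dct A)"

definition rank_ct :: "tensor \<Rightarrow> nat" where
  "rank_ct A = Max (set (rank_t A))"

definition condition_number :: "tensor \<Rightarrow> real" where
  "condition_number A =
     (let \<Sigma> = singular_values (block_diag A) - {0} in Max \<Sigma> / Min \<Sigma>)"


section \<open>Skinny t-SVD, incoherence, tangent spaces\<close>

definition tidentity :: "nat list \<Rightarrow> tensor" where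
  "tidentity rs =
     idct (map (\<lambda>s. mat (Max (set rs)) (Max (set rs)) (\<lambda>(i,j). if i = j \<and> i < s then 1 else 0)) rs)"

text \<open>In the transform domain the \<open>k\<close>-th slice of \<open>S\<close> carries the \<open>rank_t A ! k\<close> positive singular
  values of the \<open>k\<close>-th slice of \<open>A\<close>, padded with zeros.\<close>

definition is_skinny_tsvd :: "tensor \<Rightarrow> tensor \<Rightarrow> tensor \<Rightarrow> tensor \<Rightarrow> bool" where
  "is_skinny_tsvd A U S V \<longleftrightarrow>
     (let n1 = nrows A; n2 = ncols A; n3 = length A; rs = rank_t A; r = rank_ct A in
        U \<in> tensors n1 r n3 \<and> S \<in> tensors r r n3 \<and> V \<in> tensors n2 r n3 \<and>
        ttranspose U \<star> U = tidentity rs \<and> ttranspose V \<star> V = tidentity rs \<and>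
        (\<forall>k<n3. nonincreasing_diag (dct S ! k) \<and>
                (\<forall>i<r. 0 < (dct S ! k) $$ (i,i) \<longleftrightarrow> i < rs ! k)) \<and>
        A = U \<star> S \<star> ttranspose V)"

definition column_basis :: "nat \<Rightarrow> nat \<Rightarrow> nat \<Rightarrow> tensor" where
  "column_basis n n3 i =
     idct (replicate n3 (mat n 1 (\<lambda>(a,_). if a = i then 1 / sqrt (real n3) else 0)))"

text \<open>The conditions are on the factors \<open>U\<close> (of size \<open>n1 \<times> r \<times> n3\<close>) and \<open>V\<close>
  (of size \<open>n2 \<times> r \<times> n3\<close>) of a skinny t-SVD.\<close>

definition tensor_incoherent :: "real \<Rightarrow> tensor \<Rightarrow> tensor \<Rightarrow> bool" where
  "tensor_incoherent \<mu>0 U V \<longleftrightarrow>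
     (\<forall>i < nrows U. fnorm (ttranspose U \<star> column_basis (nrows U) (length U) i)
                      \<le> sqrt (\<mu>0 * real (ncols U) / real (nrows U))) \<and>
     (\<forall>j < nrows V. fnorm (ttranspose V \<star> column_basis (nrows V) (length V) j)
                      \<le> sqrt (\<mu>0 * real (ncols V) / real (nrows V)))"

definition joint_incoherent :: "real \<Rightarrow> tensor \<Rightarrow> bool" where
  "joint_incoherent \<mu>1 A \<longleftrightarrow>
     max_norm A \<le> \<mu>1 * sqrt (real (rank_ct A) / (real (nrows A) * real (ncols A) * real (length A)))
                     * tspectral_norm A"

definition fixed_rank_manifold :: "nat \<Rightarrow> nat \<Rightarrow> nat list \<Rightarrow> tensor set" where
  "fixed_rank_manifold n1 n2 rs = {Z \<in> tensors n1 n2 (length rs). rank_t Z = rs}"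

text \<open>The orthogonal projection onto the tangent space
  \<open>{U \<star> ttranspose Z1 + Z2 \<star> ttranspose V}\<close> at \<open>Z = U \<star> S \<star> ttranspose V\<close>. It depends on
  \<open>U\<close> and \<open>V\<close> only through \<open>U \<star> ttranspose U\<close> and \<open>V \<star> ttranspose V\<close>, hence not on the choice of
  the skinny t-SVD of \<open>Z\<close>.\<close>

definition tangent_proj :: "tensor \<Rightarrow> tensor \<Rightarrow> tensor" where
  "tangent_proj Z A =
     (let (U, S, V) = (SOME (U, S, V). is_skinny_tsvd Z U S V);
          Ut = ttranspose U; Vt = ttranspose V
      in tsub (tadd (U \<star> Ut \<star> A) (A \<star> V \<star> Vt)) (U \<star> Ut \<star> A \<star> V \<star> Vt))"

text \<open>\<open>Y\<close> is a value of \<open>H\<^sub>r\<^sub>s(W)\<close>.\<close>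

definition is_hard_threshold :: "nat list \<Rightarrow> tensor \<Rightarrow> tensor \<Rightarrow> bool" where
  "is_hard_threshold rs W Y \<longleftrightarrow>
     (\<exists>B. length B = length W \<and>
          (\<forall>k<length W. is_truncated_svd (rs ! k) (dct W ! k) (B ! k)) \<and> Y = idct B)"


section \<open>Sampling\<close>

definition unit_tensor :: "nat \<Rightarrow> nat \<Rightarrow> nat \<Rightarrow> nat \<times> nat \<times> nat \<Rightarrow> tensor" where
  "unit_tensor n1 n2 n3 = (\<lambda>(i,j,k).
     map (\<lambda>l. mat n1 n2 (\<lambda>(a,b). if a = i \<and> b = j \<and> l = k then 1 else 0)) [0..<n3])"

text \<open>Samples with replacement are lists of indices, so repeated indices count repeatedly.\<close>

definition sampling_op :: "(nat \<times> nat \<times> nat) list \<Rightarrow> tensor \<Rightarrow> tensor" where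
  "sampling_op \<Omega> Z =
     (let n1 = nrows Z; n2 = ncols Z; n3 = length Z in
      foldr (\<lambda>e. tadd (tscale (tinner (unit_tensor n1 n2 n3 e) Z) (unit_tensor n1 n2 n3 e)))
        \<Omega> (tzero n1 n2 n3))"

definition uniform_samples :: "nat \<Rightarrow> nat \<Rightarrow> nat \<Rightarrow> nat \<Rightarrow> (nat \<times> nat \<times> nat) list pmf" where
  "uniform_samples m n1 n2 n3 = replicate_pmf m (pmf_of_set ({..<n1} \<times> {..<n2} \<times> {..<n3}))"


section \<open>Restarted tensor Riemannian conjugate gradient descent\<close>

text \<open>In this section \<open>X\<close> is the target, \<open>Xs l\<close> and \<open>Qs l\<close> are the iterate and the search direction
  of step \<open>l\<close>, and
  \<^item> \<open>PG l\<close> is the projected gradient (of the residual on the samples),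
  \<^item> \<open>PQ' l\<close> is the projection of the previous direction, the direction before step 0 being zero,
  \<^item> \<open>PQ l\<close> is the projection of the current direction,
  all three onto the tangent space at \<open>Xs l\<close>.\<close>

definition proj_grad ::
  "(nat \<times> nat \<times> nat) list \<Rightarrow> tensor \<Rightarrow> (nat \<Rightarrow> tensor) \<Rightarrow> nat \<Rightarrow> tensor" where
  "proj_grad \<Omega> X Xs l = tangent_proj (Xs l) (sampling_op \<Omega> (tsub X (Xs l)))"

definition prev_dir :: "tensor \<Rightarrow> (nat \<Rightarrow> tensor) \<Rightarrow> nat \<Rightarrow> tensor" where
  "prev_dir X Qs l = (if l = 0 then tzero (nrows X) (ncols X) (length X) else Qs (l - 1))"

definition rcg_beta ::
  "real \<Rightarrow> real \<Rightarrow> (nat \<times> nat \<times> nat) list \<Rightarrow> tensor \<Rightarrow> (nat \<Rightarrow> tensor) \<Rightarrow> (nat \<Rightarrow> tensor) \<Rightarrow> nat \<Rightarrow> real"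
where
  "rcg_beta k1 k2 \<Omega> X Xs Qs l =
     (let PG = proj_grad \<Omega> X Xs l;
          PQ' = tangent_proj (Xs l) (prev_dir X Qs l);
          d = tinner PQ' (sampling_op \<Omega> PQ')
      in if l \<ge> 1 \<and> d \<noteq> 0 \<and>
            \<bar>tinner PG PQ'\<bar> / (fnorm PG * fnorm PQ') \<le> k1 \<and> fnorm PG \<le> k2 * fnorm PQ'
         then - (tinner PG (sampling_op \<Omega> PQ') / d) else 0)"

definition rcg_alpha_denom ::
  "(nat \<times> nat \<times> nat) list \<Rightarrow> (nat \<Rightarrow> tensor) \<Rightarrow> (nat \<Rightarrow> tensor) \<Rightarrow> nat \<Rightarrow> real" where
  "rcg_alpha_denom \<Omega> Xs Qs l =
     (let PQ = tangent_proj (Xs l) (Qs l) in tinner PQ (sampling_op \<Omega> PQ))"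

definition rcg_alpha ::
  "(nat \<times> nat \<times> nat) list \<Rightarrow> tensor \<Rightarrow> (nat \<Rightarrow> tensor) \<Rightarrow> (nat \<Rightarrow> tensor) \<Rightarrow> nat \<Rightarrow> real" where
  "rcg_alpha \<Omega> X Xs Qs l =
     tinner (proj_grad \<Omega> X Xs l) (tangent_proj (Xs l) (Qs l)) / rcg_alpha_denom \<Omega> Xs Qs l"

definition rcg_stops ::
  "(nat \<times> nat \<times> nat) list \<Rightarrow> tensor \<Rightarrow> (nat \<Rightarrow> tensor) \<Rightarrow> nat \<Rightarrow> bool" where
  "rcg_stops \<Omega> X Xs l \<longleftrightarrow>
     proj_grad \<Omega> X Xs l = tzero (nrows X) (ncols X) (length X)"

text \<open>Once the method stops, the iterate, and with it the projected gradient, no longer changes;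
  the values of \<open>Qs\<close> from then on have no influence.\<close>

definition is_rcg_run ::
  "nat list \<Rightarrow> real \<Rightarrow> real \<Rightarrow> (nat \<times> nat \<times> nat) list \<Rightarrow> tensor \<Rightarrow> (nat \<Rightarrow> tensor) \<Rightarrow> (nat \<Rightarrow> tensor) \<Rightarrow> bool"
where
  "is_rcg_run rs k1 k2 \<Omega> X Xs Qs \<longleftrightarrow>
     (\<forall>l. Qs l = tadd (proj_grad \<Omega> X Xs l)
                      (tscale (rcg_beta k1 k2 \<Omega> X Xs Qs l) (tangent_proj (Xs l) (prev_dir X Qs l))) \<and>
          (if rcg_stops \<Omega> X Xs l then Xs (Suc l) = Xs l
           else is_hard_threshold rs (tadd (Xs l) (tscale (rcg_alpha \<Omega> X Xs Qs l) (Qs l)))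
                  (Xs (Suc l))))"

text \<open>All iterates lie on the manifold, so that their tangent spaces make sense, and no step
  size has a vanishing denominator.\<close>

definition rcg_well_defined ::
  "nat list \<Rightarrow> (nat \<times> nat \<times> nat) list \<Rightarrow> tensor \<Rightarrow> (nat \<Rightarrow> tensor) \<Rightarrow> (nat \<Rightarrow> tensor) \<Rightarrow> bool" where
  "rcg_well_defined rs \<Omega> X Xs Qs \<longleftrightarrow>
     (\<forall>l. Xs l \<in> fixed_rank_manifold (nrows X) (ncols X) rs \<and>
          (\<not> rcg_stops \<Omega> X Xs l \<longrightarrow> rcg_alpha_denom \<Omega> Xs Qs l \<noteq> 0))"

definition rcg_converges :: "tensor \<Rightarrow> (nat \<Rightarrow> tensor) \<Rightarrow> bool" where
  "rcg_converges X Xs \<longleftrightarrow> (\<lambda>l. fnorm (tsub (Xs l) X)) \<longlonglongrightarrow> 0"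

text \<open>The event that the method, started at \<open>X\<^sub>0 = H\<^sub>r\<^sub>s(p\<^sup>-\<^sup>1 R\<^sub>\<Omega>(X))\<close>, is well defined and converges
  to \<open>X\<close>, whichever truncated singular value decompositions are chosen in the case of ties.\<close>

definition rcg_succeeds ::
  "nat list \<Rightarrow> real \<Rightarrow> real \<Rightarrow> real \<Rightarrow> tensor \<Rightarrow> (nat \<times> nat \<times> nat) list \<Rightarrow> bool" where
  "rcg_succeeds rs k1 k2 p X \<Omega> \<longleftrightarrow>
     (let run = (\<lambda>Xs Qs. is_hard_threshold rs (tscale (1 / p) (sampling_op \<Omega> X)) (Xs 0) \<and>
                         is_rcg_run rs k1 k2 \<Omega> X Xs Qs)
      in (\<exists>Xs Qs. run Xs Qs) \<and>
         (\<forall>Xs Qs. run Xs Qs \<longrightarrow> rcg_well_defined rs \<Omega> X Xs Qs \<and> rcg_converges X Xs))"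

end

theory Submission imports Defs begin

no_notation scalar_prod (infix "\<bullet>" 70)
hide_const (open) VectorSpace.subspace

text \<open>In the transform domain a tensor becomes a block diagonal matrix, and each slicewise notion
  becomes the corresponding notion for that matrix. Three events suffice for success. First, sampling
  is nearly isometric on the tangent space at \<open>X\<close>; this transfers to the tangent spaces at nearby
  points since tangent projections depend on the point in a Lipschitz way. Second, no index is sampled more than
  logarithmically often, which bounds the sampling operator. Third, the rescaled sample is spectrally
  close to \<open>X\<close>, which puts the initial point close to \<open>X\<close>. The probabilities come
  from even moments of random self-adjoint maps, estimated with exchangeable pairs. On these events
  conjugacy of the search directions with respect to the sampled quadratic form bounds the error
  before thresholding by a small multiple of the last two errors, and thresholding at most doubles it,
  being a best approximation, so the iterates converge geometrically.\<close>

section \<open>Orthonormal bases and the spectral theorem\<close>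

text \<open>Sampling with replacement makes the sampling operator positive semidefinite but not a
  projection: its norm is the largest multiplicity, of order log n, and after division by p this is
  far above 1. Near isometry at X therefore passes to other tangent spaces only within a radius of
  order \<epsilon> \<sigma> sqrt(p / log n), with \<sigma> the least nonzero singular value, and the
  initial point must land there. This is what the second term of the bound on m pays for, with its
  factors \<kappa>, n_(2)^{1/2} and log n. Matrices with carriers of varying size form no type class
  instance, so they are moved into one type of finitely supported matrices, an inner product space
  and a normed algebra without unit. Complements 1 - P appear as A - P * A, and coordinate
  projections replace identity matrices. The restart hypothesis enters as k1 k2 + 4 \<epsilon> k2
  \<le> 1/3, the share of the previous direction that the conjugate correction may cost. With
  isometry constant \<epsilon> / 400 the error before thresholding is at most 0.45 of the current
  envelope, and doubling leaves the rate 9/10.\<close>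

definition onset :: "'v::real_inner set \<Rightarrow> bool" where
  "onset B \<longleftrightarrow> finite B \<and> (\<forall>x\<in>B. \<forall>y\<in>B. x \<bullet> y = (if x = y then 1 else 0))"

text \<open>The ambient spaces may be infinite-dimensional, so a finite-dimensional subspace
  \<open>H\<close> is always given through a finite orthonormal basis, and its dimension is the
  cardinality of any such basis.\<close>

definition onb :: "'v::real_inner set \<Rightarrow> 'v set \<Rightarrow> bool" where
  "onb B H \<longleftrightarrow> onset B \<and> span B = H"

lemma onset_finite: "onset B \<Longrightarrow> finite B" by (simp add: onset_def)
lemma onb_onset: "onb B H \<Longrightarrow> onset B" by (simp add: onb_def)
lemma onb_finite: "onb B H \<Longrightarrow> finite B" by (simp add: onb_def onset_finite)
lemma onb_mem: "onb B H \<Longrightarrow> b \<in> B \<Longrightarrow> b \<in> H" unfolding onb_def using span_base by blast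
lemma onb_subspace: "onb B H \<Longrightarrow> subspace H" unfolding onb_def using subspace_span by blast
lemma onset_norm: "onset B \<Longrightarrow> b \<in> B \<Longrightarrow> norm b = 1"
  by (simp add: onset_def norm_eq_sqrt_inner)
lemma onset_inner: "onset B \<Longrightarrow> b \<in> B \<Longrightarrow> c \<in> B \<Longrightarrow> b \<bullet> c = (if b = c then 1 else 0)"
  by (simp add: onset_def)
lemma onset_subset: "onset B \<Longrightarrow> C \<subseteq> B \<Longrightarrow> onset C"
  unfolding onset_def using finite_subset by blast

lemma onset_sum_inner:
  assumes "onset B" "c \<in> B"
  shows "(\<Sum>b\<in>B. a b *\<^sub>R b) \<bullet> c = a c"
proof -
  have "(\<Sum>b\<in>B. a b *\<^sub>R b) \<bullet> c = (\<Sum>b\<in>B. if b = c then a b else 0)"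
    unfolding inner_sum_left using assms by (intro sum.cong) (auto simp: onset_def)
  then show ?thesis using assms by (simp add: onset_finite)
qed

lemma onb_expand:
  assumes "onb B H" "x \<in> H"
  shows "x = (\<Sum>b\<in>B. (x \<bullet> b) *\<^sub>R b)"
proof -
  have "x \<in> span B" using assms by (simp add: onb_def)
  then obtain a where a: "x = (\<Sum>b\<in>B. a b *\<^sub>R b)"
    using span_finite[of B] onb_finite[OF assms(1)] by auto
  have "x \<bullet> b = a b" if "b \<in> B" for b
    unfolding a using onset_sum_inner[OF onb_onset[OF assms(1)] that] .
  then show ?thesis using a by simp
qed

lemma onb_inner:
  assumes "onb B H" "x \<in> H"
  shows "x \<bullet> y = (\<Sum>b\<in>B. (x \<bullet> b) * (y \<bullet> b))"
proof -
  have "x \<bullet> y = (\<Sum>b\<in>B. (x \<bullet> b) *\<^sub>R b) \<bullet> y" using onb_expand[OF assms] by simp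
  also have "\<dots> = (\<Sum>b\<in>B. (x \<bullet> b) * (y \<bullet> b))"
    by (simp add: inner_sum_left) (simp add: inner_commute)
  finally show ?thesis .
qed

lemma onb_norm2:
  assumes "onb B H" "x \<in> H"
  shows "(norm x)\<^sup>2 = (\<Sum>b\<in>B. (x \<bullet> b)\<^sup>2)"
  unfolding power2_norm_eq_inner using onb_inner[OF assms, of x] by (simp add: power2_eq_square)

lemma bessel:
  assumes "onset B"
  shows "(\<Sum>b\<in>B. (x \<bullet> b)\<^sup>2) \<le> (norm x)\<^sup>2"
proof -
  define y where "y = (\<Sum>b\<in>B. (x \<bullet> b) *\<^sub>R b)"
  have yb: "y \<bullet> b = x \<bullet> b" if "b \<in> B" for b
    unfolding y_def using onset_sum_inner[OF assms that, of "\<lambda>b. x \<bullet> b"] .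
  have y1: "x \<bullet> y = (\<Sum>b\<in>B. (x \<bullet> b)\<^sup>2)"
    by (simp add: y_def inner_sum_right power2_eq_square)
  have y2: "y \<bullet> y = (\<Sum>b\<in>B. (x \<bullet> b)\<^sup>2)"
  proof -
    have "y \<bullet> y = (\<Sum>b\<in>B. (x \<bullet> b) * (y \<bullet> b))"
      by (subst (2) y_def) (simp add: inner_sum_right)
    then show ?thesis using yb by (simp add: power2_eq_square)
  qed
  have "0 \<le> (x - y) \<bullet> (x - y)" by simp
  also have "\<dots> = x \<bullet> x - (\<Sum>b\<in>B. (x \<bullet> b)\<^sup>2)"
    using y1 y2 by (simp add: inner_diff_left inner_diff_right inner_commute)
  finally show ?thesis by (simp add: power2_norm_eq_inner)
qed

lemma onset_insert:
  assumes "onset B" "norm v = 1" "\<And>b. b \<in> B \<Longrightarrow> v \<bullet> b = 0"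
  shows "onset (insert v B)"
  using assms unfolding onset_def by (auto simp: inner_commute norm_eq_sqrt_inner)

text \<open>Gram-Schmidt, one vector of \<open>A\<close> at a time; a vector already in the span is
  dropped.\<close>

lemma onset_extend:
  assumes "onset B0" "finite A"
  shows "\<exists>B. B0 \<subseteq> B \<and> onb B (span (B0 \<union> A))"
  using assms(2)
proof (induction A rule: finite_induct)
  case empty
  then show ?case using assms(1) by (auto simp: onb_def)
next
  case (insert a A)
  then obtain B where B: "B0 \<subseteq> B" "onset B" "span B = span (B0 \<union> A)" by (auto simp: onb_def)
  define a' where "a' = a - (\<Sum>b\<in>B. (a \<bullet> b) *\<^sub>R b)"
  have orth: "a' \<bullet> b = 0" if "b \<in> B" for b
    unfolding a'_def inner_diff_left using onset_sum_inner[OF B(2) that, of "\<lambda>b. a \<bullet> b"] by simp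
  have inB: "(\<Sum>b\<in>B. (a \<bullet> b) *\<^sub>R b) \<in> span B"
    by (intro span_sum span_scale span_base) auto
  have sp: "span (insert a B) = span (B0 \<union> insert a A)"
    using B(3) by (simp add: span_insert)
  show ?case
  proof (cases "a' = 0")
    case True
    then have "a \<in> span B" using inB by (simp add: a'_def)
    then have "span (insert a B) = span B" by (rule span_redundant)
    then show ?thesis using B sp by (auto simp: onb_def)
  next
    case False
    define v where "v = (1 / norm a') *\<^sub>R a'"
    have v: "norm v = 1" "\<And>b. b \<in> B \<Longrightarrow> v \<bullet> b = 0"
      using False orth by (auto simp: v_def)
    have "span (insert v B) = span (insert a B)"
    proof (rule span_eq[THEN iffD2], rule conjI)
      have "v \<in> span (insert a B)" unfolding v_def a'_def
        by (intro span_scale span_diff) (use inB span_mono[of B "insert a B"] in \<open>auto intro: span_base\<close>)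
      then show "insert v B \<subseteq> span (insert a B)" by (auto intro: span_base)
      have "a = norm a' *\<^sub>R v + (\<Sum>b\<in>B. (a \<bullet> b) *\<^sub>R b)" using False by (simp add: v_def a'_def)
      also have "\<dots> \<in> span (insert v B)"
        by (intro span_add span_scale) (use inB span_mono[of B "insert v B"] in \<open>auto intro: span_base\<close>)
      finally show "insert a B \<subseteq> span (insert v B)" by (auto intro: span_base)
    qed
    then have "onb (insert v B) (span (B0 \<union> insert a A))"
      using onset_insert[OF B(2) v] sp by (simp add: onb_def)
    then show ?thesis using B(1) by blast
  qed
qed

lemma onset_extend_onb:
  assumes "onset B0" "B0 \<subseteq> H" "onb B H"
  shows "\<exists>B'. B0 \<subseteq> B' \<and> onb B' H"
proof -
  have "span (B0 \<union> B) = H"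
    using assms span_mono[of B "B0 \<union> B"] span_minimal[of "B0 \<union> B" H] subspace_span[of B] onb_mem[OF assms(3)]
    by (auto simp: onb_def)
  then show ?thesis using onset_extend[OF assms(1) onb_finite[OF assms(3)]] by simp
qed

text \<open>Double counting of the squared inner products between \<open>C\<close> and
  \<open>B\<close>: Parseval in \<open>B\<close> gives \<open>card C\<close>, Bessel in
  \<open>C\<close> gives at most \<open>card B\<close>.\<close>

lemma onset_card_le:
  assumes "onset C" "C \<subseteq> H" "onb B H"
  shows "card C \<le> card B"
proof -
  have "real (card C) = (\<Sum>c\<in>C. \<Sum>b\<in>B. (c \<bullet> b)\<^sup>2)"
    using assms onb_norm2[OF assms(3)] onset_norm[OF assms(1)] by (simp add: subset_iff flip: onb_norm2[OF assms(3)])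
  also have "\<dots> = (\<Sum>b\<in>B. \<Sum>c\<in>C. (b \<bullet> c)\<^sup>2)"
    by (subst sum.swap) (simp add: inner_commute)
  also have "\<dots> \<le> (\<Sum>b\<in>B. (norm b)\<^sup>2)" by (intro sum_mono bessel assms)
  also have "\<dots> = real (card B)" using onset_norm[OF onb_onset[OF assms(3)]] by simp
  finally show ?thesis by simp
qed

lemma onb_card_eq:
  assumes "onb C H" "onb B H"
  shows "card C = card B"
  using onset_card_le[OF onb_onset[OF assms(1)] _ assms(2)] onset_card_le[OF onb_onset[OF assms(2)] _ assms(1)]
    onb_mem[OF assms(1)] onb_mem[OF assms(2)] by (meson le_antisym subsetI)

lemma onb_remove:
  assumes "onb B H" "v \<in> B"
  shows "onb (B - {v}) {x \<in> H. x \<bullet> v = 0}"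
proof -
  have on: "onset (B - {v})" using assms onset_subset onb_onset by blast
  have "span (B - {v}) = {x \<in> H. x \<bullet> v = 0}"
  proof (intro equalityI subsetI)
    fix x assume x: "x \<in> {x \<in> H. x \<bullet> v = 0}"
    then have "x = (\<Sum>b\<in>B. (x \<bullet> b) *\<^sub>R b)" using onb_expand[OF assms(1)] by simp
    also have "\<dots> = (\<Sum>b\<in>B-{v}. (x \<bullet> b) *\<^sub>R b)"
      using x assms onb_finite[OF assms(1)] by (simp add: sum.remove)
    also have "\<dots> \<in> span (B - {v})" by (intro span_sum span_scale span_base)
    finally show "x \<in> span (B - {v})" .
  next
    fix x assume x: "x \<in> span (B - {v})"
    have "x \<in> H" using x span_mono[of "B - {v}" B] assms(1) by (auto simp: onb_def)
    moreover have "x \<bullet> v = 0"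
      using x
    proof (induction rule: span_induct_alt)
      case (step c x y)
      then show ?case using onset_inner[OF onb_onset[OF assms(1)], of x v] assms(2) by (auto simp: inner_add_left)
    qed auto
    ultimately show "x \<in> {x \<in> H. x \<bullet> v = 0}" by simp
  qed
  with on show ?thesis by (simp add: onb_def)
qed

text \<open>The ambient space offers no compactness, so it is built up from segments, of which the
  cube is a Minkowski sum. The unit sphere of the span will be a closed part of this cube.\<close>

lemma compact_onb_cube:
  assumes "finite (B :: 'v::real_inner set)"
  shows "compact {\<Sum>b\<in>B. c b *\<^sub>R b | c. \<forall>b\<in>B. \<bar>c b\<bar> \<le> (1::real)}"
  using assms
proof (induction B rule: finite_induct)
  case (insert a B)
  have "{\<Sum>b\<in>insert a B. c b *\<^sub>R b | c. \<forall>b\<in>insert a B. \<bar>c b\<bar> \<le> (1::real)} =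
    {x + y | x y. x \<in> (\<lambda>t. t *\<^sub>R a) ` {-1..1} \<and> y \<in> {\<Sum>b\<in>B. c b *\<^sub>R b | c. \<forall>b\<in>B. \<bar>c b\<bar> \<le> (1::real)}}"
    (is "?L = ?R")
  proof (intro equalityI subsetI)
    fix x assume "x \<in> ?L"
    then obtain c where "x = (\<Sum>b\<in>insert a B. c b *\<^sub>R b)" "\<forall>b\<in>insert a B. \<bar>c b\<bar> \<le> 1" by blast
    then have "x = c a *\<^sub>R a + (\<Sum>b\<in>B. c b *\<^sub>R b)" "c a \<in> {-1..1}" "\<forall>b\<in>B. \<bar>c b\<bar> \<le> 1"
      using insert by (auto simp: abs_le_iff)
    then show "x \<in> ?R" by blast
  next
    fix x assume "x \<in> ?R"
    then obtain t c where tc: "x = t *\<^sub>R a + (\<Sum>b\<in>B. c b *\<^sub>R b)" "t \<in> {-1..1}" "\<forall>b\<in>B. \<bar>c b\<bar> \<le> 1" by blast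
    have "x = (\<Sum>b\<in>insert a B. (c(a := t)) b *\<^sub>R b)"
      using insert tc(1) by (simp, intro sum.cong) auto
    moreover have "\<forall>b\<in>insert a B. \<bar>(c(a := t)) b\<bar> \<le> 1" using tc by auto
    ultimately show "x \<in> ?L" by blast
  qed
  moreover have "compact ((\<lambda>t. t *\<^sub>R a) ` {-1..1::real})"
    by (intro compact_continuous_image continuous_intros) auto
  ultimately show ?case using compact_sums[OF _ insert.IH] by simp
qed simp

lemma compact_onb_sphere:
  assumes "onb B H"
  shows "compact {x \<in> H. norm x = 1}"
proof -
  let ?K = "{\<Sum>b\<in>B. c b *\<^sub>R b | c. \<forall>b\<in>B. \<bar>c b\<bar> \<le> (1::real)}"
  have "{x \<in> H. norm x = 1} = ?K \<inter> {x. norm x = 1}"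
  proof (intro equalityI subsetI)
    fix x assume x: "x \<in> {x \<in> H. norm x = 1}"
    have "\<bar>x \<bullet> b\<bar> \<le> 1" if "b \<in> B" for b
      using Cauchy_Schwarz_ineq2[of x b] x onset_norm[OF onb_onset[OF assms] that] by simp
    then show "x \<in> ?K \<inter> {x. norm x = 1}" using onb_expand[OF assms, of x] x by auto
  next
    fix x assume x: "x \<in> ?K \<inter> {x. norm x = 1}"
    then have "x \<in> H" using onb_subspace[OF assms] onb_mem[OF assms]
      by (auto intro!: subspace_sum subspace_scale)
    then show "x \<in> {x \<in> H. norm x = 1}" using x by simp
  qed
  then show ?thesis using compact_Int_closed[OF compact_onb_cube[OF onb_finite[OF assms]], of "{x. norm x = 1}"]
      closed_Collect_eq[of norm "\<lambda>_. 1"] by (simp add: continuous_on_norm_id)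
qed

definition selfadj_on :: "'v::real_inner set \<Rightarrow> ('v \<Rightarrow> 'v) \<Rightarrow> bool" where
  "selfadj_on H f \<longleftrightarrow> linear f \<and> f ` H \<subseteq> H \<and> (\<forall>x\<in>H. \<forall>y\<in>H. f x \<bullet> y = x \<bullet> f y)"

lemma linear_onb_bounded:
  assumes "onb B H" "linear f"
  shows "\<exists>K\<ge>0. \<forall>x\<in>H. norm (f x) \<le> K * norm x"
proof (intro exI conjI ballI)
  show "0 \<le> (\<Sum>b\<in>B. norm (f b))" by (intro sum_nonneg) auto
  fix x assume x: "x \<in> H"
  have "f x = (\<Sum>b\<in>B. (x \<bullet> b) *\<^sub>R f b)"
    by (subst onb_expand[OF assms(1) x]) (simp add: linear_sum[OF assms(2)] linear_cmul[OF assms(2)])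
  also have "norm \<dots> \<le> (\<Sum>b\<in>B. norm (f b) * norm x)"
  proof (rule sum_norm_le)
    fix b assume b: "b \<in> B"
    have "\<bar>x \<bullet> b\<bar> \<le> norm x" using Cauchy_Schwarz_ineq2[of x b] onset_norm[OF onb_onset[OF assms(1)] b] by simp
    then show "norm ((x \<bullet> b) *\<^sub>R f b) \<le> norm (f b) * norm x"
      using mult_left_mono[of "\<bar>x \<bullet> b\<bar>" "norm x" "norm (f b)"] by (simp add: mult.commute)
  qed
  finally show "norm (f x) \<le> (\<Sum>b\<in>B. norm (f b)) * norm x" by (simp add: sum_distrib_right)
qed

text \<open>The first order condition at a maximum. For \<open>a \<noteq> 0\<close> the point
  \<open>t = a / c\<close> with \<open>c\<close> above the modulus of \<open>b\<close> is small
  enough for the linear term to win.\<close>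

lemma quadratic_nonpos_linear_coeff:
  fixes a b :: real
  assumes "\<And>t. 2 * t * a + t\<^sup>2 * b \<le> 0"
  shows "a = 0"
proof (rule ccontr)
  assume a: "a \<noteq> 0"
  define c where "c = \<bar>b\<bar> + 1"
  have c: "c > 0" "- c \<le> b" by (auto simp: c_def)
  define t where "t = a / c"
  have "2 * t * a + t\<^sup>2 * b = (a\<^sup>2 / c) * (2 + b / c)"
    using c by (simp add: t_def field_simps power2_eq_square)
  moreover have "b / c \<ge> -1" using c by (simp add: field_simps)
  moreover have "a\<^sup>2 / c > 0" using a c by simp
  ultimately have "2 * t * a + t\<^sup>2 * b > 0" by (smt (verit) mult_pos_pos)
  then show False using assms[of t] by simp
qed

text \<open>A maximiser of the Rayleigh quotient on the unit sphere is an eigenvector: moving it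
  along any \<open>y\<close> in \<open>H\<close> keeps the form below \<open>l\<close> times the
  squared norm, so the linear term of the variation vanishes.\<close>

lemma selfadj_eigenvector:
  assumes B: "onb B H" "B \<noteq> {}" and f: "selfadj_on H f"
  shows "\<exists>v\<in>H. norm v = 1 \<and> (\<exists>l. f v = l *\<^sub>R v)"
proof -
  have lin: "linear f" and fH: "\<And>x. x \<in> H \<Longrightarrow> f x \<in> H" and sa: "\<And>x y. x \<in> H \<Longrightarrow> y \<in> H \<Longrightarrow> f x \<bullet> y = x \<bullet> f y"
    using f by (auto simp: selfadj_on_def)
  have sub: "subspace H" using onb_subspace[OF B(1)] .
  let ?S = "{x \<in> H. norm x = 1}"
  obtain K where K: "K \<ge> 0" "\<And>x. x \<in> H \<Longrightarrow> norm (f x) \<le> K * norm x"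
    using linear_onb_bounded[OF B(1) lin] by blast
  have contf: "continuous_on ?S f"
    unfolding continuous_on_iff
  proof (intro ballI allI impI)
    fix x e assume x: "x \<in> ?S" and e: "(0::real) < e"
    show "\<exists>d>0. \<forall>x'\<in>?S. dist x' x < d \<longrightarrow> dist (f x') (f x) < e"
    proof (intro exI conjI ballI impI)
      show "0 < e / (K + 1)" using e K by simp
      fix y assume y: "y \<in> ?S" and d: "dist y x < e / (K + 1)"
      have "dist (f y) (f x) = norm (f (y - x))" by (simp add: dist_norm linear_diff[OF lin])
      also have "\<dots> \<le> K * norm (y - x)" using x y sub by (intro K) (auto simp: subspace_diff)
      also have "\<dots> \<le> (K + 1) * norm (y - x)" by (simp add: mult_right_mono)
      also have "\<dots> < e" using d K by (simp add: dist_norm field_simps)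
      finally show "dist (f y) (f x) < e" .
    qed
  qed
  obtain b where b: "b \<in> B" using B by blast
  have "?S \<noteq> {}" using onb_mem[OF B(1) b] onset_norm[OF onb_onset[OF B(1)] b] by blast
  moreover have "continuous_on ?S (\<lambda>x. f x \<bullet> x)" by (intro continuous_intros contf)
  ultimately obtain v where v: "v \<in> ?S" "\<And>x. x \<in> ?S \<Longrightarrow> f x \<bullet> x \<le> f v \<bullet> v"
    using continuous_attains_sup[OF compact_onb_sphere[OF B(1)]] by blast
  define l where "l = f v \<bullet> v"
  \<comment> \<open>Homogeneity extends the bound from the sphere to \<open>H\<close>, so the varied
    vector need not be normalised.\<close>
  have le: "f x \<bullet> x \<le> l * (norm x)\<^sup>2" if "x \<in> H" for x
  proof (cases "x = 0")
    case False
    have "(1 / norm x) *\<^sub>R x \<in> ?S" using that False sub by (simp add: subspace_scale)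
    from v(2)[OF this] have "f x \<bullet> x / (norm x)\<^sup>2 \<le> l"
      by (simp add: l_def linear_cmul[OF lin] power2_eq_square)
    then show ?thesis using False by (simp add: field_simps)
  qed (simp add: linear_0[OF lin])
  have vH: "v \<in> H" "norm v = 1" "v \<bullet> v = 1" using v(1) by (auto simp: norm_eq_sqrt_inner)
  have "(f v - l *\<^sub>R v) \<bullet> y = 0" if y: "y \<in> H" for y
  proof (rule quadratic_nonpos_linear_coeff)
    fix t :: real
    have "v + t *\<^sub>R y \<in> H" using y vH sub by (simp add: subspace_add subspace_scale)
    from le[OF this] have "f (v + t *\<^sub>R y) \<bullet> (v + t *\<^sub>R y) \<le> l * ((v + t *\<^sub>R y) \<bullet> (v + t *\<^sub>R y))"
      by (simp add: power2_norm_eq_inner)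
    then have "l + t * (f v \<bullet> y) + t * (f y \<bullet> v) + t\<^sup>2 * (f y \<bullet> y) \<le> l * (1 + 2 * t * (v \<bullet> y) + t\<^sup>2 * (y \<bullet> y))"
      by (simp add: linear_add[OF lin] linear_cmul[OF lin] inner_add_left inner_add_right vH l_def[symmetric]
          inner_commute[of y v] power2_eq_square algebra_simps)
    moreover have "f y \<bullet> v = f v \<bullet> y" using sa[OF y vH(1)] by (simp add: inner_commute)
    ultimately show "2 * t * ((f v - l *\<^sub>R v) \<bullet> y) + t\<^sup>2 * (f y \<bullet> y - l * (y \<bullet> y)) \<le> 0"
      by (simp add: inner_diff_left algebra_simps)
  qed
  moreover have "f v - l *\<^sub>R v \<in> H" using fH vH sub by (simp add: subspace_diff subspace_scale)
  ultimately have "f v - l *\<^sub>R v = 0" by (metis inner_eq_zero_iff)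
  then show ?thesis using vH by auto
qed

text \<open>Induction on the dimension: split off one eigenvector and pass to its orthogonal
  complement, which \<open>f\<close> preserves by self-adjointness.\<close>

lemma selfadj_spectral:
  assumes "onb B H" "selfadj_on H f"
  shows "\<exists>B' ev. onb B' H \<and> (\<forall>b\<in>B'. f b = ev b *\<^sub>R b)"
  using assms
proof (induction "card B" arbitrary: B H)
  case 0
  then have "B = {}" using onb_finite[OF 0(2)] by simp
  then show ?case using 0 by blast
next
  case (Suc k)
  then have "B \<noteq> {}" by auto
  then obtain v l where v: "v \<in> H" "norm v = 1" "f v = l *\<^sub>R v"
    using selfadj_eigenvector Suc.prems by blast
  have "onset {v}" using v by (simp add: onset_def norm_eq_sqrt_inner)
  then obtain C where C: "v \<in> C" "onb C H" using onset_extend_onb[OF _ _ Suc.prems(1), of "{v}"] v by auto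
  let ?H = "{x \<in> H. x \<bullet> v = 0}"
  have onb': "onb (C - {v}) ?H" using onb_remove C by blast
  have "card C = Suc k" using onb_card_eq[OF C(2) Suc.prems(1)] Suc.hyps by simp
  then have card: "k = card (C - {v})" using C onb_finite[OF C(2)] by simp
  have "selfadj_on ?H f"
  proof -
    have "f x \<bullet> v = 0" if "x \<in> H" "x \<bullet> v = 0" for x
      using Suc.prems(2) that v by (simp add: selfadj_on_def)
    then show ?thesis using Suc.prems(2) by (auto simp: selfadj_on_def)
  qed
  from Suc.hyps(1)[OF card onb' this] obtain B' ev where B': "onb B' ?H" "\<forall>b\<in>B'. f b = ev b *\<^sub>R b" by blast
  have orth: "v \<bullet> b = 0" if "b \<in> B'" for b using onb_mem[OF B'(1) that] by (simp add: inner_commute)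
  have vB: "v \<notin> B'" using orth v(2) by (auto simp: norm_eq_sqrt_inner)
  have "span (insert v B') = H"
  proof (intro equalityI subsetI)
    fix x assume x: "x \<in> span (insert v B')"
    then show "x \<in> H" using span_minimal[of "insert v B'" H] v onb_mem[OF B'(1)] onb_subspace[OF Suc.prems(1)]
      by auto
  next
    fix x assume x: "x \<in> H"
    have "x - (x \<bullet> v) *\<^sub>R v \<in> ?H" using x v onb_subspace[OF Suc.prems(1)]
      by (simp add: subspace_diff subspace_scale inner_diff_left norm_eq_sqrt_inner)
    then show "x \<in> span (insert v B')" using B'(1) by (auto simp: span_insert onb_def)
  qed
  then have "onb (insert v B') H" using onset_insert[OF onb_onset[OF B'(1)] v(2) orth] by (simp add: onb_def)
  moreover have "\<forall>b\<in>insert v B'. f b = (ev(v := l)) b *\<^sub>R b" using B' v vB by auto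
  ultimately show ?case by blast
qed

section \<open>Finitely supported matrices\<close>

text \<open>Rows and columns share one index type and no dimension occurs in it, so rectangular
  matrices of all sizes multiply freely and associatively. For an infinite index type this costs the
  identity matrix.\<close>

typedef 'a fmat = "{f :: 'a \<Rightarrow> 'a \<Rightarrow> real. finite {p. f (fst p) (snd p) \<noteq> 0}}"
  morphisms ent Abs_fmat
  by (rule exI[of _ "\<lambda>_ _. 0"]) simp

setup_lifting type_definition_fmat

lemma fmat_eqI: "(\<And>i j. ent A i j = ent B i j) \<Longrightarrow> A = B"
  by (metis ent_inject ext)

text \<open>Row and column indices are merged, so that one finite set can serve as the range of
  every summation.\<close>

definition ind :: "'a fmat \<Rightarrow> 'a set" where
  "ind A = {i. \<exists>j. ent A i j \<noteq> 0 \<or> ent A j i \<noteq> 0}"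

lemma finite_ind [simp]: "finite (ind A)"
proof -
  have "finite {p. ent A (fst p) (snd p) \<noteq> 0}" using ent[of A] by simp
  then have "finite (fst ` {p. ent A (fst p) (snd p) \<noteq> 0} \<union> snd ` {p. ent A (fst p) (snd p) \<noteq> 0})" by blast
  moreover have "ind A \<subseteq> fst ` {p. ent A (fst p) (snd p) \<noteq> 0} \<union> snd ` {p. ent A (fst p) (snd p) \<noteq> 0}"
  proof
    fix i assume "i \<in> ind A"
    then obtain j where "ent A i j \<noteq> 0 \<or> ent A j i \<noteq> 0" by (auto simp: ind_def)
    then show "i \<in> fst ` {p. ent A (fst p) (snd p) \<noteq> 0} \<union> snd ` {p. ent A (fst p) (snd p) \<noteq> 0}"
      using image_eqI[of i fst "(i, j)" "{p. ent A (fst p) (snd p) \<noteq> 0}"] image_eqI[of i snd "(j, i)" "{p. ent A (fst p) (snd p) \<noteq> 0}"]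
      by auto
  qed
  ultimately show ?thesis by (rule rev_finite_subset)
qed

lemma ent_outside: "i \<notin> ind A \<Longrightarrow> ent A i j = 0" "j \<notin> ind A \<Longrightarrow> ent A i j = 0"
  by (auto simp: ind_def)

lift_definition mk :: "'a set \<Rightarrow> 'a set \<Rightarrow> ('a \<Rightarrow> 'a \<Rightarrow> real) \<Rightarrow> 'a fmat" is
  "\<lambda>R C f i j. if finite R \<and> finite C \<and> i \<in> R \<and> j \<in> C then f i j else 0"
proof -
  fix R C :: "'a set" and f :: "'a \<Rightarrow> 'a \<Rightarrow> real"
  have "{p. (if finite R \<and> finite C \<and> fst p \<in> R \<and> snd p \<in> C then f (fst p) (snd p) else 0) \<noteq> 0}
    \<subseteq> (if finite R \<and> finite C then R \<times> C else {})" by (auto split: if_splits)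
  then show "finite {p. (if finite R \<and> finite C \<and> fst p \<in> R \<and> snd p \<in> C then f (fst p) (snd p) else 0) \<noteq> 0}"
    by (rule finite_subset) auto
qed

lemma ent_mk: "finite R \<Longrightarrow> finite C \<Longrightarrow> ent (mk R C f) i j = (if i \<in> R \<and> j \<in> C then f i j else 0)"
  by transfer simp

lift_definition adj :: "'a fmat \<Rightarrow> 'a fmat" is "\<lambda>f i j. f j i"
proof -
  fix f :: "'a \<Rightarrow> 'a \<Rightarrow> real" assume "finite {p. f (fst p) (snd p) \<noteq> 0}"
  then have "finite (prod.swap ` {p. f (fst p) (snd p) \<noteq> 0})" by blast
  moreover have "{p. f (snd p) (fst p) \<noteq> 0} \<subseteq> prod.swap ` {p. f (fst p) (snd p) \<noteq> 0}" by force
  ultimately show "finite {p. f (snd p) (fst p) \<noteq> 0}" by (rule rev_finite_subset)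
qed

lemma ent_adj [simp]: "ent (adj A) i j = ent A j i" by transfer simp

instantiation fmat :: (type) real_vector
begin
lift_definition zero_fmat :: "'a fmat" is "\<lambda>_ _. 0" by simp
lift_definition plus_fmat :: "'a fmat \<Rightarrow> 'a fmat \<Rightarrow> 'a fmat" is "\<lambda>f g i j. f i j + g i j"
proof -
  fix f g :: "'a \<Rightarrow> 'a \<Rightarrow> real"
  assume "finite {p. f (fst p) (snd p) \<noteq> 0}" "finite {p. g (fst p) (snd p) \<noteq> 0}"
  then have "finite ({p. f (fst p) (snd p) \<noteq> 0} \<union> {p. g (fst p) (snd p) \<noteq> 0})" by blast
  then show "finite {p. f (fst p) (snd p) + g (fst p) (snd p) \<noteq> 0}" by (rule rev_finite_subset) auto
qed
lift_definition uminus_fmat :: "'a fmat \<Rightarrow> 'a fmat" is "\<lambda>f i j. - f i j" by simp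
definition minus_fmat :: "'a fmat \<Rightarrow> 'a fmat \<Rightarrow> 'a fmat" where "minus_fmat A B = A + (- B)"
lift_definition scaleR_fmat :: "real \<Rightarrow> 'a fmat \<Rightarrow> 'a fmat" is "\<lambda>c f i j. c * f i j"
  by (erule rev_finite_subset) auto
lemma ent_zero [simp]: "ent 0 i j = 0" by transfer simp
lemma ent_add [simp]: "ent (A + B) i j = ent A i j + ent B i j" by transfer simp
lemma ent_uminus [simp]: "ent (- A) i j = - ent A i j" by transfer simp
lemma ent_diff [simp]: "ent (A - B) i j = ent A i j - ent B i j" by (simp add: minus_fmat_def)
lemma ent_scaleR [simp]: "ent (c *\<^sub>R A) i j = c * ent A i j" by transfer simp
instance
  by standard (rule fmat_eqI; simp add: algebra_simps)+
end

lemma ent_sum [simp]: "ent (\<Sum>x\<in>S. f x) i j = (\<Sum>x\<in>S. ent (f x) i j)"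
  by (induction S rule: infinite_finite_induct) auto

instantiation fmat :: (type) real_inner
begin
text \<open>The Frobenius inner product. Accordingly \<open>norm\<close> on this type is always the
  Frobenius norm.\<close>

definition inner_fmat :: "'a fmat \<Rightarrow> 'a fmat \<Rightarrow> real" where
  "inner_fmat A B = (\<Sum>i\<in>ind A. \<Sum>j\<in>ind A. ent A i j * ent B i j)"
definition norm_fmat :: "'a fmat \<Rightarrow> real" where "norm_fmat A = sqrt (A \<bullet> A)"
definition sgn_fmat :: "'a fmat \<Rightarrow> 'a fmat" where "sgn_fmat A = A /\<^sub>R norm A"
definition dist_fmat :: "'a fmat \<Rightarrow> 'a fmat \<Rightarrow> real" where "dist_fmat A B = norm (A - B)"
definition uniformity_fmat :: "('a fmat \<times> 'a fmat) filter" where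
  "uniformity_fmat = (INF e\<in>{0<..}. principal {(x, y). dist x y < e})"
definition open_fmat :: "'a fmat set \<Rightarrow> bool" where
  "open_fmat U = (\<forall>x\<in>U. eventually (\<lambda>(x', y). x' = x \<longrightarrow> y \<in> U) uniformity)"

lemma inner_fmat_eq:
  assumes "finite K" "ind A \<subseteq> K \<or> ind B \<subseteq> K"
  shows "A \<bullet> B = (\<Sum>i\<in>K. \<Sum>j\<in>K. ent A i j * ent B i j)"
proof -
  have *: "(\<Sum>i\<in>L. \<Sum>j\<in>L. ent A i j * ent B i j) = (\<Sum>i\<in>L'. \<Sum>j\<in>L'. ent A i j * ent B i j)"
    if "finite L'" "L \<subseteq> L'" "ind A \<subseteq> L \<or> ind B \<subseteq> L" for L L' :: "'a set"
  proof -
    have z: "ent A i j * ent B i j = 0" if "i \<notin> L \<or> j \<notin> L" for i j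
      using \<open>ind A \<subseteq> L \<or> ind B \<subseteq> L\<close> that ent_outside[of i A j] ent_outside[of j A i] ent_outside[of i B j] ent_outside[of j B i]
      by auto
    have "(\<Sum>i\<in>L. \<Sum>j\<in>L. ent A i j * ent B i j) = (\<Sum>i\<in>L. \<Sum>j\<in>L'. ent A i j * ent B i j)"
      by (intro sum.cong refl sum.mono_neutral_left) (use that z in auto)
    also have "\<dots> = (\<Sum>i\<in>L'. \<Sum>j\<in>L'. ent A i j * ent B i j)"
      by (intro sum.mono_neutral_left) (use that z in \<open>auto intro!: sum.neutral\<close>)
    finally show ?thesis .
  qed
  have "A \<bullet> B = (\<Sum>i\<in>ind A \<union> K. \<Sum>j\<in>ind A \<union> K. ent A i j * ent B i j)"
    unfolding inner_fmat_def using assms by (intro *) auto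
  also have "\<dots> = (\<Sum>i\<in>K. \<Sum>j\<in>K. ent A i j * ent B i j)"
    using assms by (intro *[symmetric]) auto
  finally show ?thesis .
qed

instance
proof
  fix x y z :: "'a fmat" and r :: real
  show "x \<bullet> y = y \<bullet> x"
    using inner_fmat_eq[of "ind x" x y] inner_fmat_eq[of "ind x" y x] by (simp add: mult.commute)
  show "(x + y) \<bullet> z = x \<bullet> z + y \<bullet> z"
    using inner_fmat_eq[of "ind z" "x + y" z] inner_fmat_eq[of "ind z" x z] inner_fmat_eq[of "ind z" y z]
    by (simp add: algebra_simps sum.distrib)
  show "(r *\<^sub>R x) \<bullet> y = r * (x \<bullet> y)"
    using inner_fmat_eq[of "ind y" "r *\<^sub>R x" y] inner_fmat_eq[of "ind y" x y]
    by (simp add: sum_distrib_left mult.assoc)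
  show "0 \<le> x \<bullet> x" unfolding inner_fmat_def by (intro sum_nonneg) auto
  show "(x \<bullet> x = 0) = (x = 0)"
  proof
    assume "x \<bullet> x = 0"
    then have "\<forall>i\<in>ind x. (\<Sum>j\<in>ind x. ent x i j * ent x i j) = 0"
      unfolding inner_fmat_def by (subst (asm) sum_nonneg_eq_0_iff) (auto intro: sum_nonneg)
    then have *: "\<forall>i\<in>ind x. \<forall>j\<in>ind x. ent x i j * ent x i j = 0"
      by (subst (asm) sum_nonneg_eq_0_iff) auto
    show "x = 0"
    proof (rule fmat_eqI)
      fix i j show "ent x i j = ent 0 i j" using * ent_outside[of i x j] ent_outside[of j x i] by auto
    qed
  next
    assume "x = 0" then show "x \<bullet> x = 0" unfolding inner_fmat_def by simp
  qed
qed (simp_all add: norm_fmat_def sgn_fmat_def dist_fmat_def uniformity_fmat_def open_fmat_def)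
end

instantiation fmat :: (type) real_normed_algebra
begin
lift_definition times_fmat :: "'a fmat \<Rightarrow> 'a fmat \<Rightarrow> 'a fmat" is
  "\<lambda>f g i j. \<Sum>k | f i k \<noteq> 0. f i k * g k j"
proof -
  fix f g :: "'a \<Rightarrow> 'a \<Rightarrow> real"
  assume f: "finite {p. f (fst p) (snd p) \<noteq> 0}" and g: "finite {p. g (fst p) (snd p) \<noteq> 0}"
  have "{p. (\<Sum>k | f (fst p) k \<noteq> 0. f (fst p) k * g k (snd p)) \<noteq> 0} \<subseteq>
    fst ` {p. f (fst p) (snd p) \<noteq> 0} \<times> snd ` {p. g (fst p) (snd p) \<noteq> 0}"
  proof
    fix p assume "p \<in> {p. (\<Sum>k | f (fst p) k \<noteq> 0. f (fst p) k * g k (snd p)) \<noteq> 0}"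
    then obtain k where "f (fst p) k \<noteq> 0" "f (fst p) k * g k (snd p) \<noteq> 0"
      by (metis (mono_tags, lifting) mem_Collect_eq sum.neutral)
    then show "p \<in> fst ` {p. f (fst p) (snd p) \<noteq> 0} \<times> snd ` {p. g (fst p) (snd p) \<noteq> 0}"
      by (cases p) (force intro: image_eqI[of _ fst "(fst p, k)"] image_eqI[of _ snd "(k, snd p)"])
  qed
  then show "finite {p. (\<Sum>k | f (fst p) k \<noteq> 0. f (fst p) k * g k (snd p)) \<noteq> 0}"
    by (rule finite_subset) (use f g in auto)
qed

lemma ent_mult:
  assumes "finite K" "ind A \<subseteq> K \<or> ind B \<subseteq> K"
  shows "ent (A * B) i j = (\<Sum>k\<in>K. ent A i k * ent B k j)"
proof -
  have fin: "finite {k. ent A i k \<noteq> 0}" by (rule finite_subset[OF _ finite_ind[of A]]) (auto simp: ind_def)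
  have "ent (A * B) i j = (\<Sum>k | ent A i k \<noteq> 0. ent A i k * ent B k j)" by transfer simp
  also have "\<dots> = (\<Sum>k\<in>{k. ent A i k \<noteq> 0} \<union> K. ent A i k * ent B k j)"
    by (intro sum.mono_neutral_left) (use fin assms in auto)
  also have "\<dots> = (\<Sum>k\<in>K. ent A i k * ent B k j)"
    using assms ent_outside(2)[of _ A i] ent_outside(1)[of _ B j]
    by (intro sum.mono_neutral_right) (use fin in auto)
  finally show ?thesis .
qed

instance
proof
  fix a b c :: "'a fmat" and r :: real
  show "a * b * c = a * (b * c)"
  proof (rule fmat_eqI)
    fix i j
    define K where "K = ind a \<union> ind b \<union> ind c"
    have K: "finite K" "ind a \<subseteq> K" "ind b \<subseteq> K" "ind c \<subseteq> K" by (auto simp: K_def)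
    have "ent (a * b * c) i j = (\<Sum>k\<in>K. (\<Sum>l\<in>K. ent a i l * ent b l k) * ent c k j)"
      using K by (simp add: ent_mult[of K])
    also have "\<dots> = (\<Sum>k\<in>K. \<Sum>l\<in>K. ent a i l * ent b l k * ent c k j)" by (simp add: sum_distrib_right)
    also have "\<dots> = (\<Sum>l\<in>K. \<Sum>k\<in>K. ent a i l * ent b l k * ent c k j)" by (rule sum.swap)
    also have "\<dots> = (\<Sum>l\<in>K. ent a i l * (\<Sum>k\<in>K. ent b l k * ent c k j))" by (simp add: sum_distrib_left mult.assoc)
    also have "\<dots> = ent (a * (b * c)) i j" using K by (simp add: ent_mult[of K])
    finally show "ent (a * b * c) i j = ent (a * (b * c)) i j" .
  qed
  show "(a + b) * c = a * c + b * c"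
    by (rule fmat_eqI) (simp add: ent_mult[of "ind c"] algebra_simps sum.distrib)
  show "a * (b + c) = a * b + a * c"
    by (rule fmat_eqI) (simp add: ent_mult[of "ind a"] algebra_simps sum.distrib)
  show "(r *\<^sub>R a) * b = r *\<^sub>R (a * b)"
    by (rule fmat_eqI) (simp add: ent_mult[of "ind b"] sum_distrib_left mult.assoc)
  show "a * (r *\<^sub>R b) = r *\<^sub>R (a * b)"
    by (rule fmat_eqI) (simp add: ent_mult[of "ind a"] sum_distrib_left mult.left_commute)
  show "norm (a * b) \<le> norm a * norm b"
  proof -
    define K where "K = ind a \<union> ind b \<union> ind (a * b)"
    have K: "finite K" "ind a \<subseteq> K" "ind b \<subseteq> K" "ind (a * b) \<subseteq> K" by (auto simp: K_def)
    have "(a * b) \<bullet> (a * b) = (\<Sum>i\<in>K. \<Sum>j\<in>K. (\<Sum>k\<in>K. ent a i k * ent b k j)\<^sup>2)"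
      using inner_fmat_eq[of K "a * b" "a * b"] ent_mult[of K a b] K by (simp add: power2_eq_square)
    also have "\<dots> \<le> (\<Sum>i\<in>K. \<Sum>j\<in>K. (\<Sum>k\<in>K. (ent a i k)\<^sup>2) * (\<Sum>k\<in>K. (ent b k j)\<^sup>2))"
      by (intro sum_mono Cauchy_Schwarz_ineq_sum)
    also have "\<dots> = (\<Sum>i\<in>K. \<Sum>k\<in>K. (ent a i k)\<^sup>2) * (\<Sum>j\<in>K. \<Sum>k\<in>K. (ent b k j)\<^sup>2)"
      by (simp add: sum_product)
    also have "(\<Sum>j\<in>K. \<Sum>k\<in>K. (ent b k j)\<^sup>2) = (\<Sum>k\<in>K. \<Sum>j\<in>K. (ent b k j)\<^sup>2)" by (rule sum.swap)
    also have "(\<Sum>i\<in>K. \<Sum>k\<in>K. (ent a i k)\<^sup>2) * \<dots> = (a \<bullet> a) * (b \<bullet> b)"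
      using inner_fmat_eq[of K a a] inner_fmat_eq[of K b b] K by (simp add: power2_eq_square)
    finally have "sqrt ((a * b) \<bullet> (a * b)) \<le> sqrt ((a \<bullet> a) * (b \<bullet> b))" by (rule real_sqrt_le_mono)
    then show ?thesis by (simp add: norm_eq_sqrt_inner real_sqrt_mult)
  qed
qed
end

lemma adj_adj [simp]: "adj (adj A) = A" by (rule fmat_eqI) simp
lemma adj_zero [simp]: "adj 0 = 0" by (rule fmat_eqI) simp
lemma adj_add [simp]: "adj (A + B) = adj A + adj B" by (rule fmat_eqI) simp
lemma adj_diff [simp]: "adj (A - B) = adj A - adj B" by (rule fmat_eqI) simp
lemma adj_uminus [simp]: "adj (- A) = - adj A" by (rule fmat_eqI) simp
lemma adj_scaleR [simp]: "adj (c *\<^sub>R A) = c *\<^sub>R adj A" by (rule fmat_eqI) simp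
lemma adj_sum [simp]: "adj (\<Sum>x\<in>S. f x) = (\<Sum>x\<in>S. adj (f x))" by (rule fmat_eqI) simp
lemma ind_adj [simp]: "ind (adj A) = ind A" by (auto simp: ind_def)
lemma adj_mult [simp]: "adj (A * B) = adj B * adj A"
  by (rule fmat_eqI) (simp add: ent_mult[of "ind A"] mult.commute)
lemma inner_adj: "adj A \<bullet> adj B = A \<bullet> B"
  by (simp add: inner_fmat_eq[of "ind A"]) (rule sum.swap)
lemma norm_adj [simp]: "norm (adj A) = norm A" by (simp add: norm_eq_sqrt_inner inner_adj)

lemma inner_mult_left: "(A * B) \<bullet> C = B \<bullet> (adj A * C)"
proof -
  define K where "K = ind A \<union> ind B \<union> ind C"
  have K: "finite K" "ind A \<subseteq> K" "ind B \<subseteq> K" "ind C \<subseteq> K" by (auto simp: K_def)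
  have "(A * B) \<bullet> C = (\<Sum>i\<in>K. \<Sum>j\<in>K. \<Sum>k\<in>K. ent A i k * ent B k j * ent C i j)"
    using inner_fmat_eq[of K "A * B" C] ent_mult[of K A B] K by (simp add: sum_distrib_right)
  also have "\<dots> = (\<Sum>i\<in>K. \<Sum>k\<in>K. \<Sum>j\<in>K. ent A i k * ent B k j * ent C i j)"
    by (intro sum.cong refl sum.swap)
  also have "\<dots> = (\<Sum>k\<in>K. \<Sum>i\<in>K. \<Sum>j\<in>K. ent A i k * ent B k j * ent C i j)" by (rule sum.swap)
  also have "\<dots> = (\<Sum>k\<in>K. \<Sum>j\<in>K. \<Sum>i\<in>K. ent A i k * ent B k j * ent C i j)"
    by (intro sum.cong refl sum.swap)
  also have "\<dots> = B \<bullet> (adj A * C)"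
    using inner_fmat_eq[of K B "adj A * C"] ent_mult[of K "adj A" C] K
    by (simp add: sum_distrib_left mult.assoc mult.left_commute)
  finally show ?thesis .
qed

lemma inner_mult_right: "(A * B) \<bullet> C = A \<bullet> (C * adj B)"
proof -
  have "(A * B) \<bullet> C = adj (A * B) \<bullet> adj C" by (simp only: inner_adj)
  also have "\<dots> = adj A \<bullet> (B * adj C)" by (simp add: inner_mult_left)
  also have "\<dots> = A \<bullet> (C * adj B)" by (subst inner_adj[symmetric]) simp
  finally show ?thesis .
qed

lemma norm2_inner: "(norm (x::'v::real_inner))\<^sup>2 = x \<bullet> x" by (rule power2_norm_eq_inner)

lemma norm_le_normI:
  fixes x y :: "'v::real_inner"
  assumes "x \<bullet> x \<le> norm x * (c * norm y)" "c \<ge> 0"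
  shows "norm x \<le> c * norm y"
proof (cases "norm x = 0")
  case False
  have "norm x * norm x \<le> norm x * (c * norm y)" using assms by (metis norm2_inner power2_eq_square)
  then show ?thesis using False by simp
qed (use assms in simp)

text \<open>A bound on the spectral norm, phrased through Frobenius norms of products; on a matrix
  \<open>B\<close> with a single column it is the usual operator bound.\<close>

definition opb :: "'a fmat \<Rightarrow> real \<Rightarrow> bool" where
  "opb A c \<longleftrightarrow> 0 \<le> c \<and> (\<forall>B. norm (A * B) \<le> c * norm B)"

lemma opb_nonneg: "opb A c \<Longrightarrow> 0 \<le> c" by (simp add: opb_def)
lemma opb_left: "opb A c \<Longrightarrow> norm (A * B) \<le> c * norm B" by (simp add: opb_def)
text \<open>By duality: the squared norm of \<open>B * A\<close> pairs \<open>B\<close> with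
  \<open>B * A * adj A\<close>, and after transposition the left bound applies to that
  product.\<close>

lemma opb_right: 
  assumes "opb A c" shows "norm (B * A) \<le> c * norm B"
proof (rule norm_le_normI)
  have "norm (B * A * adj A) = norm (A * adj (B * A))"
    by (subst norm_adj[symmetric]) (simp add: mult.assoc)
  also have "\<dots> \<le> c * norm (B * A)" using opb_left[OF assms, of "adj (B * A)"] by (simp only: norm_adj)
  finally have le: "norm (B * A * adj A) \<le> c * norm (B * A)" .
  have "(B * A) \<bullet> (B * A) = B \<bullet> (B * A * adj A)" by (simp add: inner_mult_right)
  also have "\<dots> \<le> norm B * norm (B * A * adj A)" by (rule norm_cauchy_schwarz)
  also have "\<dots> \<le> norm B * (c * norm (B * A))" by (intro mult_left_mono le) simp
  finally show "(B * A) \<bullet> (B * A) \<le> norm (B * A) * (c * norm B)"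
    by (simp add: mult_ac)
qed (use assms opb_nonneg in auto)

section \<open>Orthogonal projections and projections onto tangent spaces\<close>

definition proj :: "'a fmat \<Rightarrow> bool" where "proj P \<longleftrightarrow> adj P = P \<and> P * P = P"

lemma proj_mult: "proj P \<Longrightarrow> P * P = P" "proj P \<Longrightarrow> P * (P * A) = P * A" "proj P \<Longrightarrow> A * P * P = A * P"
  by (simp_all add: proj_def mult.assoc flip: mult.assoc[of P P])
lemma proj_adj: "proj P \<Longrightarrow> adj P = P" by (simp add: proj_def)

lemma proj_inner_left: "proj P \<Longrightarrow> (P * A) \<bullet> (P * B) = A \<bullet> (P * B)"
  by (simp add: inner_mult_left proj_def flip: mult.assoc)
lemma proj_pythagoras:
  assumes "proj P" shows "(norm A)\<^sup>2 = (norm (P * A))\<^sup>2 + (norm (A - P * A))\<^sup>2"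
  using proj_inner_left[OF assms, of A A]
  by (simp add: norm2_inner inner_diff_left inner_diff_right inner_commute)
lemma proj_norm_le: "proj P \<Longrightarrow> norm (P * A) \<le> norm A" "proj P \<Longrightarrow> norm (A - P * A) \<le> norm A"
  using proj_pythagoras[of P A] power2_le_imp_le[of "norm (P * A)" "norm A"]
    power2_le_imp_le[of "norm (A - P * A)" "norm A"] by auto
lemma proj_norm_le_right:
  assumes "proj P" shows "norm (A * P) \<le> norm A" "norm (A - A * P) \<le> norm A"
  using proj_norm_le[OF assms, of "adj A"] assms
  by (metis norm_adj proj_adj adj_mult adj_adj adj_diff)+

text \<open>For projections \<open>P \<bullet> Q\<close> is the trace of \<open>P * Q\<close> and
  \<open>(norm P)\<^sup>2\<close> is the rank of \<open>P\<close>, so this measures how much of the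
  range of \<open>P\<close> lies outside that of \<open>Q\<close>.\<close>

lemma proj_compl_mult:
  assumes "proj P" "proj Q" shows "(norm (P - Q * P))\<^sup>2 = (norm P)\<^sup>2 - P \<bullet> Q"
proof -
  have "(Q * P) \<bullet> (Q * P) = P \<bullet> (Q * P)" by (rule proj_inner_left[OF assms(2)])
  also have "\<dots> = P \<bullet> Q"
    using inner_mult_right[of Q P P] assms by (simp add: inner_commute proj_def)
  finally show ?thesis using proj_pythagoras[OF assms(2), of P] by (simp add: norm2_inner)
qed

text \<open>With equal ranks the two one-sided defects agree, so controlling the part of one range
  outside the other controls the whole difference.\<close>

lemma proj_diff_norm:
  assumes "proj P" "proj Q" "norm P = norm Q"
  shows "(norm (P - Q))\<^sup>2 = 2 * (norm (P - Q * P))\<^sup>2"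
proof -
  have "(norm (P - Q))\<^sup>2 = (norm P)\<^sup>2 + (norm Q)\<^sup>2 - 2 * (P \<bullet> Q)"
    by (simp add: norm2_inner inner_diff_left inner_diff_right inner_commute)
  then show ?thesis using proj_compl_mult[OF assms(1,2)] assms(3) by simp
qed

lemma proj_inner_le:
  assumes "proj P" "proj Q" shows "P \<bullet> Q \<le> (norm Q)\<^sup>2"
proof -
  have "0 \<le> (norm (Q - P * Q))\<^sup>2" by simp
  also have "\<dots> = (norm Q)\<^sup>2 - Q \<bullet> P" by (rule proj_compl_mult[OF assms(2,1)])
  finally show ?thesis by (simp add: inner_commute)
qed

text \<open>The orthogonal projection onto \<open>{P * A + B * Q}\<close>.\<close>

definition tproj :: "'a fmat \<Rightarrow> 'a fmat \<Rightarrow> 'a fmat \<Rightarrow> 'a fmat" where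
  "tproj P Q A = P * A + A * Q - P * A * Q"

lemma linear_tproj: "linear (tproj P Q)"
  by (rule linearI) (simp_all add: tproj_def algebra_simps)

lemma tproj_idem:
  assumes "proj P" "proj Q" shows "tproj P Q (tproj P Q A) = tproj P Q A"
proof -
  have "P * (P * A) = P * A" "A * Q * Q = A * Q" "P * (P * (A * Q)) = P * (A * Q)" "A * (Q * Q) = A * Q" 
    using assms proj_mult by (auto simp: mult.assoc)
  then show ?thesis by (simp only: tproj_def distrib_left distrib_right left_diff_distrib right_diff_distrib mult.assoc) simp
qed

lemma tproj_sym:
  assumes "proj P" "proj Q" shows "tproj P Q A \<bullet> B = A \<bullet> tproj P Q B"
proof -
  have "(P * A) \<bullet> B = A \<bullet> (P * B)" "(A * Q) \<bullet> B = A \<bullet> (B * Q)" 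
    using assms by (simp add: inner_mult_left proj_def, simp add: inner_mult_right proj_def)
  moreover have "(P * A * Q) \<bullet> B = A \<bullet> (P * B * Q)"
    using assms inner_mult_right[of "P * A" Q B] inner_mult_left[of P A "B * Q"] by (simp add: proj_def mult.assoc)
  ultimately show ?thesis by (simp add: tproj_def inner_add_left inner_add_right inner_diff_left inner_diff_right)
qed

lemma tproj_compl: "A - tproj P Q A = (A - P * A) - (A - P * A) * Q"
  by (simp add: tproj_def algebra_simps)

lemma tproj_inner_self:
  assumes "proj P" "proj Q" shows "tproj P Q A \<bullet> tproj P Q A = A \<bullet> tproj P Q A"
  using tproj_sym[OF assms, of A "tproj P Q A"] tproj_idem[OF assms] by simp

lemma tproj_norm_le:
  assumes "proj P" "proj Q" shows "norm (tproj P Q A) \<le> norm A"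
proof -
  have "(norm A)\<^sup>2 = (norm (tproj P Q A))\<^sup>2 + (norm (A - tproj P Q A))\<^sup>2"
    using tproj_inner_self[OF assms, of A]
    by (simp add: norm2_inner inner_diff_left inner_diff_right inner_commute)
  then have "(norm (tproj P Q A))\<^sup>2 \<le> (norm A)\<^sup>2" by simp
  then show ?thesis by (rule power2_le_imp_le) simp
qed

text \<open>The tangent projection is the orthogonal sum of \<open>P * A\<close> and the part of
  \<open>A * Q\<close> outside the range of \<open>P\<close>. For a unit tensor this separates a
  column contribution from a row contribution.\<close>

lemma tproj_norm2_le:
  assumes "proj P" "proj Q" 
  shows "(norm (tproj P Q A))\<^sup>2 \<le> (norm (P * A))\<^sup>2 + (norm (A * Q))\<^sup>2"
proof -
  have e: "tproj P Q A = P * A + (A * Q - P * (A * Q))" by (simp add: tproj_def mult.assoc)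
  have "(P * A) \<bullet> (A * Q - P * (A * Q)) = 0"
    using proj_inner_left[OF assms(1), of "A * Q" A] assms
    by (simp add: inner_diff_right inner_commute)
  then have "(norm (tproj P Q A))\<^sup>2 = (norm (P * A))\<^sup>2 + (norm (A * Q - P * (A * Q)))\<^sup>2"
    unfolding e by (simp add: norm2_inner inner_add_left inner_add_right inner_commute)
  moreover have "(norm (A * Q - P * (A * Q)))\<^sup>2 \<le> (norm (A * Q))\<^sup>2"
    using proj_norm_le(2)[OF assms(1), of "A * Q"] by (simp add: power_mono)
  ultimately show ?thesis by simp
qed

text \<open>Both complements annihilate \<open>Z\<close>. Writing \<open>X\<close> as
  \<open>X * Y * X\<close> with a generalised inverse \<open>Y\<close> lets one complement act on
  each outer factor, so the error is quadratic in \<open>X - Z\<close>: the tangent space at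
  \<open>Z\<close> misses \<open>X\<close> only to second order.\<close>

lemma tproj_residual:
  assumes "proj P" "proj Q" "P * Z = Z" "Z * Q = Z" "X * Y * X = X" "opb Y c"
  shows "norm (X - tproj P Q X) \<le> c * (norm (X - Z))\<^sup>2"
proof -
  define D where "D = X - Z"
  have 1: "X - P * X = D - P * D" "X - X * Q = D - D * Q" using assms by (simp_all add: D_def algebra_simps)
  have "X - tproj P Q X = (X - P * X) * (Y * (X - X * Q))"
  proof -
    have "(X - P * X) * (Y * (X - X * Q)) = X*Y*X - X*Y*X*Q - P*(X*Y*X) + P*(X*Y*X)*Q"
      by (simp add: algebra_simps)
    then show ?thesis unfolding assms(5) tproj_compl by (simp add: algebra_simps)
  qed
  also have "norm \<dots> \<le> norm (D - P * D) * norm (Y * (D - D * Q))" unfolding 1 by (rule norm_mult_ineq)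
  also have "\<dots> \<le> norm D * (c * norm D)"
  proof (rule mult_mono)
    show "norm (D - P * D) \<le> norm D" by (rule proj_norm_le[OF assms(1)])
    have "norm (Y * (D - D * Q)) \<le> c * norm (D - D * Q)" by (rule opb_left[OF assms(6)])
    also have "\<dots> \<le> c * norm D" using proj_norm_le_right(2)[OF assms(2)] opb_nonneg[OF assms(6)] by (rule mult_left_mono)
    finally show "norm (Y * (D - D * Q)) \<le> c * norm D" .
  qed auto
  finally show ?thesis by (simp add: D_def power2_eq_square mult_ac)
qed

text \<open>A telescoping split that leaves a complement next to each difference. Complements do not
  increase the norm, so the Lipschitz constant is 1 in each projection.\<close>

lemma tproj_diff:
  assumes "proj P" "proj Q'" 
  shows "norm (tproj P Q A - tproj P' Q' A) \<le> (norm (P - P') + norm (Q - Q')) * norm A"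
proof -
  have "tproj P Q A - tproj P' Q' A = (P - P') * (A - A * Q') + (A - P * A) * (Q - Q')"
    by (simp add: tproj_def algebra_simps)
  also have "norm \<dots> \<le> norm (P - P') * norm (A - A * Q') + norm (A - P * A) * norm (Q - Q')"
    by (intro norm_triangle_le add_mono norm_mult_ineq)
  also have "\<dots> \<le> norm (P - P') * norm A + norm A * norm (Q - Q')"
    by (intro add_mono mult_left_mono mult_right_mono proj_norm_le[OF assms(1)] proj_norm_le_right[OF assms(2)]) auto
  finally show ?thesis by (simp add: algebra_simps)
qed

text \<open>The complement of \<open>Q\<close> annihilates \<open>Z\<close> and hence sees
  \<open>X\<close> only through \<open>X - Z\<close>; the factor \<open>Y\<close> costs its spectral
  bound.\<close>

lemma proj_compl_perturb:
  assumes "proj Q" "Q * Z = Z" "P = X * Y" "opb Y c"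
  shows "norm (P - Q * P) \<le> c * norm (X - Z)"
proof -
  have "P - Q * P = ((X - Z) - Q * (X - Z)) * Y" using assms by (simp add: algebra_simps)
  also have "norm \<dots> \<le> c * norm ((X - Z) - Q * (X - Z))" by (rule opb_right[OF assms(4)])
  also have "\<dots> \<le> c * norm (X - Z)" 
    using proj_norm_le(2)[OF assms(1)] opb_nonneg[OF assms(4)] by (rule mult_left_mono)
  finally show ?thesis .
qed

lemma proj_perturb:
  assumes "proj P" "proj Q" "norm P = norm Q" "Q * Z = Z" "P = X * Y" "opb Y c"
  shows "norm (P - Q) \<le> 2 * (c * norm (X - Z))"
proof -
  have "(norm (P - Q))\<^sup>2 = 2 * (norm (P - Q * P))\<^sup>2" by (rule proj_diff_norm) fact+
  also have "\<dots> \<le> 2 * (c * norm (X - Z))\<^sup>2"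
    using proj_compl_perturb[OF assms(2,4,5,6)] by (simp add: power_mono)
  also have "\<dots> \<le> (2 * (c * norm (X - Z)))\<^sup>2" by (simp add: power_mult_distrib)
  finally show ?thesis by (rule power2_le_imp_le) (use opb_nonneg[OF assms(6)] in auto)
qed

section \<open>Moments of random self-adjoint maps\<close>

text \<open>Expectations over \<open>m\<close> independent uniform samples are written as plain sums
  over these lists, which carry the factor \<open>card I ^ m\<close>.\<close>

definition samples :: "'i set \<Rightarrow> nat \<Rightarrow> 'i list set" where
  "samples I m = {xs. set xs \<subseteq> I \<and> length xs = m}"

lemma finite_samples [simp]: "finite I \<Longrightarrow> finite (samples I m)"
  unfolding samples_def by (rule finite_lists_length_eq)

lemma card_samples: "finite I \<Longrightarrow> card (samples I m) = card I ^ m"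
  unfolding samples_def by (rule card_lists_length_eq)

lemma samples_nth: "xs \<in> samples I m \<Longrightarrow> i < m \<Longrightarrow> xs ! i \<in> I"
  by (auto simp: samples_def)

lemma samples_update: "xs \<in> samples I m \<Longrightarrow> e \<in> I \<Longrightarrow> xs[i := e] \<in> samples I m"
  unfolding samples_def using set_update_subset_insert[of xs i e] by auto

text \<open>Exchangeability: trading the \<open>i\<close>-th sample for the fresh index
  \<open>e\<close> is an involution on pairs.\<close>

lemma sum_samples_swap:
  fixes F :: "'i list \<Rightarrow> 'i \<Rightarrow> real"
  assumes "i < m"
  shows "(\<Sum>xs\<in>samples I m. \<Sum>e\<in>I. F (xs[i := e]) (xs ! i)) = (\<Sum>xs\<in>samples I m. \<Sum>e\<in>I. F xs e)"
  unfolding sum.cartesian_product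
  by (rule sum.reindex_bij_witness[where i = "\<lambda>(xs, e). (xs[i := e], xs ! i)" and j = "\<lambda>(xs, e). (xs[i := e], xs ! i)"])
     (use assms in \<open>auto simp: samples_update samples_nth\<close>, auto simp: samples_def)

text \<open>The \<open>j\<close>-th and \<open>k\<close>-th powers of the absolute values are
  ordered alike, so the product of their differences is nonnegative.\<close>

lemma power_mixed_le:
  fixes x y :: real
  assumes "even (j + k)"
  shows "x ^ j * y ^ k + x ^ k * y ^ j \<le> x ^ (j + k) + y ^ (j + k)"
proof -
  have "x ^ j * y ^ k + x ^ k * y ^ j \<le> \<bar>x\<bar> ^ j * \<bar>y\<bar> ^ k + \<bar>x\<bar> ^ k * \<bar>y\<bar> ^ j"
    by (intro add_mono) (metis abs_ge_self abs_mult power_abs)+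
  also have "\<dots> \<le> \<bar>x\<bar> ^ (j + k) + \<bar>y\<bar> ^ (j + k)"
  proof -
    have "0 \<le> (\<bar>x\<bar> ^ j - \<bar>y\<bar> ^ j) * (\<bar>x\<bar> ^ k - \<bar>y\<bar> ^ k)"
    proof (cases "\<bar>x\<bar> \<le> \<bar>y\<bar>")
      case True
      then show ?thesis by (intro mult_nonpos_nonpos) (auto intro: power_mono)
    next
      case False
      then show ?thesis by (intro mult_nonneg_nonneg) (auto intro: power_mono)
    qed
    then show ?thesis by (simp add: algebra_simps power_add)
  qed
  also have "\<dots> = x ^ (j + k) + y ^ (j + k)" using assms by (simp add: power_even_abs)
  finally show ?thesis .
qed

text \<open>The scalar inequality behind the moment recursion. In the geometric sum \<open>T\<close>
  the terms \<open>j\<close> and \<open>2 * r - j\<close> are paired, and each pair is at most the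
  sum of the two pure powers.\<close>

lemma odd_power_diff_le:
  fixes x y :: real
  shows "(x ^ (2 * r + 1) - y ^ (2 * r + 1)) * (x - y)
    \<le> real (2 * r + 1) / 2 * ((x - y)\<^sup>2 * (x ^ (2 * r) + y ^ (2 * r)))"
proof -
  define T where "T = (\<Sum>j<Suc (2 * r). x ^ j * y ^ (2 * r - j))"
  have d: "x ^ (2 * r + 1) - y ^ (2 * r + 1) = (x - y) * T"
    using power_diff_sumr2[of x "2 * r + 1" y] by (simp add: T_def mult.commute)
  have T': "T = (\<Sum>j<Suc (2 * r). x ^ (2 * r - j) * y ^ j)"
    unfolding T_def by (subst sum.nat_diff_reindex[symmetric]) (intro sum.cong, auto)
  have "2 * T = (\<Sum>j<Suc (2 * r). x ^ j * y ^ (2 * r - j) + x ^ (2 * r - j) * y ^ j)"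
    using T' T_def by (simp only: sum.distrib)
  also have "\<dots> \<le> (\<Sum>j<Suc (2 * r). x ^ (2 * r) + y ^ (2 * r))"
  proof (rule sum_mono)
    fix j assume "j \<in> {..<Suc (2 * r)}"
    then show "x ^ j * y ^ (2 * r - j) + x ^ (2 * r - j) * y ^ j \<le> x ^ (2 * r) + y ^ (2 * r)"
      using power_mixed_le[of j "2 * r - j" x y] by auto
  qed
  finally have T: "T \<le> real (2 * r + 1) / 2 * (x ^ (2 * r) + y ^ (2 * r))" by (simp add: field_simps)
  have "(x - y)\<^sup>2 * T \<le> (x - y)\<^sup>2 * (real (2 * r + 1) / 2 * (x ^ (2 * r) + y ^ (2 * r)))"
    by (intro mult_left_mono T) simp
  then show ?thesis unfolding d by (simp add: power2_eq_square mult_ac)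
qed

text \<open>Expanding in both eigenbases turns the trace inequality into the scalar one.\<close>

lemma eigen_pair_ineq:
  assumes B: "onb B H" and C: "onb C H"
    and S: "selfadj_on H S" and T: "selfadj_on H T"
    and l: "\<And>b. b \<in> B \<Longrightarrow> S b = l b *\<^sub>R b" and k: "\<And>c. c \<in> C \<Longrightarrow> T c = k c *\<^sub>R c"
    and h: "\<And>z. z \<in> H \<Longrightarrow> h z = S z - T z"
  shows "(\<Sum>b\<in>B. l b ^ (2 * r + 1) * (b \<bullet> h b)) - (\<Sum>c\<in>C. k c ^ (2 * r + 1) * (c \<bullet> h c))
    \<le> real (2 * r + 1) / 2 * ((\<Sum>b\<in>B. l b ^ (2 * r) * (norm (h b))\<^sup>2) + (\<Sum>c\<in>C. k c ^ (2 * r) * (norm (h c))\<^sup>2))"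
proof -
  note Bm = onb_mem[OF B] and Cm = onb_mem[OF C]
  have SH: "S z \<in> H" "T z \<in> H" if "z \<in> H" for z using S T that by (auto simp: selfadj_on_def)
  have hH: "h z \<in> H" if "z \<in> H" for z using that SH[OF that] h onb_subspace[OF B] by (simp add: subspace_diff)
  \<comment> \<open>Between the two eigenbases \<open>S - T\<close> has the matrix entries
    \<open>b \<bullet> c\<close> times the difference of eigenvalues, so every trace becomes a
    double sum with weights \<open>(b \<bullet> c)\<^sup>2\<close>.\<close>
  have bc: "h b \<bullet> c = (l b - k c) * (b \<bullet> c)" if "b \<in> B" "c \<in> C" for b c
  proof -
    have "T b \<bullet> c = k c * (b \<bullet> c)" using T Bm Cm that k by (simp add: selfadj_on_def)
    then show ?thesis using h[OF Bm[OF that(1)]] l[OF that(1)] by (simp add: inner_diff_left left_diff_distrib)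
  qed
  have cb: "h c \<bullet> b = (l b - k c) * (b \<bullet> c)" if "b \<in> B" "c \<in> C" for b c
  proof -
    have "S c \<bullet> b = l b * (c \<bullet> b)" using S Bm Cm that l by (simp add: selfadj_on_def)
    then show ?thesis using h[OF Cm[OF that(2)]] k[OF that(2)] by (simp add: inner_diff_left inner_diff_right left_diff_distrib inner_commute)
  qed
  have 1: "b \<bullet> h b = (\<Sum>c\<in>C. (l b - k c) * (b \<bullet> c)\<^sup>2)" if "b \<in> B" for b
    using onb_inner[OF C Bm[OF that], of "h b"] bc that by (simp add: power2_eq_square mult_ac)
  have 2: "c \<bullet> h c = (\<Sum>b\<in>B. (l b - k c) * (b \<bullet> c)\<^sup>2)" if "c \<in> C" for c
    using onb_inner[OF B Cm[OF that], of "h c"] cb that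
    by (simp add: power2_eq_square mult_ac inner_commute)
  have 3: "(norm (h b))\<^sup>2 = (\<Sum>c\<in>C. (l b - k c)\<^sup>2 * (b \<bullet> c)\<^sup>2)" if "b \<in> B" for b
    using onb_norm2[OF C hH[OF Bm[OF that]]] bc that by (simp add: power_mult_distrib)
  have 4: "(norm (h c))\<^sup>2 = (\<Sum>b\<in>B. (l b - k c)\<^sup>2 * (b \<bullet> c)\<^sup>2)" if "c \<in> C" for c
    using onb_norm2[OF B hH[OF Cm[OF that]]] cb that by (simp add: power_mult_distrib)
  have "(\<Sum>b\<in>B. l b ^ (2 * r + 1) * (b \<bullet> h b)) - (\<Sum>c\<in>C. k c ^ (2 * r + 1) * (c \<bullet> h c)) =
    (\<Sum>b\<in>B. \<Sum>c\<in>C. l b ^ (2 * r + 1) * ((l b - k c) * (b \<bullet> c)\<^sup>2)) -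
    (\<Sum>c\<in>C. \<Sum>b\<in>B. k c ^ (2 * r + 1) * ((l b - k c) * (b \<bullet> c)\<^sup>2))"
    using 1 2 by (simp add: sum_distrib_left)
  also have "(\<Sum>c\<in>C. \<Sum>b\<in>B. k c ^ (2 * r + 1) * ((l b - k c) * (b \<bullet> c)\<^sup>2)) =
    (\<Sum>b\<in>B. \<Sum>c\<in>C. k c ^ (2 * r + 1) * ((l b - k c) * (b \<bullet> c)\<^sup>2))" by (rule sum.swap)
  also have "(\<Sum>b\<in>B. \<Sum>c\<in>C. l b ^ (2 * r + 1) * ((l b - k c) * (b \<bullet> c)\<^sup>2)) -
    (\<Sum>b\<in>B. \<Sum>c\<in>C. k c ^ (2 * r + 1) * ((l b - k c) * (b \<bullet> c)\<^sup>2)) =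
    (\<Sum>b\<in>B. \<Sum>c\<in>C. ((l b ^ (2 * r + 1) - k c ^ (2 * r + 1)) * (l b - k c)) * (b \<bullet> c)\<^sup>2)"
    by (simp only: sum_subtractf[symmetric]) (intro sum.cong refl, simp add: algebra_simps)
  also have "\<dots> \<le> (\<Sum>b\<in>B. \<Sum>c\<in>C. (real (2 * r + 1) / 2 * ((l b - k c)\<^sup>2 * (l b ^ (2 * r) + k c ^ (2 * r)))) * (b \<bullet> c)\<^sup>2)"
    by (intro sum_mono mult_right_mono odd_power_diff_le) simp
  also have "\<dots> = real (2 * r + 1) / 2 * ((\<Sum>b\<in>B. \<Sum>c\<in>C. l b ^ (2 * r) * ((l b - k c)\<^sup>2 * (b \<bullet> c)\<^sup>2)) +
     (\<Sum>b\<in>B. \<Sum>c\<in>C. k c ^ (2 * r) * ((l b - k c)\<^sup>2 * (b \<bullet> c)\<^sup>2)))"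
    by (simp only: sum_distrib_left flip: sum.distrib) (intro sum.cong refl, simp add: algebra_simps)
  also have "(\<Sum>b\<in>B. \<Sum>c\<in>C. k c ^ (2 * r) * ((l b - k c)\<^sup>2 * (b \<bullet> c)\<^sup>2)) =
    (\<Sum>c\<in>C. \<Sum>b\<in>B. k c ^ (2 * r) * ((l b - k c)\<^sup>2 * (b \<bullet> c)\<^sup>2))" by (rule sum.swap)
  finally show ?thesis using 3 4 by (simp add: sum_distrib_left)
qed

lemma selfadj_on_add: "selfadj_on H f \<Longrightarrow> selfadj_on H g \<Longrightarrow> subspace H \<Longrightarrow> selfadj_on H (\<lambda>z. f z + g z)"
  by (auto simp: selfadj_on_def inner_add_left inner_add_right image_subset_iff subspace_add intro: linear_compose_add)
lemma selfadj_on_scale: "selfadj_on H f \<Longrightarrow> subspace H \<Longrightarrow> selfadj_on H (\<lambda>z. c *\<^sub>R f z)"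
  by (auto simp: selfadj_on_def image_subset_iff subspace_scale intro: linear_compose_scale_right)
lemma selfadj_on_sum:
  assumes "\<And>i. i \<in> K \<Longrightarrow> selfadj_on H (f i)" "subspace H"
  shows "selfadj_on H (\<lambda>z. \<Sum>i\<in>K. f i z)"
  using assms by (auto simp: selfadj_on_def image_subset_iff inner_sum_left inner_sum_right
      intro!: linear_compose_sum subspace_sum sum.cong)

locale random_selfadj =
  fixes I :: "'i set" and g :: "'i \<Rightarrow> 'v::real_inner \<Rightarrow> 'v" and H :: "'v set" and D :: "'v set" and m :: nat
  assumes fin: "finite I" and ne: "I \<noteq> {}" and D: "onb D H" and sa: "\<And>e. e \<in> I \<Longrightarrow> selfadj_on H (g e)"
begin

definition dev :: "'i list \<Rightarrow> 'v \<Rightarrow> 'v" where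
  "dev xs z = (\<Sum>i<m. g (xs ! i) z) + (- (real m / real (card I))) *\<^sub>R (\<Sum>e\<in>I. g e z)"

lemma N: "real (card I) > 0" using fin ne by (simp add: card_gt_0_iff)

lemma subH: "subspace H" using onb_subspace[OF D] .

lemma dev_selfadj: "xs \<in> samples I m \<Longrightarrow> selfadj_on H (dev xs)"
  unfolding dev_def[abs_def]
  by (intro selfadj_on_add selfadj_on_scale selfadj_on_sum sa subH) (auto simp: samples_nth)

text \<open>One eigenbasis is fixed per sample, so that traces of powers of \<open>dev xs\<close>
  become power sums of eigenvalues and no functional calculus is called for.\<close>

definition eigsys :: "'i list \<Rightarrow> 'v set \<times> ('v \<Rightarrow> real)" where
  "eigsys xs = (SOME p. onb (fst p) H \<and> (\<forall>b\<in>fst p. dev xs b = snd p b *\<^sub>R b))"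
abbreviation "eb xs \<equiv> fst (eigsys xs)"
abbreviation "eva xs \<equiv> snd (eigsys xs)"

lemma eigsys:
  assumes "xs \<in> samples I m"
  shows "onb (eb xs) H" "\<And>b. b \<in> eb xs \<Longrightarrow> dev xs b = eva xs b *\<^sub>R b"
proof -
  obtain B' v where "onb B' H \<and> (\<forall>b\<in>B'. dev xs b = v b *\<^sub>R b)"
    using selfadj_spectral[OF D dev_selfadj[OF assms]] by blast
  then have "\<exists>p. onb (fst p) H \<and> (\<forall>b\<in>fst p. dev xs b = snd p b *\<^sub>R b)" by (intro exI[of _ "(B', v)"]) simp
  from someI_ex[OF this] show "onb (eb xs) H" "\<And>b. b \<in> eb xs \<Longrightarrow> dev xs b = eva xs b *\<^sub>R b"
    by (auto simp: eigsys_def)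
qed

lemma eb_unit: "xs \<in> samples I m \<Longrightarrow> b \<in> eb xs \<Longrightarrow> b \<bullet> b = 1"
  using onset_inner[OF onb_onset[OF eigsys(1)]] by simp
lemma eb_mem: "xs \<in> samples I m \<Longrightarrow> b \<in> eb xs \<Longrightarrow> b \<in> H"
  using onb_mem[OF eigsys(1)] by simp
lemma inner_dev: "xs \<in> samples I m \<Longrightarrow> b \<in> eb xs \<Longrightarrow> b \<bullet> dev xs b = eva xs b"
  by (simp add: eigsys eb_unit)

text \<open>This is \<open>card I ^ m\<close> times the expected trace of the
  \<open>2 * q\<close>-th power of \<open>dev\<close>.\<close>

definition moment :: "nat \<Rightarrow> real" where
  "moment q = (\<Sum>xs\<in>samples I m. \<Sum>b\<in>eb xs. eva xs b ^ (2 * q))"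

lemma moment_nonneg: "0 \<le> moment q"
  unfolding moment_def by (intro sum_nonneg) (simp add: power_mult)

lemma moment_0: "moment 0 = real (card I) ^ m * real (card D)"
  unfolding moment_def using card_samples[OF fin] onb_card_eq[OF eigsys(1) D] by simp

lemma dev_diff:
  assumes "xs \<in> samples I m" "i < m"
  shows "dev xs z - dev (xs[i := e]) z = g (xs ! i) z - g e z"
proof -
  have "dev xs z - dev (xs[i := e]) z = (\<Sum>k<m. g (xs ! k) z - g (xs[i := e] ! k) z)"
    by (simp add: dev_def sum_subtractf)
  also have "\<dots> = (\<Sum>k<m. if k = i then g (xs ! i) z - g e z else 0)"
    using assms by (intro sum.cong) (auto simp: samples_def nth_list_update)
  finally show ?thesis using assms by simp
qed

text \<open>Exchangeable pairs: \<open>xs\<close> and \<open>xs[i := e]\<close> with an independent sample \<open>e\<close>.\<close>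

lemma moment_Suc_le:
  "moment (Suc r) \<le> real (2 * r + 1) * (\<Sum>xs\<in>samples I m. \<Sum>b\<in>eb xs. eva xs b ^ (2 * r) *
     ((\<Sum>i<m. (norm (g (xs ! i) b))\<^sup>2) + real m / real (card I) * (\<Sum>e\<in>I. (norm (g e b))\<^sup>2)))"
proof -
  let ?N = "real (card I)" and ?L = "samples I m"
  define h where "h xs i e z = g (xs ! i) z - g e z" for xs :: "'i list" and i :: nat and e z
  define T where "T i xs e = (\<Sum>b\<in>eb xs. eva xs b ^ (2 * r + 1) * (b \<bullet> h xs i e b))" for xs i e
  define G where "G i xs e = (\<Sum>b\<in>eb xs. eva xs b ^ (2 * r) * (norm (h xs i e b))\<^sup>2)" for xs i e
  \<comment> \<open>Exchanging changes the sign of \<open>h\<close>, so the two traces combine to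
    the left side of the inequality for a pair of eigenbases.\<close>
  have pair: "T i xs e + T i (xs[i := e]) (xs ! i) \<le> real (2 * r + 1) / 2 * (G i xs e + G i (xs[i := e]) (xs ! i))"
    if "xs \<in> ?L" "e \<in> I" "i < m" for xs e i
  proof -
    have xs': "xs[i := e] \<in> ?L" using that by (simp add: samples_update)
    have len: "length xs = m" using that by (simp add: samples_def)
    have hm: "h (xs[i := e]) i (xs ! i) z = - h xs i e z" for z using len that by (simp add: h_def)
    have "(\<Sum>b\<in>eb xs. eva xs b ^ (2 * r + 1) * (b \<bullet> h xs i e b)) -
        (\<Sum>c\<in>eb (xs[i := e]). eva (xs[i := e]) c ^ (2 * r + 1) * (c \<bullet> h xs i e c))
      \<le> real (2 * r + 1) / 2 * ((\<Sum>b\<in>eb xs. eva xs b ^ (2 * r) * (norm (h xs i e b))\<^sup>2) +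
         (\<Sum>c\<in>eb (xs[i := e]). eva (xs[i := e]) c ^ (2 * r) * (norm (h xs i e c))\<^sup>2))"
      by (rule eigen_pair_ineq[OF eigsys(1)[OF that(1)] eigsys(1)[OF xs'] dev_selfadj[OF that(1)] dev_selfadj[OF xs']
         eigsys(2)[OF that(1)] eigsys(2)[OF xs']])
         (use dev_diff[OF that(1,3)] in \<open>auto simp: h_def\<close>)
    then show ?thesis by (simp add: T_def G_def hm sum_negf)
  qed
  have i_sum: "(\<Sum>xs\<in>?L. \<Sum>e\<in>I. T i xs e) \<le> real (2 * r + 1) / 2 * (\<Sum>xs\<in>?L. \<Sum>e\<in>I. G i xs e)" if "i < m" for i
  proof -
    have "2 * (\<Sum>xs\<in>?L. \<Sum>e\<in>I. T i xs e) = (\<Sum>xs\<in>?L. \<Sum>e\<in>I. T i xs e + T i (xs[i := e]) (xs ! i))"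
      using sum_samples_swap[OF that, of "T i" I] by (simp add: sum.distrib)
    also have "\<dots> \<le> (\<Sum>xs\<in>?L. \<Sum>e\<in>I. real (2 * r + 1) / 2 * (G i xs e + G i (xs[i := e]) (xs ! i)))"
      by (intro sum_mono pair that)
    also have "\<dots> = real (2 * r + 1) / 2 * (\<Sum>xs\<in>?L. \<Sum>e\<in>I. G i xs e + G i (xs[i := e]) (xs ! i))"
      by (simp only: sum_distrib_left)
    also have "(\<Sum>xs\<in>?L. \<Sum>e\<in>I. G i xs e + G i (xs[i := e]) (xs ! i)) = 2 * (\<Sum>xs\<in>?L. \<Sum>e\<in>I. G i xs e)"
      using sum_samples_swap[OF that, of "G i" I] by (simp add: sum.distrib)
    finally show ?thesis by simp
  qed
  \<comment> \<open>Summing the differences \<open>h\<close> over positions and fresh indices gives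
    back a multiple of \<open>dev xs\<close>. This is what makes the exchanged pair useful: one
    factor of the even power is replaced by differences.\<close>
  have row: "?N * (\<Sum>b\<in>eb xs. eva xs b ^ (2 * Suc r)) = (\<Sum>i<m. \<Sum>e\<in>I. T i xs e)" if xs: "xs \<in> ?L" for xs
  proof -
    have ND: "?N *\<^sub>R dev xs z = (\<Sum>i<m. \<Sum>e\<in>I. h xs i e z)" for z
      using N by (simp add: dev_def h_def sum_subtractf scaleR_add_right scaleR_sum_right sum_constant_scaleR sum_negf scaleR_diff_right del: sum_constant)
    have "?N * (\<Sum>b\<in>eb xs. eva xs b ^ (2 * Suc r)) = (\<Sum>b\<in>eb xs. eva xs b ^ (2 * r + 1) * (b \<bullet> (?N *\<^sub>R dev xs b)))"
      using inner_dev[OF xs] by (simp add: sum_distrib_left mult_ac)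
    also have "\<dots> = (\<Sum>b\<in>eb xs. \<Sum>i<m. \<Sum>e\<in>I. eva xs b ^ (2 * r + 1) * (b \<bullet> h xs i e b))"
      unfolding ND by (simp add: inner_sum_right sum_distrib_left)
    also have "\<dots> = (\<Sum>i<m. \<Sum>b\<in>eb xs. \<Sum>e\<in>I. eva xs b ^ (2 * r + 1) * (b \<bullet> h xs i e b))" by (rule sum.swap)
    also have "\<dots> = (\<Sum>i<m. \<Sum>e\<in>I. \<Sum>b\<in>eb xs. eva xs b ^ (2 * r + 1) * (b \<bullet> h xs i e b))"
      by (intro sum.cong refl sum.swap)
    finally show ?thesis by (simp add: T_def)
  qed
  have rowG: "(\<Sum>i<m. \<Sum>e\<in>I. G i xs e) \<le> 2 * ?N * (\<Sum>b\<in>eb xs. eva xs b ^ (2 * r) *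
     ((\<Sum>i<m. (norm (g (xs ! i) b))\<^sup>2) + real m / ?N * (\<Sum>e\<in>I. (norm (g e b))\<^sup>2)))" for xs
  proof -
    have par: "(norm (h xs i e b))\<^sup>2 \<le> 2 * (norm (g (xs ! i) b))\<^sup>2 + 2 * (norm (g e b))\<^sup>2" for i e b
    proof -
      have "0 \<le> (norm (g (xs ! i) b + g e b))\<^sup>2" by simp
      then show ?thesis unfolding h_def norm2_inner
        by (simp add: inner_add_left inner_add_right inner_diff_left inner_diff_right inner_commute)
    qed
    have "(\<Sum>i<m. \<Sum>e\<in>I. G i xs e) \<le> (\<Sum>i<m. \<Sum>e\<in>I. \<Sum>b\<in>eb xs. eva xs b ^ (2 * r) * (2 * (norm (g (xs ! i) b))\<^sup>2 + 2 * (norm (g e b))\<^sup>2))"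
      unfolding G_def by (intro sum_mono mult_left_mono par) (simp add: power_mult)
    also have "\<dots> = (\<Sum>i<m. \<Sum>b\<in>eb xs. \<Sum>e\<in>I. eva xs b ^ (2 * r) * (2 * (norm (g (xs ! i) b))\<^sup>2 + 2 * (norm (g e b))\<^sup>2))"
      by (intro sum.cong refl sum.swap)
    also have "\<dots> = (\<Sum>b\<in>eb xs. \<Sum>i<m. \<Sum>e\<in>I. eva xs b ^ (2 * r) * (2 * (norm (g (xs ! i) b))\<^sup>2 + 2 * (norm (g e b))\<^sup>2))"
      by (rule sum.swap)
    also have "\<dots> = (\<Sum>b\<in>eb xs. eva xs b ^ (2 * r) * (\<Sum>i<m. \<Sum>e\<in>I. 2 * (norm (g (xs ! i) b))\<^sup>2 + 2 * (norm (g e b))\<^sup>2))"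
      by (simp only: sum_distrib_left)
    also have "\<dots> = (\<Sum>b\<in>eb xs. 2 * ?N * (eva xs b ^ (2 * r) * ((\<Sum>i<m. (norm (g (xs ! i) b))\<^sup>2) + real m / ?N * (\<Sum>e\<in>I. (norm (g e b))\<^sup>2))))"
      using N by (intro sum.cong refl) (simp add: sum.distrib field_simps flip: sum_distrib_left)
    finally show ?thesis by (simp add: sum_distrib_left)
  qed
  have "?N * moment (Suc r) = (\<Sum>xs\<in>?L. \<Sum>i<m. \<Sum>e\<in>I. T i xs e)"
    unfolding moment_def using row by (subst sum_distrib_left) (rule sum.cong[OF refl])
  also have "\<dots> = (\<Sum>i<m. \<Sum>xs\<in>?L. \<Sum>e\<in>I. T i xs e)" by (rule sum.swap)
  also have "\<dots> \<le> (\<Sum>i<m. real (2 * r + 1) / 2 * (\<Sum>xs\<in>?L. \<Sum>e\<in>I. G i xs e))" by (intro sum_mono i_sum) simp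
  also have "\<dots> = real (2 * r + 1) / 2 * (\<Sum>i<m. \<Sum>xs\<in>?L. \<Sum>e\<in>I. G i xs e)" by (simp only: sum_distrib_left)
  also have "(\<Sum>i<m. \<Sum>xs\<in>?L. \<Sum>e\<in>I. G i xs e) = (\<Sum>xs\<in>?L. \<Sum>i<m. \<Sum>e\<in>I. G i xs e)" by (rule sum.swap)
  also have "real (2 * r + 1) / 2 * \<dots> \<le> real (2 * r + 1) / 2 * (\<Sum>xs\<in>?L. 2 * ?N * (\<Sum>b\<in>eb xs. eva xs b ^ (2 * r) *
     ((\<Sum>i<m. (norm (g (xs ! i) b))\<^sup>2) + real m / ?N * (\<Sum>e\<in>I. (norm (g e b))\<^sup>2))))"
    by (intro mult_left_mono sum_mono rowG) simp
  also have "\<dots> = ?N * (real (2 * r + 1) * (\<Sum>xs\<in>?L. \<Sum>b\<in>eb xs. eva xs b ^ (2 * r) *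
     ((\<Sum>i<m. (norm (g (xs ! i) b))\<^sup>2) + real m / ?N * (\<Sum>e\<in>I. (norm (g e b))\<^sup>2))))"
    by (simp only: flip: sum_distrib_left) simp
  finally show ?thesis using N by (simp only: mult_le_cancel_left_pos)
qed

text \<open>Markov's inequality for a trace: where \<open>dev\<close> exceeds \<open>t\<close>, some
  eigenvalue does, and in an even power sum the other terms are nonnegative.\<close>

lemma markov:
  assumes "t \<ge> 0"
  shows "real (card {xs \<in> samples I m. \<not> (\<forall>z\<in>H. norm (dev xs z) \<le> t * norm z)}) * t ^ (2 * q) \<le> moment q"
proof -
  let ?bad = "{xs \<in> samples I m. \<not> (\<forall>z\<in>H. norm (dev xs z) \<le> t * norm z)}"
  have *: "t ^ (2 * q) \<le> (\<Sum>b\<in>eb xs. eva xs b ^ (2 * q))" if "xs \<in> ?bad" for xs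
  proof -
    have xs: "xs \<in> samples I m" using that by simp
    have "\<exists>b\<in>eb xs. \<bar>eva xs b\<bar> > t"
    proof (rule ccontr)
      assume "\<not> (\<exists>b\<in>eb xs. \<bar>eva xs b\<bar> > t)"
      then have le: "\<bar>eva xs b\<bar> \<le> t" if "b \<in> eb xs" for b using that by force
      have "norm (dev xs z) \<le> t * norm z" if z: "z \<in> H" for z
      proof (rule power2_le_imp_le)
        have dH: "dev xs z \<in> H" using dev_selfadj[OF xs] z by (auto simp: selfadj_on_def)
        have "(norm (dev xs z))\<^sup>2 = (\<Sum>b\<in>eb xs. (eva xs b * (z \<bullet> b))\<^sup>2)"
          unfolding onb_norm2[OF eigsys(1)[OF xs] dH]
        proof (intro sum.cong refl)
          fix b assume b: "b \<in> eb xs"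
          have "dev xs z \<bullet> b = z \<bullet> dev xs b" using dev_selfadj[OF xs] z eb_mem[OF xs b] by (simp add: selfadj_on_def)
          then show "(dev xs z \<bullet> b)\<^sup>2 = (eva xs b * (z \<bullet> b))\<^sup>2" using eigsys(2)[OF xs b] by simp
        qed
        also have "\<dots> \<le> (\<Sum>b\<in>eb xs. t\<^sup>2 * (z \<bullet> b)\<^sup>2)"
          unfolding power_mult_distrib using power_mono[OF le, of _ 2]
          by (intro sum_mono mult_right_mono) auto
        also have "\<dots> = (t * norm z)\<^sup>2"
          by (simp add: power_mult_distrib onb_norm2[OF eigsys(1)[OF xs] z] sum_distrib_left)
        finally show "(norm (dev xs z))\<^sup>2 \<le> (t * norm z)\<^sup>2" .
      qed (use assms in simp)
      then show False using that by blast
    qed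
    then obtain b where b: "b \<in> eb xs" "\<bar>eva xs b\<bar> > t" by blast
    have "t ^ (2 * q) \<le> \<bar>eva xs b\<bar> ^ (2 * q)" using b assms by (intro power_mono) auto
    also have "\<dots> = eva xs b ^ (2 * q)" by (simp add: power_even_abs)
    also have "\<dots> \<le> (\<Sum>b\<in>eb xs. eva xs b ^ (2 * q))"
      by (rule member_le_sum[OF b(1)]) (auto simp: power_mult onb_finite[OF eigsys(1)[OF xs]])
    finally show ?thesis .
  qed
  have "real (card ?bad) * t ^ (2 * q) = (\<Sum>xs\<in>?bad. t ^ (2 * q))" by simp
  also have "\<dots> \<le> (\<Sum>xs\<in>?bad. \<Sum>b\<in>eb xs. eva xs b ^ (2 * q))" by (intro sum_mono *)
  also have "\<dots> \<le> moment q" unfolding moment_def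
    by (intro sum_mono2) (auto simp: fin power_mult intro!: sum_nonneg)
  finally show ?thesis .
qed

text \<open>The hypothesis on \<open>g\<close> bounds the variance term by \<open>R\<close> times
  the sampled form itself, that is by \<open>dev\<close> plus twice the mean. The recursion thus
  feeds on its own next moment, half of which is absorbed when
  \<open>2 * q * R \<le> 1\<close>.\<close>

lemma moment_selfbounded:
  assumes R: "R \<ge> 0" and gR: "\<And>e z. e \<in> I \<Longrightarrow> z \<in> H \<Longrightarrow> (norm (g e z))\<^sup>2 \<le> R * (z \<bullet> g e z)"
    and mean: "\<And>z. z \<in> H \<Longrightarrow> real m / real (card I) * (\<Sum>e\<in>I. z \<bullet> g e z) \<le> (norm z)\<^sup>2"
    and small: "real (2 * q) * R \<le> 1"
  shows "moment q \<le> (10 * real q * R) ^ q * (real (card I) ^ m * real (card D))"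
proof -
  let ?N = "real (card I)"
  have step: "moment (Suc r) \<le> 10 * real q * R * moment r" if r: "Suc r \<le> q" for r
  proof -
    have bound: "(\<Sum>i<m. (norm (g (xs ! i) b))\<^sup>2) + real m / ?N * (\<Sum>e\<in>I. (norm (g e b))\<^sup>2) \<le> R * (5/2 + (eva xs b)\<^sup>2 / 2)"
      if xs: "xs \<in> samples I m" and b: "b \<in> eb xs" for xs b
    proof -
      have bH: "b \<in> H" using eb_mem[OF xs b] .
      define A where "A = real m / ?N * (\<Sum>e\<in>I. b \<bullet> g e b)"
      have A: "A \<le> 1" unfolding A_def using mean[OF bH] eb_unit[OF xs b] by (simp add: norm2_inner)
      have "(\<Sum>i<m. (norm (g (xs ! i) b))\<^sup>2) + real m / ?N * (\<Sum>e\<in>I. (norm (g e b))\<^sup>2)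
        \<le> (\<Sum>i<m. R * (b \<bullet> g (xs ! i) b)) + real m / ?N * (\<Sum>e\<in>I. R * (b \<bullet> g e b))"
        using N by (intro add_mono sum_mono mult_left_mono gR bH samples_nth[OF xs]) auto
      also have "\<dots> = R * (b \<bullet> dev xs b + 2 * A)"
        by (simp add: dev_def A_def inner_add_right inner_sum_right sum_distrib_left algebra_simps)
      also have "\<dots> = R * (eva xs b + 2 * A)" by (simp only: inner_dev[OF xs b])
      \<comment> \<open>From \<open>A \<le> 1\<close> and \<open>x \<le> (1 + x\<^sup>2) / 2\<close>
        at the eigenvalue.\<close>
      also have "\<dots> \<le> R * (5/2 + (eva xs b)\<^sup>2 / 2)"
      proof (intro mult_left_mono R)
        have "0 \<le> (eva xs b - 1)\<^sup>2" by simp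
        then show "eva xs b + 2 * A \<le> 5/2 + (eva xs b)\<^sup>2 / 2" using A by (simp add: power2_diff)
      qed
      finally show ?thesis .
    qed
    define c where "c = real (2 * r + 1) * R"
    have c: "0 \<le> c" "c \<le> 1" "c \<le> real (2 * q) * R"
    proof -
      show "0 \<le> c" using R by (simp add: c_def)
      show "c \<le> real (2 * q) * R" unfolding c_def using R r by (intro mult_right_mono) auto
      then show "c \<le> 1" using small by simp
    qed
    have "moment (Suc r) \<le> real (2 * r + 1) * (\<Sum>xs\<in>samples I m. \<Sum>b\<in>eb xs. eva xs b ^ (2 * r) * (R * (5/2 + (eva xs b)\<^sup>2 / 2)))"
      by (rule order_trans[OF moment_Suc_le]) (intro mult_left_mono sum_mono bound, auto simp: power_mult)
    also have "\<dots> = c * (\<Sum>xs\<in>samples I m. \<Sum>b\<in>eb xs. 5/2 * eva xs b ^ (2 * r) + eva xs b ^ (2 * Suc r) / 2)"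
      unfolding c_def sum_distrib_left
      by (intro sum.cong refl) (simp add: algebra_simps power_add power2_eq_square add_divide_distrib)
    also have "\<dots> = c * (5/2 * moment r + moment (Suc r) / 2)"
      by (simp only: moment_def sum.distrib sum_distrib_left sum_divide_distrib)
    also have "\<dots> \<le> c * (5/2) * moment r + moment (Suc r) / 2"
      using mult_right_mono[OF c(2) moment_nonneg[of "Suc r"]] by (simp add: algebra_simps)
    \<comment> \<open>Absorption turns \<open>5/2\<close> into 5; then
      \<open>c \<le> 2 * q * R\<close> gives the factor \<open>10 * q * R\<close> per step.\<close>
    finally have "moment (Suc r) \<le> 5 * c * moment r" by simp
    also have "\<dots> \<le> 5 * (real (2 * q) * R) * moment r"
      using c by (intro mult_right_mono mult_left_mono moment_nonneg) auto
    finally show ?thesis by (simp add: mult_ac)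
  qed
  have "moment r \<le> (10 * real q * R) ^ r * moment 0" if "r \<le> q" for r
    using that
  proof (induction r)
    case (Suc r)
    have "moment (Suc r) \<le> 10 * real q * R * moment r" using step Suc by simp
    also have "\<dots> \<le> 10 * real q * R * ((10 * real q * R) ^ r * moment 0)"
      using Suc R by (intro mult_left_mono) auto
    finally show ?case by simp
  qed simp
  then show ?thesis using moment_0 by simp
qed

text \<open>Young's inequality, from Bernoulli's inequality at \<open>a / b\<close>.\<close>

lemma young_power:
  fixes a b :: real
  assumes "a \<ge> 0" "b \<ge> 0"
  shows "real (Suc r) * (a * b ^ r) \<le> a ^ Suc r + real r * b ^ Suc r"
proof (cases "b = 0")
  case False
  define t where "t = a / b"
  have a: "a = b * t" using False by (simp add: t_def)
  have "1 + real (Suc r) * (t - 1) \<le> (1 + (t - 1)) ^ Suc r"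
    using assms by (intro Bernoulli_inequality) (simp add: t_def)
  then have "real (Suc r) * t \<le> t ^ Suc r + real r" by (simp add: algebra_simps)
  then have "b ^ Suc r * (real (Suc r) * t) \<le> b ^ Suc r * (t ^ Suc r + real r)"
    using assms by (intro mult_left_mono) auto
  then show ?thesis unfolding a power_mult_distrib by (simp only: distrib_left power_Suc mult_ac)
qed (use assms in \<open>cases r; simp\<close>)

text \<open>Here the variance term is dominated by a diagonal form in the fixed basis
  \<open>D\<close> with random weights. Young's inequality separates eigenvalues from weights. The
  coefficients \<open>(b \<bullet> x)\<^sup>2\<close> sum to 1 over either basis, so the eigenvalue
  part is absorbed and scalar moments of the weights remain.\<close>

lemma moment_diag:
  fixes v :: "'i \<Rightarrow> 'v \<Rightarrow> real"
  assumes v: "\<And>e x. v e x \<ge> 0"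
    and gv: "\<And>e z. e \<in> I \<Longrightarrow> z \<in> H \<Longrightarrow> (norm (g e z))\<^sup>2 \<le> (\<Sum>x\<in>D. v e x * (z \<bullet> x)\<^sup>2)"
  shows "moment (Suc r) \<le> (real (2 * r + 1)) ^ Suc r * (\<Sum>xs\<in>samples I m. \<Sum>x\<in>D.
     ((\<Sum>i<m. v (xs ! i) x) + real m / real (card I) * (\<Sum>e\<in>I. v e x)) ^ Suc r)"
proof -
  let ?N = "real (card I)" and ?L = "samples I m"
  define V where "V xs x = (\<Sum>i<m. v (xs ! i) x) + real m / ?N * (\<Sum>e\<in>I. v e x)" for xs x
  have V: "V xs x \<ge> 0" for xs x unfolding V_def using v N by (intro add_nonneg_nonneg mult_nonneg_nonneg sum_nonneg) auto
  have bound: "(\<Sum>i<m. (norm (g (xs ! i) b))\<^sup>2) + real m / ?N * (\<Sum>e\<in>I. (norm (g e b))\<^sup>2) \<le> (\<Sum>x\<in>D. V xs x * (b \<bullet> x)\<^sup>2)"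
    if xs: "xs \<in> ?L" and b: "b \<in> eb xs" for xs b
  proof -
    have bH: "b \<in> H" using eb_mem[OF xs b] .
    have "(\<Sum>i<m. (norm (g (xs ! i) b))\<^sup>2) + real m / ?N * (\<Sum>e\<in>I. (norm (g e b))\<^sup>2) \<le>
      (\<Sum>i<m. \<Sum>x\<in>D. v (xs ! i) x * (b \<bullet> x)\<^sup>2) + real m / ?N * (\<Sum>e\<in>I. \<Sum>x\<in>D. v e x * (b \<bullet> x)\<^sup>2)"
      using N by (intro add_mono sum_mono mult_left_mono gv bH samples_nth[OF xs]) auto
    also have "\<dots> = (\<Sum>x\<in>D. \<Sum>i<m. v (xs ! i) x * (b \<bullet> x)\<^sup>2) + real m / ?N * (\<Sum>x\<in>D. \<Sum>e\<in>I. v e x * (b \<bullet> x)\<^sup>2)"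
      by (simp only: sum.swap[of _ _ D])
    also have "\<dots> = (\<Sum>x\<in>D. V xs x * (b \<bullet> x)\<^sup>2)"
      by (simp only: V_def distrib_right sum.distrib mult.assoc sum_distrib_left[symmetric] sum_distrib_right[symmetric])
    finally show ?thesis .
  qed
  define c where "c = real (2 * r + 1)"
  have y: "real (Suc r) * (c * (l ^ (2 * r) * w)) \<le> (c * w) ^ Suc r + real r * l ^ (2 * Suc r)" if "w \<ge> 0" for l w :: real
  proof -
    have "0 \<le> c * w" using that by (simp add: c_def)
    then have "real (Suc r) * ((c * w) * (l\<^sup>2) ^ r) \<le> (c * w) ^ Suc r + real r * (l\<^sup>2) ^ Suc r"
      by (rule young_power) simp
    then show ?thesis unfolding power_mult[symmetric] by (simp only: mult.assoc mult.commute[of w])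
  qed
  have "real (Suc r) * moment (Suc r) \<le> real (Suc r) * (c * (\<Sum>xs\<in>?L. \<Sum>b\<in>eb xs. eva xs b ^ (2 * r) * (\<Sum>x\<in>D. V xs x * (b \<bullet> x)\<^sup>2)))"
    unfolding c_def
    by (intro mult_left_mono order_trans[OF moment_Suc_le] sum_mono bound) (auto simp: power_mult)
  also have "\<dots> = (\<Sum>xs\<in>?L. \<Sum>b\<in>eb xs. \<Sum>x\<in>D. (real (Suc r) * (c * (eva xs b ^ (2 * r) * V xs x))) * (b \<bullet> x)\<^sup>2)"
    by (simp add: sum_distrib_left sum_distrib_right mult_ac)
  also have "\<dots> \<le> (\<Sum>xs\<in>?L. \<Sum>b\<in>eb xs. \<Sum>x\<in>D. ((c * V xs x) ^ Suc r + real r * eva xs b ^ (2 * Suc r)) * (b \<bullet> x)\<^sup>2)"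
    by (intro sum_mono mult_right_mono y V) simp
  also have "\<dots> = (\<Sum>xs\<in>?L. (\<Sum>b\<in>eb xs. \<Sum>x\<in>D. (c * V xs x) ^ Suc r * (b \<bullet> x)\<^sup>2) +
       (\<Sum>b\<in>eb xs. real r * eva xs b ^ (2 * Suc r) * (\<Sum>x\<in>D. (b \<bullet> x)\<^sup>2)))"
    by (simp only: distrib_right sum.distrib sum_distrib_left)
  also have "\<dots> = (\<Sum>xs\<in>?L. (\<Sum>x\<in>D. (c * V xs x) ^ Suc r) + (\<Sum>b\<in>eb xs. real r * eva xs b ^ (2 * Suc r)))"
  proof (rule sum.cong[OF refl])
    fix xs assume xs: "xs \<in> ?L"
    have "(\<Sum>b\<in>eb xs. \<Sum>x\<in>D. (c * V xs x) ^ Suc r * (b \<bullet> x)\<^sup>2) = (\<Sum>x\<in>D. (c * V xs x) ^ Suc r * (\<Sum>b\<in>eb xs. (x \<bullet> b)\<^sup>2))"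
      by (subst sum.swap) (simp add: sum_distrib_left inner_commute)
    also have "\<dots> = (\<Sum>x\<in>D. (c * V xs x) ^ Suc r)"
      using onb_norm2[OF eigsys(1)[OF xs] onb_mem[OF D]] onset_norm[OF onb_onset[OF D]]
      by (intro sum.cong refl) (metis mult.right_neutral one_power2)
    finally have 1: "(\<Sum>b\<in>eb xs. \<Sum>x\<in>D. (c * V xs x) ^ Suc r * (b \<bullet> x)\<^sup>2) = (\<Sum>x\<in>D. (c * V xs x) ^ Suc r)" .
    have "(\<Sum>x\<in>D. (b \<bullet> x)\<^sup>2) = 1" if "b \<in> eb xs" for b
      using onb_norm2[OF D eb_mem[OF xs that]] eb_unit[OF xs that] by (simp add: norm2_inner)
    then have 2: "(\<Sum>b\<in>eb xs. real r * eva xs b ^ (2 * Suc r) * (\<Sum>x\<in>D. (b \<bullet> x)\<^sup>2)) = (\<Sum>b\<in>eb xs. real r * eva xs b ^ (2 * Suc r))"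
      by (intro sum.cong refl) simp
    show "(\<Sum>b\<in>eb xs. \<Sum>x\<in>D. (c * V xs x) ^ Suc r * (b \<bullet> x)\<^sup>2) + (\<Sum>b\<in>eb xs. real r * eva xs b ^ (2 * Suc r) * (\<Sum>x\<in>D. (b \<bullet> x)\<^sup>2)) =
      (\<Sum>x\<in>D. (c * V xs x) ^ Suc r) + (\<Sum>b\<in>eb xs. real r * eva xs b ^ (2 * Suc r))"
      by (simp only: 1 2)
  qed
  also have "\<dots> = c ^ Suc r * (\<Sum>xs\<in>?L. \<Sum>x\<in>D. V xs x ^ Suc r) + real r * moment (Suc r)"
    by (simp only: sum.distrib moment_def sum_distrib_left power_mult_distrib)
  finally show ?thesis unfolding V_def c_def by (simp add: algebra_simps)
qed

end

section \<open>Independence: exponential moments of hit counts, and probabilities as counts\<close>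

lemma sum_samples_prod:
  fixes w :: "'i \<Rightarrow> real"
  assumes "finite I"
  shows "(\<Sum>xs\<in>samples I m. prod_list (map w xs)) = (\<Sum>e\<in>I. w e) ^ m"
proof (induction m)
  case (Suc m)
  have "samples I (Suc m) = (\<lambda>(x, xs). x # xs) ` (I \<times> samples I m)"
    by (auto simp: samples_def length_Suc_conv image_iff)
  then have "(\<Sum>xs\<in>samples I (Suc m). prod_list (map w xs)) = (\<Sum>(x, xs)\<in>I \<times> samples I m. w x * prod_list (map w xs))"
    by (simp add: sum.reindex inj_on_def case_prod_unfold)
  also have "\<dots> = (\<Sum>x\<in>I. w x) * (\<Sum>xs\<in>samples I m. prod_list (map w xs))"
    by (simp add: sum.cartesian_product[symmetric] sum_product)
  finally show ?case using Suc by simp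
next
  case 0
  have "samples I 0 = {[]}" by (auto simp: samples_def)
  then show ?case by simp
qed

definition hits :: "'i set \<Rightarrow> 'i list \<Rightarrow> nat" where "hits A xs = length (filter (\<lambda>e. e \<in> A) xs)"

text \<open>Independence factorises the exponential moment, and \<open>1 + y \<le> exp y\<close>
  replaces the binomial value by the Poisson one.\<close>

lemma sum_samples_exp_hits:
  assumes "finite I" "I \<noteq> {}" "A \<subseteq> I" "\<theta> \<ge> 0"
  shows "(\<Sum>xs\<in>samples I m. exp (\<theta> * real (hits A xs)))
    \<le> real (card I) ^ m * exp (real m * real (card A) / real (card I) * (exp \<theta> - 1))"
proof -
  let ?N = "real (card I)"
  have N: "?N > 0" using assms by (simp add: card_gt_0_iff)
  have e: "exp (\<theta> * real (hits A xs)) = prod_list (map (\<lambda>e. if e \<in> A then exp \<theta> else 1) xs)" for xs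
    by (induction xs) (auto simp: hits_def exp_add algebra_simps)
  have fA: "finite A" using assms finite_subset by blast
  have "(\<Sum>e\<in>I. if e \<in> A then exp \<theta> else 1) = (\<Sum>e\<in>I. 1 + (if e \<in> A then exp \<theta> - 1 else 0))"
    by (intro sum.cong) auto
  also have "\<dots> = ?N + real (card A) * (exp \<theta> - 1)"
    using assms by (simp only: sum.distrib, subst sum.inter_restrict[symmetric]) (auto simp: Int_absorb1)
  also have "\<dots> = ?N * (1 + real (card A) / ?N * (exp \<theta> - 1))" using N by (simp add: field_simps)
  also have "\<dots> \<le> ?N * exp (real (card A) / ?N * (exp \<theta> - 1))"
    using N by (intro mult_left_mono exp_ge_add_one_self) auto
  finally have "(\<Sum>e\<in>I. if e \<in> A then exp \<theta> else 1) ^ m \<le> (?N * exp (real (card A) / ?N * (exp \<theta> - 1))) ^ m"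
    by (intro power_mono sum_nonneg) auto
  also have "\<dots> = ?N ^ m * exp (real m * real (card A) / ?N * (exp \<theta> - 1))"
    by (simp add: power_mult_distrib exp_of_nat_mult[symmetric] mult_ac)
  finally show ?thesis unfolding e sum_samples_prod[OF assms(1)] .
qed

text \<open>Turns the probability in the theorem into a ratio of cardinalities, the form in which
  the exceptional events are estimated.\<close>

lemma prob_uniform_samples:
  "measure_pmf.prob (uniform_samples m n1 n2 n3) E = 
     real (card (samples ({..<n1} \<times> {..<n2} \<times> {..<n3}) m \<inter> E)) / real (n1 * n2 * n3) ^ m"
  if "n1 > 0" "n2 > 0" "n3 > 0"
proof -
  let ?I = "{..<n1} \<times> {..<n2} \<times> {..<n3}"
  have ne: "?I \<noteq> {}" using that by auto
  have c: "card ?I = n1 * n2 * n3" by (simp add: card_cartesian_product)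
  have "pmf (replicate_pmf m (pmf_of_set ?I)) xs = (if xs \<in> samples ?I m then 1 / real (n1 * n2 * n3) ^ m else 0)" for xs
  proof (induction m arbitrary: xs)
    case 0
    then show ?case by (auto simp: samples_def)
  next
    case (Suc m)
    show ?case
    proof (cases xs)
      case Nil
      have "xs \<notin> set_pmf (replicate_pmf (Suc m) (pmf_of_set ?I))" using Nil by (auto simp: set_replicate_pmf)
      then show ?thesis using Nil by (simp add: samples_def pmf_eq_0_set_pmf del: replicate_pmf.simps)
    next
      case (Cons y ys)
      have "replicate_pmf (Suc m) (pmf_of_set ?I) = map_pmf (\<lambda>(x, xs). x # xs) (pair_pmf (pmf_of_set ?I) (replicate_pmf m (pmf_of_set ?I)))"
        by (simp add: pair_pmf_def map_bind_pmf bind_return_pmf map_pmf_def[symmetric] bind_assoc_pmf map_pmf_comp)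
      then have "pmf (replicate_pmf (Suc m) (pmf_of_set ?I)) xs = pmf (map_pmf (\<lambda>(x, xs). x # xs) (pair_pmf (pmf_of_set ?I) (replicate_pmf m (pmf_of_set ?I)))) ((\<lambda>(x, xs). x # xs) (y, ys))"
        using Cons by simp
      also have "\<dots> = pmf (pair_pmf (pmf_of_set ?I) (replicate_pmf m (pmf_of_set ?I))) (y, ys)"
        by (rule pmf_map_inj') (auto simp: inj_def)
      also have "\<dots> = pmf (pmf_of_set ?I) y * pmf (replicate_pmf m (pmf_of_set ?I)) ys"
        by (simp add: pmf_pair)
      also have "\<dots> = (if y \<in> ?I then 1 / real (n1 * n2 * n3) else 0) * (if ys \<in> samples ?I m then 1 / real (n1 * n2 * n3) ^ m else 0)"
        using Suc ne by (simp add: pmf_of_set card_cartesian_product indicator_def mult.assoc)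
      finally show ?thesis using Cons by (auto simp: samples_def)
    qed
  qed
  then have p: "pmf (uniform_samples m n1 n2 n3) xs = (if xs \<in> samples ?I m then 1 / real (n1 * n2 * n3) ^ m else 0)" for xs
    by (simp add: uniform_samples_def)
  have sup: "set_pmf (uniform_samples m n1 n2 n3) \<subseteq> samples ?I m"
    using p by (auto simp: set_pmf_eq split: if_splits)
  have "measure_pmf.prob (uniform_samples m n1 n2 n3) E = measure_pmf.prob (uniform_samples m n1 n2 n3) (samples ?I m \<inter> E)"
    using sup by (intro measure_prob_cong_0) (auto simp: set_pmf_eq)
  also have "\<dots> = (\<Sum>xs\<in>samples ?I m \<inter> E. pmf (uniform_samples m n1 n2 n3) xs)"
    by (intro measure_measure_pmf_finite) simp
  also have "\<dots> = real (card (samples ?I m \<inter> E)) / real (n1 * n2 * n3) ^ m" by (simp add: p)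
  finally show ?thesis .
qed

section \<open>Singular value decompositions\<close>

definition eu :: "'a \<Rightarrow> 'a \<Rightarrow> 'a fmat" where "eu i j = mk {i} {j} (\<lambda>_ _. 1)"

lemma ent_eu: "ent (eu i j) a b = (if a = i \<and> b = j then 1 else 0)"
  by (simp add: eu_def ent_mk)

lemma ind_eu: "ind (eu i j) = {i, j}" by (auto simp: ind_def ent_eu)

lemma inner_eu: "A \<bullet> eu i j = ent A i j"
proof -
  have "A \<bullet> eu i j = (\<Sum>a\<in>{i,j}. \<Sum>b\<in>{i,j}. ent A a b * ent (eu i j) a b)"
    by (intro inner_fmat_eq) (auto simp: ind_eu)
  also have "\<dots> = (\<Sum>a\<in>{i,j}. \<Sum>b\<in>{i,j}. if b = j then (if a = i then ent A a b else 0) else 0)"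
    by (intro sum.cong refl) (auto simp: ent_eu)
  also have "\<dots> = ent A i j" by (simp add: sum.delta)
  finally show ?thesis .
qed

lemma ent_mult_eu: "ent (A * eu j c) i c = ent A i j"
proof -
  have "ent (A * eu j c) i c = (\<Sum>k\<in>{j, c}. ent A i k * ent (eu j c) k c)"
    by (rule ent_mult) (auto simp: ind_eu)
  then show ?thesis by (cases "j = c") (auto simp: ent_eu)
qed

text \<open>Column vectors with index set \<open>K\<close>, stored in column \<open>c\<close>.\<close>

definition colsp :: "'a \<Rightarrow> 'a set \<Rightarrow> 'a fmat set" where
  "colsp c K = {x. \<forall>i j. ent x i j \<noteq> 0 \<longrightarrow> i \<in> K \<and> j = c}"

lemma subspace_colsp: "subspace (colsp c K)"
  unfolding real_vector.subspace_def colsp_def by auto (metis add_0)+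

lemma inj_eu: "inj_on (\<lambda>i. eu i c) K"
  by (rule inj_onI) (metis ent_eu zero_neq_one)

lemma onb_colsp:
  assumes "finite K" shows "onb ((\<lambda>i. eu i c) ` K) (colsp c K)"
proof -
  have on: "onset ((\<lambda>i. eu i c) ` K)"
    using assms inj_eu[of c UNIV] by (auto simp: onset_def inner_eu ent_eu inj_on_def)
  have "span ((\<lambda>i. eu i c) ` K) = colsp c K"
  proof
    show "span ((\<lambda>i. eu i c) ` K) \<subseteq> colsp c K"
      by (rule span_minimal[OF _ subspace_colsp]) (auto simp: colsp_def ent_eu split: if_splits)
    show "colsp c K \<subseteq> span ((\<lambda>i. eu i c) ` K)"
    proof
      fix x assume x: "x \<in> colsp c K"
      have "x = (\<Sum>i\<in>K. ent x i c *\<^sub>R eu i c)"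
      proof (rule fmat_eqI)
        fix a b
        have "(\<Sum>i\<in>K. ent x i c * ent (eu i c) a b) = (\<Sum>i\<in>K. if i = a then (if b = c then ent x a c else 0) else 0)"
          by (intro sum.cong) (auto simp: ent_eu)
        also have "\<dots> = ent x a b" using x assms by (auto simp: colsp_def)
        finally show "ent x a b = ent (\<Sum>i\<in>K. ent x i c *\<^sub>R eu i c) a b" by simp
      qed
      also have "\<dots> \<in> span ((\<lambda>i. eu i c) ` K)" by (intro span_sum span_scale span_base) auto
      finally show "x \<in> span ((\<lambda>i. eu i c) ` K)" .
    qed
  qed
  with on show ?thesis by (simp add: onb_def)
qed

lemma inner_colsp:
  assumes "x \<in> colsp c K" "finite K"
  shows "x \<bullet> y = (\<Sum>i\<in>K. ent x i c * ent y i c)"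
proof -
  show ?thesis using onb_inner[OF onb_colsp[OF assms(2)] assms(1), of y] by (simp add: sum.reindex[OF inj_eu] inner_eu)
qed

lemma card_colsp: "finite K \<Longrightarrow> card ((\<lambda>i. eu i c) ` K) = card K"
  by (intro card_image inj_eu)

lemma mult_colsp:
  assumes "\<And>i j. ent A i j \<noteq> 0 \<Longrightarrow> i \<in> K'" "x \<in> colsp c K"
  shows "A * x \<in> colsp c K'"
proof -
  have "ent (A * x) i j = (\<Sum>k\<in>ind A. ent A i k * ent x k j)" for i j by (rule ent_mult) auto
  then have *: "\<exists>k. ent A i k \<noteq> 0 \<and> ent x k j \<noteq> 0" if "ent (A * x) i j \<noteq> 0" for i j
    using that by (metis (no_types, lifting) mult_eq_0_iff sum.neutral)
  then show ?thesis using assms by (fastforce simp: colsp_def)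
qed

lemma sorted_enumeration:
  fixes f :: "'b \<Rightarrow> real"
  assumes "finite B" "card B = n"
  shows "\<exists>v. bij_betw v {..<n} B \<and> (\<forall>i j. i \<le> j \<longrightarrow> j < n \<longrightarrow> f (v j) \<le> f (v i))"
proof -
  obtain xs where xs: "set xs = B" "distinct xs" using finite_distinct_list[OF assms(1)] by blast
  define ys where "ys = sort_key (\<lambda>x. - f x) xs"
  have ys: "set ys = B" "distinct ys" "length ys = n" "sorted (map (\<lambda>x. - f x) ys)"
    using xs assms distinct_card[OF xs(2)] by (auto simp: ys_def)
  show ?thesis
  proof (intro exI[of _ "\<lambda>i. ys ! i"] conjI allI impI)
    show "bij_betw ((!) ys) {..<n} B" using bij_betw_nth[OF ys(2), of "{..<n}" B] ys by auto
    fix i j assume "i \<le> j" "j < n"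
    then show "f (ys ! j) \<le> f (ys ! i)" using sorted_nth_mono[OF ys(4), of i j] ys(3) by simp
  qed
qed

text \<open>Right singular vectors are eigenvectors of \<open>adj A * A\<close> ordered by
  eigenvalue; left ones are normalised images where the singular value is positive. The others come
  from completing these images to an orthonormal basis, for which \<open>n2 \<le> n1\<close> leaves
  enough room.\<close>

lemma svd_fmat:
  fixes A :: "nat fmat"
  assumes supp: "\<And>i j. ent A i j \<noteq> 0 \<Longrightarrow> i < n1 \<and> j < n2" and tall: "n2 \<le> n1"
  obtains u v s where "\<And>i. i < n2 \<Longrightarrow> v i \<in> colsp 0 {..<n2} \<and> u i \<in> colsp 0 {..<n1} \<and> 0 \<le> s i \<and> A * v i = s i *\<^sub>R u i"
    and "\<And>i j. i < n2 \<Longrightarrow> j < n2 \<Longrightarrow> v i \<bullet> v j = (if i = j then 1 else 0) \<and> u i \<bullet> u j = (if i = j then 1 else (0::real))"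
    and "\<And>i j. i \<le> j \<Longrightarrow> j < n2 \<Longrightarrow> s j \<le> s i" and "onb (v ` {..<n2}) (colsp 0 {..<n2})"
proof -
  let ?H = "colsp (0::nat) {..<n2}" and ?K = "colsp (0::nat) {..<n1}"
  have AH: "A * x \<in> ?K" if "x \<in> ?H" for x by (rule mult_colsp[OF _ that]) (use supp in auto)
  have AK: "adj A * x \<in> ?H" if "x \<in> ?K" for x by (rule mult_colsp[OF _ that]) (use supp in auto)
  have onH: "onb ((\<lambda>i. eu i 0) ` {..<n2}) ?H" and onK: "onb ((\<lambda>i. eu i 0) ` {..<n1}) ?K"
    by (auto intro: onb_colsp)
  have "selfadj_on ?H (\<lambda>x. adj A * (A * x))"
    unfolding selfadj_on_def
  proof (intro conjI ballI)
    show "linear (\<lambda>x. adj A * (A * x))" by (rule linearI) (simp_all add: distrib_left)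
    show "(\<lambda>x. adj A * (A * x)) ` ?H \<subseteq> ?H" using AH AK by auto
    fix x y show "(adj A * (A * x)) \<bullet> y = x \<bullet> (adj A * (A * y))" by (simp add: inner_mult_left)
  qed
  then obtain B l where B: "onb B ?H" "\<And>b. b \<in> B \<Longrightarrow> adj A * (A * b) = l b *\<^sub>R b"
    using selfadj_spectral[OF onH] by blast
  have cB: "card B = n2" using onb_card_eq[OF B(1) onH] by (simp add: card_colsp)
  have Ain: "(A * b) \<bullet> (A * c) = l b * (b \<bullet> c)" if "b \<in> B" for b c
    using B(2)[OF that] by (simp add: inner_mult_left[of A c] inner_commute[of "A * b"]) (simp add: inner_commute)
  have l0: "0 \<le> l b" if "b \<in> B" for b
    using Ain[OF that, of b] onset_inner[OF onb_onset[OF B(1)] that that] inner_ge_zero[of "A * b"] by simp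
  obtain v where v: "bij_betw v {..<n2} B" "\<And>i j. i \<le> j \<Longrightarrow> j < n2 \<Longrightarrow> l (v j) \<le> l (v i)"
    using sorted_enumeration[OF onb_finite[OF B(1)] cB, of l] by blast
  have vB: "v i \<in> B" if "i < n2" for i using v(1) that by (auto simp: bij_betw_def)
  have vin: "v i \<bullet> v j = (if i = j then 1 else 0)" if "i < n2" "j < n2" for i j
    using onset_inner[OF onb_onset[OF B(1)] vB[OF that(1)] vB[OF that(2)]] v(1) that
    by (auto simp: bij_betw_def inj_on_def)
  define s where "s i = sqrt (l (v i))" for i
  define T where "T = {i. i < n2 \<and> s i > 0}"
  have mono: "s j \<le> s i" if "i \<le> j" "j < n2" for i j using v(2)[OF that] by (simp add: s_def)
  define u0 where "u0 i = (1 / s i) *\<^sub>R (A * v i)" for i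
  have s2: "s i * s i = l (v i)" if "i < n2" for i using l0[OF vB[OF that]] by (simp add: s_def)
  have u0in: "u0 i \<bullet> u0 j = (if i = j then 1 else 0)" if "i \<in> T" "j \<in> T" for i j
  proof -
    have "u0 i \<bullet> u0 j = 1 / s i * (1 / s j) * (s i * s i * (v i \<bullet> v j))"
      using that Ain[OF vB, of i "v j"] s2[of i] by (simp add: u0_def T_def)
    then show ?thesis using that vin[of i j] by (auto simp: T_def)
  qed
  have inju0: "inj_on u0 T" using u0in by (metis inj_onI zero_neq_one)
  have onu0: "onset (u0 ` T)"
    unfolding onset_def
  proof (intro conjI ballI)
    show "finite (u0 ` T)" by (simp add: T_def)
    fix x y assume "x \<in> u0 ` T" "y \<in> u0 ` T"
    then obtain i j where "i \<in> T" "j \<in> T" "x = u0 i" "y = u0 j" by auto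
    then show "x \<bullet> y = (if x = y then 1 else 0)" using u0in inju0 by (auto simp: inj_on_def)
  qed
  have u0K: "u0 ` T \<subseteq> ?K"
  proof
    fix x assume "x \<in> u0 ` T"
    then obtain i where "i < n2" "x = (1 / s i) *\<^sub>R (A * v i)" by (auto simp: u0_def T_def)
    then show "x \<in> ?K"
      using real_vector.subspace_scale[OF subspace_colsp[of 0 "{..<n1}"] AH[OF onb_mem[OF B(1) vB]]] by simp
  qed
  obtain B' where B': "u0 ` T \<subseteq> B'" "onb B' ?K" using onset_extend_onb[OF onu0 u0K onK] by blast
  have cB': "card B' = n1" using onb_card_eq[OF B'(2) onK] by (simp add: card_colsp)
  define R where "R = B' - u0 ` T"
  have finR: "finite R" using onb_finite[OF B'(2)] by (simp add: R_def)
  have "card R = n1 - card T"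
    unfolding R_def using B' cB' inju0 by (subst card_Diff_subset) (auto simp: T_def card_image onset_finite[OF onu0])
  moreover have "card ({..<n2} - T) = n2 - card T" by (subst card_Diff_subset) (auto simp: T_def)
  ultimately have "card ({..<n2} - T) \<le> card R" using tall by simp
  then obtain w where w: "inj_on w ({..<n2} - T)" "w ` ({..<n2} - T) \<subseteq> R"
    using card_le_inj[of "{..<n2} - T" R] finR by auto
  define u where "u i = (if i \<in> T then u0 i else w i)" for i
  have uB': "u i \<in> B'" if "i < n2" for i using that B'(1) w(2) by (auto simp: u_def R_def)
  have inju: "inj_on u {..<n2}"
  proof (rule inj_onI)
    fix i j assume ij: "i \<in> {..<n2}" "j \<in> {..<n2}" "u i = u j"
    have wR: "w i \<notin> u0 ` T" if "i \<in> {..<n2} - T" for i using w(2) that by (auto simp: R_def)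
    consider "i \<in> T" "j \<in> T" | "i \<in> T" "j \<notin> T" | "i \<notin> T" "j \<in> T" | "i \<notin> T" "j \<notin> T" by blast
    then show "i = j"
    proof cases
      case 1
      then show ?thesis using ij inj_onD[OF inju0, of i j] by (simp add: u_def)
    next
      case 2
      then have "w j \<in> u0 ` T" using ij(3) by (auto simp: u_def intro: rev_image_eqI)
      then show ?thesis using wR[of j] 2 ij by simp
    next
      case 3
      then have "w i \<in> u0 ` T" using ij(3) by (auto simp: u_def intro: rev_image_eqI)
      then show ?thesis using wR[of i] 3 ij by simp
    next
      case 4
      then show ?thesis using ij inj_onD[OF w(1), of i j] by (simp add: u_def)
    qed
  qed
  have uin: "u i \<bullet> u j = (if i = j then 1 else 0)" if "i < n2" "j < n2" for i j
    using onset_inner[OF onb_onset[OF B'(2)] uB'[OF that(1)] uB'[OF that(2)]] inju that by (auto simp: inj_on_def)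
  have Av: "A * v i = s i *\<^sub>R u i" if "i < n2" for i
  proof (cases "i \<in> T")
    case True then show ?thesis by (simp add: u_def u0_def T_def)
  next
    case False
    then have "s i = 0" using that l0[OF vB[OF that]] by (simp add: T_def s_def)
    moreover have "(A * v i) \<bullet> (A * v i) = s i * s i" using Ain[OF vB[OF that], of "v i"] vin[OF that that] s2[OF that] by simp
    ultimately show ?thesis by simp
  qed
  show thesis
  proof (rule that[of v u s])
    fix i assume i: "i < n2"
    have "0 \<le> s i" using l0[OF vB[OF i]] by (simp add: s_def)
    then show "v i \<in> ?H \<and> u i \<in> ?K \<and> 0 \<le> s i \<and> A * v i = s i *\<^sub>R u i"
      using onb_mem[OF B(1) vB[OF i]] onb_mem[OF B'(2) uB'[OF i]] Av[OF i] by auto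
  next
    show "onb (v ` {..<n2}) ?H" using B(1) v(1) by (simp add: bij_betw_def)
  qed (use vin uin mono in auto)
qed

lemma index_mult_mat_sum:
  fixes A :: "real mat"
  assumes "A \<in> carrier_mat a b" "B \<in> carrier_mat b c" "i < a" "j < c"
  shows "(A * B) $$ (i, j) = (\<Sum>k<b. A $$ (i, k) * B $$ (k, j))"
  using assms by (auto simp: scalar_prod_def atLeast0LessThan intro!: sum.cong)

lemma index_diag_sandwich:
  fixes U :: "real mat"
  assumes U: "U \<in> carrier_mat a q" and S: "S \<in> carrier_mat q q" "diagonal_mat S" and V: "V \<in> carrier_mat b q"
    and "i < a" "j < b"
  shows "(U * S * transpose_mat V) $$ (i, j) = (\<Sum>k<q. U $$ (i, k) * S $$ (k, k) * V $$ (j, k))"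
proof -
  have "(U * S) $$ (i, k) = U $$ (i, k) * S $$ (k, k)" if "k < q" for k
  proof -
    have "(U * S) $$ (i, k) = (\<Sum>l<q. if l = k then U $$ (i, k) * S $$ (k, k) else 0)"
      unfolding index_mult_mat_sum[OF U S(1) assms(5) that]
      using S that by (intro sum.cong refl) (auto simp: diagonal_mat_def)
    then show ?thesis using that by simp
  qed
  moreover have "(U * S * transpose_mat V) $$ (i, j) = (\<Sum>k<q. (U * S) $$ (i, k) * transpose_mat V $$ (k, j))"
    by (rule index_mult_mat_sum) (use assms in auto)
  ultimately show ?thesis using V assms(6) by simp
qed

lemma transpose_mult_self_index:
  fixes U :: "real mat"
  assumes "U \<in> carrier_mat a q" "i < q" "j < q"
  shows "(transpose_mat U * U) $$ (i, j) = (\<Sum>k<a. U $$ (k, i) * U $$ (k, j))"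
  by (subst index_mult_mat_sum[of _ q a _ q]) (use assms in auto)

lemma is_svd_exists_tall:
  assumes A: "A \<in> carrier_mat n1 n2" and tall: "n2 \<le> n1"
  shows "\<exists>U S V. is_svd A U S V"
proof -
  define F where "F = mk {..<n1} {..<n2} (\<lambda>i j. A $$ (i, j))"
  have F: "ent F i j = (if i < n1 \<and> j < n2 then A $$ (i, j) else 0)" for i j by (simp add: F_def ent_mk)
  have supp: "\<And>i j. ent F i j \<noteq> 0 \<Longrightarrow> i < n1 \<and> j < n2" using F by (auto split: if_splits)
  show ?thesis
  proof (rule svd_fmat[of F n1 n2])
    show "\<And>i j. ent F i j \<noteq> 0 \<Longrightarrow> i < n1 \<and> j < n2" "n2 \<le> n1" using supp tall by auto
  next
  fix v u s
  assume 1: "\<And>i. i < n2 \<Longrightarrow> v i \<in> colsp 0 {..<n2} \<and> u i \<in> colsp 0 {..<n1} \<and> 0 \<le> s i \<and> F * v i = s i *\<^sub>R u i"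
    and 2: "\<And>i j. i < n2 \<Longrightarrow> j < n2 \<Longrightarrow> v i \<bullet> v j = (if i = j then 1 else 0) \<and> u i \<bullet> u j = (if i = j then 1 else (0::real))"
    and 3: "\<And>i j. i \<le> j \<Longrightarrow> j < n2 \<Longrightarrow> s j \<le> s i" and 4: "onb (v ` {..<n2}) (colsp 0 {..<n2})"
  define U where "U = mat n1 n2 (\<lambda>(a, i). ent (u i) a 0)"
  define V where "V = mat n2 n2 (\<lambda>(a, i). ent (v i) a 0)"
  define S where "S = mat n2 n2 (\<lambda>(i, j). if i = j then s i else 0)"
  have car: "U \<in> carrier_mat n1 n2" "V \<in> carrier_mat n2 n2" "S \<in> carrier_mat n2 n2" by (auto simp: U_def V_def S_def)
  have dS: "diagonal_mat S" by (auto simp: diagonal_mat_def S_def)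
  have injv: "inj_on v {..<n2}" using 2 by (metis inj_onI lessThan_iff zero_neq_one)
  have UU: "transpose_mat U * U = 1\<^sub>m n2"
  proof (rule eq_matI)
    fix i j assume ij: "i < dim_row (1\<^sub>m n2)" "j < dim_col (1\<^sub>m n2)"
    then have "(transpose_mat U * U) $$ (i, j) = (\<Sum>k<n1. ent (u i) k 0 * ent (u j) k 0)"
      using transpose_mult_self_index[OF car(1)] by (simp add: U_def)
    also have "\<dots> = u i \<bullet> u j" using 1[of i] ij inner_colsp[of "u i" 0 "{..<n1}" "u j"] by simp
    finally show "(transpose_mat U * U) $$ (i, j) = 1\<^sub>m n2 $$ (i, j)" using 2 ij by simp
  qed (use car in auto)
  have VV: "transpose_mat V * V = 1\<^sub>m n2"
  proof (rule eq_matI)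
    fix i j assume ij: "i < dim_row (1\<^sub>m n2)" "j < dim_col (1\<^sub>m n2)"
    then have "(transpose_mat V * V) $$ (i, j) = (\<Sum>k<n2. ent (v i) k 0 * ent (v j) k 0)"
      using transpose_mult_self_index[OF car(2)] by (simp add: V_def)
    also have "\<dots> = v i \<bullet> v j" using 1[of i] ij inner_colsp[of "v i" 0 "{..<n2}" "v j"] by simp
    finally show "(transpose_mat V * V) $$ (i, j) = 1\<^sub>m n2 $$ (i, j)" using 2 ij by simp
  qed (use car in auto)
  have "A = U * S * transpose_mat V"
  proof (rule eq_matI)
    fix a c assume "a < dim_row (U * S * transpose_mat V)" "c < dim_col (U * S * transpose_mat V)"
    then have ac: "a < n1" "c < n2" using car by auto
    have eH: "eu c 0 \<in> colsp 0 {..<n2}" using ac by (auto simp: colsp_def ent_eu split: if_splits)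
    have "eu c 0 = (\<Sum>i<n2. ent (v i) c 0 *\<^sub>R v i)"
      by (subst onb_expand[OF 4 eH]) (simp add: sum.reindex[OF injv] inner_commute[of "eu c 0"] inner_eu)
    then have "F * eu c 0 = (\<Sum>i<n2. ent (v i) c 0 *\<^sub>R (s i *\<^sub>R u i))"
      using 1 by (simp add: sum_distrib_left)
    then have "ent F a c = (\<Sum>i<n2. ent (v i) c 0 * (s i * ent (u i) a 0))"
      using ent_mult_eu[of F c 0 a] by (simp add: mult.assoc)
    also have "\<dots> = (U * S * transpose_mat V) $$ (a, c)"
      unfolding index_diag_sandwich[OF car(1) car(3) dS car(2) ac] using ac
      by (intro sum.cong) (auto simp: U_def V_def S_def)
    finally show "A $$ (a, c) = (U * S * transpose_mat V) $$ (a, c)" using ac by (simp add: F)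
  qed (use A car in auto)
  moreover have "nonincreasing_diag S"
    unfolding nonincreasing_diag_def using dS 1 3 by (auto simp: S_def)
  ultimately show "\<exists>U S V. is_svd A U S V"
    using A tall car UU VV unfolding is_svd_def Let_def by (intro exI[of _ U] exI[of _ S] exI[of _ V]) (simp add: min_absorb2)
  qed
qed

lemma is_svdD:
  assumes "is_svd A U S V" "A \<in> carrier_mat n1 n2"
  defines "q \<equiv> min n1 n2"
  shows "U \<in> carrier_mat n1 q" "S \<in> carrier_mat q q" "V \<in> carrier_mat n2 q"
    "transpose_mat U * U = 1\<^sub>m q" "transpose_mat V * V = 1\<^sub>m q" "diagonal_mat S"
    "\<And>i. i < q \<Longrightarrow> 0 \<le> S $$ (i,i)" "\<And>i j. i \<le> j \<Longrightarrow> j < q \<Longrightarrow> S $$ (j,j) \<le> S $$ (i,i)"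
    "A = U * S * transpose_mat V"
  using assms unfolding is_svd_def nonincreasing_diag_def Let_def by (auto simp: q_def)

lemma is_svd_transpose:
  assumes svd: "is_svd A U S V" and A: "A \<in> carrier_mat n1 n2"
  shows "is_svd (transpose_mat A) V S U"
proof -
  note D = is_svdD[OF svd A]
  have "transpose_mat A = V * S * transpose_mat U"
  proof (rule eq_matI)
    fix i j assume "i < dim_row (V * S * transpose_mat U)" "j < dim_col (V * S * transpose_mat U)"
    then have ij: "i < n2" "j < n1" using D by auto
    have "transpose_mat A $$ (i, j) = A $$ (j, i)" using A ij by simp
    also have "\<dots> = (\<Sum>k<min n1 n2. U $$ (j, k) * S $$ (k, k) * V $$ (i, k))"
      by (subst D(9)) (rule index_diag_sandwich[OF D(1,2,6,3) ij(2,1)])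
    also have "\<dots> = (V * S * transpose_mat U) $$ (i, j)"
      unfolding index_diag_sandwich[OF D(3,2,6,1) ij] by (simp add: mult_ac)
    finally show "transpose_mat A $$ (i, j) = (V * S * transpose_mat U) $$ (i, j)" .
  qed (use A D in auto)
  then show ?thesis using A D svd unfolding is_svd_def Let_def by (auto simp: min.commute)
qed

lemma is_svd_exists: "\<exists>U S V. is_svd A U S V"
proof (cases "dim_col A \<le> dim_row A")
  case True
  then show ?thesis using is_svd_exists_tall[of A "dim_row A" "dim_col A"] by auto
next
  case False
  then obtain U S V where "is_svd (transpose_mat A) U S V"
    using is_svd_exists_tall[of "transpose_mat A" "dim_col A" "dim_row A"] by auto
  then have "is_svd (transpose_mat (transpose_mat A)) V S U"
    by (rule is_svd_transpose[of _ _ _ _ "dim_col A" "dim_row A"]) auto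
  then show ?thesis by auto
qed

text \<open>If \<open>M\<close> collects the columns in a linear dependence and \<open>c\<close> its
  coefficients, orthonormality recovers \<open>c\<close> from \<open>M *\<^sub>v c = 0\<close> by
  multiplication with the transpose, so \<open>c\<close> vanishes.\<close>

lemma rank_orthonormal_cols:
  fixes B :: "real mat"
  assumes B: "B \<in> carrier_mat n t" and orth: "transpose_mat B * B = 1\<^sub>m t"
  shows "vec_space.rank n B = t"
proof -
  interpret vec_space "TYPE(real)" n .
  have dot: "scalar_prod (col B i) (col B j) = (if i = j then 1 else 0)" if "i < t" "j < t" for i j
    using arg_cong[OF orth, of "\<lambda>M. M $$ (i, j)"] that B by simp
  have dist: "distinct (cols B)"
    unfolding distinct_conv_nth
  proof (intro allI impI)
    fix i j assume "i < length (cols B)" "j < length (cols B)" "i \<noteq> j"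
    then show "cols B ! i \<noteq> cols B ! j" using dot[of i j] dot[of i i] B by (auto simp: cols_nth)
  qed
  have car: "set (cols B) \<subseteq> carrier_vec n" using B cols_dim by blast
  have "lin_indpt (set (cols B))"
  proof
    assume "lin_dep (set (cols B))"
    then obtain A a v where A: "finite A" "A \<subseteq> set (cols B)" "lincomb a A = 0\<^sub>v n" "v \<in> A" "a v \<noteq> 0"
      unfolding lin_dep_def by auto
    obtain ws where ws: "set ws = A" "distinct ws" using finite_distinct_list[OF A(1)] by blast
    define M where "M = mat_of_cols n ws"
    define c where "c = vec (length ws) (\<lambda>i. a (ws ! i))"
    have wsc: "set ws \<subseteq> carrier_vec n" using A ws car by auto
    have Mc: "M \<in> carrier_mat n (length ws)" "c \<in> carrier_vec (length ws)" by (auto simp: M_def c_def)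
    have "0\<^sub>v n = lincomb_list (\<lambda>i. a (ws ! i)) ws"
      using lincomb_as_lincomb_list_distinct[OF wsc ws(2), of a] A(3) ws(1) by simp
    also have "\<dots> = M *\<^sub>v c" unfolding M_def c_def
      by (rule lincomb_list_as_mat_mult) (use wsc in auto)
    finally have M0: "M *\<^sub>v c = 0\<^sub>v n" by simp
    have wd: "scalar_prod (ws ! i) (ws ! j) = (if i = j then 1 else 0)" if "i < length ws" "j < length ws" for i j
    proof -
      have "ws ! i \<in> set (cols B)" "ws ! j \<in> set (cols B)" using that ws(1) A(2) by auto
      then obtain i' j' where "i' < t" "j' < t" "ws ! i = col B i'" "ws ! j = col B j'"
        using B by (auto simp: in_set_conv_nth cols_nth)
      moreover have "ws ! i = ws ! j \<longleftrightarrow> i = j" using ws(2) that by (simp add: nth_eq_iff_index_eq)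
      ultimately show ?thesis using dot[of i' j'] dot[of i' i'] by auto
    qed
    have "transpose_mat M * M = 1\<^sub>m (length ws)"
    proof (rule eq_matI)
      fix i j assume "i < dim_row (1\<^sub>m (length ws) :: real mat)" "j < dim_col (1\<^sub>m (length ws) :: real mat)"
      then have ij: "i < length ws" "j < length ws" by auto
      then have "col M i = ws ! i" "col M j = ws ! j"
        unfolding M_def using wsc by (auto intro!: col_mat_of_cols)
      then show "(transpose_mat M * M) $$ (i, j) = 1\<^sub>m (length ws) $$ (i, j)" using wd ij Mc by simp
    qed (use Mc in auto)
    then have "c = (transpose_mat M * M) *\<^sub>v c" using Mc by simp
    also have "\<dots> = transpose_mat M *\<^sub>v (M *\<^sub>v c)" using Mc by (simp add: assoc_mult_mat_vec[of _ "length ws" n _ "length ws"])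
    also have "\<dots> = 0\<^sub>v (length ws)" unfolding M0 using Mc by auto
    finally have "c = 0\<^sub>v (length ws)" .
    moreover obtain k where "k < length ws" "ws ! k = v" using A(4) ws(1) by (metis in_set_conv_nth)
    ultimately show False using A(5) by (metis c_def index_vec index_zero_vec(1))
  qed
  from lin_indpt_full_rank[OF B dist this] show ?thesis .
qed

text \<open>Each matrix is a right multiple of the other, so their column spaces coincide.\<close>

lemma rank_eq_of_factor:
  fixes A B :: "real mat"
  assumes A: "A \<in> carrier_mat n m" and B: "B \<in> carrier_mat n t" and M: "M \<in> carrier_mat t m" and N: "N \<in> carrier_mat m t"
    and AB: "A = B * M" and BA: "B = A * N"
  shows "vec_space.rank n A = vec_space.rank n B"
proof -
  interpret vec_space "TYPE(real)" n .
  have "col_space A = col_space B"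
    unfolding col_space_eq[OF A] col_space_eq[OF B]
  proof (intro equalityI subsetI)
    fix y assume "y \<in> {y \<in> carrier_vec (dim_row A). \<exists>x\<in>carrier_vec (dim_col A). A *\<^sub>v x = y}"
    then obtain x where x: "x \<in> carrier_vec m" "y = A *\<^sub>v x" using A by auto
    then have "y = B *\<^sub>v (M *\<^sub>v x)" unfolding AB using B M by (simp add: assoc_mult_mat_vec[of _ n t _ m])
    then show "y \<in> {y \<in> carrier_vec (dim_row B). \<exists>x\<in>carrier_vec (dim_col B). B *\<^sub>v x = y}"
      using x B M A by (auto intro!: bexI[of _ "M *\<^sub>v x"])
  next
    fix y assume "y \<in> {y \<in> carrier_vec (dim_row B). \<exists>x\<in>carrier_vec (dim_col B). B *\<^sub>v x = y}"
    then obtain x where x: "x \<in> carrier_vec t" "y = B *\<^sub>v x" using B by auto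
    then have "y = A *\<^sub>v (N *\<^sub>v x)" using A N BA by (metis assoc_mult_mat_vec)
    then show "y \<in> {y \<in> carrier_vec (dim_row A). \<exists>x\<in>carrier_vec (dim_col A). A *\<^sub>v x = y}"
      using x B N A by (auto intro!: bexI[of _ "N *\<^sub>v x"])
  qed
  then show ?thesis by (simp add: rank_def col_space_def)
qed

lemma transpose_mult_self_eq_1:
  fixes U :: "real mat"
  assumes "U \<in> carrier_mat a q"
  shows "transpose_mat U * U = 1\<^sub>m q \<longleftrightarrow> (\<forall>i<q. \<forall>j<q. (\<Sum>k<a. U $$ (k, i) * U $$ (k, j)) = (if i = j then 1 else 0))"
proof
  assume e: "transpose_mat U * U = 1\<^sub>m q"
  show "\<forall>i<q. \<forall>j<q. (\<Sum>k<a. U $$ (k, i) * U $$ (k, j)) = (if i = j then 1 else 0)"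
    using transpose_mult_self_index[OF assms] unfolding e by (metis index_one_mat(1))
next
  assume "\<forall>i<q. \<forall>j<q. (\<Sum>k<a. U $$ (k, i) * U $$ (k, j)) = (if i = j then 1 else 0)"
  then show "transpose_mat U * U = 1\<^sub>m q"
    using transpose_mult_self_index[OF assms] assms by (intro eq_matI) auto
qed

text \<open>\<open>A\<close> and the first \<open>t\<close> columns of \<open>U\<close> are right
  multiples of each other: \<open>M\<close> carries the scaled right vectors, and \<open>N\<close>
  divides them by the positive singular values.\<close>

lemma is_svd_mat_rank:
  assumes svd: "is_svd A U S V" and A: "A \<in> carrier_mat n1 n2" and t: "t \<le> min n1 n2"
    and pos: "\<And>i. i < min n1 n2 \<Longrightarrow> 0 < S $$ (i, i) \<longleftrightarrow> i < t"
  shows "mat_rank A = t"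
proof -
  define q where "q = min n1 n2"
  note D = is_svdD[OF svd A, folded q_def]
  have UU: "(\<Sum>k<n1. U $$ (k, i) * U $$ (k, j)) = (if i = j then 1 else 0)" if "i < q" "j < q" for i j
    using D(4) transpose_mult_self_eq_1[OF D(1)] that by blast
  have VV: "(\<Sum>k<n2. V $$ (k, i) * V $$ (k, j)) = (if i = j then 1 else 0)" if "i < q" "j < q" for i j
    using D(5) transpose_mult_self_eq_1[OF D(3)] that by blast
  have S0: "S $$ (i, i) = 0" if "t \<le> i" "i < q" for i using pos[of i] D(7)[of i] that by (auto simp: q_def)
  have tq: "t \<le> q" using t by (simp add: q_def)
  define B where "B = mat n1 t (\<lambda>(a, i). U $$ (a, i))"
  define M where "M = mat t n2 (\<lambda>(i, c). S $$ (i, i) * V $$ (c, i))"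
  define N where "N = mat n2 t (\<lambda>(c, i). V $$ (c, i) / S $$ (i, i))"
  have car: "B \<in> carrier_mat n1 t" "M \<in> carrier_mat t n2" "N \<in> carrier_mat n2 t" by (auto simp: B_def M_def N_def)
  have ent: "A $$ (i, j) = (\<Sum>k<q. U $$ (i, k) * S $$ (k, k) * V $$ (j, k))" if "i < n1" "j < n2" for i j
    by (subst D(9)) (rule index_diag_sandwich[OF D(1,2,6,3) that])
  have "transpose_mat B * B = 1\<^sub>m t"
    unfolding transpose_mult_self_eq_1[OF car(1)] using UU tq by (auto simp: B_def)
  then have rB: "vec_space.rank n1 B = t" using rank_orthonormal_cols[OF car(1)] by simp
  have AB: "A = B * M"
  proof (rule eq_matI)
    fix i j assume "i < dim_row (B * M)" "j < dim_col (B * M)"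
    then have ij: "i < n1" "j < n2" using car by auto
    have "A $$ (i, j) = (\<Sum>k<t. U $$ (i, k) * S $$ (k, k) * V $$ (j, k))"
      unfolding ent[OF ij] using tq S0 by (intro sum.mono_neutral_right) auto
    also have "\<dots> = (B * M) $$ (i, j)"
      unfolding index_mult_mat_sum[OF car(1,2) ij] using ij by (simp add: B_def M_def mult.assoc)
    finally show "A $$ (i, j) = (B * M) $$ (i, j)" .
  qed (use A car in auto)
  have BA: "B = A * N"
  proof (rule eq_matI)
    fix i j assume "i < dim_row (A * N)" "j < dim_col (A * N)"
    then have ij: "i < n1" "j < t" using car A by auto
    have Sj: "S $$ (j, j) \<noteq> 0" using pos[of j] ij tq by (simp add: q_def)
    have "(A * N) $$ (i, j) = (\<Sum>c<n2. (\<Sum>k<q. U $$ (i, k) * S $$ (k, k) * V $$ (c, k)) * (V $$ (c, j) / S $$ (j, j)))"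
      unfolding index_mult_mat_sum[OF A car(3) ij] using ij by (simp add: ent N_def)
    also have "\<dots> = (\<Sum>c<n2. \<Sum>k<q. U $$ (i, k) * S $$ (k, k) / S $$ (j, j) * (V $$ (c, k) * V $$ (c, j)))"
      by (simp add: sum_distrib_left sum_divide_distrib sum_distrib_right mult_ac)
    also have "\<dots> = (\<Sum>k<q. U $$ (i, k) * S $$ (k, k) / S $$ (j, j) * (\<Sum>c<n2. V $$ (c, k) * V $$ (c, j)))"
      by (subst sum.swap) (simp add: sum_distrib_left)
    also have "\<dots> = (\<Sum>k<q. if k = j then U $$ (i, j) else 0)"
      using VV ij tq Sj by (intro sum.cong) auto
    also have "\<dots> = B $$ (i, j)" using ij tq by (simp add: B_def)
    finally show "B $$ (i, j) = (A * N) $$ (i, j)" ..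
  qed (use A car in auto)
  show ?thesis unfolding mat_rank_def using rank_eq_of_factor[OF A car AB BA] rB A by simp
qed

text \<open>The diagonal is nonincreasing, so its positive entries form an initial segment, whose
  length is the rank.\<close>

lemma is_svd_pos_iff:
  assumes svd: "is_svd A U S V" and A: "A \<in> carrier_mat n1 n2"
  shows "mat_rank A \<le> min n1 n2" "\<And>i. i < min n1 n2 \<Longrightarrow> 0 < S $$ (i, i) \<longleftrightarrow> i < mat_rank A"
proof -
  define q where "q = min n1 n2"
  note D = is_svdD[OF svd A, folded q_def]
  define t where "t = card {i. i < q \<and> 0 < S $$ (i, i)}"
  have tq: "t \<le> q" unfolding t_def using card_mono[of "{..<q}" "{i. i < q \<and> 0 < S $$ (i, i)}"] by auto
  have pos: "0 < S $$ (i, i) \<longleftrightarrow> i < t" if i: "i < q" for i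
  proof
    assume p: "0 < S $$ (i, i)"
    have "{..i} \<subseteq> {i. i < q \<and> 0 < S $$ (i, i)}" using D(8)[of _ i] p i by (auto intro: less_le_trans)
    then have "card {..i} \<le> t" unfolding t_def by (intro card_mono) auto
    then show "i < t" by simp
  next
    assume it: "i < t"
    show "0 < S $$ (i, i)"
    proof (rule ccontr)
      assume n: "\<not> 0 < S $$ (i, i)"
      have "{i. i < q \<and> 0 < S $$ (i, i)} \<subseteq> {..<i}"
      proof
        fix j assume "j \<in> {i. i < q \<and> 0 < S $$ (i, i)}"
        then show "j \<in> {..<i}" using D(8)[of i j] n by (cases "i \<le> j") auto
      qed
      then have "t \<le> card {..<i}" unfolding t_def by (intro card_mono) auto
      then show False using it by simp
    qed
  qed
  have "mat_rank A = t" by (rule is_svd_mat_rank[OF svd A]) (use tq pos in \<open>auto simp: q_def\<close>)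
  then show "mat_rank A \<le> min n1 n2" "\<And>i. i < min n1 n2 \<Longrightarrow> 0 < S $$ (i, i) \<longleftrightarrow> i < mat_rank A"
    using tq pos by (auto simp: q_def)
qed

section \<open>The transform domain\<close>

text \<open>A Dirichlet kernel: multiplied by \<open>2 * sin t\<close>, the sum telescopes.\<close>

lemma sum_cos_odd: "2 * sin t * (\<Sum>l<n. cos ((2 * real l + 1) * t)) = sin (2 * real n * t)"
proof (induction n)
  case (Suc n)
  have "sin (2 * real (Suc n) * t) - sin (2 * real n * t) = 2 * sin t * cos ((2 * real n + 1) * t)"
  proof -
    have "(2 * real (Suc n) * t - 2 * real n * t) / 2 = t" "(2 * real (Suc n) * t + 2 * real n * t) / 2 = (2 * real n + 1) * t"
      by (simp_all add: field_simps)
    then show ?thesis by (simp only: sin_diff_sin)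
  qed
  then show ?case using Suc by (simp add: algebra_simps)
qed simp

definition dc :: "nat \<Rightarrow> nat \<Rightarrow> nat \<Rightarrow> real" where
  "dc n k l = sqrt ((if k = 0 then 1 else 2) / real n) * cos (pi * (2 * real l + 1) * real k / (2 * real n))"

lemma dct_mat_carrier: "dct_mat n \<in> carrier_mat n n" by (simp add: dct_mat_def)
lemma dct_mat_index: "k < n \<Longrightarrow> l < n \<Longrightarrow> dct_mat n $$ (k, l) = dc n k l" by (simp add: dct_mat_def dc_def)

text \<open>With \<open>t = pi * j / (2 * n)\<close> the closed form vanishes because
  \<open>2 * n * t\<close> is a multiple of \<open>pi\<close>, while the bound on \<open>j\<close>
  keeps \<open>sin t\<close> away from 0. Sums and differences of two frequencies below
  \<open>n\<close> lie in this range.\<close>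

lemma sum_cos_dct:
  assumes "n > 0" "\<bar>j\<bar> < 2 * int n"
  shows "(\<Sum>l<n. cos ((2 * real l + 1) * (pi * real_of_int j / (2 * real n)))) = (if j = 0 then real n else 0)"
proof (cases "j = 0")
  case False
  define t where "t = pi * real_of_int j / (2 * real n)"
  have nz: "sin t \<noteq> 0"
  proof
    assume "sin t = 0"
    then obtain i :: int where "t = real_of_int i * pi" by (auto simp: sin_zero_iff_int2)
    then have "real_of_int j = 2 * real n * real_of_int i" using assms by (simp add: t_def field_simps)
    then have j: "j = 2 * int n * i" by (metis (mono_tags, lifting) of_int_eq_iff of_int_mult of_int_numeral of_int_of_nat_eq)
    then have "i \<noteq> 0" using False by auto
    then have "2 * int n * 1 \<le> \<bar>j\<bar>" unfolding j abs_mult by (intro mult_mono) auto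
    then show False using assms by simp
  qed
  have "2 * real n * t = real_of_int j * pi" using assms by (simp add: t_def)
  then have "sin (2 * real n * t) = 0" by (simp add: sin_zero_iff_int2)
  then show ?thesis using sum_cos_odd[of t n] nz False by (simp add: t_def)
qed (use assms in simp)

lemma dc_orth:
  assumes "k < n" "k' < n"
  shows "(\<Sum>l<n. dc n k l * dc n k' l) = (if k = k' then 1 else 0)"
proof -
  have n: "n > 0" using assms by simp
  define a b where "a = sqrt ((if k = 0 then 1 else 2) / real n)" and "b = sqrt ((if k' = 0 then 1 else 2) / real n)"
  have "(\<Sum>l<n. dc n k l * dc n k' l) = (\<Sum>l<n. a * b / 2 *
     (cos ((2 * real l + 1) * (pi * real_of_int (int k - int k') / (2 * real n))) +
      cos ((2 * real l + 1) * (pi * real_of_int (int k + int k') / (2 * real n)))))"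
  proof (intro sum.cong refl)
    fix l
    have "cos (pi * (2 * real l + 1) * real k / (2 * real n)) * cos (pi * (2 * real l + 1) * real k' / (2 * real n)) =
      (cos ((2 * real l + 1) * (pi * real_of_int (int k - int k') / (2 * real n))) +
       cos ((2 * real l + 1) * (pi * real_of_int (int k + int k') / (2 * real n)))) / 2"
      by (subst cos_times_cos) (simp add: algebra_simps diff_divide_distrib add_divide_distrib)
    then show "dc n k l * dc n k' l = a * b / 2 *
     (cos ((2 * real l + 1) * (pi * real_of_int (int k - int k') / (2 * real n))) +
      cos ((2 * real l + 1) * (pi * real_of_int (int k + int k') / (2 * real n))))"
      unfolding dc_def a_def[symmetric] b_def[symmetric] by (simp add: mult_ac)
  qed
  also have "\<dots> = a * b / 2 * ((if k = k' then real n else 0) + (if k = 0 \<and> k' = 0 then real n else 0))"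
    unfolding sum_distrib_left[symmetric] sum.distrib
    using assms by (subst (1 2) sum_cos_dct) (auto simp: n)
  also have "\<dots> = (if k = k' then 1 else 0)"
    using n by (auto simp: a_def b_def)
  finally show ?thesis .
qed

lemma dct_mat_orth: "dct_mat n * transpose_mat (dct_mat n) = 1\<^sub>m n" "transpose_mat (dct_mat n) * dct_mat n = 1\<^sub>m n"
proof -
  show *: "dct_mat n * transpose_mat (dct_mat n) = 1\<^sub>m n"
  proof (rule eq_matI)
    fix i j assume "i < dim_row (1\<^sub>m n :: real mat)" "j < dim_col (1\<^sub>m n :: real mat)"
    then have ij: "i < n" "j < n" by auto
    show "(dct_mat n * transpose_mat (dct_mat n)) $$ (i, j) = 1\<^sub>m n $$ (i, j)"
      by (subst index_mult_mat_sum[of _ n n _ n]) (use ij dct_mat_carrier[of n] dc_orth[of i n j] in \<open>auto simp: dct_mat_index\<close>)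
  qed (use dct_mat_carrier in auto)
  show "transpose_mat (dct_mat n) * dct_mat n = 1\<^sub>m n"
    by (rule mat_mult_left_right_inverse[OF _ _ *]) (use dct_mat_carrier in auto)
qed

lemma dc_orth_cols:
  assumes "l < n" "l' < n"
  shows "(\<Sum>k<n. dc n k l * dc n k l') = (if l = l' then 1 else 0)"
proof -
  have "(transpose_mat (dct_mat n) * dct_mat n) $$ (l, l') = (\<Sum>k<n. dc n k l * dc n k l')"
    by (subst index_mult_mat_sum[of _ n n _ n]) (use assms dct_mat_carrier[of n] in \<open>auto simp: dct_mat_index\<close>)
  then show ?thesis using assms by (simp add: dct_mat_orth)
qed

text \<open>Flatness of the transform: a unit tensor spreads over the slices with squared weights at
  most \<open>2 / n\<close>. This turns slice averages in the incoherence conditions into bounds for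
  single samples at the price of a factor 2.\<close>

lemma dc_sq_le: "(dc n k l)\<^sup>2 \<le> 2 / real n"
proof -
  define c where "c = cos (pi * (2 * real l + 1) * real k / (2 * real n))"
  have c: "c\<^sup>2 \<le> 1" unfolding c_def by (simp add: abs_square_le_1)
  have "(dc n k l)\<^sup>2 = ((if k = 0 then 1 else 2) / real n) * c\<^sup>2"
    by (simp add: dc_def c_def power_mult_distrib)
  also have "\<dots> \<le> (2 / real n) * 1" using c by (intro mult_mono) (auto simp: divide_right_mono)
  finally show ?thesis by simp
qed

lemma tensorsD: 
  assumes "A \<in> tensors n1 n2 n3"
  shows "length A = n3" "k < n3 \<Longrightarrow> A ! k \<in> carrier_mat n1 n2"
  using assms by (auto simp: tensors_def)
lemma tensors_dims: "A \<in> tensors n1 n2 n3 \<Longrightarrow> n3 > 0 \<Longrightarrow> nrows A = n1 \<and> ncols A = n2 \<and> length A = n3"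
  using tensorsD(1)[of A n1 n2 n3] tensorsD(2)[of A n1 n2 n3 0] by (auto simp: nrows_def ncols_def)
lemma tensorsI: "length A = n3 \<Longrightarrow> (\<And>k. k < n3 \<Longrightarrow> A ! k \<in> carrier_mat n1 n2) \<Longrightarrow> A \<in> tensors n1 n2 n3"
  by (auto simp: tensors_def in_set_conv_nth)
lemma tensor_eqI:
  assumes "A \<in> tensors n1 n2 n3" "B \<in> tensors n1 n2 n3"
    "\<And>i j k. i < n1 \<Longrightarrow> j < n2 \<Longrightarrow> k < n3 \<Longrightarrow> A ! k $$ (i, j) = B ! k $$ (i, j)"
  shows "A = B"
proof (rule nth_equalityI)
  show "length A = length B" using assms tensorsD by auto
  fix k assume "k < length A"
  then have k: "k < n3" using tensorsD[OF assms(1)] by simp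
  show "A ! k = B ! k" using tensorsD(2)[OF assms(1) k] tensorsD(2)[OF assms(2) k] assms(3) k by (intro eq_matI) auto
qed

lemma tadd_tensors [intro]: "A \<in> tensors n1 n2 n3 \<Longrightarrow> B \<in> tensors n1 n2 n3 \<Longrightarrow> tadd A B \<in> tensors n1 n2 n3"
  using tensorsD[of A n1 n2 n3] tensorsD[of B n1 n2 n3] by (intro tensorsI) (auto simp: tadd_def)
lemma tsub_tensors [intro]: "A \<in> tensors n1 n2 n3 \<Longrightarrow> B \<in> tensors n1 n2 n3 \<Longrightarrow> tsub A B \<in> tensors n1 n2 n3"
  using tensorsD[of A n1 n2 n3] tensorsD[of B n1 n2 n3] by (intro tensorsI) (auto simp: tsub_def intro!: minus_carrier_mat)
lemma tscale_tensors [intro]: "A \<in> tensors n1 n2 n3 \<Longrightarrow> tscale c A \<in> tensors n1 n2 n3"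
  using tensorsD[of A n1 n2 n3] by (intro tensorsI) (auto simp: tscale_def)
lemma tzero_tensors [intro]: "tzero n1 n2 n3 \<in> tensors n1 n2 n3" by (intro tensorsI) (auto simp: tzero_def)
lemma unit_tensor_tensors [intro]: "unit_tensor n1 n2 n3 e \<in> tensors n1 n2 n3"
  by (cases e) (intro tensorsI, auto simp: unit_tensor_def)

lemma transform_tubes_tensors:
  assumes "A \<in> tensors n1 n2 n3" "n3 > 0" shows "transform_tubes M A \<in> tensors n1 n2 n3"
  using tensors_dims[OF assms] by (intro tensorsI) (auto simp: transform_tubes_def)

lemma transform_tubes_nth:
  assumes "A \<in> tensors n1 n2 n3" "M \<in> carrier_mat n3 n3" "i < n1" "j < n2" "k < n3"
  shows "transform_tubes M A ! k $$ (i, j) = (\<Sum>l<n3. M $$ (k, l) * A ! l $$ (i, j))"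
  using tensors_dims[OF assms(1)] assms
  by (auto simp: transform_tubes_def tube_def scalar_prod_def atLeast0LessThan intro!: sum.cong)

lemma transform_tubes_comp:
  assumes "A \<in> tensors n1 n2 n3" "n3 > 0" "M \<in> carrier_mat n3 n3" "N \<in> carrier_mat n3 n3" "M * N = 1\<^sub>m n3"
  shows "transform_tubes M (transform_tubes N A) = A"
proof (rule tensor_eqI[OF transform_tubes_tensors[OF transform_tubes_tensors[OF assms(1,2)] assms(2)] assms(1)])
  fix i j k assume ijk: "i < n1" "j < n2" "k < n3"
  have "transform_tubes M (transform_tubes N A) ! k $$ (i, j) = (\<Sum>l<n3. M $$ (k, l) * (\<Sum>l'<n3. N $$ (l, l') * A ! l' $$ (i, j)))"
    using transform_tubes_nth[OF transform_tubes_tensors[OF assms(1,2)] assms(3) ijk] transform_tubes_nth[OF assms(1,4) ijk(1,2)]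
    by simp
  also have "\<dots> = (\<Sum>l<n3. \<Sum>l'<n3. M $$ (k, l) * N $$ (l, l') * A ! l' $$ (i, j))"
    by (simp add: sum_distrib_left mult.assoc)
  also have "\<dots> = (\<Sum>l'<n3. (\<Sum>l<n3. M $$ (k, l) * N $$ (l, l')) * A ! l' $$ (i, j))"
    by (subst sum.swap) (simp add: sum_distrib_right)
  also have "\<dots> = (\<Sum>l'<n3. (if l' = k then A ! k $$ (i, j) else 0))"
    using index_mult_mat_sum[OF assms(3,4) ijk(3), symmetric] ijk unfolding assms(5) by (intro sum.cong refl) auto
  also have "\<dots> = A ! k $$ (i, j)" using ijk by simp
  finally show "transform_tubes M (transform_tubes N A) ! k $$ (i, j) = A ! k $$ (i, j)" .
qed

lemma dct_tensors [intro]: "A \<in> tensors n1 n2 n3 \<Longrightarrow> n3 > 0 \<Longrightarrow> dct A \<in> tensors n1 n2 n3"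
  unfolding dct_def by (rule transform_tubes_tensors)
lemma idct_tensors [intro]: "A \<in> tensors n1 n2 n3 \<Longrightarrow> n3 > 0 \<Longrightarrow> idct A \<in> tensors n1 n2 n3"
  unfolding idct_def by (rule transform_tubes_tensors)
lemma idct_dct: "A \<in> tensors n1 n2 n3 \<Longrightarrow> n3 > 0 \<Longrightarrow> idct (dct A) = A"
  using transform_tubes_comp[of A n1 n2 n3 "transpose_mat (dct_mat n3)" "dct_mat n3"] dct_mat_carrier dct_mat_orth
  by (simp add: idct_def dct_def tensors_dims transform_tubes_def[of _ A])
lemma dct_idct: "A \<in> tensors n1 n2 n3 \<Longrightarrow> n3 > 0 \<Longrightarrow> dct (idct A) = A"
  using transform_tubes_comp[of A n1 n2 n3 "dct_mat n3" "transpose_mat (dct_mat n3)"] dct_mat_carrier dct_mat_orth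
  by (simp add: idct_def dct_def tensors_dims transform_tubes_def[of _ A])
lemma dct_nth:
  assumes "A \<in> tensors n1 n2 n3" "i < n1" "j < n2" "k < n3"
  shows "dct A ! k $$ (i, j) = (\<Sum>l<n3. dc n3 k l * A ! l $$ (i, j))"
  using transform_tubes_nth[OF assms(1) dct_mat_carrier assms(2-4)] assms tensors_dims[OF assms(1)]
  by (simp add: dct_def dct_mat_index)

lemma tinner_sum:
  assumes "A \<in> tensors n1 n2 n3" "n3 > 0"
  shows "tinner A B = (\<Sum>k<n3. \<Sum>i<n1. \<Sum>j<n2. A ! k $$ (i, j) * B ! k $$ (i, j))"
  using tensors_dims[OF assms] by (simp add: tinner_def)

text \<open>Parseval tube by tube, by orthogonality of the columns of the transform.\<close>

lemma tinner_dct: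
  assumes A: "A \<in> tensors n1 n2 n3" and B: "B \<in> tensors n1 n2 n3" and n: "n3 > 0"
  shows "tinner (dct A) (dct B) = tinner A B"
proof -
  have *: "(\<Sum>k<n3. dct A ! k $$ (i, j) * dct B ! k $$ (i, j)) = (\<Sum>l<n3. A ! l $$ (i, j) * B ! l $$ (i, j))"
    if ij: "i < n1" "j < n2" for i j
  proof -
    have "(\<Sum>k<n3. dct A ! k $$ (i, j) * dct B ! k $$ (i, j)) =
      (\<Sum>k<n3. (\<Sum>l<n3. dc n3 k l * A ! l $$ (i, j)) * (\<Sum>l'<n3. dc n3 k l' * B ! l' $$ (i, j)))"
      using dct_nth[OF A ij] dct_nth[OF B ij] by simp
    also have "\<dots> = (\<Sum>k<n3. \<Sum>l<n3. \<Sum>l'<n3. dc n3 k l * dc n3 k l' * (A ! l $$ (i, j) * B ! l' $$ (i, j)))"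
      by (simp add: sum_product mult_ac)
    also have "\<dots> = (\<Sum>l<n3. \<Sum>k<n3. \<Sum>l'<n3. dc n3 k l * dc n3 k l' * (A ! l $$ (i, j) * B ! l' $$ (i, j)))"
      by (rule sum.swap)
    also have "\<dots> = (\<Sum>l<n3. \<Sum>l'<n3. (\<Sum>k<n3. dc n3 k l * dc n3 k l') * (A ! l $$ (i, j) * B ! l' $$ (i, j)))"
      by (subst sum.swap[of _ "{..<n3}" "{..<n3}"]) (simp add: sum_distrib_right)
    also have "\<dots> = (\<Sum>l<n3. \<Sum>l'<n3. if l' = l then A ! l $$ (i, j) * B ! l $$ (i, j) else 0)"
      by (intro sum.cong refl) (auto simp: dc_orth_cols)
    also have "\<dots> = (\<Sum>l<n3. A ! l $$ (i, j) * B ! l $$ (i, j))" by simp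
    finally show ?thesis .
  qed
  have sw: "(\<Sum>k<n3. \<Sum>i<n1. \<Sum>j<n2. f k i j) = (\<Sum>i<n1. \<Sum>j<n2. \<Sum>k<n3. f k i j)" for f :: "nat \<Rightarrow> nat \<Rightarrow> nat \<Rightarrow> real"
    by (subst sum.swap) (intro sum.cong refl sum.swap)
  show ?thesis
    unfolding tinner_sum[OF dct_tensors[OF A n] n] tinner_sum[OF A n] sw using * by simp
qed

section \<open>Tensors as block diagonal matrices\<close>

lemma ent_mult_supp:
  assumes "finite K" "\<And>k. ent A i k \<noteq> 0 \<Longrightarrow> k \<in> K"
  shows "ent (A * B) i j = (\<Sum>k\<in>K. ent A i k * ent B k j)"
proof -
  have "ent (A * B) i j = (\<Sum>k\<in>ind A \<union> K. ent A i k * ent B k j)" by (rule ent_mult) (use assms in auto)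
  also have "\<dots> = (\<Sum>k\<in>K. ent A i k * ent B k j)" by (rule sum.mono_neutral_right) (use assms in auto)
  finally show ?thesis .
qed

lemma inner_supp:
  assumes "finite R" "finite C" "\<And>i j. ent A i j \<noteq> 0 \<Longrightarrow> i \<in> R \<and> j \<in> C"
  shows "A \<bullet> B = (\<Sum>i\<in>R. \<Sum>j\<in>C. ent A i j * ent B i j)"
proof -
  define K where "K = ind A \<union> R \<union> C"
  have K: "finite K" "R \<subseteq> K" "C \<subseteq> K" using assms by (auto simp: K_def)
  have z: "ent A i j = 0" if "i \<notin> R \<or> j \<notin> C" for i j using assms(3) that by blast
  have "A \<bullet> B = (\<Sum>i\<in>K. \<Sum>j\<in>K. ent A i j * ent B i j)" by (rule inner_fmat_eq) (use K in \<open>auto simp: K_def\<close>)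
  also have "\<dots> = (\<Sum>i\<in>K. \<Sum>j\<in>C. ent A i j * ent B i j)"
    by (rule sum.cong[OF refl], rule sum.mono_neutral_right) (simp_all add: K z)
  also have "\<dots> = (\<Sum>i\<in>R. \<Sum>j\<in>C. ent A i j * ent B i j)"
    by (rule sum.mono_neutral_right) (simp_all add: K z)
  finally show ?thesis .
qed

text \<open>A tensor in the transform domain as one block diagonal matrix; the index \<open>(i, k)\<close> is row
  (or column) \<open>i\<close> of block \<open>k\<close>.\<close>

definition blk :: "nat \<Rightarrow> nat \<Rightarrow> real mat list \<Rightarrow> (nat \<times> nat) fmat" where
  "blk n1 n2 Ms = mk ({..<n1} \<times> {..<length Ms}) ({..<n2} \<times> {..<length Ms})
     (\<lambda>p q. if snd p = snd q then Ms ! snd p $$ (fst p, fst q) else 0)"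

text \<open>Up to the naming of indices, the matrix \<open>block_diag A\<close>. The map is
  isometric and carries \<open>\<star>\<close> and \<open>ttranspose\<close> to product and adjoint,
  so tensor identities become matrix identities.\<close>

definition iota :: "tensor \<Rightarrow> (nat \<times> nat) fmat" where "iota A = blk (nrows A) (ncols A) (dct A)"

lemma ent_blk:
  assumes "Ms \<in> tensors n1 n2 n3"
  shows "ent (blk n1 n2 Ms) (i, k) (j, l) = (if k = l \<and> k < n3 \<and> i < n1 \<and> j < n2 then Ms ! k $$ (i, j) else 0)"
  using tensorsD[OF assms] by (auto simp: blk_def ent_mk)

lemma iota_blk: "A \<in> tensors n1 n2 n3 \<Longrightarrow> n3 > 0 \<Longrightarrow> iota A = blk n1 n2 (dct A)"
  by (simp add: iota_def tensors_dims)
lemma ent_iota: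
  assumes "A \<in> tensors n1 n2 n3" "n3 > 0"
  shows "ent (iota A) (i, k) (j, l) = (if k = l \<and> k < n3 \<and> i < n1 \<and> j < n2 then dct A ! k $$ (i, j) else 0)"
  unfolding iota_blk[OF assms] by (rule ent_blk[OF dct_tensors[OF assms]])

lemma blk_inject:
  assumes "A \<in> tensors n1 n2 n3" "B \<in> tensors n1 n2 n3" "blk n1 n2 A = blk n1 n2 B"
  shows "A = B"
proof (rule tensor_eqI[OF assms(1,2)])
  fix i j k assume "i < n1" "j < n2" "k < n3"
  then show "A ! k $$ (i, j) = B ! k $$ (i, j)"
    using arg_cong[OF assms(3), of "\<lambda>Z. ent Z (i, k) (j, k)"] by (simp add: ent_blk[OF assms(1)] ent_blk[OF assms(2)])
qed
lemma iota_inject: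
  assumes "A \<in> tensors n1 n2 n3" "B \<in> tensors n1 n2 n3" "n3 > 0" "iota A = iota B"
  shows "A = B"
  using blk_inject[OF dct_tensors[OF assms(1,3)] dct_tensors[OF assms(2,3)]] assms idct_dct
  by (metis iota_blk)

lemma fmat_pair_eqI: "(\<And>i k j l. ent A (i, k) (j, l) = ent B (i, k) (j, l)) \<Longrightarrow> A = B"
  by (rule fmat_eqI) (metis surj_pair)

lemma iota_tadd:
  assumes "A \<in> tensors n1 n2 n3" "B \<in> tensors n1 n2 n3" "n3 > 0"
  shows "iota (tadd A B) = iota A + iota B"
proof (rule fmat_pair_eqI)
  fix i k j l
  have "tadd A B ! l' $$ (i, j) = A ! l' $$ (i, j) + B ! l' $$ (i, j)" if "l' < n3" "i < n1" "j < n2" for l'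
    using that tensorsD(2)[OF assms(1) that(1)] tensorsD(2)[OF assms(2) that(1)]
    by (simp add: tadd_def tensorsD(1)[OF assms(1)] tensorsD(1)[OF assms(2)])
  then show "ent (iota (tadd A B)) (i, k) (j, l) = ent (iota A + iota B) (i, k) (j, l)"
    using assms by (simp add: ent_iota[OF tadd_tensors] ent_iota[of _ n1 n2 n3] dct_nth[OF tadd_tensors] dct_nth[of _ n1 n2 n3]
       algebra_simps sum.distrib)
qed
lemma iota_tsub:
  assumes "A \<in> tensors n1 n2 n3" "B \<in> tensors n1 n2 n3" "n3 > 0"
  shows "iota (tsub A B) = iota A - iota B"
proof (rule fmat_pair_eqI)
  fix i k j l
  have "tsub A B ! l' $$ (i, j) = A ! l' $$ (i, j) - B ! l' $$ (i, j)" if "l' < n3" "i < n1" "j < n2" for l'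
    using that tensorsD(2)[OF assms(1) that(1)] tensorsD(2)[OF assms(2) that(1)]
    by (simp add: tsub_def tensorsD(1)[OF assms(1)] tensorsD(1)[OF assms(2)])
  then show "ent (iota (tsub A B)) (i, k) (j, l) = ent (iota A - iota B) (i, k) (j, l)"
    using assms by (simp add: ent_iota[OF tsub_tensors] ent_iota[of _ n1 n2 n3] dct_nth[OF tsub_tensors] dct_nth[of _ n1 n2 n3]
       right_diff_distrib sum_subtractf)
qed
lemma iota_tscale:
  assumes "A \<in> tensors n1 n2 n3" "n3 > 0"
  shows "iota (tscale c A) = c *\<^sub>R iota A"
proof (rule fmat_pair_eqI)
  fix i k j l
  have "tscale c A ! l' $$ (i, j) = c * A ! l' $$ (i, j)" if "l' < n3" "i < n1" "j < n2" for l'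
    using that tensorsD(2)[OF assms(1) that(1)] by (simp add: tscale_def tensorsD(1)[OF assms(1)])
  then show "ent (iota (tscale c A)) (i, k) (j, l) = ent (c *\<^sub>R iota A) (i, k) (j, l)"
    using assms by (simp add: ent_iota[OF tscale_tensors] ent_iota[of _ n1 n2 n3] dct_nth[OF tscale_tensors] dct_nth[of _ n1 n2 n3]
       sum_distrib_left mult_ac)
qed
lemma iota_tzero: "n3 > 0 \<Longrightarrow> iota (tzero n1 n2 n3) = 0"
proof (rule fmat_pair_eqI)
  fix i k j l
  assume "n3 > 0"
  have "tzero n1 n2 n3 ! l' $$ (i, j) = 0" if "l' < n3" "i < n1" "j < n2" for l'
    using that by (simp add: tzero_def)
  then show "ent (iota (tzero n1 n2 n3)) (i, k) (j, l) = ent 0 (i, k) (j, l)"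
    by (simp add: ent_iota[OF tzero_tensors \<open>n3 > 0\<close>] dct_nth[OF tzero_tensors])
qed

lemma iota_inner:
  assumes "A \<in> tensors n1 n2 n3" "B \<in> tensors n1 n2 n3" "n3 > 0"
  shows "iota A \<bullet> iota B = tinner A B"
proof -
  have "iota A \<bullet> iota B = (\<Sum>p\<in>{..<n1} \<times> {..<n3}. \<Sum>q\<in>{..<n2} \<times> {..<n3}. ent (iota A) p q * ent (iota B) p q)"
    by (rule inner_supp) (use ent_iota[OF assms(1,3)] in \<open>auto split: if_splits\<close>)
  also have "\<dots> = (\<Sum>i<n1. \<Sum>k<n3. \<Sum>j<n2. \<Sum>l<n3. if l = k then dct A ! k $$ (i, j) * dct B ! k $$ (i, j) else 0)"
    unfolding sum.cartesian_product'
    by (intro sum.cong refl) (auto simp: ent_iota[OF assms(1,3)] ent_iota[OF assms(2,3)])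
  also have "\<dots> = (\<Sum>i<n1. \<Sum>k<n3. \<Sum>j<n2. dct A ! k $$ (i, j) * dct B ! k $$ (i, j))"
    by (intro sum.cong refl) (simp add: sum.delta)
  also have "\<dots> = tinner (dct A) (dct B)"
    unfolding tinner_sum[OF dct_tensors[OF assms(1,3)] assms(3)] by (rule sum.swap)
  finally show ?thesis using tinner_dct[OF assms] by simp
qed
lemma iota_norm: "A \<in> tensors n1 n2 n3 \<Longrightarrow> n3 > 0 \<Longrightarrow> norm (iota A) = fnorm A"
  by (simp add: fnorm_def norm_eq_sqrt_inner iota_inner)

lemma map2_mult_tensors: 
  assumes "A \<in> tensors a b n3" "B \<in> tensors b c n3" shows "map2 (*) A B \<in> tensors a c n3"
  using tensorsD(1)[OF assms(1)] tensorsD(1)[OF assms(2)] mult_carrier_mat[OF tensorsD(2)[OF assms(1)] tensorsD(2)[OF assms(2)]]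
  by (intro tensorsI) (simp_all del: mult_carrier_mat)

lemma blk_mult:
  assumes "A \<in> tensors a b n3" "B \<in> tensors b c n3"
  shows "blk a c (map2 (*) A B) = blk a b A * blk b c B"
proof (rule fmat_pair_eqI)
  fix i k j l
  have AB: "map2 (*) A B \<in> tensors a c n3"
    by (rule map2_mult_tensors[OF assms])
  have "ent (blk a b A * blk b c B) (i, k) (j, l) = (\<Sum>p\<in>{..<b} \<times> {k}. ent (blk a b A) (i, k) p * ent (blk b c B) p (j, l))"
    by (rule ent_mult_supp) (use ent_blk[OF assms(1)] in \<open>auto split: if_splits\<close>)
  also have "\<dots> = (\<Sum>h<b. ent (blk a b A) (i, k) (h, k) * ent (blk b c B) (h, k) (j, l))"
    unfolding sum.cartesian_product' by simp
  also have "\<dots> = (if k = l \<and> k < n3 \<and> i < a \<and> j < c then (\<Sum>h<b. A ! k $$ (i, h) * B ! k $$ (h, j)) else 0)"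
    by (auto simp: ent_blk[OF assms(1)] ent_blk[OF assms(2)] intro!: sum.neutral)
  also have "\<dots> = ent (blk a c (map2 (*) A B)) (i, k) (j, l)"
    by (simp add: ent_blk[OF AB] tensorsD(1)[OF assms(1)] tensorsD(1)[OF assms(2)]
        index_mult_mat_sum[OF tensorsD(2)[OF assms(1)] tensorsD(2)[OF assms(2)]])
  finally show "ent (blk a c (map2 (*) A B)) (i, k) (j, l) = ent (blk a b A * blk b c B) (i, k) (j, l)" ..
qed

lemma tprod_tensors [intro]:
  "A \<in> tensors a b n3 \<Longrightarrow> B \<in> tensors b c n3 \<Longrightarrow> n3 > 0 \<Longrightarrow> A \<star> B \<in> tensors a c n3"
  unfolding tprod_def by (intro idct_tensors map2_mult_tensors dct_tensors)

lemma dct_tprod: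
  "A \<in> tensors a b n3 \<Longrightarrow> B \<in> tensors b c n3 \<Longrightarrow> n3 > 0 \<Longrightarrow> dct (A \<star> B) = map2 (*) (dct A) (dct B)"
  unfolding tprod_def by (intro dct_idct map2_mult_tensors dct_tensors)

lemma iota_tprod:
  assumes "A \<in> tensors a b n3" "B \<in> tensors b c n3" "n3 > 0"
  shows "iota (A \<star> B) = iota A * iota B"
  unfolding iota_blk[OF tprod_tensors[OF assms] assms(3)] iota_blk[OF assms(1,3)] iota_blk[OF assms(2,3)] dct_tprod[OF assms]
  by (rule blk_mult) (use assms in auto)

lemma map_transpose_tensors: "A \<in> tensors a b n3 \<Longrightarrow> map transpose_mat A \<in> tensors b a n3"
  using tensorsD[of A a b n3] by (intro tensorsI) auto
lemma blk_transpose: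
  assumes "A \<in> tensors a b n3" shows "blk b a (map transpose_mat A) = adj (blk a b A)"
proof (rule fmat_pair_eqI)
  fix i k j l
  have "map transpose_mat A ! k $$ (i, j) = A ! k $$ (j, i)" if "k < n3" "i < b" "j < a"
    using that tensorsD(2)[OF assms that(1)] by (simp add: tensorsD(1)[OF assms])
  then show "ent (blk b a (map transpose_mat A)) (i, k) (j, l) = ent (adj (blk a b A)) (i, k) (j, l)"
    by (auto simp: ent_blk[OF assms] ent_blk[OF map_transpose_tensors[OF assms]])
qed
lemma ttranspose_tensors [intro]: "A \<in> tensors a b n3 \<Longrightarrow> n3 > 0 \<Longrightarrow> ttranspose A \<in> tensors b a n3"
  unfolding ttranspose_def by (intro idct_tensors map_transpose_tensors dct_tensors)
lemma iota_ttranspose: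
  assumes "A \<in> tensors a b n3" "n3 > 0" shows "iota (ttranspose A) = adj (iota A)"
  unfolding iota_blk[OF ttranspose_tensors[OF assms] assms(2)] iota_blk[OF assms]
  using blk_transpose[OF dct_tensors[OF assms]] dct_idct[OF map_transpose_tensors[OF dct_tensors[OF assms]] assms(2)]
  by (simp add: ttranspose_def)

text \<open>The image under \<open>iota\<close> of the tensors of this size.\<close>

definition blks :: "nat \<Rightarrow> nat \<Rightarrow> nat \<Rightarrow> (nat \<times> nat) fmat set" where
  "blks n1 n2 n3 = {Z. \<forall>i k j l. ent Z (i, k) (j, l) \<noteq> 0 \<longrightarrow> k = l \<and> k < n3 \<and> i < n1 \<and> j < n2}"

lemma iota_blks: "A \<in> tensors n1 n2 n3 \<Longrightarrow> n3 > 0 \<Longrightarrow> iota A \<in> blks n1 n2 n3"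
  by (auto simp: blks_def ent_iota split: if_splits)

lemma blks_iota:
  assumes "Z \<in> blks n1 n2 n3" "n3 > 0" obtains A where "A \<in> tensors n1 n2 n3" "iota A = Z"
proof -
  define Ms where "Ms = map (\<lambda>k. mat n1 n2 (\<lambda>(i, j). ent Z (i, k) (j, k))) [0..<n3]"
  have Ms: "Ms \<in> tensors n1 n2 n3" by (intro tensorsI) (auto simp: Ms_def)
  have "iota (idct Ms) = blk n1 n2 Ms"
    using iota_blk[OF idct_tensors[OF Ms assms(2)] assms(2)] dct_idct[OF Ms assms(2)] by simp
  also have "\<dots> = Z"
  proof (rule fmat_pair_eqI)
    fix i k j l
    have "Ms ! k $$ (i, j) = ent Z (i, k) (j, k)" if "k < n3" "i < n1" "j < n2" using that by (simp add: Ms_def)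
    then show "ent (blk n1 n2 Ms) (i, k) (j, l) = ent Z (i, k) (j, l)"
      using assms(1) by (auto simp: ent_blk[OF Ms] blks_def)
  qed
  finally show thesis using that[OF idct_tensors[OF Ms assms(2)]] by simp
qed

section \<open>Unit tensors and the sampling operator in the transform domain\<close>

lemma unit_tensor_nth:
  "l < n3 \<Longrightarrow> a < n1 \<Longrightarrow> b < n2 \<Longrightarrow> unit_tensor n1 n2 n3 (i, j, k) ! l $$ (a, b) = (if a = i \<and> b = j \<and> l = k then 1 else 0)"
  by (simp add: unit_tensor_def)

lemma ent_iota_unit:
  assumes "i < n1" "j < n2" "k < n3"
  shows "ent (iota (unit_tensor n1 n2 n3 (i, j, k))) (a, l) (b, l') =
    (if l = l' \<and> l < n3 \<and> a = i \<and> b = j then dc n3 l k else 0)"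
proof -
  have n: "n3 > 0" using assms by simp
  have "dct (unit_tensor n1 n2 n3 (i, j, k)) ! l $$ (a, b) = (if a = i \<and> b = j then dc n3 l k else 0)"
    if "l < n3" "a < n1" "b < n2"
  proof -
    have "dct (unit_tensor n1 n2 n3 (i, j, k)) ! l $$ (a, b) = (\<Sum>h<n3. dc n3 l h * (if a = i \<and> b = j \<and> h = k then 1 else 0))"
      by (subst dct_nth[OF unit_tensor_tensors]) (use that in \<open>auto simp: unit_tensor_nth intro!: sum.cong\<close>)
    also have "\<dots> = (\<Sum>h<n3. if h = k then (if a = i \<and> b = j then dc n3 l k else 0) else 0)" by (intro sum.cong) auto
    finally show ?thesis using assms by simp
  qed
  then show ?thesis using ent_iota[OF unit_tensor_tensors n] assms by auto
qed

lemma tinner_unit: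
  assumes "A \<in> tensors n1 n2 n3" "i < n1" "j < n2" "k < n3"
  shows "tinner (unit_tensor n1 n2 n3 (i, j, k)) A = A ! k $$ (i, j)"
proof -
  have "tinner (unit_tensor n1 n2 n3 (i, j, k)) A = 
    (\<Sum>l<n3. \<Sum>a<n1. \<Sum>b<n2. if b = j then (if a = i then (if l = k then A ! l $$ (a, b) else 0) else 0) else 0)"
    using assms by (subst tinner_sum[OF unit_tensor_tensors]) (simp, intro sum.cong refl, auto simp: unit_tensor_nth)
  then show ?thesis using assms by (simp add: sum.delta)
qed

abbreviation "idx n1 n2 n3 \<equiv> {..<n1::nat} \<times> {..<n2::nat} \<times> {..<n3::nat}"

lemma unit_inner:
  assumes "e \<in> idx n1 n2 n3" "e' \<in> idx n1 n2 n3"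
  shows "iota (unit_tensor n1 n2 n3 e) \<bullet> iota (unit_tensor n1 n2 n3 e') = (if e = e' then 1 else 0)"
proof -
  obtain i j k i' j' k' where e: "e = (i, j, k)" "e' = (i', j', k')" by (cases e, cases e')
  have n: "n3 > 0" using assms by auto
  show ?thesis unfolding iota_inner[OF unit_tensor_tensors unit_tensor_tensors n] 
    using assms tinner_unit[OF unit_tensor_tensors, of i n1 j n2 k n3 e'] by (auto simp: e unit_tensor_nth)
qed

lemma iota_expand:
  assumes "A \<in> tensors n1 n2 n3" "n3 > 0"
  shows "iota A = (\<Sum>e\<in>idx n1 n2 n3. tinner (unit_tensor n1 n2 n3 e) A *\<^sub>R iota (unit_tensor n1 n2 n3 e))"
proof (rule fmat_pair_eqI)
  fix a l b l'
  have "ent (\<Sum>e\<in>idx n1 n2 n3. tinner (unit_tensor n1 n2 n3 e) A *\<^sub>R iota (unit_tensor n1 n2 n3 e)) (a, l) (b, l') =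
    (\<Sum>i<n1. \<Sum>j<n2. \<Sum>k<n3. A ! k $$ (i, j) * (if l = l' \<and> l < n3 \<and> a = i \<and> b = j then dc n3 l k else 0))"
    unfolding ent_sum sum.cartesian_product'
    using assms by (intro sum.cong refl) (simp add: tinner_unit[OF assms(1)] ent_iota_unit)
  also have "\<dots> = (\<Sum>i<n1. \<Sum>j<n2. if j = b then (if i = a then (if l = l' \<and> l < n3 then (\<Sum>k<n3. dc n3 l k * A ! k $$ (i, j)) else 0) else 0) else 0)"
    by (intro sum.cong refl) (auto simp: mult.commute)
  also have "\<dots> = ent (iota A) (a, l) (b, l')"
    by (cases "a < n1"; cases "b < n2") (auto simp: ent_iota[OF assms] sum.delta dct_nth[OF assms(1)] intro!: sum.neutral)
  finally show "ent (iota A) (a, l) (b, l') =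
    ent (\<Sum>e\<in>idx n1 n2 n3. tinner (unit_tensor n1 n2 n3 e) A *\<^sub>R iota (unit_tensor n1 n2 n3 e)) (a, l) (b, l')" ..
qed

lemma subspace_blks: "subspace (blks n1 n2 n3)"
  unfolding real_vector.subspace_def blks_def by auto (metis add_0)+

lemma inj_unit: "inj_on (\<lambda>e. iota (unit_tensor n1 n2 n3 e)) (idx n1 n2 n3)"
proof (rule inj_onI)
  fix e e' assume *: "e \<in> idx n1 n2 n3" "e' \<in> idx n1 n2 n3" "iota (unit_tensor n1 n2 n3 e) = iota (unit_tensor n1 n2 n3 e')"
  show "e = e'" using unit_inner[OF *(1,1)] unit_inner[OF *(1,2)] *(3) by (metis zero_neq_one)
qed

text \<open>Orthogonality of the transform keeps the sampled coordinates an orthonormal basis, so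
  the sampling operator stays a sum of rank-one projections.\<close>

lemma onb_blks:
  assumes "n3 > 0"
  shows "onb ((\<lambda>e. iota (unit_tensor n1 n2 n3 e)) ` idx n1 n2 n3) (blks n1 n2 n3)"
proof -
  let ?B = "(\<lambda>e. iota (unit_tensor n1 n2 n3 e)) ` idx n1 n2 n3"
  have "onset ?B"
    unfolding onset_def
  proof (intro conjI ballI)
    fix x y assume "x \<in> ?B" "y \<in> ?B"
    then obtain e e' where ee: "e \<in> idx n1 n2 n3" "e' \<in> idx n1 n2 n3" 
      "x = iota (unit_tensor n1 n2 n3 e)" "y = iota (unit_tensor n1 n2 n3 e')" by blast
    show "x \<bullet> y = (if x = y then 1 else 0)"
      using unit_inner[OF ee(1,2)] inj_onD[OF inj_unit _ ee(1,2)] ee(3,4) by (cases "e = e'") auto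
  qed auto
  moreover have "span ?B = blks n1 n2 n3"
  proof
    show "span ?B \<subseteq> blks n1 n2 n3"
      by (rule span_minimal[OF _ subspace_blks]) (use iota_blks[OF unit_tensor_tensors assms] in blast)
    show "blks n1 n2 n3 \<subseteq> span ?B"
    proof
      fix Z assume "Z \<in> blks n1 n2 n3"
      then obtain A where A: "A \<in> tensors n1 n2 n3" "iota A = Z" by (rule blks_iota[OF _ assms])
      have "Z = (\<Sum>e\<in>idx n1 n2 n3. tinner (unit_tensor n1 n2 n3 e) A *\<^sub>R iota (unit_tensor n1 n2 n3 e))"
        unfolding A(2)[symmetric] by (rule iota_expand[OF A(1) assms])
      also have "\<dots> \<in> span ?B" by (intro span_sum span_scale span_base) auto
      finally show "Z \<in> span ?B" .
    qed
  qed
  ultimately show ?thesis by (simp add: onb_def)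
qed

definition samp :: "nat \<Rightarrow> nat \<Rightarrow> nat \<Rightarrow> (nat \<times> nat \<times> nat) list \<Rightarrow> (nat \<times> nat) fmat \<Rightarrow> (nat \<times> nat) fmat" where
  "samp n1 n2 n3 \<Omega> Z = (\<Sum>e\<leftarrow>\<Omega>. (iota (unit_tensor n1 n2 n3 e) \<bullet> Z) *\<^sub>R iota (unit_tensor n1 n2 n3 e))"

lemma sampling_op_iota:
  assumes "A \<in> tensors n1 n2 n3" "n3 > 0"
  shows "sampling_op \<Omega> A \<in> tensors n1 n2 n3 \<and> iota (sampling_op \<Omega> A) = samp n1 n2 n3 \<Omega> (iota A)"
proof -
  define f where "f = (\<lambda>e. tadd (tscale (tinner (unit_tensor n1 n2 n3 e) A) (unit_tensor n1 n2 n3 e)))"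
  have "foldr f \<Omega> (tzero n1 n2 n3) \<in> tensors n1 n2 n3 \<and> iota (foldr f \<Omega> (tzero n1 n2 n3)) = samp n1 n2 n3 \<Omega> (iota A)"
  proof (induction \<Omega>)
    case Nil
    then show ?case using assms by (auto simp: samp_def iota_tzero)
  next
    case (Cons e \<Omega>)
    have t: "tscale (tinner (unit_tensor n1 n2 n3 e) A) (unit_tensor n1 n2 n3 e) \<in> tensors n1 n2 n3" by blast
    have "iota (f e (foldr f \<Omega> (tzero n1 n2 n3))) =
       tinner (unit_tensor n1 n2 n3 e) A *\<^sub>R iota (unit_tensor n1 n2 n3 e) + samp n1 n2 n3 \<Omega> (iota A)"
      using Cons by (simp add: f_def iota_tadd[OF t _ assms(2)] iota_tscale[OF unit_tensor_tensors assms(2)])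
    then show ?case using Cons t iota_inner[OF unit_tensor_tensors assms]
      by (auto simp: f_def samp_def)
  qed
  then show ?thesis using tensors_dims[OF assms] by (simp add: sampling_op_def f_def)
qed

lemma samp_linear: "linear (samp n1 n2 n3 \<Omega>)"
  by (rule linearI; induction \<Omega>) (auto simp: samp_def inner_add_right algebra_simps)
lemma samp_sym: "samp n1 n2 n3 \<Omega> Y \<bullet> Z = Y \<bullet> samp n1 n2 n3 \<Omega> Z"
  by (induction \<Omega>) (auto simp: samp_def inner_add_left inner_add_right inner_commute)
lemma samp_inner: "Y \<bullet> samp n1 n2 n3 \<Omega> Z = (\<Sum>e\<leftarrow>\<Omega>. (iota (unit_tensor n1 n2 n3 e) \<bullet> Y) * (iota (unit_tensor n1 n2 n3 e) \<bullet> Z))"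
  by (induction \<Omega>) (auto simp: samp_def inner_add_right inner_commute)
lemma samp_psd: "0 \<le> Z \<bullet> samp n1 n2 n3 \<Omega> Z"
  unfolding samp_inner by (intro sum_list_nonneg) auto

lemma sum_list_count: "(\<Sum>e\<leftarrow>xs. f e) = (\<Sum>e\<in>I. real (count_list xs e) * f e)"
  if "set xs \<subseteq> I" "finite I" for f :: "'i \<Rightarrow> real"
  using that(1)
proof (induction xs)
  case (Cons x xs)
  have "(\<Sum>e\<in>I. real (count_list (x # xs) e) * f e) = (\<Sum>e\<in>I. (if e = x then f x else 0) + real (count_list xs e) * f e)"
    by (intro sum.cong refl) (auto simp: algebra_simps)
  then show ?case using Cons that(2) by (simp add: sum.distrib)
qed simp

text \<open>Collected by index, the form is a weighted sum of squared coordinates in an orthonormal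
  basis, with the multiplicities as weights.\<close>

lemma samp_bound:
  assumes n: "n3 > 0" and sub: "set \<Omega> \<subseteq> idx n1 n2 n3" and M: "\<And>e. e \<in> idx n1 n2 n3 \<Longrightarrow> real (count_list \<Omega> e) \<le> M"
    and "M \<ge> 0"
  shows "Z \<bullet> samp n1 n2 n3 \<Omega> Z \<le> M * (norm Z)\<^sup>2"
proof -
  let ?E = "\<lambda>e. iota (unit_tensor n1 n2 n3 e)"
  have "Z \<bullet> samp n1 n2 n3 \<Omega> Z = (\<Sum>e\<in>idx n1 n2 n3. real (count_list \<Omega> e) * (Z \<bullet> ?E e)\<^sup>2)"
    unfolding samp_inner by (subst sum_list_count[OF sub]) (auto simp: power2_eq_square inner_commute)
  also have "\<dots> \<le> (\<Sum>e\<in>idx n1 n2 n3. M * (Z \<bullet> ?E e)\<^sup>2)" by (intro sum_mono mult_right_mono M) auto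
  also have "\<dots> = M * (\<Sum>b\<in>?E ` idx n1 n2 n3. (Z \<bullet> b)\<^sup>2)"
    by (simp add: sum.reindex[OF inj_unit] sum_distrib_left)
  also have "\<dots> \<le> M * (norm Z)\<^sup>2"
    by (intro mult_left_mono bessel onb_onset[OF onb_blks[OF n]] assms)
  finally show ?thesis .
qed

section \<open>Skinny decompositions and tangent spaces\<close>

text \<open>Diagonal matrices supported on \<open>K\<close>. With constant entry 1 this is a
  coordinate projection; it stands in for the identity, including the padded identity of a skinny
  decomposition.\<close>

definition dg :: "'a set \<Rightarrow> ('a \<Rightarrow> real) \<Rightarrow> 'a fmat" where
  "dg K f = mk K K (\<lambda>p q. if p = q then f p else 0)"

lemma ent_dg: "finite K \<Longrightarrow> ent (dg K f) p q = (if p = q \<and> p \<in> K then f p else 0)"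
  by (auto simp: dg_def ent_mk)
lemma adj_dg [simp]: "finite K \<Longrightarrow> adj (dg K f) = dg K f"
  by (rule fmat_eqI) (auto simp: ent_dg)
lemma ent_dg_mult: "finite K \<Longrightarrow> ent (dg K f * B) p q = (if p \<in> K then f p * ent B p q else 0)"
proof -
  assume K: "finite K"
  have "ent (dg K f * B) p q = (\<Sum>r\<in>K. ent (dg K f) p r * ent B r q)"
    by (rule ent_mult_supp) (use K in \<open>auto simp: ent_dg split: if_splits\<close>)
  also have "\<dots> = (\<Sum>r\<in>K. if r = p then f p * ent B p q else 0)" by (intro sum.cong) (auto simp: ent_dg K)
  finally show ?thesis using K by simp
qed
lemma ent_mult_dg: "finite K \<Longrightarrow> ent (B * dg K f) p q = (if q \<in> K then ent B p q * f q else 0)"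
  using ent_dg_mult[of K f "adj B" q p] by (metis adj_dg adj_mult adj_adj ent_adj mult.commute)
lemma dg_mult: "finite K \<Longrightarrow> dg K f * dg K g = dg K (\<lambda>p. f p * g p)"
  by (rule fmat_eqI) (auto simp: ent_dg_mult ent_dg)
lemma inner_dg: "finite K \<Longrightarrow> dg K f \<bullet> B = (\<Sum>p\<in>K. f p * ent B p p)"
proof -
  assume K: "finite K"
  have "dg K f \<bullet> B = (\<Sum>p\<in>K. \<Sum>q\<in>K. ent (dg K f) p q * ent B p q)"
    by (rule inner_supp) (use K in \<open>auto simp: ent_dg split: if_splits\<close>)
  also have "\<dots> = (\<Sum>p\<in>K. \<Sum>q\<in>K. if q = p then f p * ent B p p else 0)"
    by (intro sum.cong refl) (auto simp: ent_dg K)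
  finally show ?thesis using K by simp
qed
lemma norm2_dg: "finite K \<Longrightarrow> (norm (dg K f))\<^sup>2 = (\<Sum>p\<in>K. (f p)\<^sup>2)"
  unfolding norm2_inner by (simp add: inner_dg ent_dg power2_eq_square)
lemma proj_dg: "finite K \<Longrightarrow> proj (dg K (\<lambda>_. 1))"
  by (simp add: proj_def dg_mult)

lemma ent_sandwich: "finite K \<Longrightarrow> ent (A * dg K f * B) p q = (\<Sum>t\<in>K. f t * ent A p t * ent B t q)"
proof -
  assume K: "finite K"
  have "ent (A * dg K f * B) p q = (\<Sum>t\<in>K. ent (A * dg K f) p t * ent B t q)"
    by (rule ent_mult_supp) (use K in \<open>auto simp: ent_mult_dg split: if_splits\<close>)
  then show ?thesis using K by (simp add: ent_mult_dg mult_ac)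
qed

lemma opb_I: "0 \<le> c \<Longrightarrow> (\<And>B. (norm (A * B))\<^sup>2 \<le> c\<^sup>2 * (norm B)\<^sup>2) \<Longrightarrow> opb A c"
  unfolding opb_def by (auto intro!: power2_le_imp_le[of "norm (A * _)"] simp: power_mult_distrib)

lemma opb_dg:
  assumes K: "finite K" and c: "c \<ge> 0" "\<And>p. p \<in> K \<Longrightarrow> \<bar>f p\<bar> \<le> c"
  shows "opb (dg K f) c"
proof (rule opb_I[OF c(1)])
  fix B
  define L where "L = K \<union> ind B"
  have L: "finite L" "K \<subseteq> L" "ind B \<subseteq> L" using K by (auto simp: L_def)
  have "(norm (dg K f * B))\<^sup>2 = (\<Sum>p\<in>L. \<Sum>q\<in>L. (ent (dg K f * B) p q)\<^sup>2)"
    unfolding norm2_inner power2_eq_square[of "ent _ _ _"]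
    by (rule inner_supp[OF L(1,1)]) (use L K ent_outside[of _ B] in \<open>force simp: ent_dg_mult split: if_splits\<close>)
  also have "\<dots> \<le> (\<Sum>p\<in>L. \<Sum>q\<in>L. c\<^sup>2 * (ent B p q)\<^sup>2)"
  proof (intro sum_mono)
    fix p q
    have "(f p)\<^sup>2 \<le> c\<^sup>2" if "p \<in> K" using c(2)[OF that] c(1) by (simp add: abs_le_square_iff[symmetric])
    then show "(ent (dg K f * B) p q)\<^sup>2 \<le> c\<^sup>2 * (ent B p q)\<^sup>2"
      by (auto simp: ent_dg_mult K power_mult_distrib intro: mult_right_mono)
  qed
  also have "\<dots> = c\<^sup>2 * (norm B)\<^sup>2"
    using inner_fmat_eq[of L B B] L unfolding norm2_inner by (simp add: power2_eq_square sum_distrib_left)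
  finally show "(norm (dg K f * B))\<^sup>2 \<le> c\<^sup>2 * (norm B)\<^sup>2" .
qed

lemma opb_mult: "opb A a \<Longrightarrow> opb B b \<Longrightarrow> opb (A * B) (a * b)"
proof -
  assume A: "opb A a" and B: "opb B b"
  have "norm (A * B * C) \<le> a * b * norm C" for C
    using order_trans[OF opb_left[OF A, of "B * C"] mult_left_mono[OF opb_left[OF B, of C] opb_nonneg[OF A]]]
    by (simp add: mult.assoc)
  then show ?thesis using opb_nonneg[OF A] opb_nonneg[OF B] by (simp add: opb_def)
qed
lemma opb_adj: "opb A a \<Longrightarrow> opb (adj A) a"
  unfolding opb_def using opb_right[of A a "adj _"] by (metis adj_adj adj_mult norm_adj opb_def)

lemma adj_mult_self_eq_0: "adj w * w = 0 \<Longrightarrow> w = 0"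
proof (rule fmat_eqI)
  fix i j assume w: "adj w * w = 0"
  have "ent (adj w * w) j j = (\<Sum>k\<in>ind w. (ent w k j)\<^sup>2)"
    by (subst ent_mult[of "ind w"]) (auto simp: power2_eq_square)
  then have "(\<Sum>k\<in>ind w. (ent w k j)\<^sup>2) = 0" using w by simp
  then have "\<forall>k\<in>ind w. (ent w k j)\<^sup>2 = 0" by (subst (asm) sum_nonneg_eq_0_iff) auto
  then show "ent w i j = ent 0 i j" using ent_outside(1)[of i w j] by auto
qed

text \<open>\<open>u\<close> is isometric on the coordinates in \<open>K\<close> and vanishes on the
  others, because the defect \<open>u - u * dg K (\<lambda>_. 1)\<close> has Gram matrix 0. A subset
  \<open>L\<close> selects columns, and the squared norm of the projection onto their span counts
  them.\<close>

lemma partial_isometry: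
  assumes u: "adj u * u = dg K (\<lambda>_. 1)" and K: "finite K"
  shows "u * dg K (\<lambda>_. 1) = u" "dg K (\<lambda>_. 1) * adj u = adj u" "opb u 1" "opb (adj u) 1"
    "proj (u * adj u)" "(norm (u * adj u))\<^sup>2 = real (card K)"
    "\<And>L. L \<subseteq> K \<Longrightarrow> proj (u * dg L (\<lambda>_. 1) * adj u)"
    "\<And>L. L \<subseteq> K \<Longrightarrow> (norm (u * dg L (\<lambda>_. 1) * adj u))\<^sup>2 = real (card L)"
proof -
  let ?D = "dg K (\<lambda>_. 1)"
  have DD: "?D * ?D = ?D" "adj ?D = ?D" using proj_dg[OF K] by (auto simp: proj_def)
  have DD': "?D * (?D * A) = ?D * A" for A using DD by (simp flip: mult.assoc)
  have "adj (u - u * ?D) * (u - u * ?D) = adj u * u - adj u * u * ?D - ?D * (adj u * u) + ?D * (adj u * u) * ?D"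
    using K by (simp add: algebra_simps)
  also have "\<dots> = 0" unfolding u by (simp add: DD DD' mult.assoc)
  finally show 1: "u * ?D = u" using adj_mult_self_eq_0 by fastforce
  then show 2: "?D * adj u = adj u" using K by (metis adj_dg adj_mult)
  show 3: "opb u 1"
  proof (rule opb_I)
    fix B
    have "(norm (u * B))\<^sup>2 = B \<bullet> (adj u * u * B)" by (simp add: norm2_inner inner_mult_left mult.assoc)
    also have "\<dots> \<le> norm B * norm (?D * B)" unfolding u by (rule norm_cauchy_schwarz)
    also have "\<dots> \<le> norm B * norm B" by (intro mult_left_mono proj_norm_le proj_dg K) simp
    finally show "(norm (u * B))\<^sup>2 \<le> 1\<^sup>2 * (norm B)\<^sup>2" by (simp add: power2_eq_square)
  qed simp
  then show "opb (adj u) 1" by (rule opb_adj)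
  show pL: "proj (u * dg L (\<lambda>_. 1) * adj u)" if L: "L \<subseteq> K" for L
  proof -
    have fL: "finite L" using L K finite_subset by blast
    have "dg L (\<lambda>_. 1) * ?D * dg L (\<lambda>_. 1) = dg L (\<lambda>_. 1)"
      using L K fL by (intro fmat_eqI) (auto simp: ent_dg_mult ent_mult_dg ent_dg)
    then have "dg L (\<lambda>_. 1) * (?D * (dg L (\<lambda>_. 1) * A)) = dg L (\<lambda>_. 1) * A" for A by (simp flip: mult.assoc)
    then have "dg L (\<lambda>_. 1) * (adj u * (u * (dg L (\<lambda>_. 1) * A))) = dg L (\<lambda>_. 1) * A" for A
      using u by (simp flip: mult.assoc)
    then show ?thesis using fL by (simp add: proj_def mult.assoc)
  qed
  show nL: "(norm (u * dg L (\<lambda>_. 1) * adj u))\<^sup>2 = real (card L)" if L: "L \<subseteq> K" for L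
  proof -
    have fL: "finite L" using L K finite_subset by blast
    let ?E = "dg L (\<lambda>_. 1)" let ?P = "u * ?E * adj u"
    have uu: "adj u * (u * A) = ?D * A" for A using u by (simp flip: mult.assoc)
    have ED: "?D * (?E * A) = ?E * A" for A :: "'a fmat"
      using L K fL by (intro fmat_eqI) (auto simp: ent_dg_mult)
    have "?P \<bullet> ?P = (u * ?E) \<bullet> (?P * u)" by (simp add: inner_mult_right)
    also have "\<dots> = ?E \<bullet> (adj u * (?P * u))" by (rule inner_mult_left)
    also have "adj u * (?P * u) = ?E * ?D" using u by (simp add: mult.assoc uu ED)
    also have "?E \<bullet> (?E * ?D) = (\<Sum>p\<in>L. 1)" using L fL K by (simp add: inner_dg ent_dg_mult ent_dg subset_iff)
    finally show ?thesis by (simp add: norm2_inner)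
  qed
  show "proj (u * adj u)" using pL[of K] 1 by simp
  show "(norm (u * adj u))\<^sup>2 = real (card K)" using nL[of K] 1 by simp
qed

text \<open>For \<open>rs = rank_t Z\<close> these are the positions of the positive singular values
  in all slices, without the padding; their number is the total rank.\<close>

definition ridx :: "nat list \<Rightarrow> (nat \<times> nat) set" where "ridx rs = {(i, k). k < length rs \<and> i < rs ! k}"

lemma ridx_Sigma: "ridx rs = prod.swap ` (SIGMA k:{..<length rs}. {..<rs ! k})"
  by (auto simp: ridx_def image_iff)
lemma finite_ridx [simp]: "finite (ridx rs)" by (simp add: ridx_Sigma)
lemma card_ridx: "card (ridx rs) = sum_list rs"
proof -
  have "card (ridx rs) = (\<Sum>k<length rs. rs ! k)"
    unfolding ridx_Sigma by (subst card_image) auto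
  then show ?thesis by (simp add: sum_list_sum_nth atLeast0LessThan)
qed

lemma nth_le_Max: "k < length rs \<Longrightarrow> rs ! k \<le> Max (set rs)" for rs :: "nat list"
  by (intro Max_ge) auto

lemma iota_idct_diag:
  assumes n: "n3 > 0" and f: "\<And>k. k < n3 \<Longrightarrow> Ms ! k \<in> carrier_mat r r" "length Ms = n3"
    and e: "\<And>i j k. k < n3 \<Longrightarrow> i < r \<Longrightarrow> j < r \<Longrightarrow> Ms ! k $$ (i, j) = (if i = j \<and> (i, k) \<in> K then h (i, k) else 0)"
    and K: "K \<subseteq> {..<r} \<times> {..<n3}"
  shows "Ms \<in> tensors r r n3" "iota (idct Ms) = dg K h" "blk r r Ms = dg K h"
proof -
  show Ms: "Ms \<in> tensors r r n3" using f by (intro tensorsI) auto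
  have fK: "finite K" using K finite_subset by blast
  show *: "blk r r Ms = dg K h"
    by (rule fmat_pair_eqI) (use K in \<open>auto simp: ent_blk[OF Ms] e ent_dg[OF fK]\<close>)
  then show "iota (idct Ms) = dg K h"
    using iota_blk[OF idct_tensors[OF Ms n] n] dct_idct[OF Ms n] by simp
qed

lemma rank_t_length: "Z \<in> tensors n1 n2 n3 \<Longrightarrow> n3 > 0 \<Longrightarrow> length (rank_t Z) = n3"
  using tensorsD(1)[OF dct_tensors] by (simp add: rank_t_def)

lemma iota_tidentity:
  assumes "length rs = n3" "n3 > 0"
  shows "tidentity rs \<in> tensors (Max (set rs)) (Max (set rs)) n3" "iota (tidentity rs) = dg (ridx rs) (\<lambda>_. 1)"
proof -
  define Ms :: tensor where "Ms = map (\<lambda>s. mat (Max (set rs)) (Max (set rs)) (\<lambda>(i,j). if i = j \<and> i < s then 1 else 0)) rs"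
  have sub: "ridx rs \<subseteq> {..<Max (set rs)} \<times> {..<n3}"
    using nth_le_Max[of _ rs] assms by (auto simp: ridx_def intro: less_le_trans)
  have a: "\<And>k. k < n3 \<Longrightarrow> Ms ! k \<in> carrier_mat (Max (set rs)) (Max (set rs))" "length Ms = n3"
    using assms by (auto simp: Ms_def)
  have "Ms ! k $$ (i, j) = (if i = j \<and> (i, k) \<in> ridx rs then 1 else 0)" if "k < n3" "i < Max (set rs)" "j < Max (set rs)" for i j k
    using that assms by (auto simp: Ms_def ridx_def)
  note * = iota_idct_diag[where h = "\<lambda>_. 1", OF assms(2) a this sub]
  show "tidentity rs \<in> tensors (Max (set rs)) (Max (set rs)) n3" "iota (tidentity rs) = dg (ridx rs) (\<lambda>_. 1)"
    using *(2) idct_tensors[OF *(1) assms(2)] by (simp_all add: tidentity_def Ms_def)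
qed

lemma skinny_iota:
  assumes Z: "Z \<in> tensors n1 n2 n3" "n3 > 0" and sk: "is_skinny_tsvd Z U S V"
  defines "K \<equiv> ridx (rank_t Z)" and "u \<equiv> iota U" and "v \<equiv> iota V" and "s \<equiv> (\<lambda>(i, k). dct S ! k $$ (i, i))"
  shows "U \<in> tensors n1 (rank_ct Z) n3" "V \<in> tensors n2 (rank_ct Z) n3"
    "adj u * u = dg K (\<lambda>_. 1)" "adj v * v = dg K (\<lambda>_. 1)" "iota Z = u * dg K s * adj v" "\<And>p. p \<in> K \<Longrightarrow> 0 < s p"
proof -
  let ?r = "rank_ct Z" let ?rs = "rank_t Z"
  have d: "nrows Z = n1" "ncols Z = n2" "length Z = n3" using tensors_dims[OF Z] by auto
  have len: "length ?rs = n3" using rank_t_length[OF Z] .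
  have sk': "U \<in> tensors n1 ?r n3" "S \<in> tensors ?r ?r n3" "V \<in> tensors n2 ?r n3"
      "ttranspose U \<star> U = tidentity ?rs" "ttranspose V \<star> V = tidentity ?rs"
      "\<And>k. k < n3 \<Longrightarrow> nonincreasing_diag (dct S ! k)"
      "\<And>k i. k < n3 \<Longrightarrow> i < ?r \<Longrightarrow> 0 < dct S ! k $$ (i, i) \<longleftrightarrow> i < ?rs ! k" "Z = U \<star> S \<star> ttranspose V"
    using sk unfolding is_skinny_tsvd_def Let_def d by auto
  show "U \<in> tensors n1 ?r n3" "V \<in> tensors n2 ?r n3" by fact+
  note tt = ttranspose_tensors[OF _ Z(2)]
  have Kr: "K \<subseteq> {..<?r} \<times> {..<n3}"
    unfolding K_def rank_ct_def using nth_le_Max[of _ ?rs] len by (auto simp: ridx_def intro: less_le_trans)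
  show "adj u * u = dg K (\<lambda>_. 1)"
    using iota_tprod[OF tt[OF sk'(1)] sk'(1) Z(2)] iota_ttranspose[OF sk'(1) Z(2)] sk'(4) iota_tidentity[OF len Z(2)]
    by (simp add: u_def K_def)
  show "adj v * v = dg K (\<lambda>_. 1)"
    using iota_tprod[OF tt[OF sk'(3)] sk'(3) Z(2)] iota_ttranspose[OF sk'(3) Z(2)] sk'(5) iota_tidentity[OF len Z(2)]
    by (simp add: v_def K_def)
  have dS: "dct S ! k $$ (i, j) = (if i = j \<and> (i, k) \<in> K then s (i, k) else 0)" if "k < n3" "i < ?r" "j < ?r" for i j k
  proof -
    have "dct S ! k \<in> carrier_mat ?r ?r" using tensorsD(2)[OF dct_tensors[OF sk'(2) Z(2)] that(1)] .
    then have "dct S ! k $$ (i, j) = 0" if "i \<noteq> j" using sk'(6)[OF \<open>k < n3\<close>] that \<open>i < ?r\<close> \<open>j < ?r\<close>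
      by (auto simp: nonincreasing_diag_def diagonal_mat_def)
    moreover have "0 \<le> dct S ! k $$ (i, i)" using sk'(6)[OF that(1)] that \<open>dct S ! k \<in> carrier_mat ?r ?r\<close>
      by (auto simp: nonincreasing_diag_def)
    moreover have "(i, k) \<in> K \<longleftrightarrow> i < ?rs ! k" using that len by (auto simp: K_def ridx_def)
    ultimately show ?thesis using sk'(7)[OF that(1,2)] by (cases "i = j") (auto simp: s_def)
  qed
  have "blk ?r ?r (dct S) = dg K s"
    by (rule iota_idct_diag(3)[OF Z(2) _ _ dS Kr]) (use tensorsD[OF dct_tensors[OF sk'(2) Z(2)]] in auto)
  then have iS: "iota S = dg K s" using iota_blk[OF sk'(2) Z(2)] by simp
  have "iota Z = iota U * iota S * iota (ttranspose V)"
    by (subst sk'(8)) (simp add: iota_tprod[OF tprod_tensors[OF sk'(1,2) Z(2)] tt[OF sk'(3)] Z(2)] iota_tprod[OF sk'(1,2) Z(2)])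
  then show "iota Z = u * dg K s * adj v" by (simp add: u_def v_def iS iota_ttranspose[OF sk'(3) Z(2)])
  fix p assume "p \<in> K"
  then show "0 < s p" using sk'(7) Kr len by (auto simp: K_def ridx_def s_def)
qed

text \<open>The witness \<open>Y\<close> is the Moore-Penrose inverse, with inverted singular
  values. A lower bound \<open>c\<close> on these is an upper bound \<open>1 / c\<close> on its
  spectral norm.\<close>

lemma factor_facts:
  assumes u: "adj u * u = dg K (\<lambda>_. 1)" and v: "adj v * v = dg K (\<lambda>_. 1)" and Z: "Z = u * dg K s * adj v"
    and K: "finite K"
  shows "(u * adj u) * Z = Z" "Z * (v * adj v) = Z"
    "\<And>c. c > 0 \<Longrightarrow> (\<And>p. p \<in> K \<Longrightarrow> c \<le> s p) \<Longrightarrow> 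
       \<exists>Y. u * adj u = Z * Y \<and> v * adj v = Y * Z \<and> Z * Y * Z = Z \<and> opb Y (1 / c)"
proof -
  note U = partial_isometry[OF u K] and V = partial_isometry[OF v K]
  let ?D = "dg K (\<lambda>_. 1)"
  have uu: "adj u * (u * A) = ?D * A" for A using u by (simp flip: mult.assoc)
  have vv: "adj v * (v * A) = ?D * A" for A using v by (simp flip: mult.assoc)
  have uD: "u * (?D * A) = u * A" and vD: "v * (?D * A) = v * A" for A using U V by (simp_all flip: mult.assoc)
  have DD: "?D * (dg K f * A) = dg K f * A" "dg K f * (?D * A) = dg K f * A" for f A
    using K by (intro fmat_eqI; simp add: ent_dg_mult)+
  show 1: "(u * adj u) * Z = Z" unfolding Z by (simp add: mult.assoc uu uD)
  show 2: "Z * (v * adj v) = Z" unfolding Z by (simp add: mult.assoc vv DD)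
  fix c :: real assume c: "c > 0" "\<And>p. p \<in> K \<Longrightarrow> c \<le> s p"
  define Y where "Y = v * dg K (\<lambda>p. 1 / s p) * adj u"
  have s1: "dg K s * (dg K (\<lambda>p. 1 / s p) * A) = ?D * A" "dg K (\<lambda>p. 1 / s p) * (dg K s * A) = ?D * A" for A
    using c K by (intro fmat_eqI; force simp: ent_dg_mult)+
  have ZY: "u * adj u = Z * Y" unfolding Z Y_def by (simp add: mult.assoc vv DD s1 uD)
  have YZ: "v * adj v = Y * Z" unfolding Z Y_def by (simp add: mult.assoc uu DD s1 vD)
  have "opb (dg K (\<lambda>p. 1 / s p)) (1 / c)"
    by (rule opb_dg[OF K]) (use c in \<open>force simp: abs_if field_simps intro: order_trans\<close>)+
  then have "opb Y (1 * (1 / c) * 1)" unfolding Y_def by (intro opb_mult V(3) U(4))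
  then show "\<exists>Y. u * adj u = Z * Y \<and> v * adj v = Y * Z \<and> Z * Y * Z = Z \<and> opb Y (1 / c)"
    using ZY YZ 1 by (intro exI[of _ Y]) simp
qed

text \<open>\<open>tangent_proj\<close> selects its decomposition by Hilbert choice; the selected
  factors are exposed here once, in a form valid for all arguments \<open>A\<close>.\<close>

lemma iota_tangent_proj:
  assumes Z: "Z \<in> tensors n1 n2 n3" "n3 > 0" and ex: "\<exists>U S V. is_skinny_tsvd Z U S V"
  obtains U S V where "is_skinny_tsvd Z U S V"
    "\<And>A. A \<in> tensors n1 n2 n3 \<Longrightarrow> tangent_proj Z A \<in> tensors n1 n2 n3 \<and>
       iota (tangent_proj Z A) = tproj (iota U * adj (iota U)) (iota V * adj (iota V)) (iota A)"
proof -
  define T where "T = (SOME (U, S, V). is_skinny_tsvd Z U S V)"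
  obtain U S V where USV: "T = (U, S, V)" by (cases T)
  obtain U' S' V' where "is_skinny_tsvd Z U' S' V'" using ex by blast
  then have "case (U', S', V') of (U, S, V) \<Rightarrow> is_skinny_tsvd Z U S V" by simp
  then have "case T of (U, S, V) \<Rightarrow> is_skinny_tsvd Z U S V" unfolding T_def by (rule someI)
  then have sk: "is_skinny_tsvd Z U S V" by (simp add: USV)
  note f = skinny_iota[OF Z sk]
  show thesis
  proof (rule that[OF sk])
    fix A assume A: "A \<in> tensors n1 n2 n3"
    note n = Z(2)
    let ?Ut = "ttranspose U" let ?Vt = "ttranspose V"
    have Ut: "?Ut \<in> tensors (rank_ct Z) n1 n3" and Vt: "?Vt \<in> tensors (rank_ct Z) n2 n3" using f n by auto
    have 1: "U \<star> ?Ut \<in> tensors n1 n1 n3" using f(1) Ut n by auto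
    have 2: "U \<star> ?Ut \<star> A \<in> tensors n1 n2 n3" using 1 A n by auto
    have 3: "A \<star> V \<in> tensors n1 (rank_ct Z) n3" "A \<star> V \<star> ?Vt \<in> tensors n1 n2 n3" using A f(2) Vt n by auto
    have 4: "U \<star> ?Ut \<star> A \<star> V \<in> tensors n1 (rank_ct Z) n3" "U \<star> ?Ut \<star> A \<star> V \<star> ?Vt \<in> tensors n1 n2 n3" using 2 f(2) Vt n by auto
    have tp: "tangent_proj Z A = tsub (tadd (U \<star> ?Ut \<star> A) (A \<star> V \<star> ?Vt)) (U \<star> ?Ut \<star> A \<star> V \<star> ?Vt)"
      unfolding tangent_proj_def T_def[symmetric] USV by (simp add: Let_def)
    have "iota (tangent_proj Z A) = iota U * adj (iota U) * iota A + iota A * iota V * adj (iota V)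
        - iota U * adj (iota U) * iota A * iota V * adj (iota V)"
      unfolding tp iota_tsub[OF tadd_tensors[OF 2 3(2)] 4(2) n] iota_tadd[OF 2 3(2) n] iota_tprod[OF 1 A n] iota_tprod[OF f(1) Ut n]
        iota_tprod[OF 3(1) Vt n] iota_tprod[OF A f(2) n] iota_tprod[OF 4(1) Vt n] iota_tprod[OF 2 f(2) n]
        iota_ttranspose[OF f(1) n] iota_ttranspose[OF f(2) n] by simp
    then show "tangent_proj Z A \<in> tensors n1 n2 n3 \<and>
       iota (tangent_proj Z A) = tproj (iota U * adj (iota U)) (iota V * adj (iota V)) (iota A)"
      using 2 3 4 by (auto simp: tp tproj_def mult.assoc)
  qed
qed

text \<open>Full decompositions of the slices are assembled into one. The last claim writes
  truncated slices with the same factors, so a thresholded tensor and its source can be compared on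
  common singular vectors.\<close>

lemma slice_svds:
  assumes Z: "Ms \<in> tensors n1 n2 n3" and svd: "\<And>k. k < n3 \<Longrightarrow> is_svd (Ms ! k) (Us k) (Ss k) (Vs k)"
  defines "q \<equiv> min n1 n2" and "u \<equiv> blk n1 (min n1 n2) (map Us [0..<n3])" and "v \<equiv> blk n2 (min n1 n2) (map Vs [0..<n3])"
    and "s \<equiv> (\<lambda>(i, k). Ss k $$ (i, i))" and "K \<equiv> {..<min n1 n2} \<times> {..<n3}"
  assumes n: "n3 > 0"
  shows "adj u * u = dg K (\<lambda>_. 1)" "adj v * v = dg K (\<lambda>_. 1)" "blk n1 n2 Ms = u * dg K s * adj v"
    "\<And>i k j l. ent u (i, k) (j, l) \<noteq> 0 \<Longrightarrow> k = l"
    "\<And>Ns t. Ns \<in> tensors n1 n2 n3 \<Longrightarrow> (\<And>k. k < n3 \<Longrightarrow> Ns ! k = Us k * truncate_diag (t k) (Ss k) * transpose_mat (Vs k)) \<Longrightarrow>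
        blk n1 n2 Ns = u * dg K (\<lambda>p. if fst p < t (snd p) then s p else 0) * adj v"
proof -
  note D = is_svdD[OF svd tensorsD(2)[OF Z], folded q_def]
  have tU: "map Us [0..<n3] \<in> tensors n1 q n3" and tV: "map Vs [0..<n3] \<in> tensors n2 q n3" using D by (auto intro!: tensorsI)
  have qK: "K = {..<q} \<times> {..<n3}" by (simp add: K_def q_def)
  have iso: "adj (blk a q (map Us [0..<n3])) * blk a q (map Us [0..<n3]) = dg K (\<lambda>_. 1)"
    if "map Us [0..<n3] \<in> tensors a q n3" "\<And>k. k < n3 \<Longrightarrow> transpose_mat (Us k) * Us k = 1\<^sub>m q" for a Us
  proof -
    have l: "map2 (*) (map transpose_mat (map Us [0..<n3])) (map Us [0..<n3]) ! k = 1\<^sub>m q" if "k < n3" for k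
      using that \<open>\<And>k. k < n3 \<Longrightarrow> transpose_mat (Us k) * Us k = 1\<^sub>m q\<close> by simp
    have "blk q q (map2 (*) (map transpose_mat (map Us [0..<n3])) (map Us [0..<n3])) = dg K (\<lambda>_. 1)"
      by (rule iota_idct_diag(3)[OF n, where K = K]) (use l in \<open>auto simp: qK simp del: map_map\<close>)
    then show ?thesis
      using blk_mult[OF map_transpose_tensors[OF that(1)] that(1)] blk_transpose[OF that(1)] by simp
  qed
  show "adj u * u = dg K (\<lambda>_. 1)" unfolding u_def q_def[symmetric] by (rule iso[OF tU D(4)])
  show "adj v * v = dg K (\<lambda>_. 1)" unfolding v_def q_def[symmetric] by (rule iso[OF tV D(5)])
  show "k = l" if "ent u (i, k) (j, l) \<noteq> 0" for i k j l
    using that by (auto simp: u_def ent_blk[OF tU[unfolded q_def]] split: if_splits)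
  have gen: "blk n1 n2 Ns = u * dg K f * adj v"
    if Ns: "Ns \<in> tensors n1 n2 n3" "\<And>k. k < n3 \<Longrightarrow> Ns ! k = Us k * Ts k * transpose_mat (Vs k)"
      and T: "\<And>k. k < n3 \<Longrightarrow> Ts k \<in> carrier_mat q q" 
        "\<And>k i j. k < n3 \<Longrightarrow> i < q \<Longrightarrow> j < q \<Longrightarrow> Ts k $$ (i, j) = (if i = j then f (i, k) else 0)" for Ns Ts f
  proof -
    have b: "blk q q (map Ts [0..<n3]) = dg K f" and tT: "map Ts [0..<n3] \<in> tensors q q n3"
      by (rule iota_idct_diag[OF n, where K = K]; use T in \<open>auto simp: qK\<close>)+
    have UT: "map2 (*) (map Us [0..<n3]) (map Ts [0..<n3]) \<in> tensors n1 q n3" by (rule map2_mult_tensors[OF tU tT])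
    have tV': "map transpose_mat (map Vs [0..<n3]) \<in> tensors q n2 n3" by (rule map_transpose_tensors[OF tV])
    have "Ns = map2 (*) (map2 (*) (map Us [0..<n3]) (map Ts [0..<n3])) (map transpose_mat (map Vs [0..<n3]))"
      by (rule nth_equalityI) (use Ns tensorsD(1)[OF Ns(1)] in auto)
    then have "blk n1 n2 Ns = blk n1 q (map Us [0..<n3]) * blk q q (map Ts [0..<n3]) * adj (blk n2 q (map Vs [0..<n3]))"
      using blk_mult[OF UT tV'] blk_mult[OF tU tT] blk_transpose[OF tV] by simp
    then show ?thesis unfolding b by (simp only: u_def v_def q_def)
  qed
  show "blk n1 n2 Ms = u * dg K s * adj v"
    by (rule gen[OF Z D(9)]) (use D(2,6) in \<open>fastforce simp: s_def diagonal_mat_def\<close>)+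
  show "blk n1 n2 Ns = u * dg K (\<lambda>p. if fst p < t (snd p) then s p else 0) * adj v"
    if "Ns \<in> tensors n1 n2 n3" "\<And>k. k < n3 \<Longrightarrow> Ns ! k = Us k * truncate_diag (t k) (Ss k) * transpose_mat (Vs k)" for Ns t
    by (rule gen[OF that]) (use D(2) in \<open>fastforce simp: s_def truncate_diag_def\<close>)+
qed

text \<open>Cut the decomposition of each slice at its rank and pad with zeros up to the maximal
  rank. Zero columns turn the Gram matrices into padded identities, and the discarded singular
  values are 0.\<close>

lemma skinny_tsvd_exists:
  assumes Z: "Z \<in> tensors n1 n2 n3" and n: "n3 > 0"
  shows "\<exists>U S V. is_skinny_tsvd Z U S V"
proof -
  let ?rs = "rank_t Z" let ?r = "rank_ct Z"
  define q where "q = min n1 n2"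
  have d: "nrows Z = n1" "ncols Z = n2" "length Z = n3" using tensors_dims[OF Z n] by auto
  have dZ: "dct Z \<in> tensors n1 n2 n3" using Z n by auto
  have "\<forall>k. \<exists>U S V. is_svd (dct Z ! k) U S V" using is_svd_exists by blast
  then obtain Us Ss Vs where svd: "\<And>k. is_svd (dct Z ! k) (Us k) (Ss k) (Vs k)" by metis
  note D = is_svdD[OF svd tensorsD(2)[OF dZ], folded q_def]
  have len: "length ?rs = n3" using rank_t_length[OF Z n] .
  have rk: "?rs ! k = mat_rank (dct Z ! k)" if "k < n3" for k using that tensorsD(1)[OF dZ] by (simp add: rank_t_def)
  have pos: "?rs ! k \<le> q" "i < q \<Longrightarrow> 0 < Ss k $$ (i, i) \<longleftrightarrow> i < ?rs ! k" if "k < n3" for k i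
    using is_svd_pos_iff[OF svd tensorsD(2)[OF dZ that]] rk[OF that] by (auto simp: q_def)
  have rq: "?r \<le> q" unfolding rank_ct_def
    using n len pos(1) by (subst Max_le_iff) (auto simp: in_set_conv_nth)
  have rsr: "?rs ! k \<le> ?r" if "k < n3" for k unfolding rank_ct_def using nth_le_Max[of k ?rs] that len by simp
  define UU where "UU = map (\<lambda>k. mat n1 ?r (\<lambda>(a, i). if i < ?rs ! k then Us k $$ (a, i) else 0)) [0..<n3]"
  define VV where "VV = map (\<lambda>k. mat n2 ?r (\<lambda>(a, i). if i < ?rs ! k then Vs k $$ (a, i) else 0)) [0..<n3]"
  define SS where "SS = map (\<lambda>k. mat ?r ?r (\<lambda>(i, j). if i = j \<and> i < ?rs ! k then Ss k $$ (i, i) else 0)) [0..<n3]"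
  have t: "UU \<in> tensors n1 ?r n3" "VV \<in> tensors n2 ?r n3" "SS \<in> tensors ?r ?r n3"
    by (auto intro!: tensorsI simp: UU_def VV_def SS_def)
  have iso: "ttranspose (idct A) \<star> idct A = tidentity ?rs"
    if A: "A = map (\<lambda>k. mat a ?r (\<lambda>(x, i). if i < ?rs ! k then B k $$ (x, i) else 0)) [0..<n3]"
      and B: "\<And>k. k < n3 \<Longrightarrow> B k \<in> carrier_mat a q" "\<And>k. k < n3 \<Longrightarrow> transpose_mat (B k) * B k = 1\<^sub>m q" for A a B
  proof -
    have tA: "A \<in> tensors a ?r n3" unfolding A by (auto intro!: tensorsI)
    have iA: "idct A \<in> tensors a ?r n3" using tA n by auto
    have tt: "ttranspose (idct A) \<in> tensors ?r a n3" using iA n by auto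
    have "dct (ttranspose (idct A)) = map transpose_mat A"
      unfolding ttranspose_def dct_idct[OF tA n] by (rule dct_idct[OF map_transpose_tensors[OF tA] n])
    then have e: "ttranspose (idct A) \<star> idct A = idct (map2 (*) (map transpose_mat A) A)"
      unfolding tprod_def by (simp add: dct_idct[OF tA n])
    have "map2 (*) (map transpose_mat A) A = map (\<lambda>s. mat (Max (set ?rs)) (Max (set ?rs)) (\<lambda>(i,j). if i = j \<and> i < s then 1 else 0)) ?rs"
    proof (rule tensor_eqI)
      show "map2 (*) (map transpose_mat A) A \<in> tensors ?r ?r n3" by (rule map2_mult_tensors[OF map_transpose_tensors[OF tA] tA])
      show "map (\<lambda>s. mat (Max (set ?rs)) (Max (set ?rs)) (\<lambda>(i,j). if i = j \<and> i < s then 1 else 0)) ?rs \<in> tensors ?r ?r n3"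
        by (rule tensorsI) (use len in \<open>auto simp: rank_ct_def\<close>)
      fix i j k assume ijk: "i < ?r" "j < ?r" "k < n3"
      have Ak: "A ! k \<in> carrier_mat a ?r" by (rule tensorsD(2)[OF tA ijk(3)])
      have "map2 (*) (map transpose_mat A) A ! k $$ (i, j) = (transpose_mat (A ! k) * A ! k) $$ (i, j)"
        using ijk tensorsD(1)[OF tA] by simp
      also have "\<dots> = (\<Sum>x<a. A ! k $$ (x, i) * A ! k $$ (x, j))" by (rule transpose_mult_self_index[OF Ak ijk(1,2)])
      also have "\<dots> = (if i < ?rs ! k \<and> j < ?rs ! k then (\<Sum>x<a. B k $$ (x, i) * B k $$ (x, j)) else 0)"
        using ijk by (auto simp: A)
      also have "\<dots> = (if i = j \<and> i < ?rs ! k then 1 else 0)"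
        using transpose_mult_self_eq_1[OF B(1)[OF ijk(3)]] B(2)[OF ijk(3)] pos(1)[OF ijk(3)] by auto
      also have "\<dots> = map (\<lambda>s. mat (Max (set ?rs)) (Max (set ?rs)) (\<lambda>(i,j). if i = j \<and> i < s then 1 else 0)) ?rs ! k $$ (i, j)"
        using ijk len by (simp add: rank_ct_def)
      finally show "map2 (*) (map transpose_mat A) A ! k $$ (i, j) = map (\<lambda>s. mat (Max (set ?rs)) (Max (set ?rs)) (\<lambda>(i,j). if i = j \<and> i < s then 1 else 0)) ?rs ! k $$ (i, j)" .
    qed
    then show ?thesis unfolding e tidentity_def by simp
  qed
  have ZUSV: "Z = idct UU \<star> idct SS \<star> ttranspose (idct VV)"
  proof -
    have i: "idct UU \<in> tensors n1 ?r n3" "idct VV \<in> tensors n2 ?r n3" "idct SS \<in> tensors ?r ?r n3" using t n by auto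
    have dV: "dct (ttranspose (idct VV)) = map transpose_mat VV"
      unfolding ttranspose_def dct_idct[OF t(2) n] by (rule dct_idct[OF map_transpose_tensors[OF t(2)] n])
    have "idct UU \<star> idct SS \<star> ttranspose (idct VV) = idct (map2 (*) (map2 (*) UU SS) (map transpose_mat VV))"
      unfolding tprod_def[of "idct UU \<star> idct SS"] dct_tprod[OF i(1,3) n] dV dct_idct[OF t(1) n] dct_idct[OF t(3) n] ..
    also have "map2 (*) (map2 (*) UU SS) (map transpose_mat VV) = dct Z"
    proof (rule tensor_eqI[OF _ dZ])
      show "map2 (*) (map2 (*) UU SS) (map transpose_mat VV) \<in> tensors n1 n2 n3"
        by (rule map2_mult_tensors[OF map2_mult_tensors[OF t(1,3)] map_transpose_tensors[OF t(2)]])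
      fix a b k assume abk: "a < n1" "b < n2" "k < n3"
      have c: "UU ! k \<in> carrier_mat n1 ?r" "SS ! k \<in> carrier_mat ?r ?r" "VV ! k \<in> carrier_mat n2 ?r"
        using tensorsD(2)[OF t(1) abk(3)] tensorsD(2)[OF t(2) abk(3)] tensorsD(2)[OF t(3) abk(3)] by auto
      have dS: "diagonal_mat (SS ! k)" using abk by (auto simp: SS_def diagonal_mat_def)
      have "map2 (*) (map2 (*) UU SS) (map transpose_mat VV) ! k $$ (a, b) = (UU ! k * SS ! k * transpose_mat (VV ! k)) $$ (a, b)"
        using abk tensorsD(1)[OF t(1)] tensorsD(1)[OF t(2)] tensorsD(1)[OF t(3)] by simp
      also have "\<dots> = (\<Sum>i<?r. UU ! k $$ (a, i) * SS ! k $$ (i, i) * VV ! k $$ (b, i))"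
        by (rule index_diag_sandwich[OF c(1,2) dS c(3) abk(1,2)])
      also have "\<dots> = (\<Sum>i<?r. if i < ?rs ! k then Us k $$ (a, i) * Ss k $$ (i, i) * Vs k $$ (b, i) else 0)"
        using abk by (intro sum.cong refl) (simp add: UU_def SS_def VV_def)
      also have "\<dots> = (\<Sum>i<?rs ! k. Us k $$ (a, i) * Ss k $$ (i, i) * Vs k $$ (b, i))"
        using rsr[OF abk(3)] by (intro sum.mono_neutral_cong_right) auto
      also have "\<dots> = (\<Sum>i<q. Us k $$ (a, i) * Ss k $$ (i, i) * Vs k $$ (b, i))"
      proof (rule sum.mono_neutral_left)
        show "\<forall>i\<in>{..<q} - {..<?rs ! k}. Us k $$ (a, i) * Ss k $$ (i, i) * Vs k $$ (b, i) = 0"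
        proof
          fix i assume "i \<in> {..<q} - {..<?rs ! k}"
          then have "Ss k $$ (i, i) = 0" using pos(2)[OF abk(3), of i] D(7)[OF abk(3), of i] by auto
          then show "Us k $$ (a, i) * Ss k $$ (i, i) * Vs k $$ (b, i) = 0" by simp
        qed
      qed (use pos(1)[OF abk(3)] in auto)
      also have "\<dots> = dct Z ! k $$ (a, b)"
        by (subst D(9)[OF abk(3)]) (rule index_diag_sandwich[OF D(1,2,6,3)[OF abk(3)] abk(1,2), symmetric])
      finally show "map2 (*) (map2 (*) UU SS) (map transpose_mat VV) ! k $$ (a, b) = dct Z ! k $$ (a, b)" .
    qed
    finally show ?thesis using idct_dct[OF Z n] by simp
  qed
  have sd: "nonincreasing_diag (dct (idct SS) ! k) \<and> (\<forall>i<?r. 0 < dct (idct SS) ! k $$ (i, i) \<longleftrightarrow> i < ?rs ! k)"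
    if k: "k < n3" for k
    unfolding dct_idct[OF t(3) n] nonincreasing_diag_def
    using k D(7,8)[OF k] pos(2)[OF k] rq rsr[OF k] pos(1)[OF k] by (auto simp: SS_def diagonal_mat_def)
  have "is_skinny_tsvd Z (idct UU) (idct SS) (idct VV)"
    unfolding is_skinny_tsvd_def Let_def d
    using t n iso[OF UU_def D(1) D(4)] iso[OF VV_def D(3) D(5)] sd ZUSV by auto
  then show ?thesis by blast
qed

section \<open>Hard thresholding\<close>

lemma sum_ent_col_le: "finite R \<Longrightarrow> (\<Sum>t\<in>R. (ent A t p)\<^sup>2) \<le> (norm A)\<^sup>2"
  using bessel[OF onb_onset[OF onb_colsp[of R p]], of A] by (simp add: sum.reindex[OF inj_eu] inner_eu)

lemma norm_eu: "norm (eu i j) = 1"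
  by (simp add: norm_eq_sqrt_inner inner_eu ent_eu)

lemma opb_sum_ent_col_le:
  assumes "opb G 1" "finite R" shows "(\<Sum>t\<in>R. (ent G t p)\<^sup>2) \<le> 1"
proof -
  have "(\<Sum>t\<in>R. (ent G t p)\<^sup>2) \<le> (norm (G * eu p p))\<^sup>2"
    using sum_ent_col_le[OF assms(2), of "G * eu p p" p] by (simp add: ent_mult_eu)
  also have "\<dots> \<le> 1\<^sup>2" using opb_left[OF assms(1), of "eu p p"] by (intro power_mono) (auto simp: norm_eu)
  finally show ?thesis by simp
qed

lemma norm2_isometry_left:
  assumes "adj u * u = dg K (\<lambda>_. 1)" "dg K (\<lambda>_. 1) * B = B"
  shows "(norm (u * B))\<^sup>2 = (norm B)\<^sup>2"
  using assms by (simp add: norm2_inner inner_mult_left flip: mult.assoc)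
lemma norm2_isometry_right:
  assumes "adj v * v = dg K (\<lambda>_. 1)" "B * dg K (\<lambda>_. 1) = B"
  shows "(norm (B * adj v))\<^sup>2 = (norm B)\<^sup>2"
  using assms by (simp add: norm2_inner inner_mult_right mult.assoc)

text \<open>The rearrangement behind Ky Fan's inequality: weights at most 1 with total at most
  \<open>r\<close> are best spent on the first \<open>r\<close> values. Subtracting
  \<open>a r\<close> throughout makes the comparison termwise.\<close>

lemma sum_weighted_le_top:
  fixes a c :: "nat \<Rightarrow> real"
  assumes dec: "\<And>i j. i \<le> j \<Longrightarrow> j < q \<Longrightarrow> a j \<le> a i" and a0: "\<And>i. i < q \<Longrightarrow> 0 \<le> a i"
    and c: "\<And>i. i < q \<Longrightarrow> 0 \<le> c i \<and> c i \<le> 1" and sc: "(\<Sum>i<q. c i) \<le> real r"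
  shows "(\<Sum>i<q. a i * c i) \<le> (\<Sum>i<q. if i < r then a i else 0)"
proof (cases "q \<le> r")
  case True
  then show ?thesis using a0 c by (intro sum_mono) (auto simp: mult_left_le)
next
  case False
  have "(\<Sum>i<q. (a i - a r) * c i) \<le> (\<Sum>i<q. if i < r then a i - a r else 0)"
  proof (rule sum_mono)
    fix i assume i: "i \<in> {..<q}"
    show "(a i - a r) * c i \<le> (if i < r then a i - a r else 0)"
    proof (cases "i < r")
      case True
      then have "0 \<le> a i - a r" using dec[of i r] False by simp
      then show ?thesis using True c[of i] i by (simp add: mult_left_le)
    next
      case F: False
      then have "a i - a r \<le> 0" using dec[of r i] i by simp
      then show ?thesis using F c[of i] i by (simp add: mult_nonpos_nonneg)
    qed
  qed
  also have "\<dots> = (\<Sum>i<q. if i < r then a i else 0) - (\<Sum>i<q. if i < r then a r else 0)"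
    unfolding sum_subtractf[symmetric] by (intro sum.cong) auto
  also have "(\<Sum>i<q. if i < r then a r else 0) = (\<Sum>i<r. a r)"
    using False by (intro sum.mono_neutral_cong_right) auto
  finally have "(\<Sum>i<q. a i * c i) \<le> (\<Sum>i<q. if i < r then a i else 0) - real r * a r + a r * (\<Sum>i<q. c i)"
    by (simp add: left_diff_distrib sum_subtractf sum_distrib_left)
  also have "a r * (\<Sum>i<q. c i) \<le> a r * real r" using sc a0[of r] False by (intro mult_left_mono) auto
  finally show ?thesis by simp
qed

locale block_svd =
  fixes q n3 :: nat and W :: "(nat \<times> nat) fmat" and u' v' :: "(nat \<times> nat) fmat" and s :: "nat \<times> nat \<Rightarrow> real"
    and rs :: "nat list" and u v :: "(nat \<times> nat) fmat" and sX :: "nat \<times> nat \<Rightarrow> real" and X :: "(nat \<times> nat) fmat"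
  assumes u': "adj u' * u' = dg ({..<q} \<times> {..<n3}) (\<lambda>_. 1)" and v': "adj v' * v' = dg ({..<q} \<times> {..<n3}) (\<lambda>_. 1)"
    and W: "W = u' * dg ({..<q} \<times> {..<n3}) s * adj v'"
    and u'b: "\<And>i k j l. ent u' (i, k) (j, l) \<noteq> 0 \<Longrightarrow> k = l"
    and s0: "\<And>p. p \<in> {..<q} \<times> {..<n3} \<Longrightarrow> 0 \<le> s p"
    and sdec: "\<And>i j k. i \<le> j \<Longrightarrow> j < q \<Longrightarrow> k < n3 \<Longrightarrow> s (j, k) \<le> s (i, k)"
    and u: "adj u * u = dg (ridx rs) (\<lambda>_. 1)" and ub: "\<And>i k j l. ent u (i, k) (j, l) \<noteq> 0 \<Longrightarrow> k = l"
    and v: "adj v * v = dg (ridx rs) (\<lambda>_. 1)" and X: "X = u * dg (ridx rs) sX * adj v"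
    and len: "length rs = n3"
begin

definition "K = {..<q} \<times> {..<n3}"
definition "trunc = u' * dg K (\<lambda>p. if fst p < rs ! snd p then s p else 0) * adj v'"

lemma finK [simp]: "finite K" by (simp add: K_def)
lemmas U' = partial_isometry[OF u'[folded K_def] finK]
lemmas V' = partial_isometry[OF v'[folded K_def] finK]
lemmas UX = partial_isometry[OF u finite_ridx]

lemma dgK1 [simp]: "dg K (\<lambda>_. 1) * dg K f = dg K f" "dg K f * dg K (\<lambda>_. 1) = dg K f"
  by (simp_all add: dg_mult)

lemma norm2_sandwich: "(norm (u' * dg K f * adj v'))\<^sup>2 = (\<Sum>p\<in>K. (f p)\<^sup>2)"
  using norm2_isometry_right[OF v'[folded K_def], of "u' * dg K f"] norm2_isometry_left[OF u'[folded K_def], of "dg K f"]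
  by (simp add: mult.assoc norm2_dg)

text \<open>The Eckart--Young theorem, slice by slice.\<close>

lemma best_approx: "norm (W - trunc) \<le> norm (W - X)"
proof (rule power2_le_imp_le)
  define P where "P = u * adj u"
  have P: "proj P" "P * X = X" using UX(5) factor_facts(1)[OF u v X finite_ridx] by (simp_all add: P_def)
  \<comment> \<open>\<open>G\<close> compares the left singular vectors of \<open>W\<close> with the
    column space of \<open>X\<close>: \<open>c p\<close> below is the squared length of the
    projection of vector \<open>p\<close> onto it. The block structure keeps slices apart, so these
    lengths total at most the rank \<open>rs ! k\<close> in slice \<open>k\<close>.\<close>
  define G where "G = adj u * u'"
  have G: "opb G 1" "opb (adj G) 1"
    using opb_mult[OF UX(4) U'(3)] opb_mult[OF U'(4) UX(3)] by (simp_all add: G_def)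
  have Grow: "dg (ridx rs) (\<lambda>_. 1) * G = G" using UX(2) by (simp add: G_def flip: mult.assoc)
  have Gsupp: "t \<in> ridx rs" if "ent G t p \<noteq> 0" for t p
    using that ent_dg_mult[OF finite_ridx, of rs "\<lambda>_. 1" G t p] unfolding Grow by (auto split: if_splits)
  have Gblk: "l = k" if "ent G (j, l) (i, k) \<noteq> 0" for i j k l
  proof -
    have "ent G (j, l) (i, k) = (\<Sum>p\<in>ind u'. ent (adj u) (j, l) p * ent u' p (i, k))"
      unfolding G_def by (rule ent_mult) auto
    then have "(\<Sum>p\<in>ind u'. ent (adj u) (j, l) p * ent u' p (i, k)) \<noteq> 0" using that by simp
    then obtain p where "ent (adj u) (j, l) p * ent u' p (i, k) \<noteq> 0" by (rule sum.not_neutral_contains_not_neutral)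
    then have "ent u p (j, l) \<noteq> 0" "ent u' p (i, k) \<noteq> 0" by auto
    moreover obtain a b where "p = (a, b)" by (cases p)
    ultimately show ?thesis using ub[of a b j l] u'b[of a b i k] by simp
  qed
  define c where "c p = (\<Sum>t\<in>ridx rs. (ent G t p)\<^sup>2)" for p
  have c01: "0 \<le> c p \<and> c p \<le> 1" for p
    unfolding c_def using opb_sum_ent_col_le[OF G(1), of "ridx rs" p] by (auto intro: sum_nonneg)
  have csum: "(\<Sum>i<q. c (i, k)) \<le> real (rs ! k)" if k: "k < n3" for k
  proof -
    let ?T = "(\<lambda>j. (j, k)) ` {..<rs ! k}"
    have T: "?T \<subseteq> ridx rs" using k len by (auto simp: ridx_def)
    have z: "ent G t (i, k) = 0" if "t \<in> ridx rs - ?T" for t i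
    proof (rule ccontr)
      assume "ent G t (i, k) \<noteq> 0"
      then have "snd t = k" using Gblk[of "fst t" "snd t" i k] by simp
      then show False using that by (auto simp: ridx_def image_iff)
    qed
    have "(\<Sum>i<q. c (i, k)) = (\<Sum>i<q. \<Sum>t\<in>?T. (ent G t (i, k))\<^sup>2)"
      unfolding c_def using z T by (intro sum.cong refl sum.mono_neutral_right) auto
    also have "\<dots> = (\<Sum>t\<in>?T. \<Sum>i<q. (ent G t (i, k))\<^sup>2)" by (rule sum.swap)
    also have "\<dots> \<le> (\<Sum>t\<in>?T. 1)"
    proof (rule sum_mono)
      fix t
      have "(\<Sum>i<q. (ent G t (i, k))\<^sup>2) = (\<Sum>p\<in>(\<lambda>i. (i, k)) ` {..<q}. (ent (adj G) p t)\<^sup>2)"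
        by (subst sum.reindex) (auto simp: inj_on_def)
      also have "\<dots> \<le> 1" by (rule opb_sum_ent_col_le[OF G(2)]) simp
      finally show "(\<Sum>i<q. (ent G t (i, k))\<^sup>2) \<le> 1" .
    qed
    also have "\<dots> = real (rs ! k)" by (simp add: card_image inj_on_def)
    finally show ?thesis .
  qed
  have PW: "(norm (P * W))\<^sup>2 = (\<Sum>p\<in>K. (s p)\<^sup>2 * c p)"
  proof -
    have "P * W = u * (G * dg K s * adj v')" by (simp add: P_def G_def W K_def mult.assoc)
    moreover have "dg (ridx rs) (\<lambda>_. 1) * (G * dg K s * adj v') = G * dg K s * adj v'" using Grow by (simp flip: mult.assoc)
    ultimately have "(norm (P * W))\<^sup>2 = (norm (G * dg K s * adj v'))\<^sup>2" using norm2_isometry_left[OF u] by simp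
    also have "\<dots> = (norm (G * dg K s))\<^sup>2" by (rule norm2_isometry_right[OF v'[folded K_def]]) (simp add: mult.assoc)
    also have "\<dots> = (\<Sum>t\<in>ridx rs. \<Sum>p\<in>K. (ent G t p * s p)\<^sup>2)"
    proof -
      have "(G * dg K s) \<bullet> (G * dg K s) = (\<Sum>t\<in>ridx rs. \<Sum>p\<in>K. ent (G * dg K s) t p * ent (G * dg K s) t p)"
        by (rule inner_supp) (use Gsupp in \<open>auto simp: ent_mult_dg split: if_splits\<close>)
      then show ?thesis unfolding norm2_inner by (simp add: ent_mult_dg power2_eq_square)
    qed
    also have "\<dots> = (\<Sum>p\<in>K. (s p)\<^sup>2 * c p)"
      by (subst sum.swap) (simp add: c_def sum_distrib_left power_mult_distrib mult.commute)
    finally show ?thesis .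
  qed
  have top: "(\<Sum>p\<in>K. (s p)\<^sup>2 * c p) \<le> (\<Sum>p\<in>K. if fst p < rs ! snd p then (s p)\<^sup>2 else 0)"
  proof -
    have sw: "(\<Sum>p\<in>K. f p) = (\<Sum>k<n3. \<Sum>i<q. f (i, k))" for f :: "nat \<times> nat \<Rightarrow> real"
      unfolding K_def sum.cartesian_product' by (rule sum.swap)
    have s2: "(s (j, k))\<^sup>2 \<le> (s (i, k))\<^sup>2" if "i \<le> j" "j < q" "k < n3" for i j k
      using sdec[OF that] s0[of "(j, k)"] that by (intro power_mono) auto
    show ?thesis unfolding sw
    proof (rule sum_mono)
      fix k assume "k \<in> {..<n3}"
      then have k: "k < n3" by simp
      show "(\<Sum>i<q. (s (i, k))\<^sup>2 * c (i, k)) \<le> (\<Sum>i<q. if fst (i, k) < rs ! snd (i, k) then (s (i, k))\<^sup>2 else 0)"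
        using sum_weighted_le_top[of q "\<lambda>i. (s (i, k))\<^sup>2" "\<lambda>i. c (i, k)" "rs ! k"] s2 c01 csum[OF k] k by simp
    qed
  qed
  have "W - trunc = u' * dg K (\<lambda>p. if fst p < rs ! snd p then 0 else s p) * adj v'"
  proof -
    have "dg K s - dg K (\<lambda>p. if fst p < rs ! snd p then s p else 0) = dg K (\<lambda>p. if fst p < rs ! snd p then 0 else s p)"
      by (rule fmat_eqI) (auto simp: ent_dg)
    then show ?thesis unfolding W trunc_def K_def[symmetric] by (simp add: left_diff_distrib[symmetric] right_diff_distrib[symmetric])
  qed
  then have "(norm (W - trunc))\<^sup>2 = (\<Sum>p\<in>K. if fst p < rs ! snd p then 0 else (s p)\<^sup>2)"
    by (simp add: norm2_sandwich if_distrib[of "\<lambda>x. x\<^sup>2"] cong: if_cong)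
  also have "\<dots> = (\<Sum>p\<in>K. (s p)\<^sup>2) - (\<Sum>p\<in>K. if fst p < rs ! snd p then (s p)\<^sup>2 else 0)"
    unfolding sum_subtractf[symmetric] by (intro sum.cong) auto
  \<comment> \<open>The truncation keeps at least as much of \<open>W\<close> as the projection onto
    the column space of \<open>X\<close>, and the complement of that projection annihilates
    \<open>X\<close>.\<close>
  also have "\<dots> \<le> (norm W)\<^sup>2 - (norm (P * W))\<^sup>2"
    using top PW norm2_sandwich[of s] by (simp add: W K_def)
  also have "\<dots> = (norm (W - P * W))\<^sup>2" using proj_pythagoras[OF P(1), of W] by simp
  also have "W - P * W = (W - X) - P * (W - X)" using P(2) by (simp add: algebra_simps)
  also have "(norm \<dots>)\<^sup>2 \<le> (norm (W - X))\<^sup>2" using proj_norm_le(2)[OF P(1)] by (simp add: power_mono)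
  finally show "(norm (W - trunc))\<^sup>2 \<le> (norm (W - X))\<^sup>2" .
qed simp

text \<open>With too few positive singular values in slice \<open>k\<close> of \<open>W\<close>, the
  range of \<open>X\<close> there would have a projection \<open>R\<close> leaving a defect
  \<open>R - Q * R\<close> of norm at least 1. But this defect is the complement of \<open>Q\<close>
  applied to \<open>(X - W) * (Yp * R)\<close>. Smallness is assumed for this product, so that a
  Frobenius bound and a spectral bound on \<open>X - W\<close> can both supply it.\<close>

lemma rank_gap:
  assumes Yp: "u * adj u = X * Yp" and small: "\<And>R. proj R \<Longrightarrow> (norm R)\<^sup>2 \<le> real (sum_list rs) \<Longrightarrow> norm ((X - W) * (Yp * R)) < 1"
    and k: "k < n3" and i0: "i0 < rs ! k"
  shows "i0 < q \<and> 0 < s (i0, k)"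
proof (rule ccontr)
  assume neg: "\<not> (i0 < q \<and> 0 < s (i0, k))"
  define Kp where "Kp = {p \<in> K. 0 < s p}"
  define L where "L = {p \<in> Kp. snd p = k}"
  have sub: "Kp \<subseteq> K" "L \<subseteq> K" "L \<subseteq> Kp" by (auto simp: Kp_def L_def)
  have fin: "finite Kp" "finite L" using sub finK finite_subset by blast+
  have "L \<subseteq> (\<lambda>i. (i, k)) ` {..<i0}"
  proof
    fix p assume "p \<in> L"
    then obtain i where i: "p = (i, k)" "i < q" "0 < s (i, k)" by (cases p) (auto simp: L_def Kp_def K_def)
    have "i < i0"
    proof (rule ccontr)
      assume "\<not> i < i0"
      then have "s (i, k) \<le> s (i0, k)" "i0 < q" using sdec[of i0 i k] i k by auto
      then show False using neg i by simp
    qed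
    then show "p \<in> (\<lambda>i. (i, k)) ` {..<i0}" using i by auto
  qed
  then have "card L \<le> card ((\<lambda>i. (i, k)) ` {..<i0})" by (intro card_mono) auto
  also have "\<dots> \<le> i0" using card_image_le[of "{..<i0}" "\<lambda>i. (i, k)"] by simp
  finally have cL: "card L \<le> i0" .
  \<comment> \<open>\<open>Q\<close> projects onto the range of \<open>W\<close> and
    \<open>QL\<close> onto its part in slice \<open>k\<close>. Since \<open>R\<close> lives in slice
    \<open>k\<close>, it pairs with both alike.\<close>
  define Q where "Q = u' * dg Kp (\<lambda>_. 1) * adj u'"
  define QL where "QL = u' * dg L (\<lambda>_. 1) * adj u'"
  have Q: "proj Q" "proj QL" "(norm QL)\<^sup>2 = real (card L)" unfolding Q_def QL_def by (rule U'; use sub in blast)+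
  have QW: "Q * W = W"
  proof -
    have "dg Kp (\<lambda>_. 1) * (adj u' * u') * dg K s = dg K s"
    proof (rule fmat_eqI)
      fix p r
      have "\<not> 0 < s p \<Longrightarrow> p \<in> K \<Longrightarrow> s p = 0" using s0[of p] by (auto simp: K_def)
      then show "ent (dg Kp (\<lambda>_. 1) * (adj u' * u') * dg K s) p r = ent (dg K s) p r"
        unfolding u'[folded K_def] mult.assoc dgK1 by (auto simp: ent_dg_mult fin ent_dg Kp_def)
    qed
    then have "dg Kp (\<lambda>_. 1) * (adj u' * (u' * (dg K s * A))) = dg K s * A" for A by (simp flip: mult.assoc)
    then show ?thesis by (simp add: Q_def W K_def mult.assoc)
  qed
  define Rk where "Rk = (\<lambda>i. (i, k)) ` {..<rs ! k}"
  have Rk: "Rk \<subseteq> ridx rs" "card Rk = rs ! k" using k len by (auto simp: Rk_def ridx_def card_image inj_on_def)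
  have fR: "finite Rk" by (simp add: Rk_def)
  define R where "R = u * dg Rk (\<lambda>_. 1) * adj u"
  have R: "proj R" "(norm R)\<^sup>2 = real (rs ! k)" unfolding R_def using UX(7)[OF Rk(1)] UX(8)[OF Rk(1)] Rk(2) by auto
  have PR: "X * Yp * R = R"
  proof -
    have "dg (ridx rs) (\<lambda>_. 1) * (dg Rk (\<lambda>_. 1) * A) = dg Rk (\<lambda>_. 1) * A" for A :: "(nat \<times> nat) fmat"
      using Rk(1) fR by (intro fmat_eqI) (auto simp: ent_dg_mult)
    then have "adj u * (u * (dg Rk (\<lambda>_. 1) * A)) = dg Rk (\<lambda>_. 1) * A" for A using u by (simp flip: mult.assoc)
    then show ?thesis unfolding Yp[symmetric] by (simp add: R_def mult.assoc)
  qed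
  have rsk: "rs ! k \<le> sum_list rs" using k len by (simp add: elem_le_sum_list)
  have "R - Q * R = (X - W) * (Yp * R) - Q * ((X - W) * (Yp * R))"
  proof -
    have "(X - W) * (Yp * R) - Q * ((X - W) * (Yp * R)) = X * Yp * R - Q * (X * Yp * R) - (W - Q * W) * (Yp * R)"
      by (simp add: algebra_simps)
    then show ?thesis using PR QW by simp
  qed
  then have "norm (R - Q * R) \<le> norm ((X - W) * (Yp * R))" using proj_norm_le(2)[OF Q(1)] by simp
  also have "\<dots> < 1" by (rule small[OF R(1)]) (use R(2) rsk in simp)
  finally have "norm (R - Q * R) < 1" .
  then have lt: "(norm (R - Q * R))\<^sup>2 < 1" by (simp add: power_less_one_iff abs_square_less_1)
  have "R \<bullet> (Q - QL) = 0"
  proof -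
    have 1: "l = k" if "ent R (a, l) p \<noteq> 0" for a l p
    proof -
      have "ent R (a, l) p = (\<Sum>t\<in>Rk. 1 * ent u (a, l) t * ent (adj u) t p)" unfolding R_def by (rule ent_sandwich[OF fR])
      then have "(\<Sum>t\<in>Rk. 1 * ent u (a, l) t * ent (adj u) t p) \<noteq> 0" using that by simp
      then obtain t where "t \<in> Rk" "1 * ent u (a, l) t * ent (adj u) t p \<noteq> 0" by (rule sum.not_neutral_contains_not_neutral)
      then have "t \<in> Rk" "ent u (a, l) t \<noteq> 0" by auto
      then show ?thesis using ub by (auto simp: Rk_def)
    qed
    have 2: "ent (Q - QL) (a, k) p = 0" for a p
    proof -
      have "ent (Q - QL) (a, k) p = (\<Sum>t\<in>Kp. 1 * ent u' (a, k) t * ent (adj u') t p) - (\<Sum>t\<in>L. 1 * ent u' (a, k) t * ent (adj u') t p)"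
        unfolding Q_def QL_def by (simp only: ent_diff ent_sandwich fin)
      also have "(\<Sum>t\<in>Kp. 1 * ent u' (a, k) t * ent (adj u') t p) = (\<Sum>t\<in>L. 1 * ent u' (a, k) t * ent (adj u') t p)"
      proof (rule sum.mono_neutral_right[OF fin(1) sub(3)], rule ballI)
        fix t assume t: "t \<in> Kp - L"
        have "ent u' (a, k) t = 0"
        proof (rule ccontr)
          assume "ent u' (a, k) t \<noteq> 0"
          then have "snd t = k" using u'b[of a k "fst t" "snd t"] by simp
          then show False using t by (simp add: L_def)
        qed
        then show "1 * ent u' (a, k) t * ent (adj u') t p = 0" by simp
      qed
      finally show ?thesis by simp
    qed
    have "ent R p r * ent (Q - QL) p r = 0" for p r
      using 1[of "fst p" "snd p" r] 2[of "fst p" r] by (cases "ent R p r = 0") auto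
    then show ?thesis by (simp add: inner_fmat_def del: ent_diff)
  qed
  then have "R \<bullet> Q \<le> real (card L)" using proj_inner_le[OF R(1) Q(2)] Q(3) by (simp add: inner_diff_right)
  \<comment> \<open>The defect equals a difference of ranks here, and these are integers with
    \<open>card L \<le> i0 < rs ! k\<close>.\<close>
  then have "real (rs ! k) - real (card L) < 1" using lt proj_compl_mult[OF R(1) Q(1)] R(2) by simp
  then show False using cL i0 by linarith
qed

end

lemma truncated_svd_carrier:
  assumes svd: "is_svd A U S V" and A: "A \<in> carrier_mat n1 n2"
  shows "U * truncate_diag t S * transpose_mat V \<in> carrier_mat n1 n2"
  using is_svdD[OF svd A] by (auto simp: truncate_diag_def)

lemma is_svd_truncate:
  assumes svd: "is_svd A U S V" and A: "A \<in> carrier_mat n1 n2"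
  shows "is_svd (U * truncate_diag t S * transpose_mat V) U (truncate_diag t S) V"
proof -
  note D = is_svdD[OF svd A]
  have "nonincreasing_diag (truncate_diag t S)"
    unfolding nonincreasing_diag_def diagonal_mat_def truncate_diag_def using D(2,6,7,8) by auto
  then show ?thesis using truncated_svd_carrier[OF svd A, of t] D unfolding is_svd_def Let_def by (auto simp: truncate_diag_def)
qed

text \<open>What the iteration uses of thresholding, for any resolution of ties: best approximation,
  and the exact rank as soon as the perturbation is small against a generalised inverse of
  \<open>X\<close>.\<close>

lemma hard_threshold_facts:
  assumes W: "W \<in> tensors n1 n2 n3" and n: "n3 > 0" and X: "X \<in> tensors n1 n2 n3"
    and sk: "is_skinny_tsvd X U S V" and rs: "rs = rank_t X" and ht: "is_hard_threshold rs W Y"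
  shows "Y \<in> tensors n1 n2 n3" "norm (iota W - iota Y) \<le> norm (iota W - iota X)"
    "\<And>Yp. iota U * adj (iota U) = iota X * Yp \<Longrightarrow> 
      (\<And>R. proj R \<Longrightarrow> (norm R)\<^sup>2 \<le> real (sum_list rs) \<Longrightarrow> norm ((iota X - iota W) * (Yp * R)) < 1) \<Longrightarrow> rank_t Y = rs"
proof -
  have dW: "dct W \<in> tensors n1 n2 n3" using W n by auto
  obtain B where B: "length B = n3" "\<And>k. k < n3 \<Longrightarrow> is_truncated_svd (rs ! k) (dct W ! k) (B ! k)" "Y = idct B"
    using ht tensorsD(1)[OF W] by (auto simp: is_hard_threshold_def)
  have "\<forall>k. \<exists>U S V. k < n3 \<longrightarrow> is_svd (dct W ! k) U S V \<and> B ! k = U * truncate_diag (rs ! k) S * transpose_mat V"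
    using B(2) unfolding is_truncated_svd_def by blast
  then obtain Us Ss Vs where svd: "\<And>k. k < n3 \<Longrightarrow> is_svd (dct W ! k) (Us k) (Ss k) (Vs k)"
    and Bk: "\<And>k. k < n3 \<Longrightarrow> B ! k = Us k * truncate_diag (rs ! k) (Ss k) * transpose_mat (Vs k)" by metis
  have tB: "B \<in> tensors n1 n2 n3"
    using B(1) Bk truncated_svd_carrier[OF svd tensorsD(2)[OF dW]] by (intro tensorsI) auto
  show Y: "Y \<in> tensors n1 n2 n3" using tB n by (auto simp: B(3))
  have iY: "iota Y = blk n1 n2 B" using iota_blk[OF Y n] dct_idct[OF tB n] by (simp add: B(3))
  have iW: "iota W = blk n1 n2 (dct W)" by (rule iota_blk[OF W n])
  define q where "q = min n1 n2"
  define u' where "u' = blk n1 q (map Us [0..<n3])"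
  define v' where "v' = blk n2 q (map Vs [0..<n3])"
  define s where "s = (\<lambda>(i, k). Ss k $$ (i, i))"
  note ss = slice_svds[OF dW svd n, folded q_def, folded u'_def v'_def s_def]
  note D = is_svdD[OF svd tensorsD(2)[OF dW], folded q_def]
  note skf = skinny_iota[OF X n sk]
  have len: "length rs = n3" using rank_t_length[OF X n] by (simp add: rs)
  interpret block_svd q n3 "iota W" u' v' s rs "iota U" "iota V" "\<lambda>(i, k). dct S ! k $$ (i, i)" "iota X"
  proof
    show "\<And>i k j l. ent (iota U) (i, k) (j, l) \<noteq> 0 \<Longrightarrow> k = l" using ent_iota[OF skf(1) n] by (auto split: if_splits)
    show "\<And>p. p \<in> {..<q} \<times> {..<n3} \<Longrightarrow> 0 \<le> s p" using D(7) by (auto simp: s_def)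
    show "\<And>i j k. i \<le> j \<Longrightarrow> j < q \<Longrightarrow> k < n3 \<Longrightarrow> s (j, k) \<le> s (i, k)" using D(8) by (auto simp: s_def)
    show "iota W = u' * dg ({..<q} \<times> {..<n3}) s * adj v'" unfolding iW by (rule ss(3))
  qed (use ss skf len in \<open>auto simp: rs\<close>)
  have YY: "iota Y = trunc" unfolding iY trunc_def K_def by (rule ss(5)[where t = "\<lambda>k. rs ! k", OF _ tB]) (use Bk in auto)
  show "norm (iota W - iota Y) \<le> norm (iota W - iota X)" unfolding YY by (rule best_approx)
  fix Yp assume Yp: "iota U * adj (iota U) = iota X * Yp"
    and small: "\<And>R. proj R \<Longrightarrow> (norm R)\<^sup>2 \<le> real (sum_list rs) \<Longrightarrow> norm ((iota X - iota W) * (Yp * R)) < 1"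
  have "mat_rank (B ! k) = rs ! k" if k: "k < n3" for k
  proof (rule is_svd_mat_rank)
    show "is_svd (B ! k) (Us k) (truncate_diag (rs ! k) (Ss k)) (Vs k)"
      unfolding Bk[OF k] by (rule is_svd_truncate[OF svd[OF k] tensorsD(2)[OF dW k]])
    show "B ! k \<in> carrier_mat n1 n2" by (rule tensorsD(2)[OF tB k])
    have gap: "i < q \<and> 0 < s (i, k)" if "i < rs ! k" for i by (rule rank_gap[OF Yp small k that])
    show "rs ! k \<le> min n1 n2" unfolding q_def[symmetric] using gap by (metis leI less_irrefl)
    show "0 < truncate_diag (rs ! k) (Ss k) $$ (i, i) \<longleftrightarrow> i < rs ! k" if "i < min n1 n2" for i
      using that gap[of i] D(2)[OF k k] by (auto simp: truncate_diag_def s_def q_def)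
  qed
  moreover have "dct Y = B" using dct_idct[OF tB n] by (simp add: B(3))
  ultimately show "rank_t Y = rs" using B(1) len by (intro nth_equalityI) (auto simp: rank_t_def)
qed

lemma hard_threshold_exists: "\<exists>Y. is_hard_threshold rs W Y"
proof -
  have "\<forall>k. \<exists>B. is_truncated_svd (rs ! k) (dct W ! k) B"
    unfolding is_truncated_svd_def using is_svd_exists by blast
  then obtain F where F: "\<And>k. is_truncated_svd (rs ! k) (dct W ! k) (F k)" by metis
  show ?thesis unfolding is_hard_threshold_def
    by (rule exI[of _ "idct (map F [0..<length W])"], rule exI[of _ "map F [0..<length W]"]) (use F in auto)
qed

text \<open>Turns a spectral bound on the perturbation into a Frobenius bound: best approximation gives
  \<open>|D|^2 \<le> 2 <W - X, D>\<close> for \<open>D = Y - X\<close>, and \<open>D\<close> is covered by two projections of small trace.\<close>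

lemma low_rank_error:
  fixes X Y W :: "'a fmat"
  assumes best: "norm (W - Y) \<le> norm (W - X)" and t: "opb (W - X) t"
    and P: "proj P" "P * X = X" "norm P \<le> \<rho>" and Q: "proj Q" "Y * Q = Y" "norm Q \<le> \<rho>"
  shows "norm (Y - X) \<le> 4 * t * \<rho>"
proof -
  define A D where "A = W - X" and "D = Y - X"
  have t0: "t \<ge> 0" using t opb_nonneg by blast
  have "(norm (A - D))\<^sup>2 \<le> (norm A)\<^sup>2" using best by (simp add: A_def D_def power_mono)
  then have dd: "D \<bullet> D \<le> 2 * (A \<bullet> D)" by (simp add: norm2_inner inner_diff_left inner_diff_right inner_commute)
  \<comment> \<open>The complement of \<open>P\<close> removes \<open>X\<close> from
    \<open>D\<close> and leaves the same complement applied to \<open>Y\<close>, which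
    \<open>Q\<close> fixes from the right.\<close>
  have e: "D - P * D = (D - P * D) * Q" using P Q by (simp add: D_def algebra_simps)
  have "A \<bullet> (P * D) = (P * A) \<bullet> D" using P(1) by (simp add: inner_mult_left proj_def)
  also have "\<dots> \<le> norm (P * A) * norm D" by (rule norm_cauchy_schwarz)
  also have "\<dots> \<le> (t * norm P) * norm D" using opb_right[OF t, of P] by (simp add: A_def mult_right_mono)
  also have "\<dots> \<le> (t * \<rho>) * norm D" using P(3) t0 by (intro mult_right_mono mult_left_mono) auto
  finally have 1: "A \<bullet> (P * D) \<le> t * \<rho> * norm D" .
  have "A \<bullet> (D - P * D) = (A * Q) \<bullet> (D - P * D)"
    using Q(1) e inner_mult_right[of "D - P * D" Q A] by (simp add: proj_def inner_commute)
  also have "\<dots> \<le> norm (A * Q) * norm (D - P * D)" by (rule norm_cauchy_schwarz)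
  also have "\<dots> \<le> (t * \<rho>) * norm D"
  proof (rule mult_mono)
    show "norm (A * Q) \<le> t * \<rho>" using opb_left[OF t, of Q] mult_left_mono[OF Q(3) t0] by (simp add: A_def)
    show "norm (D - P * D) \<le> norm D" by (rule proj_norm_le(2)[OF P(1)])
    show "0 \<le> t * \<rho>" using t0 norm_ge_zero[of P] P(3) by (intro mult_nonneg_nonneg) linarith+
  qed simp
  finally have 2: "A \<bullet> (D - P * D) \<le> t * \<rho> * norm D" .
  have "A \<bullet> D = A \<bullet> (P * D) + A \<bullet> (D - P * D)" by (simp add: inner_diff_right)
  then have "D \<bullet> D \<le> norm D * (4 * t * \<rho>)" using dd 1 2 by (simp add: algebra_simps)
  then have "D \<bullet> D \<le> norm D * (4 * t * \<rho> * 1)" by simp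
  then have "norm D * norm D \<le> norm D * (4 * t * \<rho>)" by (metis norm2_inner power2_eq_square mult.right_neutral)
  then have "norm D \<le> 4 * t * \<rho> \<or> norm D = 0" by (metis mult_le_cancel_left_pos norm_ge_zero order_le_less)
  moreover have "0 \<le> 4 * t * \<rho>" using t0 norm_ge_zero[of P] P(3) by (intro mult_nonneg_nonneg) linarith+
  ultimately show ?thesis by (auto simp: D_def)
qed

section \<open>The sampled quadratic form\<close>

lemma diag_block_mat_uniform:
  assumes "set Ms \<subseteq> carrier_mat n1 n2"
  shows "diag_block_mat Ms \<in> carrier_mat (length Ms * n1) (length Ms * n2) \<and>
    (\<forall>k<length Ms. \<forall>l<length Ms. \<forall>i<n1. \<forall>j<n2. 
       diag_block_mat Ms $$ (k * n1 + i, l * n2 + j) = (if k = l then Ms ! k $$ (i, j) else (0::real)))"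
  using assms
proof (induction Ms)
  case (Cons A As)
  let ?B = "diag_block_mat As"
  have A: "A \<in> carrier_mat n1 n2" and B: "?B \<in> carrier_mat (length As * n1) (length As * n2)"
    and IH: "\<And>k l i j. k < length As \<Longrightarrow> l < length As \<Longrightarrow> i < n1 \<Longrightarrow> j < n2 \<Longrightarrow>
       ?B $$ (k * n1 + i, l * n2 + j) = (if k = l then As ! k $$ (i, j) else 0)"
    using Cons by auto
  have e: "diag_block_mat (A # As) = four_block_mat A (0\<^sub>m n1 (length As * n2)) (0\<^sub>m (length As * n1) n2) ?B"
    using A B by (auto simp: Let_def)
  have bd: "k * n + i < N * n" if "k < N" "i < n" for k i n N :: nat
  proof -
    have "k * n + i < Suc k * n" using that by simp
    also have "\<dots> \<le> N * n" using that by (intro mult_right_mono) auto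
    finally show ?thesis .
  qed
  show ?case
  proof (intro conjI allI impI)
    show "diag_block_mat (A # As) \<in> carrier_mat (length (A # As) * n1) (length (A # As) * n2)"
      unfolding e using A B by auto
    fix k l i j assume kl: "k < length (A # As)" "l < length (A # As)" "i < n1" "j < n2"
    show "diag_block_mat (A # As) $$ (k * n1 + i, l * n2 + j) = (if k = l then (A # As) ! k $$ (i, j) else 0)"
    proof (cases k; cases l)
      fix k' l' assume "k = Suc k'" "l = Suc l'"
      then show ?thesis unfolding e using A B kl IH[of k' l' i j] bd[of k' "length As" i n1] bd[of l' "length As" j n2]
        by (simp add: add.assoc)
    next
      fix l' assume "k = 0" "l = Suc l'"
      then show ?thesis unfolding e using A B kl bd[of l' "length As" j n2] by (simp add: add.assoc)
    next
      fix k' assume "k = Suc k'" "l = 0"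
      then show ?thesis unfolding e using A B kl bd[of k' "length As" i n1] by (simp add: add.assoc)
    next
      assume "k = 0" "l = 0"
      then show ?thesis unfolding e using A B kl by simp
    qed
  qed
qed simp

lemma sum_div_mod:
  fixes f :: "nat \<Rightarrow> real"
  shows "(\<Sum>p<n3 * b. f p) = (\<Sum>q\<in>{..<b} \<times> {..<n3}. f (snd q * b + fst q))"
proof (rule sum.reindex_bij_witness[where i = "\<lambda>q. snd q * b + fst q" and j = "\<lambda>p. (p mod b, p div b)"])
  fix p assume p: "p \<in> {..<n3 * b}"
  then have b: "b > 0" by (cases "b = 0") auto
  show "snd (p mod b, p div b) * b + fst (p mod b, p div b) = p" by simp
  then show "f (snd (p mod b, p div b) * b + fst (p mod b, p div b)) = f p" by simp
  show "(p mod b, p div b) \<in> {..<b} \<times> {..<n3}" using p b by (auto simp: less_mult_imp_div_less)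
next
  fix q assume q: "q \<in> {..<b} \<times> {..<n3}"
  then show "((snd q * b + fst q) mod b, (snd q * b + fst q) div b) = q" by auto
  have "snd q * b + fst q < Suc (snd q) * b" using q by auto
  also have "\<dots> \<le> n3 * b" using q by (intro mult_right_mono) auto
  finally show "snd q * b + fst q \<in> {..<n3 * b}" by simp
qed

text \<open>Flattens the index \<open>(i, k)\<close> of a vector stored in column \<open>c\<close>
  to \<open>k * b + i\<close>, the order used by \<open>diag_block_mat\<close>.\<close>

definition tov :: "nat \<Rightarrow> nat \<Rightarrow> nat \<times> nat \<Rightarrow> (nat \<times> nat) fmat \<Rightarrow> real vec" where
  "tov b n3 c x = vec (n3 * b) (\<lambda>p. ent x (p mod b, p div b) c)"

lemma ent_mult_supp_right:
  assumes "finite K" "\<And>k. ent B k j \<noteq> 0 \<Longrightarrow> k \<in> K"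
  shows "ent (A * B) i j = (\<Sum>k\<in>K. ent A i k * ent B k j)"
  using ent_mult_supp[OF assms(1), of "adj B" j "adj A" i] assms(2) by (simp add: mult.commute flip: adj_mult)

lemma colspD: "x \<in> colsp c K \<Longrightarrow> ent x i j \<noteq> 0 \<Longrightarrow> i \<in> K \<and> j = c"
  unfolding colsp_def by blast

lemma mult_tov:
  assumes N: "N \<in> carrier_mat (n3 * a) (n3 * b)" and x: "x \<in> colsp c ({..<b} \<times> {..<n3})"
    and NF: "\<And>k l i j. k < n3 \<Longrightarrow> l < n3 \<Longrightarrow> i < a \<Longrightarrow> j < b \<Longrightarrow> N $$ (k * a + i, l * b + j) = ent F (i, k) (j, l)"
  shows "N *\<^sub>v tov b n3 c x = tov a n3 c (F * x)"
proof (rule eq_vecI)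
  show "dim_vec (N *\<^sub>v tov b n3 c x) = dim_vec (tov a n3 c (F * x))" using N by (simp add: tov_def)
  fix p assume "p < dim_vec (tov a n3 c (F * x))"
  then have p: "p < n3 * a" by (simp add: tov_def)
  then have a: "a > 0" by (cases "a = 0") auto
  define k i where "k = p div a" and "i = p mod a"
  have ki: "p = k * a + i" "k < n3" "i < a" using p a by (auto simp: k_def i_def less_mult_imp_div_less)
  have "(N *\<^sub>v tov b n3 c x) $ p = (\<Sum>q<n3 * b. N $$ (p, q) * tov b n3 c x $ q)"
    using N p by (auto simp: scalar_prod_def tov_def atLeast0LessThan intro!: sum.cong)
  also have "\<dots> = (\<Sum>q<n3 * b. N $$ (p, q) * ent x (q mod b, q div b) c)"
    by (intro sum.cong) (auto simp: tov_def)
  also have "\<dots> = (\<Sum>q\<in>{..<b} \<times> {..<n3}. N $$ (p, snd q * b + fst q) * ent x q c)"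
    unfolding sum_div_mod by (intro sum.cong refl) auto
  also have "\<dots> = (\<Sum>q\<in>{..<b} \<times> {..<n3}. ent F (i, k) q * ent x q c)"
    by (intro sum.cong refl) (auto simp: ki NF)
  also have "\<dots> = ent (F * x) (i, k) c"
    by (rule ent_mult_supp_right[symmetric]) (use colspD[OF x] in auto)
  finally show "(N *\<^sub>v tov b n3 c x) $ p = tov a n3 c (F * x) $ p" using p by (simp add: tov_def k_def i_def)
qed

lemma singular_values_nonneg:
  assumes "e \<in> singular_values A" shows "0 \<le> e"
proof -
  obtain l w where e: "e = sqrt l" and w: "w \<in> carrier_vec (dim_col A)" "w \<noteq> 0\<^sub>v (dim_col A)"
    "(transpose_mat A * A) *\<^sub>v w = l \<cdot>\<^sub>v w"
    using assms by (auto simp: singular_values_def eigenvalue_def eigenvector_def)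
  have sq: "scalar_prod y y = (\<Sum>i<dim_vec y. (y $ i)\<^sup>2)" for y :: "real vec"
    by (simp add: scalar_prod_def power2_eq_square atLeast0LessThan)
  have Aw: "A *\<^sub>v w \<in> carrier_vec (dim_row A)" by (rule mult_mat_vec_carrier[OF _ w(1)]) auto
  have "l * scalar_prod w w = scalar_prod (l \<cdot>\<^sub>v w) w" using w by simp
  also have "\<dots> = scalar_prod (transpose_mat A *\<^sub>v (A *\<^sub>v w)) w"
    using w by (simp add: assoc_mult_mat_vec[of _ "dim_col A" "dim_row A" _ "dim_col A", symmetric] flip: w(3))
  also have "\<dots> = scalar_prod (A *\<^sub>v w) (A *\<^sub>v w)"
    by (rule transpose_vec_mult_scalar[OF _ w(1) Aw]) auto
  also have "\<dots> \<ge> 0" unfolding sq by (intro sum_nonneg) auto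
  finally have "0 \<le> l * scalar_prod w w" .
  moreover have "0 < scalar_prod w w"
  proof -
    obtain i where "i < dim_col A" "w $ i \<noteq> 0" using w by (metis eq_vecI carrier_vecD index_zero_vec)
    then show ?thesis unfolding sq using w by (intro sum_pos2[of _ i]) auto
  qed
  ultimately show ?thesis by (simp add: e zero_le_mult_iff)
qed

lemma finite_singular_values: "finite (singular_values A)"
proof -
  let ?B = "transpose_mat A * A"
  have B: "?B \<in> carrier_mat (dim_col A) (dim_col A)" by (rule mult_carrier_mat[of _ _ "dim_row A"]) auto
  have "char_poly ?B \<noteq> 0" using degree_monic_char_poly[OF B] by auto
  then have "finite {e. poly (char_poly ?B) e = 0}" by (rule poly_roots_finite)
  moreover have "singular_values A = sqrt ` {e. poly (char_poly ?B) e = 0}"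
    unfolding singular_values_def eigenvalue_root_char_poly[OF B] by auto
  ultimately show ?thesis by simp
qed

text \<open>The columns of \<open>v\<close> and \<open>u\<close> at one position form a singular
  pair of \<open>iota X\<close>; the flattened right vector is the eigenvector that
  \<open>singular_values\<close> asks for.\<close>

lemma singular_value_block:
  assumes X: "X \<in> tensors n1 n2 n3" "n3 > 0" and sk: "is_skinny_tsvd X U S V" and ik: "(i, k) \<in> ridx (rank_t X)"
  shows "dct S ! k $$ (i, i) \<in> singular_values (block_diag X)"
proof -
  let ?K = "ridx (rank_t X)" let ?M = "block_diag X"
  note f = skinny_iota[OF X sk]
  define s where "s = (\<lambda>(i, k). dct S ! k $$ (i, i))"
  define u v where "u = iota U" and "v = iota V"
  have uu: "adj u * (u * A) = dg ?K (\<lambda>_. 1) * A" and vv: "adj v * (v * A) = dg ?K (\<lambda>_. 1) * A" for A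
    using f(3,4) by (simp_all add: u_def v_def flip: mult.assoc)
  have Xf: "iota X = u * dg ?K s * adj v" using f(5) by (simp add: u_def v_def s_def)
  define c :: "nat \<times> nat" where "c = (0, 0)"
  define p where "p = (i, k)"
  have pK: "p \<in> ?K" using ik by (simp add: p_def)
  have dge: "dg ?K h * eu p c = h p *\<^sub>R eu p c" for h
    using pK by (intro fmat_eqI) (auto simp: ent_dg_mult ent_eu)
  define x y where "x = v * eu p c" and "y = u * eu p c"
  have Xx: "iota X * x = s p *\<^sub>R y"
  proof -
    have "iota X * x = u * (dg ?K s * (adj v * (v * eu p c)))" by (simp add: Xf x_def mult.assoc)
    then show ?thesis by (simp add: vv dge y_def)
  qed
  have Xy: "adj (iota X) * y = s p *\<^sub>R x"
  proof -
    have "adj (iota X) * y = v * (dg ?K s * (adj u * (u * eu p c)))" by (simp add: Xf y_def mult.assoc)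
    then show ?thesis by (simp add: uu dge x_def)
  qed
  have eup: "eu p c \<in> colsp c {p}" by (auto simp: colsp_def ent_eu split: if_splits)
  have xc: "x \<in> colsp c ({..<n2} \<times> {..<n3})" unfolding x_def v_def
    by (rule mult_colsp[OF _ eup]) (use ent_iota[OF f(2) X(2)] in \<open>auto split: if_splits\<close>)
  have yc: "y \<in> colsp c ({..<n1} \<times> {..<n3})" unfolding y_def u_def
    by (rule mult_colsp[OF _ eup]) (use ent_iota[OF f(1) X(2)] in \<open>auto split: if_splits\<close>)
  have dX: "dct X \<in> tensors n1 n2 n3" using X by auto
  have M: "?M \<in> carrier_mat (n3 * n1) (n3 * n2)"
    and Mi: "\<And>k l i j. k < n3 \<Longrightarrow> l < n3 \<Longrightarrow> i < n1 \<Longrightarrow> j < n2 \<Longrightarrow> ?M $$ (k * n1 + i, l * n2 + j) = ent (iota X) (i, k) (j, l)"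
    using diag_block_mat_uniform[of "dct X" n1 n2] dX by (auto simp: tensors_def block_diag_def ent_iota[OF X])
  have bd: "k * n + i < n3 * n" if "k < n3" "i < n" for k i n :: nat
  proof -
    have "k * n + i < Suc k * n" using that by simp
    also have "\<dots> \<le> n3 * n" using that by (intro mult_right_mono) auto
    finally show ?thesis .
  qed
  have Mx: "?M *\<^sub>v tov n2 n3 c x = s p \<cdot>\<^sub>v tov n1 n3 c y"
  proof -
    have "?M *\<^sub>v tov n2 n3 c x = tov n1 n3 c (iota X * x)" by (rule mult_tov[OF M xc]) (rule Mi)
    then show ?thesis unfolding Xx by (auto simp: tov_def)
  qed
  have "transpose_mat ?M *\<^sub>v tov n1 n3 c y = tov n2 n3 c (adj (iota X) * y)"
    by (rule mult_tov[OF _ yc]) (use M Mi bd in auto)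
  then have My: "transpose_mat ?M *\<^sub>v tov n1 n3 c y = s p \<cdot>\<^sub>v tov n2 n3 c x"
    unfolding Xy by (auto simp: tov_def)
  have tx: "tov n2 n3 c x \<in> carrier_vec (n3 * n2)" and ty: "tov n1 n3 c y \<in> carrier_vec (n3 * n1)" by (auto simp: tov_def)
  have "(transpose_mat ?M * ?M) *\<^sub>v tov n2 n3 c x = transpose_mat ?M *\<^sub>v (?M *\<^sub>v tov n2 n3 c x)"
    using M tx by (simp add: assoc_mult_mat_vec[of _ "n3 * n2" "n3 * n1" _ "n3 * n2"])
  also have "\<dots> = s p \<cdot>\<^sub>v (transpose_mat ?M *\<^sub>v tov n1 n3 c y)"
    unfolding Mx using M ty by (intro mult_mat_vec) auto
  also have "\<dots> = (s p * s p) \<cdot>\<^sub>v tov n2 n3 c x" unfolding My by (simp add: smult_smult_assoc)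
  finally have ev: "(transpose_mat ?M * ?M) *\<^sub>v tov n2 n3 c x = (s p * s p) \<cdot>\<^sub>v tov n2 n3 c x" .
  have "x \<noteq> 0"
  proof
    assume "x = 0"
    then have "dg ?K (\<lambda>_. 1) * eu p c = 0" using vv[of "eu p c"] by (simp add: x_def)
    then have "norm (eu p c) = 0" by (simp add: dge)
    then show False by (simp add: norm_eu)
  qed
  have "\<exists>q. ent x q c \<noteq> 0"
  proof (rule ccontr)
    assume n: "\<not> (\<exists>q. ent x q c \<noteq> 0)"
    have "ent x i j = ent 0 i j" for i j using n colspD[OF xc, of i j] by (cases "j = c") auto
    then have "x = 0" by (rule fmat_eqI)
    then show False using \<open>x \<noteq> 0\<close> by simp
  qed
  then obtain a l where al: "ent x (a, l) c \<noteq> 0" by auto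
  then have "a < n2" "l < n3" using colspD[OF xc al] by auto
  then have "tov n2 n3 c x $ (l * n2 + a) = ent x (a, l) c" using bd[of l a n2] by (simp add: tov_def)
  then have nz: "tov n2 n3 c x \<noteq> 0\<^sub>v (n3 * n2)" using al bd[OF \<open>l < n3\<close> \<open>a < n2\<close>] by (metis index_zero_vec(1))
  have "eigenvalue (transpose_mat ?M * ?M) (s p * s p)"
    unfolding eigenvalue_def eigenvector_def using ev nz tx M by (intro exI[of _ "tov n2 n3 c x"]) auto
  moreover have "s p = sqrt (s p * s p)" using f(6)[OF ik] by (simp add: s_def p_def)
  ultimately have "s p \<in> singular_values ?M" unfolding singular_values_def by blast
  then show ?thesis by (simp add: s_def p_def)
qed

lemma rank_t_nonzero:
  assumes X: "X \<in> tensors n1 n2 n3" "n3 > 0" "X \<noteq> tzero n1 n2 n3" and sk: "is_skinny_tsvd X U S V"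
  shows "ridx (rank_t X) \<noteq> {}"
proof
  assume e: "ridx (rank_t X) = {}"
  have "dg {} (\<lambda>(i, k). dct S ! k $$ (i, i)) = (0 :: (nat \<times> nat) fmat)" by (rule fmat_eqI) (simp add: ent_dg)
  then have "iota X = 0" using skinny_iota(5)[OF X(1,2) sk] by (simp add: e)
  then have "X = tzero n1 n2 n3" using iota_inject[OF X(1) tzero_tensors X(2)] iota_tzero[OF X(2)] by simp
  then show False using X by simp
qed

text \<open>Links \<open>condition_number\<close> and \<open>tspectral_norm\<close>, which are
  defined through eigenvalues, to the diagonal entries of \<open>S\<close>: these are nonzero
  singular values and hence at least the least one.\<close>

lemma smallest_singular_value:
  assumes X: "X \<in> tensors n1 n2 n3" "n3 > 0" "X \<noteq> tzero n1 n2 n3" and sk: "is_skinny_tsvd X U S V"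
  obtains \<sigma> where "\<sigma> > 0" "\<And>i k. (i, k) \<in> ridx (rank_t X) \<Longrightarrow> \<sigma> \<le> dct S ! k $$ (i, i)"
    "tspectral_norm X = condition_number X * \<sigma>" "condition_number X \<ge> 1"
proof -
  let ?S = "singular_values (block_diag X)" 
  have fin: "finite ?S" by (rule finite_singular_values)
  have in': "dct S ! k $$ (i, i) \<in> ?S - {0}" if "(i, k) \<in> ridx (rank_t X)" for i k
    using singular_value_block[OF X(1,2) sk that] skinny_iota(6)[OF X(1,2) sk that] by simp
  obtain i k where "(i, k) \<in> ridx (rank_t X)" using rank_t_nonzero[OF X sk] by (metis ex_in_conv surj_pair)
  then have ne: "?S - {0} \<noteq> {}" using in' by blast
  define \<sigma> where "\<sigma> = Min (?S - {0})"
  have sm: "\<sigma> \<in> ?S - {0}" unfolding \<sigma>_def by (rule Min_in) (use fin ne in auto)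
  then have pos: "\<sigma> > 0" using singular_values_nonneg[of \<sigma>] by fastforce
  have Mx: "Max (?S - {0}) = Max ?S"
  proof (rule antisym)
    show "Max (?S - {0}) \<le> Max ?S" by (rule Max_mono) (use fin ne in auto)
    have "Max ?S \<in> ?S" by (rule Max_in) (use fin ne in auto)
    moreover have "\<sigma> \<le> Max ?S" using sm fin by (intro Max_ge) auto
    ultimately show "Max ?S \<le> Max (?S - {0})" using pos fin by (intro Max_ge) auto
  qed
  have cn: "condition_number X = Max ?S / \<sigma>" by (simp add: condition_number_def \<sigma>_def Let_def Mx)
  have ge: "\<sigma> \<le> Max ?S" using sm fin by (intro Max_ge) auto
  show thesis
  proof (rule that[OF pos])
    show "\<sigma> \<le> dct S ! k $$ (i, i)" if "(i, k) \<in> ridx (rank_t X)" for i k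
      unfolding \<sigma>_def using in'[OF that] fin by (intro Min_le) auto
    show "tspectral_norm X = condition_number X * \<sigma>" using pos by (simp add: cn tspectral_norm_def spectral_norm_def)
    show "condition_number X \<ge> 1" using ge pos by (simp add: cn)
  qed
qed

section \<open>A bounded semidefinite form that is nearly the inner product on tangent
  spaces\<close>

lemma quadratic_discriminant:
  fixes a b c :: real
  assumes "\<And>t. 0 \<le> a + 2 * t * b + t\<^sup>2 * c" "c \<ge> 0"
  shows "b\<^sup>2 \<le> a * c"
proof (cases "c = 0")
  case True
  have "b = 0"
  proof (rule ccontr)
    assume "b \<noteq> 0"
    then show False using assms(1)[of "- (a + 1) / (2 * b)"] True by (simp add: field_simps)
  qed
  then show ?thesis using True by simp
next
  case False
  then have "0 \<le> a - b\<^sup>2 / c" using assms(1)[of "- b / c"] by (simp add: power2_eq_square field_simps)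
  then show ?thesis using False assms(2) by (simp add: field_simps)
qed

text \<open>\<open>R\<close> stands for the sampling operator, and the form \<open>B\<close> is its
  quadratic form divided by \<open>p\<close>. Off the tangent spaces only the crude bound through
  \<open>m\<close> is at hand; this \<open>m\<close> is a real number, the root of a multiplicity
  bound over \<open>p\<close>.\<close>

locale psd_form =
  fixes R :: "'v::real_inner \<Rightarrow> 'v" and p m :: real
  assumes lin: "linear R" and sym: "\<And>x y. R x \<bullet> y = x \<bullet> R y" and psd: "\<And>x. 0 \<le> x \<bullet> R x" and p: "p > 0"
    and m: "m \<ge> 1" and bound: "\<And>x. x \<bullet> R x \<le> p * m\<^sup>2 * (norm x)\<^sup>2"
begin

definition B where "B x y = (x \<bullet> R y) / p"

lemma B_simps: "B (x + y) z = B x z + B y z" "B z (x + y) = B z x + B z y" "B (c *\<^sub>R x) y = c * B x y" "B x (c *\<^sub>R y) = c * B x y"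
  "B (x - y) z = B x z - B y z" "B z (x - y) = B z x - B z y" "B 0 x = 0" "B x 0 = 0"
  by (simp_all add: B_def inner_add_left inner_add_right inner_diff_left inner_diff_right
      linear_add[OF lin] linear_diff[OF lin] linear_cmul[OF lin] linear_0[OF lin] add_divide_distrib diff_divide_distrib)
lemma B_sym: "B x y = B y x" using sym[of x y] inner_commute[of y "R x"] by (simp add: B_def)
lemma B_nonneg: "0 \<le> B x x" using psd p by (simp add: B_def)
lemma B_bound: "B x x \<le> (m * norm x)\<^sup>2"
  using bound[of x] p by (simp add: B_def field_simps power_mult_distrib)

lemma B_cs: "(B x y)\<^sup>2 \<le> B x x * B y y"
proof (rule quadratic_discriminant[OF _ B_nonneg])
  fix t
  have "0 \<le> B (x + t *\<^sub>R y) (x + t *\<^sub>R y)" by (rule B_nonneg)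
  then show "0 \<le> B x x + 2 * t * B x y + t\<^sup>2 * B y y"
    by (simp add: B_simps B_sym[of y x] power2_eq_square algebra_simps)
qed

lemma B_le:
  assumes "B x x \<le> a\<^sup>2" "B y y \<le> b\<^sup>2" "a \<ge> 0" "b \<ge> 0"
  shows "\<bar>B x y\<bar> \<le> a * b"
proof -
  have "(B x y)\<^sup>2 \<le> a\<^sup>2 * b\<^sup>2" using B_cs[of x y] mult_mono[OF assms(1,2)] B_nonneg by (meson order_trans zero_le_power2)
  then have "\<bar>B x y\<bar> \<le> \<bar>a * b\<bar>" by (simp add: abs_le_square_iff power_mult_distrib)
  then show ?thesis using assms by simp
qed

text \<open>Polarisation after scaling both vectors to the common length
  \<open>norm x * norm y\<close>, so that the parallelogram identity loses nothing.\<close>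

lemma polarize:
  assumes T: "\<And>z c d. z \<in> {c *\<^sub>R x + d *\<^sub>R y} \<Longrightarrow> \<bar>B z z - z \<bullet> z\<bar> \<le> \<delta> * (z \<bullet> z)"
  shows "\<bar>B x y - x \<bullet> y\<bar> \<le> \<delta> * (norm x * norm y)"
proof (cases "x = 0 \<or> y = 0")
  case True
  then show ?thesis by (auto simp: B_simps)
next
  case False
  define \<nu> where "\<nu> = norm x * norm y"
  have \<nu>: "\<nu> > 0" using False by (simp add: \<nu>_def)
  define x' y' where "x' = norm y *\<^sub>R x" and "y' = norm x *\<^sub>R y"
  have T1: "\<bar>B (x' + y') (x' + y') - (x' + y') \<bullet> (x' + y')\<bar> \<le> \<delta> * ((x' + y') \<bullet> (x' + y'))"
    by (rule T[of _ "norm y" "norm x"]) (simp add: x'_def y'_def)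
  have T2: "\<bar>B (x' - y') (x' - y') - (x' - y') \<bullet> (x' - y')\<bar> \<le> \<delta> * ((x' - y') \<bullet> (x' - y'))"
    by (rule T[of _ "norm y" "- norm x"]) (simp add: x'_def y'_def)
  have n: "x' \<bullet> x' = \<nu>\<^sup>2" "y' \<bullet> y' = \<nu>\<^sup>2"
    unfolding power2_norm_eq_inner[symmetric] by (simp_all add: x'_def y'_def \<nu>_def power_mult_distrib)
  have "4 * \<bar>B x' y' - x' \<bullet> y'\<bar> \<le> \<delta> * ((x' + y') \<bullet> (x' + y')) + \<delta> * ((x' - y') \<bullet> (x' - y'))"
  proof -
    have "4 * (B x' y' - x' \<bullet> y') = (B (x' + y') (x' + y') - (x' + y') \<bullet> (x' + y')) - (B (x' - y') (x' - y') - (x' - y') \<bullet> (x' - y'))"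
      by (simp add: B_simps B_sym[of y' x'] inner_add_left inner_add_right inner_diff_left inner_diff_right inner_commute)
    then have "4 * \<bar>B x' y' - x' \<bullet> y'\<bar> = \<bar>(B (x' + y') (x' + y') - (x' + y') \<bullet> (x' + y')) - (B (x' - y') (x' - y') - (x' - y') \<bullet> (x' - y'))\<bar>"
      by (metis abs_mult abs_numeral)
    also have "\<dots> \<le> \<bar>B (x' + y') (x' + y') - (x' + y') \<bullet> (x' + y')\<bar> + \<bar>B (x' - y') (x' - y') - (x' - y') \<bullet> (x' - y')\<bar>"
      by (rule abs_triangle_ineq4)
    finally show ?thesis using T1 T2 by linarith
  qed
  also have "\<dots> = 4 * (\<delta> * \<nu>\<^sup>2)"
    using n by (simp add: inner_add_left inner_add_right inner_diff_left inner_diff_right inner_commute algebra_simps)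
  finally have "\<bar>B x' y' - x' \<bullet> y'\<bar> \<le> \<delta> * \<nu>\<^sup>2" by simp
  moreover have "B x' y' - x' \<bullet> y' = \<nu> * (B x y - x \<bullet> y)"
    by (simp add: x'_def y'_def B_simps \<nu>_def algebra_simps)
  ultimately have "\<nu> * \<bar>B x y - x \<bullet> y\<bar> \<le> \<nu> * (\<delta> * \<nu>)" using \<nu> by (simp add: abs_mult power2_eq_square mult_ac)
  then have "\<bar>B x y - x \<bullet> y\<bar> \<le> \<delta> * \<nu>" using \<nu> by (simp only: mult_le_cancel_left_pos)
  then show ?thesis by (simp add: \<nu>_def)
qed

text \<open>\<open>Y\<close> splits into a part in the range of \<open>PX\<close>, where the form is
  understood, and a remainder left to the crude bound. That the remainder must survive the factor
  \<open>m\<close> is what limits how far the tangent space may move.\<close>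

lemma rip_transfer:
  assumes idem: "PX (PX Y) = PX Y" and PXs: "\<And>x y. PX x \<bullet> y = x \<bullet> PX y"
    and rip: "\<And>Z. PX Z = Z \<Longrightarrow> \<bar>B Z Z - Z \<bullet> Z\<bar> \<le> \<delta> * (Z \<bullet> Z)"
    and close: "norm (Y - PX Y) \<le> \<eta> * norm Y" and \<eta>: "m * \<eta> \<le> \<delta>" "\<eta> \<ge> 0" and \<delta>: "\<delta> \<le> 1/100"
  shows "\<bar>B Y Y - Y \<bullet> Y\<bar> \<le> 4 * \<delta> * (Y \<bullet> Y)"
proof -
  define Y1 Y2 where "Y1 = PX Y" and "Y2 = Y - PX Y"
  define N where "N = norm Y"
  have N0: "N \<ge> 0" by (simp add: N_def)
  have YY: "Y = Y1 + Y2" by (simp add: Y1_def Y2_def)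
  have o: "Y1 \<bullet> Y2 = 0" using PXs[of Y "PX Y"] PXs[of Y Y] idem by (simp add: Y1_def Y2_def inner_diff_right)
  have \<delta>0: "\<delta> \<ge> 0" using \<eta> m by (smt (verit) mult_nonneg_nonneg)
  have n12: "N\<^sup>2 = (norm Y1)\<^sup>2 + (norm Y2)\<^sup>2" 
    using o by (simp add: N_def YY power2_norm_eq_inner inner_add_left inner_add_right inner_commute)
  have Y1N: "norm Y1 \<le> N" by (rule power2_le_imp_le[OF _ N0]) (simp add: n12)
  have "m * norm Y2 \<le> m * (\<eta> * N)" using close m by (intro mult_left_mono) (auto simp: Y2_def N_def)
  also have "\<dots> \<le> \<delta> * N" using mult_right_mono[OF \<eta>(1) N0] by (simp add: mult.assoc)
  finally have mY2: "m * norm Y2 \<le> \<delta> * N" .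
  then have Y2N: "norm Y2 \<le> \<delta> * N" using m mult_right_mono[of 1 m "norm Y2"] by simp
  have B22: "B Y2 Y2 \<le> (\<delta> * N)\<^sup>2"
    by (rule order_trans[OF B_bound power_mono[OF mY2]]) (use m in simp)
  have r1: "\<bar>B Y1 Y1 - (norm Y1)\<^sup>2\<bar> \<le> \<delta> * (norm Y1)\<^sup>2" using rip[of Y1] idem by (simp add: Y1_def power2_norm_eq_inner)
  have Y1N2: "(norm Y1)\<^sup>2 \<le> N\<^sup>2" using Y1N by (intro power_mono) auto
  have d1: "\<delta> * (norm Y1)\<^sup>2 \<le> \<delta> * N\<^sup>2" using Y1N2 \<delta>0 by (intro mult_left_mono)
  have d2: "\<delta> * N\<^sup>2 \<le> 1/100 * N\<^sup>2" using \<delta> by (intro mult_right_mono) auto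
  have "B Y1 Y1 \<le> (11/10 * N)\<^sup>2"
    using r1 d1 d2 Y1N2 by (simp add: power_mult_distrib power2_eq_square) 
  then have B12: "\<bar>B Y1 Y2\<bar> \<le> 11/10 * N * (\<delta> * N)" by (rule B_le[OF _ B22]) (use N0 \<delta>0 in auto)
  have dd: "(\<delta> * N)\<^sup>2 \<le> 1/100 * (\<delta> * N\<^sup>2)"
  proof -
    have "(\<delta> * N)\<^sup>2 = \<delta> * (\<delta> * N\<^sup>2)" by (simp add: power2_eq_square mult_ac)
    also have "\<dots> \<le> 1/100 * (\<delta> * N\<^sup>2)" using \<delta> \<delta>0 by (intro mult_right_mono) auto
    finally show ?thesis .
  qed
  have Y22: "(norm Y2)\<^sup>2 \<le> (\<delta> * N)\<^sup>2" using Y2N by (intro power_mono) auto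
  have dN: "0 \<le> \<delta> * N\<^sup>2" using \<delta>0 by simp
  have "B Y Y - N\<^sup>2 = (B Y1 Y1 - (norm Y1)\<^sup>2) - (norm Y2)\<^sup>2 + 2 * B Y1 Y2 + B Y2 Y2"
    by (simp add: n12) (simp add: YY B_simps B_sym[of Y2 Y1])
  \<comment> \<open>The four terms are, in order, near isometry on \<open>Y1\<close>, the lost norm
    of \<open>Y2\<close>, the cross term, and the form on \<open>Y2\<close>.\<close>
  then have "\<bar>B Y Y - N\<^sup>2\<bar> \<le> \<delta> * N\<^sup>2 + 1/100 * (\<delta> * N\<^sup>2) + 22/10 * (\<delta> * N\<^sup>2) + 1/100 * (\<delta> * N\<^sup>2)"
  proof -
    assume e: "B Y Y - N\<^sup>2 = (B Y1 Y1 - (norm Y1)\<^sup>2) - (norm Y2)\<^sup>2 + 2 * B Y1 Y2 + B Y2 Y2"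
    have B12': "\<bar>B Y1 Y2\<bar> \<le> 11/10 * (\<delta> * N\<^sup>2)" using B12 by (simp add: power2_eq_square mult_ac)
    have "0 \<le> (norm Y2)\<^sup>2" by simp
    then show ?thesis
      unfolding e abs_le_iff using r1 d1 Y22 dd B12' B22 B_nonneg[of Y2] by (intro conjI; linarith)
  qed
  also have "\<dots> \<le> 4 * (\<delta> * N\<^sup>2)" using dN by simp
  finally show ?thesis by (simp add: N_def power2_norm_eq_inner mult_ac)
qed

text \<open>One conjugate gradient step in abstract form: \<open>E\<close> is the error,
  \<open>Pr\<close> the tangent projection at the current iterate, \<open>G\<close> the projected
  gradient, \<open>w\<close> the projected previous direction, \<open>Q\<close> the new direction.
  By \<open>perp\<close> and the bound on \<open>\<tau>\<close>, the normal part of the error is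
  small even after multiplication by \<open>m\<close>.\<close>

context
  fixes Pr :: "'v \<Rightarrow> 'v" and \<delta> \<tau> k1 k2 b :: real and E w G Q :: 'v
  assumes Prl: "linear Pr" and idem: "\<And>x. Pr (Pr x) = Pr x" and Prs: "\<And>x y. Pr x \<bullet> y = x \<bullet> Pr y"
    and rip: "\<And>Z. Pr Z = Z \<Longrightarrow> \<bar>B Z Z - Z \<bullet> Z\<bar> \<le> \<delta> * (Z \<bullet> Z)" and \<delta>: "0 \<le> \<delta>" "\<delta> \<le> 1/100"
    and perp: "norm (E - Pr E) \<le> \<tau> * norm E" and \<tau>: "m * \<tau> \<le> \<delta>" "0 \<le> \<tau>"
    and w: "Pr w = w" and k: "0 \<le> k1" "k1 < 1" "0 \<le> k2"
    and G: "G = Pr (R E)" and Q: "Q = G + b *\<^sub>R w"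
    and b: "b = 0 \<or> (w \<bullet> R w \<noteq> 0 \<and> b = - (G \<bullet> R w / (w \<bullet> R w)) \<and> \<bar>G \<bullet> w\<bar> \<le> k1 * (norm G * norm w) \<and> norm G \<le> k2 * norm w)"
begin

lemma rip2: "Pr x = x \<Longrightarrow> Pr y = y \<Longrightarrow> \<bar>B x y - x \<bullet> y\<bar> \<le> \<delta> * (norm x * norm y)"
  by (rule polarize, rule rip) (auto simp: linear_add[OF Prl] linear_cmul[OF Prl])

lemma rip_upper: "Pr x = x \<Longrightarrow> B x x \<le> (1 + \<delta>) * (norm x)\<^sup>2"
  and rip_lower: "Pr x = x \<Longrightarrow> (1 - \<delta>) * (norm x)\<^sup>2 \<le> B x x"
  using rip[of x] by (auto simp: power2_norm_eq_inner algebra_simps abs_le_iff)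

lemma PrE: "norm (Pr E) \<le> norm E"
proof -
  have "(norm (Pr E))\<^sup>2 = E \<bullet> Pr E" using Prs[of E "Pr E"] idem by (simp add: power2_norm_eq_inner)
  also have "\<dots> \<le> norm E * norm (Pr E)" by (rule norm_cauchy_schwarz)
  finally show ?thesis by (cases "Pr E = 0") (auto simp: power2_eq_square)
qed

text \<open>Division by \<open>p\<close> brings gradient, direction and conjugate correction to the
  scale of the error: \<open>g\<close> approximates \<open>E\<close>.\<close>

definition "g = (1 / p) *\<^sub>R G"
definition "h = (1 / p) *\<^sub>R Q"
definition "x = (b / p) *\<^sub>R w"

lemma in_T: "Pr G = G" "Pr g = g" "Pr Q = Q" "Pr h = h" "Pr x = x"
  using idem w unfolding g_def h_def x_def unfolding Q G by (simp_all add: linear_add[OF Prl] linear_cmul[OF Prl])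
lemma hgx: "h = g + x" unfolding h_def g_def x_def unfolding Q by (simp add: scaleR_add_right)

text \<open>For tangent \<open>Y\<close> the pairing with \<open>g\<close> is \<open>B E Y\<close>.
  The tangent part of \<open>E\<close> costs \<open>\<delta>\<close> by near isometry, the normal
  part \<open>11/10 * \<delta>\<close> by Cauchy-Schwarz for \<open>B\<close>.\<close>

lemma g_inner:
  assumes Y: "Pr Y = Y" shows "\<bar>g \<bullet> Y - E \<bullet> Y\<bar> \<le> 21/10 * \<delta> * (norm E * norm Y)"
proof -
  define E2 where "E2 = E - Pr E"
  have gY: "g \<bullet> Y = B (Pr E) Y + B E2 Y"
  proof -
    have "g \<bullet> Y = B E Y" using Prs[of "R E" Y] Y sym[of E Y] unfolding g_def unfolding G by (simp add: B_def)
    also have "E = Pr E + E2" by (simp add: E2_def)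
    finally show ?thesis by (simp add: B_simps(1))
  qed
  have EY: "E \<bullet> Y = Pr E \<bullet> Y" using Prs[of E Y] Y by simp
  have 1: "\<bar>B (Pr E) Y - Pr E \<bullet> Y\<bar> \<le> \<delta> * (norm (Pr E) * norm Y)" using rip2[OF idem Y] .
  also have "\<dots> \<le> \<delta> * (norm E * norm Y)" using PrE \<delta> by (intro mult_left_mono mult_right_mono) auto
  finally have 1: "\<bar>B (Pr E) Y - Pr E \<bullet> Y\<bar> \<le> \<delta> * (norm E * norm Y)" .
  have "m * norm E2 \<le> m * (\<tau> * norm E)" using perp m by (intro mult_left_mono) (auto simp: E2_def)
  also have "\<dots> \<le> \<delta> * norm E" using mult_right_mono[OF \<tau>(1) norm_ge_zero[of E]] by (simp add: mult.assoc)
  finally have "m * norm E2 \<le> \<delta> * norm E" .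
  then have a: "B E2 E2 \<le> (\<delta> * norm E)\<^sup>2"
    using order_trans[OF B_bound power_mono[of "m * norm E2" "\<delta> * norm E" 2]] m by simp
  have "B Y Y \<le> (1 + \<delta>) * (norm Y)\<^sup>2" by (rule rip_upper[OF Y])
  also have "\<dots> \<le> (11/10)\<^sup>2 * (norm Y)\<^sup>2" using \<delta> by (intro mult_right_mono) (auto simp: power2_eq_square)
  finally have c: "B Y Y \<le> (11/10 * norm Y)\<^sup>2" by (simp only: power_mult_distrib)
  have 2: "\<bar>B E2 Y\<bar> \<le> \<delta> * norm E * (11/10 * norm Y)" by (rule B_le[OF a c]) (use \<delta> in auto)
  have "\<bar>B E2 Y\<bar> \<le> 11/10 * (\<delta> * (norm E * norm Y))" using 2 by (simp add: mult_ac)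
  then show ?thesis using 1 unfolding gY EY by linarith
qed

lemma g_PrE: "norm (g - Pr E) \<le> 21/10 * \<delta> * norm E"
proof -
  define Y where "Y = g - Pr E"
  have Y: "Pr Y = Y" using in_T idem by (simp add: Y_def linear_diff[OF Prl])
  have "(norm Y)\<^sup>2 = g \<bullet> Y - E \<bullet> Y"
    using Prs[of E Y] Y by (simp add: power2_norm_eq_inner) (simp add: Y_def inner_diff_left)
  also have "\<dots> \<le> 21/10 * \<delta> * (norm E * norm Y)" using g_inner[OF Y] by linarith
  finally have "norm Y * norm Y \<le> (21/10 * \<delta> * norm E) * norm Y" by (simp add: power2_eq_square mult_ac)
  then show ?thesis using \<delta> by (cases "Y = 0") (auto simp: Y_def)
qed

text \<open>The normal part of \<open>E\<close> adds one more \<open>\<delta>\<close>, since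
  \<open>m \<ge> 1\<close> gives \<open>\<tau> \<le> \<delta>\<close>.\<close>

lemma E_g: "norm (E - g) \<le> 31/10 * \<delta> * norm E"
proof -
  have "norm (E - g) \<le> norm (E - Pr E) + norm (g - Pr E)"
    using norm_triangle_ineq4[of "E - Pr E" "g - Pr E"] by simp
  moreover have "\<tau> \<le> \<delta>" using \<tau> m mult_right_mono[of 1 m \<tau>] by simp
  then have "norm (E - Pr E) \<le> \<delta> * norm E" using perp mult_right_mono[of \<tau> \<delta> "norm E"] by simp
  ultimately show ?thesis using g_PrE by (simp add: algebra_simps)
qed

lemma g_le: "norm g \<le> (1 + 21/10 * \<delta>) * norm E"
  using norm_triangle_ineq[of "Pr E" "g - Pr E"] g_PrE PrE by (simp add: algebra_simps)

text \<open>The method can stop only at the target: without a gradient the last estimate bounds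
  \<open>norm E\<close> by half of itself.\<close>

lemma gradient_zero: "G = 0 \<Longrightarrow> E = 0"
proof -
  assume "G = 0"
  then have g0: "g = 0" unfolding g_def by simp
  have "norm E \<le> 31/10 * \<delta> * norm E" using E_g unfolding g0 by simp
  also have "\<dots> \<le> 1/2 * norm E" using \<delta> by (intro mult_right_mono) auto
  finally show "E = 0" by simp
qed

text \<open>The formula for \<open>b\<close> expresses conjugacy to the previous direction; after a
  restart the correction is 0.\<close>

lemma conjugate: "B h x = 0"
proof (cases "b = 0")
  case False
  then have "w \<bullet> R w \<noteq> 0" "b = - (G \<bullet> R w / (w \<bullet> R w))" using b by auto
  then have "b * (w \<bullet> R w) = - (G \<bullet> R w)" by simp
  moreover have "Q \<bullet> R w = G \<bullet> R w + b * (w \<bullet> R w)" unfolding Q by (simp add: inner_add_left)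
  ultimately have "B Q w = 0" by (simp add: B_def)
  then show ?thesis unfolding h_def x_def by (simp add: B_simps)
next
  case True
  show ?thesis unfolding x_def unfolding True by (simp add: B_simps)
qed

text \<open>By conjugacy \<open>h\<close> is \<open>g\<close> minus a component orthogonal to
  \<open>h\<close> in the form \<open>B\<close>, so \<open>h\<close> is no longer than
  \<open>g\<close> in that form. The factor with \<open>12/10\<close> pays for the passage between
  form and norm.\<close>

lemma h_le: "norm h \<le> (1 + 12/10 * \<delta>) * norm g"
proof -
  have hh: "B h h = B g h" using conjugate hgx B_sym by (metis B_simps(1) add_cancel_left_right B_sym)
  have "(B h h)\<^sup>2 \<le> B g g * B h h" using B_cs[of g h] hh by simp
  then have "B h h \<le> B g g" using B_nonneg[of h] B_nonneg[of g] by (cases "B h h = 0") (auto simp: power2_eq_square)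
  then have "(1 - \<delta>) * (norm h)\<^sup>2 \<le> (1 + \<delta>) * (norm g)\<^sup>2" using rip_lower[OF in_T(4)] rip_upper[OF in_T(2)] by linarith
  also have "\<dots> \<le> ((1 - \<delta>) * (1 + 12/10 * \<delta>)\<^sup>2) * (norm g)\<^sup>2"
  proof (intro mult_right_mono)
    have a: "\<delta> * \<delta> \<le> 1/100 * \<delta>" using \<delta> by (intro mult_right_mono) auto
    have b: "\<delta> * \<delta> * \<delta> \<le> 1/100 * (1/100 * \<delta>)"
      using mult_mono[OF \<delta>(2) a] \<delta> by (simp add: mult_ac)
    define e where "e = \<delta> / 5"
    have e: "\<delta> = 5 * e" by (simp add: e_def)
    have "(1 - \<delta>) * (1 + 12/10 * \<delta>)\<^sup>2 = 1 + 14/10 * \<delta> - 96/100 * (\<delta> * \<delta>) - 144/100 * (\<delta> * \<delta> * \<delta>)"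
      unfolding e by (simp add: power2_eq_square algebra_simps)
    then show "1 + \<delta> \<le> (1 - \<delta>) * (1 + 12/10 * \<delta>)\<^sup>2" using a b \<delta> by linarith
  qed simp
  finally have "(norm h)\<^sup>2 \<le> ((1 + 12/10 * \<delta>) * norm g)\<^sup>2" using \<delta> by (simp add: power_mult_distrib mult.assoc)
  then show ?thesis by (rule power2_le_imp_le) (use \<delta> in simp)
qed

text \<open>Bounds what becomes the previous direction of the next step, at the scale of
  \<open>p\<close> times the present error. This is how two consecutive errors enter the
  recursion.\<close>

lemma direction_le: "norm Q \<le> (1 + 5 * \<delta>) * p * norm E"
proof -
  have a: "\<delta> * \<delta> \<le> 1/100 * \<delta>" using \<delta> by (intro mult_right_mono) auto
  have "norm h \<le> (1 + 12/10 * \<delta>) * ((1 + 21/10 * \<delta>) * norm E)"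
    by (rule order_trans[OF h_le mult_left_mono[OF g_le]]) (use \<delta> in simp)
  also have "\<dots> = (1 + 33/10 * \<delta> + 252/100 * (\<delta> * \<delta>)) * norm E"
  proof -
    define e where "e = \<delta> / 10"
    have e: "\<delta> = 10 * e" by (simp add: e_def)
    show ?thesis unfolding e by (simp add: algebra_simps)
  qed
  also have "\<dots> \<le> (1 + 5 * \<delta>) * norm E" using a \<delta> by (intro mult_right_mono) auto
  finally show ?thesis using p by (simp add: h_def field_simps)
qed

text \<open>The angle condition with \<open>k1\<close> bounds the numerator of \<open>b\<close>, and
  the length condition with \<open>k2\<close> replaces \<open>G\<close> by \<open>w\<close>. Near
  isometry adds \<open>\<delta>\<close> to \<open>k1\<close> and leaves \<open>1 - \<delta>\<close>
  below.\<close>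

lemma x_le: "norm x \<le> (k1 * k2 + \<delta> * k2) / (1 - \<delta>) * (norm w / p)"
proof (cases "b = 0")
  case True
  then have x0: "x = 0" unfolding x_def by simp
  show ?thesis unfolding x0 using k \<delta> p by simp
next
  case False
  then have b': "w \<bullet> R w \<noteq> 0" "b = - (G \<bullet> R w / (w \<bullet> R w))" "\<bar>G \<bullet> w\<bar> \<le> k1 * (norm G * norm w)" "norm G \<le> k2 * norm w"
    using b by auto
  have w0: "w \<noteq> 0" using b'(1) by auto
  have gw: "\<bar>g \<bullet> w\<bar> \<le> k1 * (norm g * norm w)" using b'(3) p by (simp add: g_def abs_mult field_simps)
  have "\<bar>B g w\<bar> \<le> (k1 + \<delta>) * (norm g * norm w)" using rip2[OF in_T(2) w] gw by (simp add: algebra_simps abs_le_iff)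
  also have "\<dots> \<le> (k1 + \<delta>) * (k2 * norm w / p * norm w)"
    using b'(4) p k \<delta> by (intro mult_left_mono mult_right_mono) (auto simp: g_def divide_right_mono)
  finally have Bgw: "\<bar>B g w\<bar> \<le> (k1 + \<delta>) * (k2 * norm w / p * norm w)" .
  have Bww: "(1 - \<delta>) * (norm w)\<^sup>2 \<le> B w w" by (rule rip_lower[OF w])
  have pos: "0 < (1 - \<delta>) * (norm w)\<^sup>2" using w0 \<delta> by simp
  have "b / p = - (B g w / B w w)"
    using p b'(1) by (simp add: b'(2) B_def g_def)
  then have "norm x = \<bar>B g w\<bar> / B w w * norm w" using Bww pos by (simp add: x_def abs_mult)
  also have "\<dots> \<le> (k1 + \<delta>) * (k2 * norm w / p * norm w) / ((1 - \<delta>) * (norm w)\<^sup>2) * norm w"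
    using Bgw Bww pos k \<delta> p by (intro mult_right_mono frac_le) auto
  also have "\<dots> = (k1 * k2 + \<delta> * k2) / (1 - \<delta>) * (norm w / p)"
  proof -
    define d where "d = 1 - \<delta>"
    have "d \<noteq> 0" using \<delta> by (simp add: d_def)
    then show ?thesis unfolding d_def[symmetric] using w0 p by (simp add: power2_eq_square field_simps)
  qed
  finally show ?thesis .
qed

text \<open>The new error is \<open>E - g\<close>, minus the conjugate correction, plus a multiple
  \<open>1 - a\<close> of \<open>h\<close>. Conjugacy gives \<open>B h h = B g h\<close>, which puts
  \<open>a\<close> near 1. The costs \<open>31/10\<close> and \<open>11/10\<close> are rounded up to
  10.\<close>

lemma residual_le:
  "norm (E - (G \<bullet> Q / (Q \<bullet> R Q)) *\<^sub>R Q) \<le> 10 * \<delta> * norm E + (k1 * k2 + \<delta> * k2) / (1 - \<delta>) * (norm w / p)"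
proof -
  define a where "a = g \<bullet> h / B h h"
  have aQ: "(G \<bullet> Q / (Q \<bullet> R Q)) *\<^sub>R Q = a *\<^sub>R h"
    using p by (simp add: a_def g_def h_def B_simps) (simp add: B_def)
  have hh: "B h h = B g h" using conjugate hgx B_sym by (metis B_simps(1) add_cancel_left_right B_sym)
  have 3: "\<bar>1 - a\<bar> * norm h \<le> 11/10 * \<delta> * norm E"
  proof (cases "h = 0")
    case False
    have lo: "(1 - \<delta>) * (norm h)\<^sup>2 \<le> B h h" by (rule rip_lower[OF in_T(4)])
    have pos: "0 < (1 - \<delta>) * (norm h)\<^sup>2" using False \<delta> by simp
    have "1 - a = (B g h - g \<bullet> h) / B h h" using lo pos by (simp add: a_def diff_divide_distrib hh[symmetric])
    then have "\<bar>1 - a\<bar> * norm h = \<bar>B g h - g \<bullet> h\<bar> / B h h * norm h" using lo pos by simp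
    also have "\<dots> \<le> \<delta> * (norm g * norm h) / ((1 - \<delta>) * (norm h)\<^sup>2) * norm h"
      using rip2[OF in_T(2) in_T(4)] lo pos \<delta> by (intro mult_right_mono frac_le) auto
    also have "\<dots> = \<delta> / (1 - \<delta>) * norm g" using False by (simp add: power2_eq_square)
    also have "\<dots> \<le> (100/99 * \<delta>) * ((1 + 21/1000) * norm E)"
    proof (rule mult_mono)
      show "\<delta> / (1 - \<delta>) \<le> 100/99 * \<delta>"
        using \<delta> mult_right_mono[of 1 "100/99 * (1 - \<delta>)" \<delta>] by (simp add: field_simps)
      have "(1 + 21/10 * \<delta>) * norm E \<le> (1 + 21/1000) * norm E" using \<delta> by (intro mult_right_mono) auto
      then show "norm g \<le> (1 + 21/1000) * norm E" using g_le by linarith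
    qed (use \<delta> in auto)
    also have "\<dots> = (100/99 * (1 + 21/1000)) * (\<delta> * norm E)" by simp
    also have "\<dots> \<le> 11/10 * (\<delta> * norm E)" using \<delta> by (intro mult_right_mono) auto
    finally show ?thesis by (simp add: mult_ac)
  qed (use \<delta> in auto)
  have "E - a *\<^sub>R h = (E - g) - x + (1 - a) *\<^sub>R h" by (simp add: hgx algebra_simps)
  also have "norm \<dots> \<le> norm (E - g) + norm x + norm ((1 - a) *\<^sub>R h)"
    by (meson norm_triangle_ineq norm_triangle_ineq4 order_trans add_mono order_refl)
  also have "\<dots> \<le> 31/10 * \<delta> * norm E + (k1 * k2 + \<delta> * k2) / (1 - \<delta>) * (norm w / p) + 11/10 * \<delta> * norm E"
    using E_g x_le 3 by (intro add_mono) auto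
  also have "\<dots> \<le> 10 * \<delta> * norm E + (k1 * k2 + \<delta> * k2) / (1 - \<delta>) * (norm w / p)"
    using \<delta> mult_nonneg_nonneg[OF \<delta>(1) norm_ge_zero[of E]] by (simp add: algebra_simps)
  finally show ?thesis by (simp only: aQ)
qed

text \<open>A vanishing denominator forces \<open>Q = 0\<close>, so \<open>G\<close> would be
  parallel to \<open>w\<close>, against the angle condition with \<open>k1 < 1\<close>.\<close>

lemma denom_nonzero:
  assumes G0: "G \<noteq> 0" shows "Q \<bullet> R Q \<noteq> 0"
proof
  assume "Q \<bullet> R Q = 0"
  then have "B Q Q = 0" by (simp add: B_def)
  then have "(1 - \<delta>) * (norm Q)\<^sup>2 \<le> 0" using rip_lower[OF in_T(3)] by simp
  then have Q0: "Q = 0" using \<delta> by (simp add: mult_le_0_iff)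
  then have Gw: "G = - b *\<^sub>R w" using Q by (simp add: eq_neg_iff_add_eq_0)
  then have b0: "b \<noteq> 0" "w \<noteq> 0" using G0 by auto
  then have "\<bar>G \<bullet> w\<bar> \<le> k1 * (norm G * norm w)" using b by auto
  moreover have "\<bar>G \<bullet> w\<bar> = norm G * norm w" using Gw by (simp add: abs_mult power2_norm_eq_inner[symmetric] power2_eq_square)
  ultimately have "norm G * norm w \<le> k1 * (norm G * norm w)" by simp
  moreover have "norm G * norm w > 0" using G0 b0 by simp
  ultimately show False using k by (simp add: mult_le_cancel_right1)
qed

end
end

section \<open>Convergence on a good sample\<close>

definition bk :: "nat \<Rightarrow> nat \<Rightarrow> nat \<Rightarrow> (nat \<times> nat) fmat \<Rightarrow> (nat \<times> nat) fmat" where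
  "bk n1 n2 n3 A = mk ({..<n1} \<times> {..<n3}) ({..<n2} \<times> {..<n3}) (\<lambda>p q. if snd p = snd q then ent A p q else 0)"

lemma ent_bk: "ent (bk n1 n2 n3 A) (i, k) (j, l) = (if k = l \<and> k < n3 \<and> i < n1 \<and> j < n2 then ent A (i, k) (j, l) else 0)"
  by (auto simp: bk_def ent_mk)
lemma linear_bk: "linear (bk n1 n2 n3)"
  by (rule linearI; rule fmat_pair_eqI) (auto simp: ent_bk)
lemma bk_blks: "bk n1 n2 n3 A \<in> blks n1 n2 n3" by (auto simp: blks_def ent_bk split: if_splits)
lemma bk_id: "A \<in> blks n1 n2 n3 \<Longrightarrow> bk n1 n2 n3 A = A"
  by (rule fmat_pair_eqI) (auto simp: ent_bk blks_def)
lemma bk_sym: "bk n1 n2 n3 A \<bullet> B = A \<bullet> bk n1 n2 n3 B"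
proof -
  define L where "L = ind A \<union> ind B \<union> ind (bk n1 n2 n3 A)"
  have L: "finite L" "ind A \<subseteq> L" "ind (bk n1 n2 n3 A) \<subseteq> L" by (auto simp: L_def)
  have "ent (bk n1 n2 n3 A) p q * ent B p q = ent A p q * ent (bk n1 n2 n3 B) p q" for p q
    by (cases p; cases q) (simp add: ent_bk)
  then show ?thesis using inner_fmat_eq[OF L(1), of "bk n1 n2 n3 A" B] inner_fmat_eq[OF L(1), of A "bk n1 n2 n3 B"] L by simp
qed

lemma blks_mult:
  assumes "A \<in> blks a b n3" "B \<in> blks b c n3" "n3 > 0" shows "A * B \<in> blks a c n3"
proof -
  obtain A' where A': "A' \<in> tensors a b n3" "iota A' = A" by (rule blks_iota[OF assms(1,3)])
  obtain B' where B': "B' \<in> tensors b c n3" "iota B' = B" by (rule blks_iota[OF assms(2,3)])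
  show ?thesis using iota_blks[OF tprod_tensors[OF A'(1) B'(1) assms(3)] assms(3)] iota_tprod[OF A'(1) B'(1) assms(3)] A' B' by simp
qed
lemma blks_adj: "A \<in> blks a b n3 \<Longrightarrow> adj A \<in> blks b a n3"
  by (auto simp: blks_def)
lemma blks_arith: "A \<in> blks a b n3 \<Longrightarrow> B \<in> blks a b n3 \<Longrightarrow> A + B \<in> blks a b n3"
  "A \<in> blks a b n3 \<Longrightarrow> B \<in> blks a b n3 \<Longrightarrow> A - B \<in> blks a b n3" "A \<in> blks a b n3 \<Longrightarrow> c *\<^sub>R A \<in> blks a b n3"
  using subspace_blks[of a b n3] by (auto simp: real_vector.subspace_add real_vector.subspace_diff real_vector.subspace_scale)

lemma tproj_blks: "P \<in> blks a a n3 \<Longrightarrow> Q \<in> blks b b n3 \<Longrightarrow> A \<in> blks a b n3 \<Longrightarrow> n3 > 0 \<Longrightarrow> tproj P Q A \<in> blks a b n3"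
  unfolding tproj_def by (intro blks_arith blks_mult)

text \<open>\<open>tproj\<close> acts on all matrices, whereas near isometry is known for block
  diagonal ones. Compression by \<open>bk\<close> gives a self-adjoint idempotent on the whole type
  whose fixed points are block diagonal, as the abstract step requires.\<close>

definition btproj where "btproj n1 n2 n3 P Q A = bk n1 n2 n3 (tproj P Q (bk n1 n2 n3 A))"

lemma linear_btproj: "linear (btproj n1 n2 n3 P Q)"
  unfolding btproj_def[abs_def] using linear_compose[OF linear_compose[OF linear_bk linear_tproj] linear_bk]
  by (simp add: o_def)
lemma btproj_id: "P \<in> blks n1 n1 n3 \<Longrightarrow> Q \<in> blks n2 n2 n3 \<Longrightarrow> n3 > 0 \<Longrightarrow> A \<in> blks n1 n2 n3 \<Longrightarrow> btproj n1 n2 n3 P Q A = tproj P Q A"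
  by (simp add: btproj_def bk_id tproj_blks)
lemma btproj_idem:
  assumes "P \<in> blks n1 n1 n3" "Q \<in> blks n2 n2 n3" "n3 > 0" "proj P" "proj Q"
  shows "btproj n1 n2 n3 P Q (btproj n1 n2 n3 P Q A) = btproj n1 n2 n3 P Q A"
  using assms by (simp add: btproj_def bk_id[OF bk_blks] bk_id[OF tproj_blks] bk_blks tproj_idem)
lemma btproj_sym:
  "proj P \<Longrightarrow> proj Q \<Longrightarrow> btproj n1 n2 n3 P Q A \<bullet> B = A \<bullet> btproj n1 n2 n3 P Q B"
  by (simp add: btproj_def bk_sym tproj_sym)

text \<open>The deterministic side: \<open>rip\<close>, \<open>mult\<close> and \<open>init\<close>
  are the three sampling events. \<open>m\<close> is the bound of the form, not the number of
  samples. \<open>\<rho>\<close> is the radius around \<open>X\<close> within which tangent spaces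
  may be exchanged, and \<open>t\<close> is the spectral error of the rescaled sample.\<close>

locale rcg_setup =
  fixes n1 n2 n3 :: nat and X U S V :: tensor and rs :: "nat list" and \<sigma> p m \<delta> k1 k2 \<rho> t :: real
    and \<Omega> :: "(nat \<times> nat \<times> nat) list"
  assumes n3: "n3 > 0" and X: "X \<in> tensors n1 n2 n3" and sk: "is_skinny_tsvd X U S V" and rs: "rs = rank_t X"
    and \<sigma>: "\<sigma> > 0" "\<And>i k. (i, k) \<in> ridx rs \<Longrightarrow> \<sigma> \<le> dct S ! k $$ (i, i)"
    and p: "p > 0" and m: "m \<ge> 1" and \<delta>: "0 < \<delta>" "\<delta> \<le> 1/1600" and k: "0 \<le> k1" "k1 < 1" "0 \<le> k2" "k1 * k2 + 4 * \<delta> * k2 \<le> 1/3"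
    and \<rho>: "0 < \<rho>" "4 * m * \<rho> \<le> \<delta> * \<sigma>"
    and rip: "\<And>Z. Z \<in> blks n1 n2 n3 \<Longrightarrow> tproj (iota U * adj (iota U)) (iota V * adj (iota V)) Z = Z \<Longrightarrow>
      \<bar>(Z \<bullet> samp n1 n2 n3 \<Omega> Z) / p - Z \<bullet> Z\<bar> \<le> \<delta> * (Z \<bullet> Z)"
    and mult: "\<And>Z. Z \<bullet> samp n1 n2 n3 \<Omega> Z \<le> p * m\<^sup>2 * (norm Z)\<^sup>2"
    and init: "opb ((1 / p) *\<^sub>R samp n1 n2 n3 \<Omega> (iota X) - iota X) t" "4 * t * sqrt (real (sum_list rs)) \<le> \<rho>"
begin

abbreviation "tX \<equiv> iota X"
abbreviation "R \<equiv> samp n1 n2 n3 \<Omega>"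
definition "PU = iota U * adj (iota U)"
definition "PV = iota V * adj (iota V)"

sublocale psd_form R p m
  by (rule psd_form.intro[OF samp_linear samp_sym samp_psd p m mult])

lemmas skf = skinny_iota[OF X n3 sk, folded rs]
lemma dims: "nrows X = n1" "ncols X = n2" "length X = n3" using tensors_dims[OF X n3] by auto
lemma len: "length rs = n3" using rank_t_length[OF X n3] by (simp add: rs)

lemma skinny_projs:
  assumes Z: "Z \<in> tensors n1 n2 n3" "rank_t Z = rs" and sk: "is_skinny_tsvd Z U' S' V'"
  defines "P \<equiv> iota U' * adj (iota U')" and "Q \<equiv> iota V' * adj (iota V')"
  shows "proj P" "proj Q" "P * iota Z = iota Z" "iota Z * Q = iota Z" "norm P = sqrt (real (sum_list rs))"
    "norm Q = sqrt (real (sum_list rs))" "P \<in> blks n1 n1 n3" "Q \<in> blks n2 n2 n3"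
proof -
  note f = skinny_iota[OF Z(1) n3 sk, unfolded Z(2)]
  note u = partial_isometry[OF f(3) finite_ridx] and v = partial_isometry[OF f(4) finite_ridx]
  show "proj P" "proj Q" using u v by (simp_all add: P_def Q_def)
  show "P * iota Z = iota Z" "iota Z * Q = iota Z" using factor_facts(1,2)[OF f(3,4,5) finite_ridx] by (simp_all add: P_def Q_def)
  show "norm P = sqrt (real (sum_list rs))" "norm Q = sqrt (real (sum_list rs))"
    using u(6) v(6) unfolding P_def Q_def card_ridx[symmetric] by (metis norm_ge_zero real_sqrt_unique)+
  show "P \<in> blks n1 n1 n3" "Q \<in> blks n2 n2 n3" unfolding P_def Q_def
    using blks_mult[OF iota_blks[OF f(1) n3] blks_adj[OF iota_blks[OF f(1) n3]] n3] blks_mult[OF iota_blks[OF f(2) n3] blks_adj[OF iota_blks[OF f(2) n3]] n3] by auto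
qed

lemmas XP = skinny_projs[OF X rs[symmetric] sk, folded PU_def PV_def]

lemma pinv: "\<exists>Y. PU = tX * Y \<and> PV = Y * tX \<and> tX * Y * tX = tX \<and> opb Y (1 / \<sigma>)"
  unfolding PU_def PV_def
  by (rule factor_facts(3)[OF skf(3,4,5) finite_ridx \<sigma>(1)]) (use \<sigma>(2) in auto)

text \<open>The range projections move linearly with the error, while the normal part of
  \<open>X\<close> is quadratic in it. The row space case is the column space case for
  adjoints.\<close>

lemma close_projs:
  assumes Z: "Z \<in> tensors n1 n2 n3" "rank_t Z = rs" and sk: "is_skinny_tsvd Z U' S' V'"
  shows "norm (iota U' * adj (iota U') - PU) \<le> 2 * norm (tX - iota Z) / \<sigma>"
    "norm (iota V' * adj (iota V') - PV) \<le> 2 * norm (tX - iota Z) / \<sigma>"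
    "norm (tX - tproj (iota U' * adj (iota U')) (iota V' * adj (iota V')) tX) \<le> (norm (tX - iota Z))\<^sup>2 / \<sigma>"
proof -
  note f = skinny_projs[OF Z sk]
  obtain Y where Y: "PU = tX * Y" "PV = Y * tX" "tX * Y * tX = tX" "opb Y (1 / \<sigma>)" using pinv by blast
  have "norm (PU - iota U' * adj (iota U')) \<le> 2 * (1 / \<sigma> * norm (tX - iota Z))"
    by (rule proj_perturb[OF XP(1) f(1) _ f(3) Y(1,4)]) (use XP(5) f(5) in simp)
  then show "norm (iota U' * adj (iota U') - PU) \<le> 2 * norm (tX - iota Z) / \<sigma>" by (simp add: norm_minus_commute)
  have "norm (PV - iota V' * adj (iota V')) \<le> 2 * (1 / \<sigma> * norm (adj tX - adj (iota Z)))"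
  proof (rule proj_perturb[OF XP(2) f(2)])
    show "norm PV = norm (iota V' * adj (iota V'))" using XP f by simp
    show "iota V' * adj (iota V') * adj (iota Z) = adj (iota Z)"
      using arg_cong[OF f(4), of adj] proj_adj[OF f(2)] by simp
    show "PV = adj tX * adj Y" using arg_cong[OF Y(2), of adj] proj_adj[OF XP(2)] by simp
    show "opb (adj Y) (1 / \<sigma>)" by (rule opb_adj[OF Y(4)])
  qed
  also have "norm (adj tX - adj (iota Z)) = norm (tX - iota Z)" by (metis adj_diff norm_adj)
  finally show "norm (iota V' * adj (iota V') - PV) \<le> 2 * norm (tX - iota Z) / \<sigma>" by (simp add: norm_minus_commute)
  show "norm (tX - tproj (iota U' * adj (iota U')) (iota V' * adj (iota V')) tX) \<le> (norm (tX - iota Z))\<^sup>2 / \<sigma>"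
    using tproj_residual[OF f(1,2,3,4) Y(3,4)] by simp
qed

lemma \<rho>\<sigma>: "\<rho> < \<sigma>"
proof -
  have "4 * \<rho> \<le> 4 * m * \<rho>" using m \<rho> by simp
  also have "\<dots> \<le> \<delta> * \<sigma>" by (rule \<rho>(2))
  also have "\<dots> \<le> 1 * \<sigma>" using \<delta> \<sigma> by (intro mult_right_mono) auto
  finally show ?thesis using \<rho> by simp
qed

text \<open>The abstract step carried over to tensors. Near isometry at \<open>Z\<close> holds with
  \<open>4 * \<delta>\<close>, whence \<open>40 * \<delta>\<close> and \<open>20 * \<delta>\<close>;
  the \<open>1/3\<close> is the assumed bound on \<open>k1 * k2 + 4 * \<delta> * k2\<close>.\<close>

lemma iteration:
  assumes Z: "Z \<in> tensors n1 n2 n3" "rank_t Z = rs" and near: "norm (tX - iota Z) \<le> \<rho>"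
    and D: "D \<in> tensors n1 n2 n3"
    and PG: "PG = tangent_proj Z (sampling_op \<Omega> (tsub X Z))" and PW: "PW = tangent_proj Z D"
    and b: "b = 0 \<or> (tinner PW (sampling_op \<Omega> PW) \<noteq> 0 \<and> b = - (tinner PG (sampling_op \<Omega> PW) / tinner PW (sampling_op \<Omega> PW)) \<and>
        \<bar>tinner PG PW\<bar> / (fnorm PG * fnorm PW) \<le> k1 \<and> fnorm PG \<le> k2 * fnorm PW)"
    and Q: "Q = tadd PG (tscale b PW)"
    and \<alpha>: "\<alpha> = tinner PG (tangent_proj Z Q) / tinner (tangent_proj Z Q) (sampling_op \<Omega> (tangent_proj Z Q))"
  shows "Q \<in> tensors n1 n2 n3" "norm (iota Q) \<le> (1 + 20 * \<delta>) * p * norm (tX - iota Z)"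
    "tadd Z (tscale \<alpha> Q) \<in> tensors n1 n2 n3"
    "norm (tX - iota (tadd Z (tscale \<alpha> Q))) \<le> 40 * \<delta> * norm (tX - iota Z) + 1/3 / (1 - 4 * \<delta>) * (norm (iota D) / p)"
    "PG = tzero n1 n2 n3 \<Longrightarrow> tX = iota Z"
    "PG \<noteq> tzero n1 n2 n3 \<Longrightarrow> tinner (tangent_proj Z Q) (sampling_op \<Omega> (tangent_proj Z Q)) \<noteq> 0"
proof -
  define E where "E = tX - iota Z"
  obtain U' S' V' where sk': "is_skinny_tsvd Z U' S' V'"
    and tp: "\<And>A. A \<in> tensors n1 n2 n3 \<Longrightarrow> tangent_proj Z A \<in> tensors n1 n2 n3 \<and>
       iota (tangent_proj Z A) = tproj (iota U' * adj (iota U')) (iota V' * adj (iota V')) (iota A)"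
    using iota_tangent_proj[OF Z(1) n3 skinny_tsvd_exists[OF Z(1) n3]] by blast
  define P' Q' where "P' = iota U' * adj (iota U')" and "Q' = iota V' * adj (iota V')"
  note f = skinny_projs[OF Z sk', folded P'_def Q'_def] and cp = close_projs[OF Z sk', folded P'_def Q'_def E_def]
  define Pr where "Pr = btproj n1 n2 n3 P' Q'"
  define PX where "PX = btproj n1 n2 n3 PU PV"
  have Prid: "Pr A = tproj P' Q' A" if "A \<in> blks n1 n2 n3" for A
    unfolding Pr_def by (rule btproj_id[OF f(7,8) n3 that])
  have PXid: "PX A = tproj PU PV A" if "A \<in> blks n1 n2 n3" for A
    unfolding PX_def by (rule btproj_id[OF XP(7,8) n3 that])
  have Prb: "Pr A \<in> blks n1 n2 n3" for A by (simp add: Pr_def btproj_def bk_blks)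
  have PXb: "PX A \<in> blks n1 n2 n3" for A by (simp add: PX_def btproj_def bk_blks)
  have TXZ: "tsub X Z \<in> tensors n1 n2 n3" using X Z by blast
  have iE: "iota (tsub X Z) = E" using iota_tsub[OF X Z(1) n3] by (simp add: E_def)
  note so = sampling_op_iota[OF _ n3]
  have PGt: "PG \<in> tensors n1 n2 n3" and iPG: "iota PG = tproj P' Q' (R E)"
    using tp[of "sampling_op \<Omega> (tsub X Z)"] so[OF TXZ] iE by (auto simp: PG P'_def Q'_def)
  have RE: "R E \<in> blks n1 n2 n3" using so[OF TXZ] iota_blks n3 iE by metis
  have PWt: "PW \<in> tensors n1 n2 n3" and iPW: "iota PW = tproj P' Q' (iota D)"
    using tp[OF D] by (auto simp: PW P'_def Q'_def)
  show Qt: "Q \<in> tensors n1 n2 n3" unfolding Q using PGt PWt by blast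
  define w where "w = iota PW"
  define G where "G = iota PG"
  define q where "q = G + b *\<^sub>R w"
  have iQ: "iota Q = q" unfolding Q q_def G_def w_def
    using iota_tadd[OF PGt tscale_tensors[OF PWt] n3] iota_tscale[OF PWt n3] by simp
  have GPr: "G = Pr (R E)" using Prid[OF RE] iPG by (simp add: G_def)
  have idem: "Pr (Pr A) = Pr A" for A unfolding Pr_def by (rule btproj_idem[OF f(7,8) n3 f(1,2)])
  have Prs: "Pr A \<bullet> B = A \<bullet> Pr B" for A B unfolding Pr_def by (rule btproj_sym[OF f(1,2)])
  have wPr: "Pr w = w"
    using Prid[OF iota_blks[OF D n3]] idem[of "iota D"] iPW by (simp add: w_def)
  have e0: "norm E \<ge> 0" by simp
  have close: "norm (A - PX A) \<le> (4 * norm E / \<sigma>) * norm A" if "Pr A = A" for A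
  proof -
    have Ab: "A \<in> blks n1 n2 n3" using Prb[of A] that by simp
    have "norm (A - PX A) = norm (tproj P' Q' A - tproj PU PV A)" using that Prid[OF Ab] PXid[OF Ab] by simp
    also have "\<dots> \<le> (norm (P' - PU) + norm (Q' - PV)) * norm A" by (rule tproj_diff[OF f(1) XP(2)])
    also have "\<dots> \<le> (2 * norm E / \<sigma> + 2 * norm E / \<sigma>) * norm A"
      using cp(1,2) by (intro mult_right_mono add_mono) auto
    finally show ?thesis by simp
  qed
  have m4: "m * (4 * norm E / \<sigma>) \<le> \<delta>"
  proof -
    have "m * (4 * norm E) \<le> m * (4 * \<rho>)" using near m by (intro mult_left_mono) (auto simp: E_def)
    also have "\<dots> \<le> \<delta> * \<sigma>" using \<rho>(2) by (simp add: mult_ac)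
    finally show ?thesis using \<sigma> by (simp add: field_simps)
  qed
  have ripZ: "\<bar>B A A - A \<bullet> A\<bar> \<le> 4 * \<delta> * (A \<bullet> A)" if "Pr A = A" for A
  proof (rule rip_transfer[where PX = PX and \<eta> = "4 * norm E / \<sigma>"])
    show "PX (PX A) = PX A" unfolding PX_def by (rule btproj_idem[OF XP(7,8) n3 XP(1,2)])
    show "PX a \<bullet> c = a \<bullet> PX c" for a c unfolding PX_def by (rule btproj_sym[OF XP(1,2)])
    show "\<bar>B Y Y - Y \<bullet> Y\<bar> \<le> \<delta> * (Y \<bullet> Y)" if "PX Y = Y" for Y
    proof -
      have "Y \<in> blks n1 n2 n3" using PXb[of Y] that by simp
      then show ?thesis using rip[of Y] PXid[of Y] that by (simp add: B_def PU_def PV_def)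
    qed
  qed (use close[OF that] m4 \<sigma> \<delta> in auto)
  have perp: "norm (E - Pr E) \<le> norm E / \<sigma> * norm E"
  proof -
    have Eb: "E \<in> blks n1 n2 n3" unfolding E_def by (intro blks_arith iota_blks X Z n3)
    \<comment> \<open>\<open>Z\<close> lies in its own tangent space, so \<open>E\<close> and
      \<open>tX\<close> have the same normal part.\<close>
    have "iota Z - tproj P' Q' (iota Z) = 0" using f(3,4) by (simp add: tproj_def)
    then have "E - tproj P' Q' E = tX - tproj P' Q' tX"
      by (simp add: E_def linear_diff[OF linear_tproj])
    then show ?thesis using cp(3) Prid[OF Eb] by (simp add: power2_eq_square)
  qed
  have mt: "m * (norm E / \<sigma>) \<le> 4 * \<delta>" 
  proof -
    have "4 * (m * (norm E / \<sigma>)) \<le> \<delta>" using m4 by (simp add: mult_ac)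
    then show ?thesis using \<delta> by linarith
  qed
  have in1: "tinner A (sampling_op \<Omega> A') = iota A \<bullet> R (iota A')" if "A \<in> tensors n1 n2 n3" "A' \<in> tensors n1 n2 n3" for A A'
    using so[OF that(2)] iota_inner[OF that(1) _ n3, of "sampling_op \<Omega> A'"] by simp
  have in2: "tinner PG PW = G \<bullet> w" "fnorm PG = norm G" "fnorm PW = norm w"
    using iota_inner[OF PGt PWt n3] iota_norm[OF PGt n3] iota_norm[OF PWt n3] by (simp_all add: G_def w_def)
  \<comment> \<open>If the denominator is 0, the angle quotient is 0 by convention and tells
    nothing, but then both sides of the multiplied form vanish.\<close>
  have bb: "b = 0 \<or> (w \<bullet> R w \<noteq> 0 \<and> b = - (G \<bullet> R w / (w \<bullet> R w)) \<and> \<bar>G \<bullet> w\<bar> \<le> k1 * (norm G * norm w) \<and> norm G \<le> k2 * norm w)"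
  proof -
    have "\<bar>G \<bullet> w\<bar> \<le> k1 * (norm G * norm w)" if "\<bar>G \<bullet> w\<bar> / (norm G * norm w) \<le> k1"
    proof (cases "norm G * norm w = 0")
      case False
      then have "norm G * norm w > 0" by simp
      then show ?thesis using that by (simp only: pos_divide_le_eq)
    qed auto
    then show ?thesis using b unfolding in2 in1[OF PWt PWt] in1[OF PGt PWt] G_def[symmetric] w_def[symmetric] by blast
  qed
  have d4: "0 \<le> 4 * \<delta>" "4 * \<delta> \<le> 1/100" and t0: "0 \<le> norm E / \<sigma>" using \<delta> \<sigma> by auto
  note A = linear_btproj[of n1 n2 n3 P' Q', folded Pr_def] idem Prs ripZ d4 perp mt t0 wPr k(1,2,3) GPr q_def bb
  have Pq: "Pr q = q" by (rule in_T(3)[OF A])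
  have tQ: "tangent_proj Z Q \<in> tensors n1 n2 n3" "iota (tangent_proj Z Q) = q"
    using tp[OF Qt] Prid[OF iota_blks[OF Qt n3]] Pq iQ by (auto simp: P'_def Q'_def)
  have \<alpha>': "\<alpha> = G \<bullet> q / (q \<bullet> R q)"
    unfolding \<alpha> in1[OF tQ(1) tQ(1)] tQ(2) using iota_inner[OF PGt tQ(1) n3] by (simp add: G_def tQ(2))
  show "norm (iota Q) \<le> (1 + 20 * \<delta>) * p * norm (tX - iota Z)"
    using direction_le[OF A] by (simp add: iQ E_def)
  show Wt: "tadd Z (tscale \<alpha> Q) \<in> tensors n1 n2 n3" using Z Qt by blast
  have "tX - iota (tadd Z (tscale \<alpha> Q)) = E - \<alpha> *\<^sub>R q"
    using iota_tadd[OF Z(1) tscale_tensors[OF Qt] n3] iota_tscale[OF Qt n3] by (simp add: E_def iQ)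
  then have "norm (tX - iota (tadd Z (tscale \<alpha> Q))) \<le> 10 * (4 * \<delta>) * norm E + (k1 * k2 + 4 * \<delta> * k2) / (1 - 4 * \<delta>) * (norm w / p)"
    using residual_le[OF A] by (simp add: \<alpha>')
  also have "\<dots> \<le> 10 * (4 * \<delta>) * norm E + 1/3 / (1 - 4 * \<delta>) * (norm (iota D) / p)"
  proof (intro add_left_mono mult_mono divide_right_mono)
    show "norm w \<le> norm (iota D)" unfolding w_def iPW by (rule tproj_norm_le[OF f(1,2)])
  qed (use k \<delta> p in auto)
  finally show "norm (tX - iota (tadd Z (tscale \<alpha> Q))) \<le> 40 * \<delta> * norm (tX - iota Z) + 1/3 / (1 - 4 * \<delta>) * (norm (iota D) / p)"
    by (simp add: E_def)
  show "tX = iota Z" if "PG = tzero n1 n2 n3"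
  proof -
    have G0: "G = 0" using iota_tzero[OF n3] that by (simp add: G_def)
    have "E = 0" by (rule gradient_zero[OF A]) (simp_all add: G0)
    then show ?thesis by (simp add: E_def)
  qed
  show "tinner (tangent_proj Z Q) (sampling_op \<Omega> (tangent_proj Z Q)) \<noteq> 0" if "PG \<noteq> tzero n1 n2 n3"
  proof -
    have G0: "G \<noteq> 0" using iota_inject[OF PGt tzero_tensors n3] iota_tzero[OF n3] that by (auto simp: G_def)
    show ?thesis unfolding in1[OF tQ(1) tQ(1)] tQ(2) by (rule denom_nonzero[OF A]) (simp_all add: G0)
  qed
qed

text \<open>Best approximation and the triangle inequality give the factor 2. An error below
  \<open>\<sigma>\<close> cannot lower the rank, so the iterate stays on the manifold.\<close>

lemma threshold_step:
  assumes W: "W \<in> tensors n1 n2 n3" and ht: "is_hard_threshold rs W Y" and near: "norm (tX - iota W) < \<sigma>"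
  shows "Y \<in> tensors n1 n2 n3" "rank_t Y = rs" "norm (tX - iota Y) \<le> 2 * norm (tX - iota W)"
proof -
  note h = hard_threshold_facts[OF W n3 X sk rs ht, folded PU_def]
  show "Y \<in> tensors n1 n2 n3" by (rule h(1))
  obtain Yp where Yp: "PU = tX * Yp" "opb Yp (1 / \<sigma>)" using pinv by blast
  show "rank_t Y = rs"
  proof (rule h(3)[OF Yp(1)])
    fix T :: "(nat \<times> nat) fmat" assume T: "proj T" "(norm T)\<^sup>2 \<le> real (sum_list rs)"
    have "norm ((tX - iota W) * (Yp * T)) \<le> norm ((tX - iota W) * Yp)"
      using proj_norm_le_right(1)[OF T(1), of "(tX - iota W) * Yp"] by (simp add: mult.assoc)
    also have "\<dots> \<le> 1 / \<sigma> * norm (tX - iota W)" by (rule opb_right[OF Yp(2)])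
    also have "\<dots> < 1" using near \<sigma> by simp
    finally show "norm ((tX - iota W) * (Yp * T)) < 1" .
  qed
  have "norm (tX - iota Y) \<le> norm (tX - iota W) + norm (iota W - iota Y)"
    using norm_triangle_ineq[of "tX - iota W" "iota W - iota Y"] by simp
  then show "norm (tX - iota Y) \<le> 2 * norm (tX - iota W)" using h(2) by (simp add: norm_minus_commute)
qed

text \<open>For the rescaled sample the closeness to \<open>X\<close> is spectral. Both endpoints
  have total rank \<open>sum_list rs\<close>, which converts the spectral error \<open>t\<close>
  into the Frobenius radius \<open>\<rho>\<close>.\<close>

lemma initial_point:
  assumes ht: "is_hard_threshold rs (tscale (1 / p) (sampling_op \<Omega> X)) Y"
  shows "Y \<in> tensors n1 n2 n3" "rank_t Y = rs" "norm (tX - iota Y) \<le> \<rho>"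
proof -
  define W where "W = tscale (1 / p) (sampling_op \<Omega> X)"
  have W: "W \<in> tensors n1 n2 n3" and iW: "iota W = (1 / p) *\<^sub>R R tX"
    using sampling_op_iota[OF X n3, of \<Omega>] iota_tscale[of "sampling_op \<Omega> X" n1 n2 n3 "1 / p"] n3 by (auto simp: W_def)
  have t: "opb (iota W - tX) t" using init(1) by (simp add: iW)
  then have t0: "t \<ge> 0" by (rule opb_nonneg)
  note h = hard_threshold_facts[OF W n3 X sk rs ht[folded W_def], folded PU_def]
  show Y: "Y \<in> tensors n1 n2 n3" by (rule h(1))
  obtain Yp where Yp: "PU = tX * Yp" "opb Yp (1 / \<sigma>)" using pinv by blast
  have ts: "t * sqrt (real (sum_list rs)) < \<sigma>"
  proof -
    have "0 \<le> t * sqrt (real (sum_list rs))" using t0 by simp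
    then show ?thesis using init(2) \<rho>\<sigma> by linarith
  qed
  show rY: "rank_t Y = rs"
  proof (rule h(3)[OF Yp(1)])
    fix T :: "(nat \<times> nat) fmat" assume T: "proj T" "(norm T)\<^sup>2 \<le> real (sum_list rs)"
    have nT: "norm T \<le> sqrt (real (sum_list rs))" using T(2) by (rule real_le_rsqrt)
    have "norm ((tX - iota W) * (Yp * T)) = norm ((iota W - tX) * (Yp * T))"
      by (metis minus_diff_eq minus_mult_left norm_minus_cancel)
    also have "\<dots> \<le> t * norm (Yp * T)" by (rule opb_left[OF t])
    also have "\<dots> \<le> t * (1 / \<sigma> * norm T)" by (intro mult_left_mono opb_left[OF Yp(2)] t0)
    also have "\<dots> \<le> t * (1 / \<sigma> * sqrt (real (sum_list rs)))" using nT \<sigma> t0 by (intro mult_left_mono) auto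
    also have "\<dots> < 1" using ts \<sigma> by (simp add: field_simps)
    finally show "norm ((tX - iota W) * (Yp * T)) < 1" .
  qed
  obtain U' S' V' where sk': "is_skinny_tsvd Y U' S' V'" using skinny_tsvd_exists[OF Y n3] by blast
  note f = skinny_projs[OF Y rY sk']
  have "norm (iota Y - tX) \<le> 4 * t * sqrt (real (sum_list rs))"
    by (rule low_rank_error[OF h(2) t XP(1,3) _ f(2,4)]) (use XP(5) f(6) in auto)
  then show "norm (tX - iota Y) \<le> \<rho>" using init(2) by (simp add: norm_minus_commute)
qed

text \<open>Induction with the envelope \<open>c l\<close>. Since two past errors enter, the
  invariant also bounds the previous direction, by the previous envelope
  \<open>10/9 * c l\<close>.\<close>

lemma run_converges:
  assumes ht: "is_hard_threshold rs (tscale (1 / p) (sampling_op \<Omega> X)) (Xs 0)" and run: "is_rcg_run rs k1 k2 \<Omega> X Xs Qs"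
  shows "rcg_well_defined rs \<Omega> X Xs Qs \<and> rcg_converges X Xs"
proof -
  define e where "e l = norm (tX - iota (Xs l))" for l
  define c where "c l = \<rho> * (9/10) ^ l" for l
  have c: "0 < c l" "c l \<le> \<rho>" "c (Suc l) = 9/10 * c l" for l
    using \<rho> mult_left_mono[OF power_le_one[of "9/10 :: real" l], of \<rho>] by (auto simp: c_def)
  have step: "Qs l \<in> tensors n1 n2 n3 \<and> norm (iota (Qs l)) \<le> (1 + 20 * \<delta>) * p * e l \<and>
      (\<not> rcg_stops \<Omega> X Xs l \<longrightarrow> rcg_alpha_denom \<Omega> Xs Qs l \<noteq> 0) \<and>
      Xs (Suc l) \<in> tensors n1 n2 n3 \<and> rank_t (Xs (Suc l)) = rs \<and> e (Suc l) \<le> c (Suc l)"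
    if Xl: "Xs l \<in> tensors n1 n2 n3" "rank_t (Xs l) = rs" "e l \<le> c l"
      and Dl: "prev_dir X Qs l \<in> tensors n1 n2 n3" "norm (iota (prev_dir X Qs l)) \<le> (1 + 20 * \<delta>) * p * (10/9 * c l)" for l
  proof -
    have near: "norm (tX - iota (Xs l)) \<le> \<rho>" using Xl(3) c(2)[of l] by (simp add: e_def)
    define b where "b = rcg_beta k1 k2 \<Omega> X Xs Qs l"
    define PG where "PG = tangent_proj (Xs l) (sampling_op \<Omega> (tsub X (Xs l)))"
    define PW where "PW = tangent_proj (Xs l) (prev_dir X Qs l)"
    have Ql: "Qs l = tadd PG (tscale b PW)"
      using run by (simp add: is_rcg_run_def b_def PG_def PW_def proj_grad_def)
    have bb: "b = 0 \<or> (tinner PW (sampling_op \<Omega> PW) \<noteq> 0 \<and> b = - (tinner PG (sampling_op \<Omega> PW) / tinner PW (sampling_op \<Omega> PW)) \<and>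
        \<bar>tinner PG PW\<bar> / (fnorm PG * fnorm PW) \<le> k1 \<and> fnorm PG \<le> k2 * fnorm PW)"
      unfolding b_def rcg_beta_def Let_def PG_def PW_def proj_grad_def by auto
    define \<alpha> where "\<alpha> = rcg_alpha \<Omega> X Xs Qs l"
    have \<alpha>: "\<alpha> = tinner PG (tangent_proj (Xs l) (Qs l)) / tinner (tangent_proj (Xs l) (Qs l)) (sampling_op \<Omega> (tangent_proj (Xs l) (Qs l)))"
      by (simp add: \<alpha>_def rcg_alpha_def rcg_alpha_denom_def PG_def proj_grad_def Let_def)
    note it = iteration[OF Xl(1,2) near Dl(1) PG_def PW_def bb Ql \<alpha>]
    have stops: "rcg_stops \<Omega> X Xs l \<longleftrightarrow> PG = tzero n1 n2 n3" by (simp add: rcg_stops_def proj_grad_def PG_def dims)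
    \<comment> \<open>The current error contributes \<open>1/40\<close> and the previous direction
      \<open>4/10\<close>; doubling \<open>45/100\<close> gives the rate
      \<open>9/10\<close>.\<close>
    have dW: "norm (tX - iota (tadd (Xs l) (tscale \<alpha> (Qs l)))) \<le> 45/100 * c l"
    proof -
      have 1: "40 * \<delta> * e l \<le> 1/40 * c l" using \<delta> Xl(3) c(1)[of l] by (intro mult_mono) (auto simp: e_def)
      have "1/3 / (1 - 4 * \<delta>) * (norm (iota (prev_dir X Qs l)) / p) \<le> 1/3 / (399/400) * ((1 + 20/1600) * (10/9 * c l))"
      proof (rule mult_mono)
        show "1/3 / (1 - 4 * \<delta>) \<le> (1/3 / (399/400) :: real)" using \<delta> by (intro divide_left_mono) auto
        have "norm (iota (prev_dir X Qs l)) / p \<le> (1 + 20 * \<delta>) * (10/9 * c l)" using Dl(2) p by (simp add: field_simps)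
        also have "\<dots> \<le> (1 + 20/1600) * (10/9 * c l)" using \<delta> c(1)[of l] by (intro mult_right_mono) auto
        finally show "norm (iota (prev_dir X Qs l)) / p \<le> (1 + 20/1600) * (10/9 * c l)" .
      qed (use p in auto)
      also have "\<dots> \<le> 4/10 * c l" using c(1)[of l] by simp
      finally show ?thesis using it(4) 1 c(1)[of l] by (simp add: e_def)
    qed
    have next': "Xs (Suc l) \<in> tensors n1 n2 n3 \<and> rank_t (Xs (Suc l)) = rs \<and> e (Suc l) \<le> c (Suc l)"
    proof (cases "rcg_stops \<Omega> X Xs l")
      case True
      then have "Xs (Suc l) = Xs l" using run by (simp add: is_rcg_run_def)
      moreover have "e l = 0" using it(5) True stops by (simp add: e_def)
      ultimately show ?thesis using Xl c(1)[of "Suc l"] by (simp add: e_def)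
    next
      case False
      have "if rcg_stops \<Omega> X Xs l then Xs (Suc l) = Xs l
          else is_hard_threshold rs (tadd (Xs l) (tscale (rcg_alpha \<Omega> X Xs Qs l) (Qs l))) (Xs (Suc l))"
        using run unfolding is_rcg_run_def by blast
      then have ht: "is_hard_threshold rs (tadd (Xs l) (tscale \<alpha> (Qs l))) (Xs (Suc l))"
        using False by (simp add: \<alpha>_def)
      have "norm (tX - iota (tadd (Xs l) (tscale \<alpha> (Qs l)))) < \<sigma>" using dW c[of l] \<rho>\<sigma> by linarith
      from threshold_step[OF it(3) ht this] show ?thesis using dW c(3)[of l] by (simp add: e_def)
    qed
    show ?thesis using it(1,2) it(6) stops next' by (simp add: e_def rcg_alpha_denom_def Let_def)
  qed
  have inv: "Xs l \<in> tensors n1 n2 n3 \<and> rank_t (Xs l) = rs \<and> e l \<le> c l \<and> prev_dir X Qs l \<in> tensors n1 n2 n3 \<and>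
      norm (iota (prev_dir X Qs l)) \<le> (1 + 20 * \<delta>) * p * (10/9 * c l)" for l
  proof (induction l)
    case 0
    have "prev_dir X Qs 0 = tzero n1 n2 n3" by (simp add: prev_dir_def dims)
    moreover have "0 \<le> (1 + 20 * \<delta>) * p * (10/9 * c 0)" using \<delta> p c(1)[of 0] by (intro mult_nonneg_nonneg) auto
    ultimately show ?case using initial_point[OF ht] iota_tzero[OF n3] by (auto simp: e_def c_def)
  next
    case (Suc l)
    then have s: "Qs l \<in> tensors n1 n2 n3" "norm (iota (Qs l)) \<le> (1 + 20 * \<delta>) * p * e l"
      "Xs (Suc l) \<in> tensors n1 n2 n3" "rank_t (Xs (Suc l)) = rs" "e (Suc l) \<le> c (Suc l)" using step by blast+
    have "(1 + 20 * \<delta>) * p * e l \<le> (1 + 20 * \<delta>) * p * c l" using Suc \<delta> p by (intro mult_left_mono) auto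
    then have "norm (iota (Qs l)) \<le> (1 + 20 * \<delta>) * p * c l" using s(2) by linarith
    moreover have "c l = 10/9 * c (Suc l)" using c(3)[of l] by simp
    ultimately have "norm (iota (Qs l)) \<le> (1 + 20 * \<delta>) * p * (10/9 * c (Suc l))" by (metis (no_types))
    then show ?case using s by (simp add: prev_dir_def)
  qed
  have "rcg_well_defined rs \<Omega> X Xs Qs"
    unfolding rcg_well_defined_def fixed_rank_manifold_def dims using inv step len by auto
  moreover have "rcg_converges X Xs"
  proof -
    have "(\<lambda>l. c l) \<longlonglongrightarrow> \<rho> * 0" unfolding c_def by (intro tendsto_mult tendsto_const LIMSEQ_power_zero) simp
    then have c0: "c \<longlonglongrightarrow> 0" by simp
    have f: "fnorm (tsub (Xs l) X) = e l" for l
      using iota_norm[OF tsub_tensors[of "Xs l" n1 n2 n3 X] n3] iota_tsub[of "Xs l" n1 n2 n3 X] inv[of l] X n3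
      by (simp add: e_def norm_minus_commute)
    show ?thesis unfolding rcg_converges_def f
      by (rule tendsto_sandwich[OF _ _ tendsto_const c0]) (use inv in \<open>auto simp: e_def intro!: always_eventually\<close>)
  qed
  ultimately show ?thesis ..
qed

end

text \<open>Ties leave a choice at every thresholding, so the run is built by dependent choice. Step
  \<open>l\<close> reads its sequences at \<open>l\<close> and \<open>l - 1\<close>, so constant
  sequences can stand for the unfinished run.\<close>

lemma rcg_run_exists:
  "\<exists>Xs Qs. is_hard_threshold rs W (Xs 0) \<and> is_rcg_run rs k1 k2 \<Omega> X Xs Qs"
proof -
  define qf where "qf l z d = tadd (proj_grad \<Omega> X (\<lambda>_. z) l) (tscale (rcg_beta k1 k2 \<Omega> X (\<lambda>_. z) (\<lambda>_. d) l) (tangent_proj z (prev_dir X (\<lambda>_. d) l)))" for l z d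
  define nxt where "nxt l z q z' = (if rcg_stops \<Omega> X (\<lambda>_. z) l then z' = z
     else is_hard_threshold rs (tadd z (tscale (rcg_alpha \<Omega> X (\<lambda>_. z) (\<lambda>_. q) l) q)) z')" for l z q z'
  obtain Y0 where Y0: "is_hard_threshold rs W Y0" using hard_threshold_exists by blast
  have ex: "\<exists>z'. nxt l z q z'" for l z q unfolding nxt_def using hard_threshold_exists by auto
  have "\<exists>f. \<forall>n. (n = 0 \<longrightarrow> f n = (Y0, qf 0 Y0 Y0)) \<and>
     (nxt n (fst (f n)) (snd (f n)) (fst (f (Suc n))) \<and> snd (f (Suc n)) = qf (Suc n) (fst (f (Suc n))) (snd (f n)))"
  proof (rule dependent_nat_choice)
    show "\<exists>s. 0 = 0 \<longrightarrow> s = (Y0, qf 0 Y0 Y0)" by blast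
    fix s and n :: nat
    obtain z' where "nxt n (fst s) (snd s) z'" using ex by blast
    then show "\<exists>s'. (Suc n = 0 \<longrightarrow> s' = (Y0, qf 0 Y0 Y0)) \<and> nxt n (fst s) (snd s) (fst s') \<and> snd s' = qf (Suc n) (fst s') (snd s)"
      by (intro exI[of _ "(z', qf (Suc n) z' (snd s))"]) simp
  qed
  then obtain f where f0: "f 0 = (Y0, qf 0 Y0 Y0)" and fn: "\<And>n. nxt n (fst (f n)) (snd (f n)) (fst (f (Suc n)))"
    and fq: "\<And>n. snd (f (Suc n)) = qf (Suc n) (fst (f (Suc n))) (snd (f n))" by metis
  define Xs Qs where "Xs l = fst (f l)" and "Qs l = snd (f l)" for l
  have pd: "prev_dir X Qs l = prev_dir X (\<lambda>_. Qs (l - 1)) l" for l by (simp add: prev_dir_def)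
  have pg: "proj_grad \<Omega> X Xs l = proj_grad \<Omega> X (\<lambda>_. Xs l) l" for l by (simp add: proj_grad_def)
  have be: "rcg_beta k1 k2 \<Omega> X Xs Qs l = rcg_beta k1 k2 \<Omega> X (\<lambda>_. Xs l) (\<lambda>_. Qs (l - 1)) l" for l
    by (simp add: rcg_beta_def pd[of l] pg[of l])
  have q: "Qs l = tadd (proj_grad \<Omega> X Xs l) (tscale (rcg_beta k1 k2 \<Omega> X Xs Qs l) (tangent_proj (Xs l) (prev_dir X Qs l)))" for l
  proof (cases l)
    case 0
    then show ?thesis using f0 by (simp add: qf_def Xs_def Qs_def proj_grad_def rcg_beta_def prev_dir_def Let_def)
  next
    case (Suc n)
    then show ?thesis using fq[of n] by (simp add: qf_def be[of "Suc n"] pd[of "Suc n"] pg[of "Suc n"] Xs_def[symmetric] Qs_def[symmetric])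
  qed
  have "rcg_alpha \<Omega> X Xs Qs l = rcg_alpha \<Omega> X (\<lambda>_. Xs l) (\<lambda>_. Qs l) l" "rcg_stops \<Omega> X Xs l = rcg_stops \<Omega> X (\<lambda>_. Xs l) l" for l
    by (simp_all add: rcg_alpha_def rcg_alpha_denom_def rcg_stops_def proj_grad_def)
  then have "is_rcg_run rs k1 k2 \<Omega> X Xs Qs"
    unfolding is_rcg_run_def using q fn by (auto simp: nxt_def Xs_def[symmetric] Qs_def[symmetric])
  moreover have "is_hard_threshold rs W (Xs 0)" using Y0 f0 by (simp add: Xs_def)
  ultimately show ?thesis by blast
qed

lemma (in rcg_setup) rcg_succeeds: "rcg_succeeds rs k1 k2 p X \<Omega>"
  unfolding rcg_succeeds_def Let_def using rcg_run_exists run_converges by blast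

section \<open>Probability of a good sample\<close>

text \<open>A single position \<open>(i, j)\<close> repeated in every slice with weights
  \<open>f\<close>: the common shape of transformed unit tensors and of the transformed column
  basis.\<close>

definition tb :: "nat \<Rightarrow> nat \<Rightarrow> nat \<Rightarrow> (nat \<Rightarrow> real) \<Rightarrow> (nat \<times> nat) fmat" where
  "tb n3 i j f = mk ({i} \<times> {..<n3}) ({j} \<times> {..<n3}) (\<lambda>p q. if snd p = snd q then f (snd p) else 0)"

lemma ent_tb: "ent (tb n3 i j f) (a, k) (b, l) = (if a = i \<and> b = j \<and> k = l \<and> k < n3 then f k else 0)"
  by (auto simp: tb_def ent_mk)
lemma ent_tb': "ent (tb n3 i j f) (a, k) (b, l) = (if k = l then if a = i \<and> b = j \<and> k < n3 then f k else 0 else 0)"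
  by (simp add: ent_tb)
lemma adj_tb: "adj (tb n3 i j f) = tb n3 j i f"
  by (rule fmat_pair_eqI) (auto simp: ent_tb)
lemma iota_unit_tb: "i < n1 \<Longrightarrow> j < n2 \<Longrightarrow> k < n3 \<Longrightarrow> iota (unit_tensor n1 n2 n3 (i, j, k)) = tb n3 i j (\<lambda>l. dc n3 l k)"
  by (rule fmat_pair_eqI) (auto simp: ent_iota_unit ent_tb)

lemma column_basis_tb:
  assumes "n3 > 0" "i < n"
  shows "column_basis n n3 i \<in> tensors n 1 n3" "iota (column_basis n n3 i) = tb n3 i 0 (\<lambda>_. 1 / sqrt (real n3))"
proof -
  define Ms :: tensor where "Ms = replicate n3 (mat n 1 (\<lambda>(a,_). if a = i then 1 / sqrt (real n3) else 0))"
  have Ms: "Ms \<in> tensors n 1 n3" by (rule tensorsI) (auto simp: Ms_def)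
  have c: "column_basis n n3 i = idct Ms" by (simp add: column_basis_def Ms_def)
  show t: "column_basis n n3 i \<in> tensors n 1 n3" using Ms assms by (auto simp: c)
  have "iota (column_basis n n3 i) = blk n 1 Ms" using iota_blk[OF t assms(1)] dct_idct[OF Ms assms(1)] by (simp add: c)
  also have "\<dots> = tb n3 i 0 (\<lambda>_. 1 / sqrt (real n3))"
    by (rule fmat_pair_eqI, subst ent_blk[OF Ms]) (use assms in \<open>auto simp: ent_tb Ms_def\<close>)
  finally show "iota (column_basis n n3 i) = tb n3 i 0 (\<lambda>_. 1 / sqrt (real n3))" .
qed

lemma ent_tb_mult: "ent (tb n3 i j f * y) (a, l) q = (if a = i \<and> l < n3 then f l * ent y (j, l) q else 0)"
proof -
  have "ent (tb n3 i j f * y) (a, l) q = (\<Sum>r\<in>{j} \<times> {..<n3}. ent (tb n3 i j f) (a, l) r * ent y r q)"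
    by (rule ent_mult_supp) (auto simp: ent_tb split: if_splits)
  also have "\<dots> = (\<Sum>k<n3. if k = l then (if a = i then f l * ent y (j, l) q else 0) else 0)"
    unfolding sum.cartesian_product' by (simp add: ent_tb' if_distrib[of "\<lambda>x. x * _"] cong: if_cong)
  finally show ?thesis by simp
qed

lemma inner_tb: "tb n3 i j f \<bullet> A = (\<Sum>l<n3. f l * ent A (i, l) (j, l))"
proof -
  have "tb n3 i j f \<bullet> A = (\<Sum>p\<in>{i} \<times> {..<n3}. \<Sum>q\<in>{j} \<times> {..<n3}. ent (tb n3 i j f) p q * ent A p q)"
    by (rule inner_supp) (auto simp: ent_tb split: if_splits)
  also have "\<dots> = (\<Sum>l<n3. \<Sum>k<n3. if k = l then f l * ent A (i, l) (j, l) else 0)"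
    unfolding sum.cartesian_product' by (simp add: ent_tb' if_distrib[of "\<lambda>x. x * _"] cong: if_cong)
  finally show ?thesis by simp
qed

lemma norm2_proj_tb:
  assumes P: "proj P" "P \<in> blks n n n3"
  shows "(norm (P * tb n3 i j f))\<^sup>2 = (\<Sum>l<n3. (f l)\<^sup>2 * ent P (i, l) (i, l))"
proof -
  have "(norm (P * tb n3 i j f))\<^sup>2 = tb n3 i j f \<bullet> (P * tb n3 i j f)"
    using proj_inner_left[OF P(1)] by (simp add: norm2_inner)
  also have "\<dots> = (\<Sum>l<n3. f l * ent (P * tb n3 i j f) (i, l) (j, l))" by (rule inner_tb)
  also have "\<dots> = (\<Sum>l<n3. (f l)\<^sup>2 * ent P (i, l) (i, l))"
  proof (rule sum.cong[OF refl])
    fix l assume l: "l \<in> {..<n3}"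
    have "adj (P * tb n3 i j f) = tb n3 j i f * P" using proj_adj[OF P(1)] by (simp add: adj_tb)
    then have "ent (P * tb n3 i j f) (i, l) (j, l) = ent (tb n3 j i f * P) (j, l) (i, l)" by (metis ent_adj)
    also have "\<dots> = f l * ent P (i, l) (i, l)" using l by (simp add: ent_tb_mult)
    finally show "f l * ent (P * tb n3 i j f) (i, l) (j, l) = (f l)\<^sup>2 * ent P (i, l) (i, l)" by (simp add: power2_eq_square)
  qed
  finally show ?thesis .
qed

lemma proj_diag_nonneg: 
  assumes "proj P" shows "0 \<le> ent P i i"
proof -
  have "ent P i i = eu i i \<bullet> (P * eu i i)"
    using ent_mult_eu[of P i i i] inner_eu[of "P * eu i i" i i] by (simp add: inner_commute)
  also have "\<dots> = (P * eu i i) \<bullet> (P * eu i i)" by (rule proj_inner_left[OF assms, symmetric])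
  finally show ?thesis by simp
qed

text \<open>The transformed column basis has equal weight in all slices, so the squared norm in the
  incoherence condition is the slice average of the diagonal of the column space projection.\<close>

lemma incoherent_diag:
  assumes U: "U \<in> tensors n r n3" and n: "n3 > 0" "i < n" and P: "proj (iota U * adj (iota U))"
    and inc: "fnorm (ttranspose U \<star> column_basis n n3 i) \<le> sqrt c" and c: "0 \<le> c"
  shows "(\<Sum>l<n3. ent (iota U * adj (iota U)) (i, l) (i, l)) \<le> real n3 * c"
proof -
  let ?P = "iota U * adj (iota U)" let ?c = "tb n3 i 0 (\<lambda>_. 1 / sqrt (real n3))"
  have Pb: "?P \<in> blks n n n3" using blks_mult[OF iota_blks[OF U n(1)] blks_adj[OF iota_blks[OF U n(1)]] n(1)] .
  have t: "ttranspose U \<star> column_basis n n3 i \<in> tensors r 1 n3"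
    using tprod_tensors[OF ttranspose_tensors[OF U n(1)] column_basis_tb(1)[OF n] n(1)] .
  have "iota (ttranspose U \<star> column_basis n n3 i) = adj (iota U) * ?c"
    using iota_tprod[OF ttranspose_tensors[OF U n(1)] column_basis_tb(1)[OF n] n(1)] iota_ttranspose[OF U n(1)] column_basis_tb(2)[OF n]
    by simp
  then have "(fnorm (ttranspose U \<star> column_basis n n3 i))\<^sup>2 = (norm (adj (iota U) * ?c))\<^sup>2"
    using iota_norm[OF t n(1)] by simp
  also have "\<dots> = ?c \<bullet> (?P * ?c)" by (simp add: norm2_inner inner_mult_left mult.assoc)
  also have "\<dots> = (norm (?P * ?c))\<^sup>2" using proj_inner_left[OF P, of ?c ?c] by (simp add: norm2_inner)
  also have "\<dots> = (\<Sum>l<n3. (1 / sqrt (real n3))\<^sup>2 * ent ?P (i, l) (i, l))" by (rule norm2_proj_tb[OF P Pb])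
  also have "\<dots> = (\<Sum>l<n3. ent ?P (i, l) (i, l)) / real n3"
    by (simp add: power_divide sum_divide_distrib)
  finally have eq: "(fnorm (ttranspose U \<star> column_basis n n3 i))\<^sup>2 = (\<Sum>l<n3. ent ?P (i, l) (i, l)) / real n3" .
  have "0 \<le> fnorm (ttranspose U \<star> column_basis n n3 i)" by (simp add: fnorm_def tinner_def sum_nonneg)
  then have "(fnorm (ttranspose U \<star> column_basis n n3 i))\<^sup>2 \<le> c" using power_mono[OF inc, of 2] c by simp
  then have "(\<Sum>l<n3. ent ?P (i, l) (i, l)) / real n3 \<le> c" unfolding eq .
  then show ?thesis using n by (simp add: field_simps)
qed

text \<open>A unit tensor weighs the slices unequally, but no weight exceeds twice the uniform
  one.\<close>

lemma norm2_proj_unit_le: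
  assumes P: "proj P" "P \<in> blks n n n3" and d: "(\<Sum>l<n3. ent P (i, l) (i, l)) \<le> real n3 * c" and n3: "n3 > 0"
  shows "(norm (P * tb n3 i j (\<lambda>l. dc n3 l k)))\<^sup>2 \<le> 2 * c"
proof -
  have "(norm (P * tb n3 i j (\<lambda>l. dc n3 l k)))\<^sup>2 = (\<Sum>l<n3. (dc n3 l k)\<^sup>2 * ent P (i, l) (i, l))" by (rule norm2_proj_tb[OF P])
  also have "\<dots> \<le> (\<Sum>l<n3. 2 / real n3 * ent P (i, l) (i, l))"
    by (intro sum_mono mult_right_mono dc_sq_le proj_diag_nonneg P)
  also have "\<dots> = 2 / real n3 * (\<Sum>l<n3. ent P (i, l) (i, l))" by (simp only: sum_distrib_left)
  also have "\<dots> \<le> 2 / real n3 * (real n3 * c)" using d by (intro mult_left_mono) auto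
  finally show ?thesis using n3 by simp
qed

lemma samp_nth: "samp n1 n2 n3 \<Omega> Z = (\<Sum>i<length \<Omega>. (iota (unit_tensor n1 n2 n3 (\<Omega> ! i)) \<bullet> Z) *\<^sub>R iota (unit_tensor n1 n2 n3 (\<Omega> ! i)))"
  by (simp add: samp_def sum_list_sum_nth atLeast0LessThan)

lemma card_idx: "card (idx n1 n2 n3) = n1 * n2 * n3" by (simp add: card_cartesian_product)

lemma onb_unit_expand:
  assumes "n3 > 0" "Z \<in> blks n1 n2 n3"
  shows "(\<Sum>e\<in>idx n1 n2 n3. (iota (unit_tensor n1 n2 n3 e) \<bullet> Z) *\<^sub>R iota (unit_tensor n1 n2 n3 e)) = Z"
  using onb_expand[OF onb_blks[OF assms(1)] assms(2)]
  by (simp add: sum.reindex[OF inj_unit] inner_commute)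

text \<open>The random maps are of rank one along the projected unit tensors \<open>PE e\<close>,
  scaled so that their expected sum is the tangent projection. Row and column incoherence each
  contribute \<open>2 * c\<close> to the squared length of \<open>PE e\<close>, which gives the
  self-bounding constant \<open>R\<close>.\<close>

lemma rip_event:
  fixes P Q :: "(nat \<times> nat) fmat"
  assumes n: "n1 > 0" "n2 > 0" "n3 > 0" and m: "m > 0" and P: "proj P" "P \<in> blks n1 n1 n3" and Q: "proj Q" "Q \<in> blks n2 n2 n3"
    and c: "\<And>i. i < n1 \<Longrightarrow> (\<Sum>l<n3. ent P (i, l) (i, l)) \<le> real n3 * c" "\<And>j. j < n2 \<Longrightarrow> (\<Sum>l<n3. ent Q (j, l) (j, l)) \<le> real n3 * c"
    and Neq: "N = real (n1 * n2 * n3)" and R: "R = N / real m * (4 * c)" and c0: "0 \<le> c" and small: "real (2 * q) * R \<le> 1" and \<delta>: "\<delta> \<ge> 0"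
  shows "real (card {xs \<in> samples (idx n1 n2 n3) m. \<not> (\<forall>Z\<in>blks n1 n2 n3. tproj P Q Z = Z \<longrightarrow>
      \<bar>(Z \<bullet> samp n1 n2 n3 xs Z) / (real m / N) - Z \<bullet> Z\<bar> \<le> \<delta> * (Z \<bullet> Z))}) * \<delta> ^ (2 * q)
    \<le> (10 * real q * R) ^ q * (N ^ m * N)"
proof -
  let ?I = "idx n1 n2 n3" let ?H = "blks n1 n2 n3" let ?T = "tproj P Q"
  define E where "E e = iota (unit_tensor n1 n2 n3 e)" for e
  define PE where "PE e = ?T (E e)" for e
  define \<kappa> where "\<kappa> = N / real m"
  have Np: "N > 0" unfolding Neq using n by simp
  have \<kappa>: "\<kappa> > 0" using Np m by (simp add: \<kappa>_def)
  define g where "g e Z = (\<kappa> * (PE e \<bullet> Z)) *\<^sub>R PE e" for e Z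
  have Eb: "E e \<in> ?H" for e unfolding E_def by (rule iota_blks[OF unit_tensor_tensors n(3)])
  have Tb: "?T Z \<in> ?H" if "Z \<in> ?H" for Z by (rule tproj_blks[OF P(2) Q(2) that n(3)])
  have PEb: "PE e \<in> ?H" for e unfolding PE_def by (rule Tb[OF Eb])
  have sub: "subspace ?H" by (rule subspace_blks)
  have D: "onb (E ` ?I) ?H" unfolding E_def by (rule onb_blks[OF n(3)])
  interpret random_selfadj ?I g ?H "E ` ?I" m
  proof
    show "?I \<noteq> {}" using n by auto
    fix e assume "e \<in> ?I"
    show "selfadj_on ?H (g e)"
      unfolding selfadj_on_def
    proof (intro conjI ballI)
      show "linear (g e)" by (rule linearI) (simp_all add: g_def inner_add_right algebra_simps)
      show "g e ` ?H \<subseteq> ?H" by (auto simp only: g_def intro: real_vector.subspace_scale[OF sub PEb])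
      show "g e Y \<bullet> Z = Y \<bullet> g e Z" for Y Z by (simp add: g_def inner_commute)
    qed
  qed (use D in auto)
  have cI: "real (card ?I) = N" by (simp only: card_idx Neq)
  have PEZ: "PE e \<bullet> Z = E e \<bullet> ?T Z" for e Z unfolding PE_def by (rule tproj_sym[OF P(1) Q(1)])
  have PEn: "(norm (PE e))\<^sup>2 \<le> 4 * c" if eI: "e \<in> ?I" for e
  proof -
    obtain i j k where e: "e = (i, j, k)" "i < n1" "j < n2" "k < n3" using eI by auto
    have Et: "E e = tb n3 i j (\<lambda>l. dc n3 l k)" unfolding E_def e(1) by (rule iota_unit_tb[OF e(2-4)])
    have "norm (E e * Q) = norm (Q * tb n3 j i (\<lambda>l. dc n3 l k))"
      using proj_adj[OF Q(1)] norm_adj[of "E e * Q"] by (simp add: Et adj_tb)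
    then have "(norm (PE e))\<^sup>2 \<le> (norm (P * tb n3 i j (\<lambda>l. dc n3 l k)))\<^sup>2 + (norm (Q * tb n3 j i (\<lambda>l. dc n3 l k)))\<^sup>2"
      using tproj_norm2_le[OF P(1) Q(1), of "E e"] by (simp add: PE_def Et)
    also have "\<dots> \<le> 2 * c + 2 * c"
      by (rule add_mono[OF norm2_proj_unit_le[OF P c(1)[OF e(2)] n(3)] norm2_proj_unit_le[OF Q c(2)[OF e(3)] n(3)]])
    finally show ?thesis by simp
  qed
  have R0: "R \<ge> 0" using R Np c0 by simp
  have gR: "(norm (g e Z))\<^sup>2 \<le> R * (Z \<bullet> g e Z)" if "e \<in> ?I" for e Z
  proof -
    have "(norm (g e Z))\<^sup>2 = \<kappa> * (PE e \<bullet> Z)\<^sup>2 * (\<kappa> * (norm (PE e))\<^sup>2)"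
      by (simp add: g_def power_mult_distrib) (simp add: power2_eq_square)
    also have "\<dots> \<le> \<kappa> * (PE e \<bullet> Z)\<^sup>2 * R"
      using PEn[OF that] \<kappa> by (intro mult_left_mono) (auto simp: R \<kappa>_def[symmetric])
    also have "\<dots> = R * (Z \<bullet> g e Z)" by (simp add: g_def power2_eq_square inner_commute)
    finally show ?thesis .
  qed
  have mk: "real m / N * \<kappa> = 1" using Np m by (simp add: \<kappa>_def)
  have mean: "real m / real (card ?I) * (\<Sum>e\<in>?I. Z \<bullet> g e Z) \<le> (norm Z)\<^sup>2" if Z: "Z \<in> ?H" for Z
  proof -
    have "real m / real (card ?I) * (\<Sum>e\<in>?I. Z \<bullet> g e Z) = (\<Sum>e\<in>?I. (real m / N * \<kappa>) * (E e \<bullet> ?T Z)\<^sup>2)"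
      unfolding cI by (simp add: g_def sum_distrib_left PEZ[symmetric] inner_commute[of Z] power2_eq_square mult_ac)
    also have "\<dots> = (\<Sum>b\<in>E ` ?I. (?T Z \<bullet> b)\<^sup>2)"
      unfolding mk using inj_unit[of n1 n2 n3] by (simp add: E_def sum.reindex inner_commute)
    also have "\<dots> = (norm (?T Z))\<^sup>2" using onb_norm2[OF D Tb[OF Z]] by simp
    also have "\<dots> \<le> (norm Z)\<^sup>2" by (intro power_mono tproj_norm_le P Q) simp
    finally show ?thesis .
  qed
  have dv: "Z \<bullet> dev xs Z = (Z \<bullet> samp n1 n2 n3 xs Z) / (real m / N) - Z \<bullet> Z"
    if Z: "Z \<in> ?H" "?T Z = Z" and xs: "xs \<in> samples ?I m" for xs Z
  proof -
    have "(\<Sum>e\<in>?I. g e Z) = \<kappa> *\<^sub>R (\<Sum>e\<in>?I. (E e \<bullet> Z) *\<^sub>R ?T (E e))"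
      using Z(2) PEZ by (simp add: g_def PE_def scaleR_sum_right)
    also have "(\<Sum>e\<in>?I. (E e \<bullet> Z) *\<^sub>R ?T (E e)) = ?T (\<Sum>e\<in>?I. (E e \<bullet> Z) *\<^sub>R E e)"
      by (simp add: linear_sum[OF linear_tproj] linear_cmul[OF linear_tproj])
    also have "\<dots> = Z" using onb_unit_expand[OF n(3) Z(1)] Z(2) by (simp add: E_def)
    finally have 1: "(\<Sum>e\<in>?I. g e Z) = \<kappa> *\<^sub>R Z" .
    have "Z \<bullet> (\<Sum>i<m. g (xs ! i) Z) = \<kappa> * (\<Sum>i<m. (E (xs ! i) \<bullet> Z)\<^sup>2)"
      using Z(2) PEZ[of _ Z] by (simp add: g_def inner_sum_right sum_distrib_left power2_eq_square inner_commute[of Z] mult.assoc)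
    also have "(\<Sum>i<m. (E (xs ! i) \<bullet> Z)\<^sup>2) = Z \<bullet> samp n1 n2 n3 xs Z"
      using xs by (simp add: samp_nth samples_def E_def inner_sum_right power2_eq_square inner_commute)
    finally have 2: "Z \<bullet> (\<Sum>i<m. g (xs ! i) Z) = \<kappa> * (Z \<bullet> samp n1 n2 n3 xs Z)" .
    show ?thesis unfolding dev_def cI 1 inner_add_right 2 using mk m Np
      by (simp add: \<kappa>_def)
  qed
  have "{xs \<in> samples ?I m. \<not> (\<forall>Z\<in>?H. ?T Z = Z \<longrightarrow> \<bar>(Z \<bullet> samp n1 n2 n3 xs Z) / (real m / N) - Z \<bullet> Z\<bar> \<le> \<delta> * (Z \<bullet> Z))}
    \<subseteq> {xs \<in> samples ?I m. \<not> (\<forall>Z\<in>?H. norm (dev xs Z) \<le> \<delta> * norm Z)}"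
  proof (intro subsetI CollectI conjI notI)
    fix xs assume xs: "xs \<in> {xs \<in> samples ?I m. \<not> (\<forall>Z\<in>?H. ?T Z = Z \<longrightarrow> \<bar>(Z \<bullet> samp n1 n2 n3 xs Z) / (real m / N) - Z \<bullet> Z\<bar> \<le> \<delta> * (Z \<bullet> Z))}"
    then show "xs \<in> samples ?I m" by simp
    assume a: "\<forall>Z\<in>?H. norm (dev xs Z) \<le> \<delta> * norm Z"
    have "\<bar>(Z \<bullet> samp n1 n2 n3 xs Z) / (real m / N) - Z \<bullet> Z\<bar> \<le> \<delta> * (Z \<bullet> Z)" if "Z \<in> ?H" "?T Z = Z" for Z
    proof -
      have "\<bar>Z \<bullet> dev xs Z\<bar> \<le> norm Z * norm (dev xs Z)" by (rule Cauchy_Schwarz_ineq2)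
      also have "\<dots> \<le> norm Z * (\<delta> * norm Z)" using a that by (intro mult_left_mono) auto
      also have "\<dots> = \<delta> * (Z \<bullet> Z)" by (simp add: power2_norm_eq_inner[symmetric] power2_eq_square)
      finally show ?thesis using dv[OF that] xs by simp
    qed
    then show False using xs by blast
  qed
  then have "card {xs \<in> samples ?I m. \<not> (\<forall>Z\<in>?H. ?T Z = Z \<longrightarrow> \<bar>(Z \<bullet> samp n1 n2 n3 xs Z) / (real m / N) - Z \<bullet> Z\<bar> \<le> \<delta> * (Z \<bullet> Z))}
    \<le> card {xs \<in> samples ?I m. \<not> (\<forall>Z\<in>?H. norm (dev xs Z) \<le> \<delta> * norm Z)}"
    by (intro card_mono) auto
  then have "real (card {xs \<in> samples ?I m. \<not> (\<forall>Z\<in>?H. ?T Z = Z \<longrightarrow> \<bar>(Z \<bullet> samp n1 n2 n3 xs Z) / (real m / N) - Z \<bullet> Z\<bar> \<le> \<delta> * (Z \<bullet> Z))}) * \<delta> ^ (2 * q)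
    \<le> moment q"
    using order_trans[OF mult_right_mono markov[OF \<delta>, of q]] \<delta> by simp
  also have "\<dots> \<le> (10 * real q * R) ^ q * (real (card ?I) ^ m * real (card (E ` ?I)))"
    by (rule moment_selfbounded[OF R0 gR mean small])
  also have "real (card (E ` ?I)) = N" unfolding cI[symmetric] E_def by (subst card_image[OF inj_unit]) simp
  finally show ?thesis unfolding cI .
qed

text \<open>A union bound over the indices with the exponential moment of a multiplicity at
  parameter 1. Its mean is at most 1 because \<open>m\<close> does not exceed the number of indices,
  so the moment is at most \<open>exp 2\<close>.\<close>

lemma count_event:
  assumes n: "n1 > 0" "n2 > 0" "n3 > 0" and Neq: "N = real (n1 * n2 * n3)" and m: "m \<le> n1 * n2 * n3"
  shows "real (card {xs \<in> samples (idx n1 n2 n3) m. \<not> (\<forall>e\<in>idx n1 n2 n3. real (count_list xs e) \<le> M)}) * exp M \<le> N ^ m * N * exp 2"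
proof -
  let ?I = "idx n1 n2 n3" let ?bad = "{xs \<in> samples ?I m. \<not> (\<forall>e\<in>?I. real (count_list xs e) \<le> M)}"
  have cI: "real (card ?I) = N" by (simp only: card_idx Neq)
  have Np: "N > 0" unfolding Neq using n by simp
  have mN: "real m \<le> N" unfolding Neq using m by (simp only: of_nat_le_iff)
  have cl: "hits {e} xs = count_list xs e" for e :: "nat \<times> nat \<times> nat" and xs
    by (induction xs) (auto simp: hits_def)
  have e1: "exp (1::real) - 1 \<le> 2" using exp_le by simp
  have "(\<Sum>xs\<in>samples ?I m. exp (1 * real (hits {e} xs))) \<le> N ^ m * exp 2" if "e \<in> ?I" for e
  proof -
    have "(\<Sum>xs\<in>samples ?I m. exp (1 * real (hits {e} xs))) \<le> N ^ m * exp (real m * real (card {e}) / N * (exp 1 - 1))"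
      unfolding cI[symmetric] by (rule sum_samples_exp_hits) (use that n in auto)
    also have "\<dots> \<le> N ^ m * exp 2"
    proof (intro mult_left_mono)
      have "real m / N * (exp 1 - 1) \<le> 1 * 2" using mN Np e1 by (intro mult_mono) auto
      then show "exp (real m * real (card {e}) / N * (exp 1 - 1)) \<le> exp 2" by simp
    qed (use Np in simp)
    finally show ?thesis .
  qed
  then have tot: "(\<Sum>e\<in>?I. \<Sum>xs\<in>samples ?I m. exp (real (count_list xs e))) \<le> (\<Sum>e\<in>?I. N ^ m * exp 2)"
    unfolding cl by (intro sum_mono) simp
  have "real (card ?bad) * exp M = (\<Sum>xs\<in>?bad. exp M)" by simp
  also have "\<dots> \<le> (\<Sum>xs\<in>?bad. \<Sum>e\<in>?I. exp (real (count_list xs e)))"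
  proof (rule sum_mono)
    fix xs assume "xs \<in> ?bad"
    then obtain e where e: "e \<in> ?I" "M < real (count_list xs e)" by force
    have "exp M \<le> exp (real (count_list xs e))" using e by simp
    also have "\<dots> \<le> (\<Sum>e\<in>?I. exp (real (count_list xs e)))" by (rule member_le_sum[OF e(1)]) auto
    finally show "exp M \<le> (\<Sum>e\<in>?I. exp (real (count_list xs e)))" .
  qed
  also have "\<dots> \<le> (\<Sum>xs\<in>samples ?I m. \<Sum>e\<in>?I. exp (real (count_list xs e)))"
    by (intro sum_mono2) (auto intro!: sum_nonneg)
  also have "\<dots> = (\<Sum>e\<in>?I. \<Sum>xs\<in>samples ?I m. exp (real (count_list xs e)))" by (rule sum.swap)
  also have "\<dots> \<le> N ^ m * N * exp 2" using tot by (simp only: sum_constant cI mult_ac)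
  finally show ?thesis .
qed

lemma norm2_columns:
  assumes "finite L" "ind C \<subseteq> L"
  shows "(norm C)\<^sup>2 = (\<Sum>q\<in>L. (norm (C * eu q c))\<^sup>2)"
proof -
  have "(norm (C * eu q c))\<^sup>2 = (\<Sum>p\<in>L. (ent C p q)\<^sup>2)" for q
  proof -
    have "eu q c \<in> colsp c {q}" by (auto simp: colsp_def ent_eu split: if_splits)
    then have "C * eu q c \<in> colsp c L" by (rule mult_colsp[rotated]) (use assms(2) in \<open>auto simp: ind_def\<close>)
    then show ?thesis unfolding norm2_inner using inner_colsp[of "C * eu q c" c L "C * eu q c"] assms(1)
      by (simp add: ent_mult_eu power2_eq_square)
  qed
  then have "(\<Sum>q\<in>L. (norm (C * eu q c))\<^sup>2) = (\<Sum>p\<in>L. \<Sum>q\<in>L. (ent C p q)\<^sup>2)" by simp (rule sum.swap)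
  then show ?thesis using inner_fmat_eq[OF assms(1), of C C] assms(2) unfolding norm2_inner by (simp add: power2_eq_square)
qed

text \<open>It suffices to test vectors stored in column \<open>c\<close>: the squared Frobenius
  norm is a sum over columns, each of which can be moved there without change of norm.\<close>

lemma opb_of_columns:
  assumes A: "\<And>p q. ent A p q \<noteq> 0 \<Longrightarrow> q \<in> K" and K: "finite K" and t: "t \<ge> 0"
    and col: "\<And>z. z \<in> colsp c K \<Longrightarrow> norm (A * z) \<le> t * norm z"
  shows "opb A t"
proof (rule opb_I[OF t])
  fix B
  define C where "C = dg K (\<lambda>_. 1) * B"
  have AK: "A * dg K (\<lambda>_. 1) = A" using A K by (intro fmat_eqI) (auto simp: ent_mult_dg)
  then have AB: "A * B = A * C" by (simp add: C_def flip: mult.assoc)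
  define L where "L = ind C \<union> ind (A * C)"
  have L: "finite L" "ind C \<subseteq> L" "ind (A * C) \<subseteq> L" by (auto simp: L_def)
  have "(norm (A * C))\<^sup>2 = (\<Sum>q\<in>L. (norm (A * C * eu q c))\<^sup>2)" by (rule norm2_columns[OF L(1,3)])
  also have "\<dots> \<le> (\<Sum>q\<in>L. t\<^sup>2 * (norm (C * eu q c))\<^sup>2)"
  proof (rule sum_mono)
    fix q
    have "eu q c \<in> colsp c {q}" by (auto simp: colsp_def ent_eu split: if_splits)
    then have "C * eu q c \<in> colsp c K" by (rule mult_colsp[rotated]) (use K in \<open>auto simp: C_def ent_dg_mult split: if_splits\<close>)
    from col[OF this] have "norm (A * C * eu q c) \<le> t * norm (C * eu q c)" by (simp add: mult.assoc)
    then show "(norm (A * C * eu q c))\<^sup>2 \<le> t\<^sup>2 * (norm (C * eu q c))\<^sup>2"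
      unfolding power_mult_distrib[symmetric] by (intro power_mono) auto
  qed
  also have "\<dots> = t\<^sup>2 * (norm C)\<^sup>2" unfolding norm2_columns[OF L(1,2), of c] by (simp only: sum_distrib_left)
  also have "\<dots> \<le> t\<^sup>2 * (norm B)\<^sup>2"
    unfolding C_def using proj_norm_le(1)[OF proj_dg[OF K], of B] by (intro mult_left_mono power_mono) auto
  finally show "(norm (A * B))\<^sup>2 \<le> t\<^sup>2 * (norm B)\<^sup>2" by (simp only: AB)
qed

lemma norm2_tb_mult:
  assumes "y \<in> colsp c K"
  shows "(norm (tb n3 i j f * y))\<^sup>2 = (\<Sum>l<n3. (f l)\<^sup>2 * (ent y (j, l) c)\<^sup>2)"
proof -
  have "tb n3 i j f * y \<in> colsp c ({i} \<times> {..<n3})" by (rule mult_colsp[OF _ assms]) (auto simp: ent_tb split: if_splits)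
  then have "(norm (tb n3 i j f * y))\<^sup>2 = (\<Sum>p\<in>{i} \<times> {..<n3}. (ent (tb n3 i j f * y) p c)\<^sup>2)"
    unfolding norm2_inner by (subst inner_colsp) (auto simp: power2_eq_square)
  also have "\<dots> = (\<Sum>l<n3. (f l)\<^sup>2 * (ent y (j, l) c)\<^sup>2)"
    unfolding sum.cartesian_product' by (simp add: ent_tb_mult power_mult_distrib)
  finally show ?thesis .
qed

text \<open>Polynomial moments from exponential ones: raising \<open>1 + y \<le> exp y\<close> to
  the power \<open>q\<close> produces the parameter \<open>\<theta> = q / \<mu>\<close>, and
  \<open>\<theta> \<le> 1\<close> makes \<open>exp \<theta> - 1\<close> at most
  \<open>2 * \<theta>\<close>.\<close>

lemma hits_moment:
  assumes I: "finite I" "I \<noteq> {}" "A \<subseteq> I" and \<mu>: "\<mu> = real m * real (card A) / real (card I)" and q: "real q \<le> \<mu>" "0 < \<mu>"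
  shows "(\<Sum>xs\<in>samples I m. (real (hits A xs) + \<mu>) ^ q) \<le> real (card I) ^ m * (\<mu> * exp 2) ^ q"
proof -
  define \<theta> where "\<theta> = real q / \<mu>"
  have \<theta>: "0 \<le> \<theta>" "\<theta> \<le> 1" using q by (auto simp: \<theta>_def)
  have e: "exp \<theta> - 1 \<le> 2 * \<theta>"
  proof -
    have "exp \<theta> \<le> 1 + \<theta> + \<theta>\<^sup>2" by (rule exp_bound[OF \<theta>])
    moreover have "\<theta>\<^sup>2 \<le> \<theta>" using \<theta> by (simp add: power2_eq_square mult_left_le)
    ultimately show ?thesis by simp
  qed
  have "(real (hits A xs) + \<mu>) ^ q \<le> \<mu> ^ q * exp (\<theta> * real (hits A xs))" for xs
  proof -
    have "real (hits A xs) + \<mu> = \<mu> * (1 + real (hits A xs) / \<mu>)" using q by (simp add: field_simps)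
    also have "\<dots> \<le> \<mu> * exp (real (hits A xs) / \<mu>)" using q by (intro mult_left_mono exp_ge_add_one_self) auto
    finally have "(real (hits A xs) + \<mu>) ^ q \<le> (\<mu> * exp (real (hits A xs) / \<mu>)) ^ q" using q by (intro power_mono) auto
    also have "\<dots> = \<mu> ^ q * exp (\<theta> * real (hits A xs))"
      by (simp add: power_mult_distrib exp_of_nat_mult[symmetric] \<theta>_def mult_ac)
    finally show ?thesis .
  qed
  then have "(\<Sum>xs\<in>samples I m. (real (hits A xs) + \<mu>) ^ q) \<le> \<mu> ^ q * (\<Sum>xs\<in>samples I m. exp (\<theta> * real (hits A xs)))"
    unfolding sum_distrib_left by (intro sum_mono)
  also have "\<dots> \<le> \<mu> ^ q * (real (card I) ^ m * exp (\<mu> * (exp \<theta> - 1)))"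
    using sum_samples_exp_hits[OF I \<theta>(1), of m] q unfolding \<mu> by (intro mult_left_mono) auto
  also have "\<dots> \<le> \<mu> ^ q * (real (card I) ^ m * exp (\<mu> * (2 * \<theta>)))"
    using e q by (intro mult_left_mono) auto
  also have "\<mu> * (2 * \<theta>) = real q * 2" using q by (simp add: \<theta>_def)
  finally show ?thesis by (simp add: power_mult_distrib exp_of_nat_mult mult_ac)
qed

text \<open>Supplies the basis of the product space on which the self-adjoint dilation acts.\<close>

lemma onb_Times:
  assumes B: "onb B H" and B': "onb B' H'"
  shows "onb ((\<lambda>b. (b, 0)) ` B \<union> (\<lambda>b. (0, b)) ` B') (H \<times> H')"
  unfolding onb_def
proof
  have nz: "b \<noteq> 0" if "b \<in> B" for b using onset_norm[OF onb_onset[OF B] that] by auto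
  have nz': "b \<noteq> 0" if "b \<in> B'" for b using onset_norm[OF onb_onset[OF B'] that] by auto
  show "onset ((\<lambda>b. (b, 0)) ` B \<union> (\<lambda>b. (0, b)) ` B')"
    using onb_onset[OF B] onb_onset[OF B'] nz nz' by (auto simp: onset_def split: if_splits) blast+
  let ?f = "\<lambda>b. (b, 0)" and ?f' = "\<lambda>b. (0, b)"
  have sH: "span B = H" "span B' = H'" using B B' by (auto simp: onb_def)
  have l: "linear ?f" "linear ?f'" by (auto intro!: linearI)
  show "span (?f ` B \<union> ?f' ` B') = H \<times> H'"
  proof
    have "subspace (H \<times> H')"
      using onb_subspace[OF B] onb_subspace[OF B'] unfolding real_vector.subspace_def by (auto simp: zero_prod_def)
    moreover have "0 \<in> H" "0 \<in> H'" using onb_subspace[OF B] onb_subspace[OF B'] real_vector.subspace_0 by auto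
    ultimately show "span (?f ` B \<union> ?f' ` B') \<subseteq> H \<times> H'"
      using onb_mem[OF B] onb_mem[OF B'] by (intro span_minimal) auto
    show "H \<times> H' \<subseteq> span (?f ` B \<union> ?f' ` B')"
    proof
      fix w assume "w \<in> H \<times> H'"
      then have w: "fst w \<in> span B" "snd w \<in> span B'" unfolding sH by auto
      have "?f (fst w) \<in> span (?f ` B)" using w(1) unfolding span_linear_image[OF l(1)] by blast
      moreover have "?f' (snd w) \<in> span (?f' ` B')" using w(2) unfolding span_linear_image[OF l(2)] by blast
      ultimately have "?f (fst w) + ?f' (snd w) \<in> span (?f ` B \<union> ?f' ` B')"
        by (intro span_add) (use span_mono[of _ "?f ` B \<union> ?f' ` B'"] in blast)+
      then show "w \<in> span (?f ` B \<union> ?f' ` B')" by simp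
    qed
  qed
qed

lemma sum_of_bool_hits:
  "xs \<in> samples I m \<Longrightarrow> (\<Sum>i<m. if xs ! i \<in> A then a else 0) = a * real (hits A xs)"
proof -
  have "(\<Sum>i<length xs. if xs ! i \<in> A then a else 0) = (\<Sum>x\<leftarrow>xs. if x \<in> A then a else 0)"
    by (simp add: sum_list_sum_nth atLeast0LessThan)
  also have "\<dots> = a * real (hits A xs)" by (induction xs) (auto simp: hits_def algebra_simps)
  finally show "xs \<in> samples I m \<Longrightarrow> ?thesis" by (auto simp: samples_def)
qed

text \<open>The self-adjoint dilation of the rectangular matrix \<open>A\<close> turns the deviation of its operator
  norm into a moment of a random self-adjoint map.\<close>

lemma init_event:
  assumes n: "n1 > 0" "n2 > 0" "n3 > 0" and m: "m > 0" and Neq: "N = real (n1 * n2 * n3)"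
    and X: "X \<in> tensors n1 n2 n3" and a: "\<And>i j k. i < n1 \<Longrightarrow> j < n2 \<Longrightarrow> k < n3 \<Longrightarrow> \<bar>X ! k $$ (i, j)\<bar> \<le> a"
    and q: "q > 0" "real q * real (max n1 n2) \<le> real m" and t: "t \<ge> 0"
    and A0: "A0 = (N / real m * a)\<^sup>2 * (2 / real n3)"
  shows "real (card {xs \<in> samples (idx n1 n2 n3) m. \<not> opb ((1 / (real m / N)) *\<^sub>R samp n1 n2 n3 xs (iota X) - iota X) t}) * t ^ (2 * q)
    \<le> real (2 * q) ^ q * (real ((n1 + n2) * n3) * (N ^ m * (A0 * (real m / real (min n1 n2) * exp 2)) ^ q))"
proof -
  let ?I = "idx n1 n2 n3"
  define c :: "nat \<times> nat" where "c = (0, 0)"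
  define K1 where "K1 = {..<n1} \<times> {..<n3}"
  define K2 where "K2 = {..<n2} \<times> {..<n3}"
  define E where "E e = iota (unit_tensor n1 n2 n3 e)" for e
  define \<kappa> where "\<kappa> e = N / real m * (E e \<bullet> iota X)" for e
  \<comment> \<open>The dilation of one term of the rescaled sample: \<open>E e\<close> and its
    adjoint exchange the two components.\<close>
  define g where "g e w = \<kappa> e *\<^sub>R (E e * snd w, adj (E e) * fst w)" for e and w :: "(nat \<times> nat) fmat \<times> (nat \<times> nat) fmat"
  let ?H1 = "colsp c K1" and ?H2 = "colsp c K2"
  let ?b1 = "\<lambda>p. (eu p c, 0::(nat \<times> nat) fmat)" and ?b2 = "\<lambda>p. (0::(nat \<times> nat) fmat, eu p c)"
  define D where "D = ?b1 ` K1 \<union> ?b2 ` K2"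
  have finK: "finite K1" "finite K2" by (auto simp: K1_def K2_def)
  have Np: "N > 0" unfolding Neq using n by simp
  have cI: "real (card ?I) = N" by (simp only: card_idx Neq)
  have a0: "a \<ge> 0" using a[of 0 0 0] n by force
  have A0p: "A0 \<ge> 0" by (simp add: A0)
  have eu0: "eu p c \<noteq> 0" for p by (metis ent_eu ent_zero zero_neq_one)
  have euinj: "eu p c = eu p' c \<longleftrightarrow> p = p'" for p p' by (metis ent_eu zero_neq_one)
  have D: "onb D (?H1 \<times> ?H2)"
    using onb_Times[OF onb_colsp[OF finK(1), of c] onb_colsp[OF finK(2), of c]] by (simp add: D_def image_image)
  have Eb: "E e \<in> blks n1 n2 n3" for e unfolding E_def by (rule iota_blks[OF unit_tensor_tensors n(3)])
  have EK: "ent (E e) p q \<noteq> 0 \<Longrightarrow> p \<in> K1 \<and> q \<in> K2" for e p q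
    using Eb[of e] by (cases p; cases q) (auto simp: blks_def K1_def K2_def)
  have E1: "E e * z \<in> ?H1" if "z \<in> ?H2" for e z by (rule mult_colsp[OF _ that]) (use EK in blast)
  have E2: "adj (E e) * y \<in> ?H2" if "y \<in> ?H1" for e y by (rule mult_colsp[OF _ that]) (use EK in auto)
  interpret random_selfadj ?I g "?H1 \<times> ?H2" D m
  proof
    show "?I \<noteq> {}" using n by auto
    fix e assume "e \<in> ?I"
    show "selfadj_on (?H1 \<times> ?H2) (g e)"
      unfolding selfadj_on_def
    proof (intro conjI ballI)
      show "linear (g e)" by (rule linearI) (simp_all add: g_def algebra_simps)
      show "g e ` (?H1 \<times> ?H2) \<subseteq> ?H1 \<times> ?H2"
        by (rule image_subsetI) (auto simp only: g_def scaleR_Pair mem_Times_iff fst_conv snd_conv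
            intro!: real_vector.subspace_scale[OF subspace_colsp] E1 E2)
      show "g e Y \<bullet> Z = Y \<bullet> g e Z" for Y Z
        using inner_mult_left[of "E e" "snd Y" "fst Z"] inner_mult_left[of "adj (E e)" "fst Y" "snd Z"]
        by (simp add: g_def inner_prod_def algebra_simps)
    qed
  qed (use D in auto)
  \<comment> \<open>The basis vectors that \<open>e\<close> touches: its row index in the first
    component and its column index in the second, in every slice. On these the squared image is
    dominated with weight \<open>A0\<close>, the diagonal form that the moment bound
    expects.\<close>
  define rs where "rs e = ?b1 ` ({fst e} \<times> {..<n3}) \<union> ?b2 ` ({fst (snd e)} \<times> {..<n3})" for e :: "nat \<times> nat \<times> nat"
  define v where "v e x = (if x \<in> rs e then A0 else 0)" for e x
  have b12: "?b1 p \<noteq> ?b2 p'" for p p' using eu0 by auto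
  have rsD: "rs e \<subseteq> D" if "e \<in> ?I" for e using that by (auto simp: rs_def D_def K1_def K2_def)
  have rssum: "(\<Sum>x\<in>rs e. h x) = (\<Sum>l<n3. h (?b1 (fst e, l))) + (\<Sum>l<n3. h (?b2 (fst (snd e), l)))"
    for e and h :: "(nat \<times> nat) fmat \<times> (nat \<times> nat) fmat \<Rightarrow> real"
  proof -
    have i: "inj_on ?b1 S" "inj_on ?b2 S" for S using euinj by (auto simp: inj_on_def)
    have "(\<Sum>x\<in>rs e. h x) = sum h (?b1 ` ({fst e} \<times> {..<n3})) + sum h (?b2 ` ({fst (snd e)} \<times> {..<n3}))"
      unfolding rs_def by (rule sum.union_disjoint) (use b12 in auto)
    also have "\<dots> = (\<Sum>l<n3. h (?b1 (fst e, l))) + (\<Sum>l<n3. h (?b2 (fst (snd e), l)))"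
      unfolding sum.reindex[OF i(1)] sum.reindex[OF i(2)] by (simp add: sum.cartesian_product')
    finally show ?thesis .
  qed
  have gv: "(norm (g e w))\<^sup>2 \<le> (\<Sum>x\<in>D. v e x * (w \<bullet> x)\<^sup>2)" if e: "e \<in> ?I" and w: "w \<in> ?H1 \<times> ?H2" for e w
  proof -
    obtain i j k where e': "e = (i, j, k)" "i < n1" "j < n2" "k < n3" using e by auto
    obtain y z where w': "w = (y, z)" "y \<in> ?H1" "z \<in> ?H2" using w by auto
    have Et: "E e = tb n3 i j (\<lambda>l. dc n3 l k)" unfolding E_def e'(1) by (rule iota_unit_tb[OF e'(2-4)])
    have EX: "E e \<bullet> iota X = X ! k $$ (i, j)"
      using iota_inner[OF unit_tensor_tensors X n(3)] tinner_unit[OF X e'(2-4)] by (simp add: E_def e'(1))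
    have "(\<kappa> e)\<^sup>2 \<le> (N / real m * a)\<^sup>2"
      unfolding abs_le_square_iff[symmetric] using a[OF e'(2-4)] Np a0 
      by (simp add: \<kappa>_def EX abs_mult mult_left_mono divide_right_mono)
    then have \<kappa>: "(\<kappa> e)\<^sup>2 * (2 / real n3) \<le> A0" unfolding A0 by (intro mult_right_mono) auto
    have le: "(\<Sum>l<n3. (dc n3 l k)\<^sup>2 * f l) \<le> 2 / real n3 * (\<Sum>l<n3. f l)" if "\<And>l. 0 \<le> f l" for f
      unfolding sum_distrib_left by (intro sum_mono mult_right_mono dc_sq_le that)
    have "(norm (g e w))\<^sup>2 = (\<kappa> e)\<^sup>2 * ((norm (E e * z))\<^sup>2 + (norm (adj (E e) * y))\<^sup>2)"
      by (simp add: g_def w' power_mult_distrib norm_Pair distrib_left)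
    also have "\<dots> \<le> (\<kappa> e)\<^sup>2 * (2 / real n3 * (\<Sum>l<n3. (ent z (j, l) c)\<^sup>2) + 2 / real n3 * (\<Sum>l<n3. (ent y (i, l) c)\<^sup>2))"
      unfolding Et adj_tb norm2_tb_mult[OF w'(2)] norm2_tb_mult[OF w'(3)] by (intro mult_left_mono add_mono le) auto
    also have "\<dots> = (\<kappa> e)\<^sup>2 * (2 / real n3) * ((\<Sum>l<n3. (ent y (i, l) c)\<^sup>2) + (\<Sum>l<n3. (ent z (j, l) c)\<^sup>2))"
      by (simp add: algebra_simps)
    also have "\<dots> \<le> A0 * ((\<Sum>l<n3. (ent y (i, l) c)\<^sup>2) + (\<Sum>l<n3. (ent z (j, l) c)\<^sup>2))"
      using \<kappa> by (intro mult_right_mono) (auto intro!: add_nonneg_nonneg sum_nonneg)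
    also have "\<dots> = (\<Sum>x\<in>rs e. A0 * (w \<bullet> x)\<^sup>2)"
      unfolding rssum by (simp add: w' e' inner_eu sum_distrib_left distrib_left)
    also have "\<dots> = (\<Sum>x\<in>D. v e x * (w \<bullet> x)\<^sup>2)"
      by (rule sum.mono_neutral_cong_left) (use rsD[OF e] onb_finite[OF D] in \<open>auto simp: v_def\<close>)
    finally show ?thesis .
  qed
  have vsum: "(\<Sum>xs\<in>samples ?I m. ((\<Sum>i<m. v (xs ! i) x) + real m / real (card ?I) * (\<Sum>e\<in>?I. v e x)) ^ q)
      \<le> N ^ m * (A0 * (real m / real (min n1 n2) * exp 2)) ^ q" if x: "x \<in> D" for x
  proof -
    \<comment> \<open>The indices touching \<open>x\<close> form a horizontal or a lateral slice of
      the index box, so the mean hit count is \<open>m / n1\<close> or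
      \<open>m / n2\<close>.\<close>
    define Cx where "Cx = {e \<in> ?I. x \<in> rs e}"
    define \<mu> where "\<mu> = real m * real (card Cx) / real (card ?I)"
    have cases: "(\<exists>i<n1. Cx = {i} \<times> {..<n2} \<times> {..<n3}) \<or> (\<exists>j<n2. Cx = {..<n1} \<times> {j} \<times> {..<n3})"
    proof -
      consider i l where "x = ?b1 (i, l)" "i < n1" "l < n3" | j l where "x = ?b2 (j, l)" "j < n2" "l < n3"
        using x by (auto simp: D_def K1_def K2_def)
      then show ?thesis
      proof cases
        case 1
        then have "Cx = {i} \<times> {..<n2} \<times> {..<n3}" using euinj eu0 by (auto simp: Cx_def rs_def)
        then show ?thesis using 1 by blast
      next
        case 2
        then have "Cx = {..<n1} \<times> {j} \<times> {..<n3}" using euinj eu0[symmetric] by (auto simp: Cx_def rs_def)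
        then show ?thesis using 2 by blast
      qed
    qed
    then have "\<mu> = real m / real n1 \<or> \<mu> = real m / real n2"
      unfolding \<mu>_def card_idx using n by (auto simp: card_cartesian_product)
    moreover have "real q * real n1 \<le> real m" "real q * real n2 \<le> real m"
      using q(2) mult_left_mono[of "real n1" "real (max n1 n2)" "real q"] mult_left_mono[of "real n2" "real (max n1 n2)" "real q"] by auto
    ultimately obtain n' where n': "\<mu> = real m / real n'" "n' > 0" "real q * real n' \<le> real m" "min n1 n2 \<le> n'"
      using n by (metis min.cobounded1 min.cobounded2)
    have \<mu>: "real q \<le> \<mu>" "0 < \<mu>" unfolding n'(1) using n'(2,3) m by (simp_all add: pos_le_divide_eq)
    have \<mu>': "\<mu> \<le> real m / real (min n1 n2)"
      unfolding n'(1) using n'(4) n by (intro divide_left_mono) auto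
    have "(\<Sum>xs\<in>samples ?I m. ((\<Sum>i<m. v (xs ! i) x) + real m / real (card ?I) * (\<Sum>e\<in>?I. v e x)) ^ q)
       = (\<Sum>xs\<in>samples ?I m. A0 ^ q * (real (hits Cx xs) + \<mu>) ^ q)"
    proof (intro sum.cong refl)
      fix xs assume xs: "xs \<in> samples ?I m"
      have "(\<Sum>i<m. v (xs ! i) x) = (\<Sum>i<m. if xs ! i \<in> Cx then A0 else 0)"
        using samples_nth[OF xs] by (intro sum.cong) (auto simp: v_def Cx_def)
      also have "\<dots> = A0 * real (hits Cx xs)" by (rule sum_of_bool_hits[OF xs])
      finally have 1: "(\<Sum>i<m. v (xs ! i) x) = A0 * real (hits Cx xs)" .
      have "(\<Sum>e\<in>?I. v e x) = (\<Sum>e\<in>Cx. A0)"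
        by (rule sum.mono_neutral_cong_right) (auto simp: Cx_def v_def)
      then have 2: "real m / real (card ?I) * (\<Sum>e\<in>?I. v e x) = A0 * \<mu>" by (simp add: \<mu>_def)
      show "((\<Sum>i<m. v (xs ! i) x) + real m / real (card ?I) * (\<Sum>e\<in>?I. v e x)) ^ q = A0 ^ q * (real (hits Cx xs) + \<mu>) ^ q"
        unfolding 1 2 by (simp only: distrib_left[symmetric] power_mult_distrib)
    qed
    also have "\<dots> \<le> A0 ^ q * (N ^ m * (\<mu> * exp 2) ^ q)"
      unfolding sum_distrib_left[symmetric] cI[symmetric] using n \<mu>
      by (intro mult_left_mono hits_moment) (auto simp: \<mu>_def Cx_def A0p)
    also have "\<dots> \<le> A0 ^ q * (N ^ m * (real m / real (min n1 n2) * exp 2) ^ q)"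
      using \<mu> \<mu>' Np A0p by (intro mult_left_mono power_mono mult_right_mono) auto
    finally show ?thesis by (simp only: power_mult_distrib mult_ac)
  qed
  obtain r where r: "q = Suc r" using q(1) by (cases q) auto
  have cD: "real (card D) = real ((n1 + n2) * n3)"
  proof -
    have i: "inj_on ?b1 S" "inj_on ?b2 S" for S using euinj by (auto simp: inj_on_def)
    have "card D = card K1 + card K2" unfolding D_def
      by (subst card_Un_disjoint) (use finK b12 card_image[OF i(1)] card_image[OF i(2)] in auto)
    then show ?thesis by (simp add: K1_def K2_def card_cartesian_product algebra_simps)
  qed
  have "moment q \<le> real (2 * r + 1) ^ q * (\<Sum>xs\<in>samples ?I m. \<Sum>x\<in>D.
     ((\<Sum>i<m. v (xs ! i) x) + real m / real (card ?I) * (\<Sum>e\<in>?I. v e x)) ^ q)"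
    unfolding r by (rule moment_diag) (use gv A0p in \<open>auto simp: v_def\<close>)
  also have "\<dots> = real (2 * r + 1) ^ q * (\<Sum>x\<in>D. \<Sum>xs\<in>samples ?I m.
     ((\<Sum>i<m. v (xs ! i) x) + real m / real (card ?I) * (\<Sum>e\<in>?I. v e x)) ^ q)"
    by (subst sum.swap) (rule refl)
  also have "\<dots> \<le> real (2 * q) ^ q * (\<Sum>x\<in>D. N ^ m * (A0 * (real m / real (min n1 n2) * exp 2)) ^ q)"
  proof (rule mult_mono)
    show "real (2 * r + 1) ^ q \<le> real (2 * q) ^ q" by (rule power_mono) (auto simp: r)
    show "(\<Sum>x\<in>D. \<Sum>xs\<in>samples ?I m. ((\<Sum>i<m. v (xs ! i) x) + real m / real (card ?I) * (\<Sum>e\<in>?I. v e x)) ^ q)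
      \<le> (\<Sum>x\<in>D. N ^ m * (A0 * (real m / real (min n1 n2) * exp 2)) ^ q)" by (intro sum_mono vsum)
    show "0 \<le> (\<Sum>x\<in>D. \<Sum>xs\<in>samples ?I m. ((\<Sum>i<m. v (xs ! i) x) + real m / real (card ?I) * (\<Sum>e\<in>?I. v e x)) ^ q)"
      using A0p by (intro sum_nonneg zero_le_power add_nonneg_nonneg mult_nonneg_nonneg) (auto simp: v_def)
  qed simp
  finally have mom: "moment q \<le> real (2 * q) ^ q * (real ((n1 + n2) * n3) * (N ^ m * (A0 * (real m / real (min n1 n2) * exp 2)) ^ q))"
    by (simp only: sum_constant cD)
  let ?A = "\<lambda>xs. (1 / (real m / N)) *\<^sub>R samp n1 n2 n3 xs (iota X) - iota X"
  have good: "opb (?A xs) t" if xs: "xs \<in> samples ?I m" and dv: "\<forall>w\<in>?H1 \<times> ?H2. norm (dev xs w) \<le> t * norm w" for xs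
  proof -
    have len: "length xs = m" using xs by (simp add: samples_def)
    have "?A xs = (\<Sum>i<m. \<kappa> (xs ! i) *\<^sub>R E (xs ! i)) + (- (real m / N)) *\<^sub>R (\<Sum>e\<in>?I. \<kappa> e *\<^sub>R E e)"
    proof -
      have "(- (real m / N)) *\<^sub>R (\<Sum>e\<in>?I. \<kappa> e *\<^sub>R E e) = - (\<Sum>e\<in>?I. (E e \<bullet> iota X) *\<^sub>R E e)"
        using m Np by (simp add: scaleR_sum_right \<kappa>_def sum_negf)
      also have "\<dots> = - iota X" using onb_unit_expand[OF n(3) iota_blks[OF X n(3)]] by (simp add: E_def)
      finally have "(- (real m / N)) *\<^sub>R (\<Sum>e\<in>?I. \<kappa> e *\<^sub>R E e) = - iota X" .
      moreover have "(\<Sum>i<m. \<kappa> (xs ! i) *\<^sub>R E (xs ! i)) = (1 / (real m / N)) *\<^sub>R samp n1 n2 n3 xs (iota X)"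
        by (simp add: samp_nth len E_def \<kappa>_def scaleR_sum_right)
      ultimately show ?thesis by (simp only: diff_conv_add_uminus)
    qed
    note Aeq = this
    \<comment> \<open>On vectors \<open>(0, z)\<close> the dilation reproduces the matrix
      itself.\<close>
    have fstdev: "fst (dev xs (0, z)) = ?A xs * z" for z
      unfolding Aeq dev_def cI g_def by (simp add: fst_sum sum_distrib_right algebra_simps)
    show ?thesis
    proof (rule opb_of_columns[where K = K2 and c = c])
      have "iota X \<in> blks n1 n2 n3" by (rule iota_blks[OF X n(3)])
      moreover have "samp n1 n2 n3 xs (iota X) \<in> blks n1 n2 n3" unfolding samp_nth
        by (intro real_vector.subspace_sum real_vector.subspace_scale subspace_blks iota_blks[OF unit_tensor_tensors n(3)])
      ultimately have "?A xs \<in> blks n1 n2 n3"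
        by (intro real_vector.subspace_diff real_vector.subspace_scale subspace_blks)
      then show "ent (?A xs) p q \<noteq> 0 \<Longrightarrow> q \<in> K2" for p q by (cases p; cases q) (auto simp: blks_def K2_def)
      show "finite K2" "t \<ge> 0" by (fact finK t)+
      fix z assume z: "z \<in> ?H2"
      have "(0, z) \<in> ?H1 \<times> ?H2" using z by (auto simp: colsp_def)
      then have "norm (dev xs (0, z)) \<le> t * norm z" using dv by (force simp: norm_Pair)
      then show "norm (?A xs * z) \<le> t * norm z" unfolding fstdev[symmetric] by (metis norm_fst_le order_trans prod.collapse)
    qed
  qed
  have "card {xs \<in> samples ?I m. \<not> opb (?A xs) t}
    \<le> card {xs \<in> samples ?I m. \<not> (\<forall>w\<in>?H1 \<times> ?H2. norm (dev xs w) \<le> t * norm w)}"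
  proof (rule card_mono)
    show "{xs \<in> samples ?I m. \<not> opb (?A xs) t} \<subseteq> {xs \<in> samples ?I m. \<not> (\<forall>w\<in>?H1 \<times> ?H2. norm (dev xs w) \<le> t * norm w)}"
      using good by blast
  qed simp
  then have "real (card {xs \<in> samples ?I m. \<not> opb (?A xs) t}) * t ^ (2 * q) \<le> moment q"
    using order_trans[OF mult_right_mono markov[OF t, of q]] t by simp
  then show ?thesis using mom by linarith
qed

section \<open>Choice of the parameters and union of the exceptional events\<close>

lemma tensor_nonzero_dims:
  assumes X: "X \<in> tensors n1 n2 n3" "X \<noteq> tzero n1 n2 n3"
  shows "n1 > 0" "n2 > 0" "n3 > 0"
proof -
  have "X = tzero n1 n2 n3" if "n1 = 0 \<or> n2 = 0 \<or> n3 = 0"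
  proof (rule nth_equalityI)
    show "length X = length (tzero n1 n2 n3)" using tensorsD(1)[OF X(1)] by (simp add: tzero_def)
    fix k assume "k < length X"
    then show "X ! k = tzero n1 n2 n3 ! k"
      using tensorsD(1)[OF X(1)] tensorsD(2)[OF X(1), of k] that by (intro eq_matI) (auto simp: tzero_def)
  qed
  then have "\<not> (n1 = 0 \<or> n2 = 0 \<or> n3 = 0)" using X(2) by blast
  then show "n1 > 0" "n2 > 0" "n3 > 0" by simp_all
qed

text \<open>The first fraction is nonnegative because \<open>k1 * (1 + 4 * \<epsilon>) < 1\<close>,
  and the numerators of the others add up to
  \<open>3 * (k1 * k2 + 4 * \<epsilon> * k2)\<close>.\<close>

lemma restart_conditions:
  fixes k1 k2 \<epsilon> :: real
  assumes k: "0 \<le> k1" "0 \<le> k2" and \<epsilon>: "0 < \<epsilon>" and pos: "(1 - 4 * \<epsilon>) - k1 * (1 + 4 * \<epsilon>) > 0"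
    and \<gamma>: "(18 * \<epsilon> - 10 * k1 * \<epsilon> * (1 + 4 * \<epsilon>)) / ((1 - 4 * \<epsilon>) - k1 * (1 + 4 * \<epsilon>)) + (4 * k2 * \<epsilon> + k1 * k2) / (1 - 4 * \<epsilon>)
      + (8 * k2 * \<epsilon> + 2 * k1 * k2) / (1 - 4 * \<epsilon>) < 1"
  shows "k1 < 1" "\<epsilon> < 1/4" "k1 * k2 + 4 * \<epsilon> * k2 \<le> 1/3"
proof -
  have k1: "k1 \<le> k1 * (1 + 4 * \<epsilon>)" using mult_left_mono[of 1 "1 + 4 * \<epsilon>" k1] k \<epsilon> by simp
  show "k1 < 1" "\<epsilon> < 1/4" using k1 k \<epsilon> pos by linarith+
  have "(k1 * (1 + 4 * \<epsilon>)) * \<epsilon> \<le> 1 * \<epsilon>" using pos \<epsilon> by (intro mult_right_mono) auto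
  moreover have "10 * k1 * \<epsilon> * (1 + 4 * \<epsilon>) = 10 * ((k1 * (1 + 4 * \<epsilon>)) * \<epsilon>)" by (simp only: mult_ac)
  ultimately have "0 \<le> 18 * \<epsilon> - 10 * k1 * \<epsilon> * (1 + 4 * \<epsilon>)" using \<epsilon> by linarith
  then have "0 \<le> (18 * \<epsilon> - 10 * k1 * \<epsilon> * (1 + 4 * \<epsilon>)) / ((1 - 4 * \<epsilon>) - k1 * (1 + 4 * \<epsilon>))" using pos by simp
  then have "(4 * k2 * \<epsilon> + k1 * k2) / (1 - 4 * \<epsilon>) + (8 * k2 * \<epsilon> + 2 * k1 * k2) / (1 - 4 * \<epsilon>) < 1" using \<gamma> by linarith
  then have "(3 * (k1 * k2 + 4 * \<epsilon> * k2)) / (1 - 4 * \<epsilon>) < 1" unfolding add_divide_distrib[symmetric] by (simp add: algebra_simps)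
  then have "3 * (k1 * k2 + 4 * \<epsilon> * k2) < 1 - 4 * \<epsilon>" using \<open>\<epsilon> < 1/4\<close> by (simp add: divide_less_eq)
  moreover define y where "y = k1 * k2 + 4 * \<epsilon> * k2"
  ultimately have "y \<le> 1/3" using \<epsilon> unfolding y_def[symmetric] by linarith
  then show "k1 * k2 + 4 * \<epsilon> * k2 \<le> 1/3" by (simp only: y_def)
qed

text \<open>Rank as a sum of diagonal entries. Combined with incoherence it bounds the total rank,
  and thereby \<open>\<mu>0\<close> from below.\<close>

lemma norm2_proj_trace:
  assumes P: "proj P" "P \<in> blks n n n3"
  shows "(norm P)\<^sup>2 = (\<Sum>i<n. \<Sum>l<n3. ent P (i, l) (i, l))"
proof -
  let ?K = "{..<n} \<times> {..<n3}"
  have "ind P \<subseteq> ?K" using P(2) by (auto simp: ind_def blks_def)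
  then have "(norm P)\<^sup>2 = (\<Sum>q\<in>?K. (norm (P * eu q (0, 0)))\<^sup>2)" by (intro norm2_columns) auto
  also have "\<dots> = (\<Sum>q\<in>?K. ent P q q)"
  proof (rule sum.cong[OF refl])
    fix q
    have "(norm (P * eu q (0, 0)))\<^sup>2 = (P * eu q (0, 0)) \<bullet> eu q (0, 0)"
      using proj_inner_left[OF P(1), of "eu q (0, 0)" "eu q (0, 0)"] by (simp add: norm2_inner inner_commute)
    then show "(norm (P * eu q (0, 0)))\<^sup>2 = ent P q q" by (simp add: inner_eu ent_mult_eu)
  qed
  finally show ?thesis by (simp add: sum.cartesian_product')
qed

lemma exp_2_le: "exp (2::real) \<le> 9" and exp_3_le: "exp (3::real) \<le> 27" and exp_4_le: "exp (4::real) \<le> 81"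
proof -
  have "exp (real k) \<le> 3 ^ k" for k :: nat using power_mono[OF exp_le, of k] by (simp add: exp_of_nat_mult[of k 1, simplified])
  from this[of 2] this[of 3] this[of 4] show "exp (2::real) \<le> 9" "exp (3::real) \<le> 27" "exp (4::real) \<le> 81" by simp_all
qed

lemma ridx_bounds:
  assumes "ridx rs \<noteq> {}"
  shows "1 \<le> Max (set rs)" "1 \<le> sum_list rs" "sum_list rs \<le> length rs * Max (set rs)"
proof -
  obtain i k where ik: "k < length rs" "i < rs ! k" using assms by (auto simp: ridx_def)
  then show "1 \<le> Max (set rs)" using nth_le_Max[of k rs] by linarith
  have "card (ridx rs) > 0" using assms by (simp add: card_gt_0_iff)
  then show "1 \<le> sum_list rs" by (simp add: card_ridx)
  have "sum_list rs = (\<Sum>k<length rs. rs ! k)" by (simp add: sum_list_sum_nth atLeast0LessThan)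
  also have "\<dots> \<le> (\<Sum>k<length rs. Max (set rs))" by (intro sum_mono nth_le_Max) auto
  finally show "sum_list rs \<le> length rs * Max (set rs)" by simp
qed

text \<open>The moment order \<open>q\<close> is the logarithm of \<open>B\<close> rounded up, so
  that powers of \<open>exp (- q)\<close> beat the dimensions. The three exceptional sets have at
  most 1, 9 and 2 times \<open>N ^ m / B\<close> elements, 12 in all.\<close>

lemma sampling_events:
  assumes n: "n1 > 0" "n2 > 0" "n3 > 0" "max n1 (max n2 n3) \<ge> 2"
    and X: "X \<in> tensors n1 n2 n3" and a: "a > 0" "\<And>i j k. i < n1 \<Longrightarrow> j < n2 \<Longrightarrow> k < n3 \<Longrightarrow> \<bar>X ! k $$ (i, j)\<bar> \<le> a"
    and P: "proj P" "P \<in> blks n1 n1 n3" and Q: "proj Q" "Q \<in> blks n2 n2 n3"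
    and c: "0 \<le> c" "\<And>i. i < n1 \<Longrightarrow> (\<Sum>l<n3. ent P (i, l) (i, l)) \<le> real n3 * c" "\<And>j. j < n2 \<Longrightarrow> (\<Sum>l<n3. ent Q (j, l) (j, l)) \<le> real n3 * c"
    and m: "m > 0" "m \<le> n1 * n2 * n3"
    and N: "N = real (n1 * n2 * n3)" and B: "B = real (max n1 n2) * real n3" and L: "L = ln B"
    and \<delta>: "0 < \<delta>" "\<delta> \<le> 1" and Lm: "5/2 * L * real (max n1 n2) \<le> real m"
    and R: "27 * (100 * L * c * N) \<le> \<delta>\<^sup>2 * real m"
  obtains bad where "bad \<subseteq> samples (idx n1 n2 n3) m" "real (card bad) \<le> 12 * (N ^ m / B)"
    "\<And>xs Z. xs \<in> samples (idx n1 n2 n3) m - bad \<Longrightarrow> Z \<in> blks n1 n2 n3 \<Longrightarrow> tproj P Q Z = Z \<Longrightarrow>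
      \<bar>(Z \<bullet> samp n1 n2 n3 xs Z) / (real m / N) - Z \<bullet> Z\<bar> \<le> \<delta> * (Z \<bullet> Z)"
    "\<And>xs e. xs \<in> samples (idx n1 n2 n3) m - bad \<Longrightarrow> e \<in> idx n1 n2 n3 \<Longrightarrow> real (count_list xs e) \<le> 5 * ln (real (max n1 (max n2 n3)))"
    "\<And>xs. xs \<in> samples (idx n1 n2 n3) m - bad \<Longrightarrow>
      opb ((1 / (real m / N)) *\<^sub>R samp n1 n2 n3 xs (iota X) - iota X) (a * sqrt (810 * L * (N / real n3 / real (min n1 n2)) * (N / real m)))"
proof -
  let ?I = "idx n1 n2 n3"
  define nn where "nn = max n1 (max n2 n3)"
  define nmax where "nmax = max n1 n2"
  define nmin where "nmin = min n1 n2"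
  have pos: "nmax > 0" "nmin > 0" "nn > 0" "nmin \<le> nmax" using n by (auto simp: nmax_def nmin_def nn_def)
  have NB: "N = B * real nmin" unfolding N B by (simp add: nmax_def nmin_def max_def min_def)
  have Bn: "B = real (nmax * n3)" by (simp add: B nmax_def)
  have "nn = max nmax n3" by (simp add: nn_def nmax_def max.assoc)
  moreover have "nmax \<le> nmax * n3" "n3 \<le> nmax * n3" using pos n by simp_all
  ultimately have "nn \<le> nmax * n3" by simp
  then have "2 \<le> nmax * n3" using n(4) unfolding nn_def by linarith
  then have B2: "2 \<le> B" unfolding Bn by (simp only: numeral_le_real_of_nat_iff)
  have BN: "N > 0" "B > 0" using B2 pos by (auto simp: NB)
  have "ln 2 \<le> L" unfolding L using B2 by simp
  then have L23: "2/3 \<le> L" using ln2_ge_two_thirds by linarith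
  have expL: "exp L = B" using BN by (simp add: L)
  define q where "q = nat \<lceil>L\<rceil>"
  \<comment> \<open>Rounding up adds less than 1, which is at most \<open>3/2 * L\<close> because
    \<open>L \<ge> 2/3\<close>.\<close>
  have q: "L \<le> real q" "real q \<le> 5/2 * L" "q > 0" using L23 unfolding q_def by linarith+
  have expq: "B ^ k \<le> exp (real k * real q)" for k
  proof -
    have "B ^ k = exp (real k * L)" by (simp add: exp_of_nat_mult expL)
    then show ?thesis using q by (simp add: mult_left_mono)
  qed
  have minB: "real nmin \<le> B"
  proof -
    have "nmin \<le> nmax * n3" using pos n by (metis Suc_leI le_trans mult.right_neutral mult_le_mono2 One_nat_def)
    then show ?thesis unfolding Bn by (simp only: of_nat_le_iff)
  qed
  define bada where "bada = {xs \<in> samples ?I m. \<not> (\<forall>Z\<in>blks n1 n2 n3. tproj P Q Z = Z \<longrightarrow>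
      \<bar>(Z \<bullet> samp n1 n2 n3 xs Z) / (real m / N) - Z \<bullet> Z\<bar> \<le> \<delta> * (Z \<bullet> Z))}"
  define badb where "badb = {xs \<in> samples ?I m. \<not> (\<forall>e\<in>?I. real (count_list xs e) \<le> 5 * ln (real nn))}"
  define A0 where "A0 = (N / real m * a)\<^sup>2 * (2 / real n3)"
  \<comment> \<open>Taking \<open>exp 4\<close> where the moment bound has \<open>exp 2\<close>
    leaves \<open>exp (2 * q)\<close>, hence \<open>B\<^sup>2\<close>, against a dimension of at
    most \<open>2 * B\<close>.\<close>
  define t where "t = sqrt (2 * real q * (A0 * (real m / real nmin * exp 4)))"
  define badc where "badc = {xs \<in> samples ?I m. \<not> opb ((1 / (real m / N)) *\<^sub>R samp n1 n2 n3 xs (iota X) - iota X) t}"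
  have A0: "A0 > 0" using a BN m n by (simp add: A0_def)
  have t: "t > 0" using A0 q m pos by (simp add: t_def)
  have ca: "real (card bada) \<le> N ^ m / B"
  proof -
    define R where "R = N / real m * (4 * c)"
    have R0: "R \<ge> 0" using BN c by (simp add: R_def)
    have "10 * real q * R \<le> 25 * L * R" using q R0 by (intro mult_right_mono) auto
    also have "\<dots> = 100 * L * c * N / real m" by (simp add: R_def)
    also have "\<dots> \<le> \<delta>\<^sup>2 / 27" using R m by (simp add: field_simps)
    finally have qR: "10 * real q * R \<le> \<delta>\<^sup>2 / 27" .
    \<comment> \<open>A factor \<open>exp 3\<close> per step gains \<open>B ^ 3\<close> in total, of
      which the dimension \<open>N \<le> B * B\<close> uses two.\<close>
    have e3: "\<delta>\<^sup>2 / 27 \<le> \<delta>\<^sup>2 / exp 3" using exp_3_le by (intro divide_left_mono) auto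
    have "\<delta>\<^sup>2 \<le> 1" using \<delta> by (simp add: power_le_one)
    moreover have "real q * R \<ge> 0" using R0 by simp
    ultimately have small: "real (2 * q) * R \<le> 1" using qR by simp
    have "real (card bada) * \<delta> ^ (2 * q) \<le> (10 * real q * R) ^ q * (N ^ m * N)"
      unfolding bada_def by (rule rip_event[OF n(1-3) m(1) P Q c(2,3) N R_def c(1) small]) (use \<delta> in auto)
    also have "\<dots> \<le> (\<delta>\<^sup>2 / exp 3) ^ q * (N ^ m * N)"
      using R0 BN by (intro mult_right_mono power_mono order_trans[OF qR e3]) auto
    also have "\<dots> = \<delta> ^ (2 * q) * (N ^ m * N / exp (3 * real q))"
    proof -
      have "\<delta> ^ (2 * q) = (\<delta>\<^sup>2) ^ q" "exp (3 * real q) = exp 3 ^ q" by (simp_all add: power_mult exp_of_nat2_mult)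
      then show ?thesis by (simp only: power_divide times_divide_eq_left times_divide_eq_right)
    qed
    finally have "\<delta> ^ (2 * q) * real (card bada) \<le> \<delta> ^ (2 * q) * (N ^ m * N / exp (3 * real q))"
      by (simp only: mult.commute[of "real (card bada)"])
    then have "real (card bada) \<le> N ^ m * N / exp (3 * real q)"
      using \<delta> by (simp only: mult_le_cancel_left_pos zero_less_power)
    also have "\<dots> \<le> N ^ m * N / B ^ 3" using expq[of 3] BN by (intro divide_left_mono) auto
    also have "\<dots> \<le> N ^ m * (B * B) / B ^ 3"
      using minB BN by (intro divide_right_mono mult_left_mono) (auto simp: NB)
    also have "\<dots> = N ^ m / B" using BN by (simp add: field_simps power3_eq_cube)
    finally show ?thesis .
  qed
  have cb: "real (card badb) \<le> 9 * (N ^ m / B)"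
  proof -
    have e5: "exp (5 * ln (real nn)) = real nn ^ 5"
      using pos by (simp add: exp_of_nat_mult[of 5, simplified])
    \<comment> \<open>Five dimensions are multiplied, each at most \<open>nn\<close>; hence the
      threshold \<open>5 * ln nn\<close> for multiplicities.\<close>
    have "n1 * n2 * n3 * (nmax * n3) \<le> nn * nn * nn * (nn * nn)"
      by (intro mult_le_mono) (auto simp: nn_def nmax_def)
    then have "N * B \<le> real nn ^ 5"
      unfolding N Bn by (simp only: of_nat_mult[symmetric] of_nat_power[symmetric] of_nat_le_iff) (simp add: power_numeral_reduce)
    have "real (card badb) * exp (5 * ln (real nn)) \<le> N ^ m * N * exp 2"
      unfolding badb_def by (rule count_event[OF n(1-3) N m(2)])
    then have "real (card badb) * real nn ^ 5 \<le> N ^ m * N * exp 2" unfolding e5 .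
    moreover have "real (card badb) * (N * B) \<le> real (card badb) * real nn ^ 5"
      using \<open>N * B \<le> real nn ^ 5\<close> by (intro mult_left_mono) auto
    moreover have "N ^ m * N * exp 2 \<le> N ^ m * N * 9" using exp_2_le BN by (intro mult_left_mono) auto
    ultimately have "real (card badb) * (N * B) \<le> N ^ m * N * 9" by linarith
    then have "N * (real (card badb) * B) \<le> N * (9 * N ^ m)" by (simp add: mult_ac)
    then show ?thesis using BN by (simp add: field_simps)
  qed
  have cc: "real (card badc) \<le> 2 * (N ^ m / B)"
  proof -
    define Y where "Y = A0 * (real m / real nmin * exp 2)"
    have Y: "Y > 0" using A0 m pos by (simp add: Y_def)
    have qm: "real q * real nmax \<le> real m" 
      using mult_right_mono[OF q(2), of "real nmax"] Lm by (simp add: nmax_def)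
    have "t ^ (2 * q) = (2 * real q * (A0 * (real m / real nmin * exp 4))) ^ q"
      using t A0 by (simp add: power_mult t_def)
    also have "2 * real q * (A0 * (real m / real nmin * exp 4)) = real (2 * q) * (Y * exp 2)"
      by (simp add: Y_def exp_add[symmetric])
    also have "(real (2 * q) * (Y * exp 2)) ^ q = real (2 * q) ^ q * Y ^ q * exp (2 * real q)"
      by (simp add: power_mult_distrib exp_of_nat2_mult)
    finally have tq: "t ^ (2 * q) = real (2 * q) ^ q * Y ^ q * exp (2 * real q)" .
    have "real (card badc) * t ^ (2 * q) \<le> real (2 * q) ^ q * (real ((n1 + n2) * n3) * (N ^ m * Y ^ q))"
      unfolding badc_def Y_def nmin_def
      by (rule init_event[OF n(1-3) m(1) N X a(2) q(3) qm[unfolded nmax_def] less_imp_le[OF t] A0_def])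
    then have "real (2 * q) ^ q * Y ^ q * (real (card badc) * exp (2 * real q))
        \<le> real (2 * q) ^ q * Y ^ q * (real ((n1 + n2) * n3) * N ^ m)"
      unfolding tq by (simp only: mult_ac)
    moreover have "0 < real (2 * q) ^ q * Y ^ q" using q Y by (intro mult_pos_pos zero_less_power) auto
    ultimately have 1: "real (card badc) * exp (2 * real q) \<le> real ((n1 + n2) * n3) * N ^ m"
      by (simp only: mult_le_cancel_left_pos)
    have "(n1 + n2) * n3 \<le> 2 * (nmax * n3)" by (auto simp: nmax_def)
    then have "real ((n1 + n2) * n3) \<le> real (2 * (nmax * n3))" by (simp only: of_nat_le_iff)
    also have "\<dots> = 2 * B" by (simp add: Bn)
    finally have "real ((n1 + n2) * n3) \<le> 2 * B" .
    then have "real ((n1 + n2) * n3) * N ^ m \<le> 2 * B * N ^ m" using BN by (intro mult_right_mono) auto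
    moreover have "real (card badc) * B\<^sup>2 \<le> real (card badc) * exp (2 * real q)"
      using expq[of 2] by (intro mult_left_mono) auto
    ultimately have "real (card badc) * B\<^sup>2 \<le> 2 * B * N ^ m" using 1 by linarith
    then have "B * (real (card badc) * B) \<le> B * (2 * N ^ m)" by (simp add: power2_eq_square mult_ac)
    then show ?thesis using BN by (simp add: field_simps)
  qed
  have tle: "t \<le> a * sqrt (810 * L * (N / real n3 / real (min n1 n2)) * (N / real m))"
  proof -
    have e4: "A0 * (real m / real nmin * exp 4) \<le> A0 * (real m / real nmin * 81)"
      using exp_4_le A0 by (intro mult_left_mono) auto
    have "2 * real q \<le> 5 * L" using q by simp
    from mult_mono[OF this e4] have "2 * real q * (A0 * (real m / real nmin * exp 4)) \<le> 5 * L * (A0 * (real m / real nmin * 81))"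
      using A0 L23 by simp
    also have "\<dots> = a\<^sup>2 * (810 * L * (N / real n3 / real nmin) * (N / real m))"
    proof -
      have "A0 * real m = a\<^sup>2 * (2 * (N / real n3) * (N / real m))"
        using m by (simp add: A0_def power2_eq_square mult_ac)
      then have "5 * L * ((A0 * real m) / real nmin * 81) = a\<^sup>2 * (810 * L * (N / real n3 / real nmin) * (N / real m))"
        by (simp add: mult_ac)
      then show ?thesis by (simp only: times_divide_eq_right times_divide_eq_left mult.assoc)
    qed
    finally have "t \<le> sqrt (a\<^sup>2 * (810 * L * (N / real n3 / real nmin) * (N / real m)))" unfolding t_def by (rule real_sqrt_le_mono)
    also have "\<dots> = sqrt (a\<^sup>2) * sqrt (810 * L * (N / real n3 / real nmin) * (N / real m))" by (rule real_sqrt_mult)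
    finally have "t \<le> sqrt (a\<^sup>2) * sqrt (810 * L * (N / real n3 / real nmin) * (N / real m))" .
    moreover have "sqrt (a\<^sup>2) = a" using a(1) by simp
    ultimately show ?thesis unfolding nmin_def by metis
  qed
  show thesis
  proof (rule that[of "bada \<union> badb \<union> badc"])
    show "bada \<union> badb \<union> badc \<subseteq> samples ?I m" by (auto simp: bada_def badb_def badc_def)
    have "card (bada \<union> badb \<union> badc) \<le> card bada + card badb + card badc"
      by (meson add_mono card_Un_le le_refl order_trans)
    then have "real (card (bada \<union> badb \<union> badc)) \<le> real (card bada) + real (card badb) + real (card badc)"
      by (simp only: of_nat_add[symmetric] of_nat_le_iff)
    then show "real (card (bada \<union> badb \<union> badc)) \<le> 12 * (N ^ m / B)" using ca cb cc by linarith
    show "\<bar>(Z \<bullet> samp n1 n2 n3 xs Z) / (real m / N) - Z \<bullet> Z\<bar> \<le> \<delta> * (Z \<bullet> Z)"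
      if "xs \<in> samples ?I m - (bada \<union> badb \<union> badc)" "Z \<in> blks n1 n2 n3" "tproj P Q Z = Z" for xs Z
      using that unfolding bada_def by blast
    show "real (count_list xs e) \<le> 5 * ln (real (max n1 (max n2 n3)))"
      if "xs \<in> samples ?I m - (bada \<union> badb \<union> badc)" "e \<in> ?I" for xs e
      using that unfolding badb_def nn_def by blast
    show "opb ((1 / (real m / N)) *\<^sub>R samp n1 n2 n3 xs (iota X) - iota X) (a * sqrt (810 * L * (N / real n3 / real (min n1 n2)) * (N / real m)))"
      if xs: "xs \<in> samples ?I m - (bada \<union> badb \<union> badc)" for xs
    proof -
      have "opb ((1 / (real m / N)) *\<^sub>R samp n1 n2 n3 xs (iota X) - iota X) t"
        using xs unfolding badc_def by blast
      then show ?thesis using tle unfolding opb_def by (meson mult_right_mono norm_ge_zero order_trans)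
    qed
  qed
qed

text \<open>The first sample bound yields near isometry, the second puts the initial point within
  \<open>\<rho>\<close>. With \<open>\<delta> = \<epsilon> / 400\<close> the bound
  \<open>\<epsilon> < 1/4\<close> becomes \<open>\<delta> \<le> 1/1600\<close>.\<close>

lemma success_probability:
  assumes X: "X \<in> tensors n1 n2 n3" "X \<noteq> tzero n1 n2 n3" and sk: "is_skinny_tsvd X U S V"
    and \<mu>0: "\<mu>0 > 0" "tensor_incoherent \<mu>0 U V" and \<mu>1: "\<mu>1 > 0" "joint_incoherent \<mu>1 X"
    and n2: "max n1 (max n2 n3) \<ge> 2" and k: "0 \<le> k1" "k1 < 1" "0 \<le> k2" "k1 * k2 + 4 * \<epsilon> * k2 \<le> 1/3" and \<epsilon>: "0 < \<epsilon>" "\<epsilon> < 1/4"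
    and m: "m \<le> n1 * n2 * n3" and p: "p = real m / real (n1 * n2 * n3)"
    and B: "B = real (max n1 n2) * real n3" and L: "L = ln B"
    and I1: "10 ^ 9 * (\<mu>0 * real (rank_ct X) / \<epsilon>\<^sup>2) * (B * L) \<le> real m"
    and I2: "10 ^ 9 * (\<mu>1 * real (rank_ct X) * condition_number X / \<epsilon> * sqrt (real (min n1 n2)) * ln (real (max n1 (max n2 n3)))) * (B * sqrt L) \<le> real m"
  shows "measure_pmf.prob (uniform_samples m n1 n2 n3) {\<Omega>. rcg_succeeds (rank_t X) k1 k2 p X \<Omega>} \<ge> 1 - 12 / B"
proof -
  note n = tensor_nonzero_dims[OF X]
  let ?I = "idx n1 n2 n3"
  define rs where "rs = rank_t X"
  define r where "r = rank_ct X"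
  define \<kappa> where "\<kappa> = condition_number X"
  define N where "N = real (n1 * n2 * n3)"
  define nmin where "nmin = real (min n1 n2)"
  define ell where "ell = ln (real (max n1 (max n2 n3)))"
  define \<delta> where "\<delta> = \<epsilon> / 400"
  obtain \<sigma> where \<sigma>: "\<sigma> > 0" "\<And>i k. (i, k) \<in> ridx rs \<Longrightarrow> \<sigma> \<le> dct S ! k $$ (i, i)"
    "tspectral_norm X = \<kappa> * \<sigma>" "\<kappa> \<ge> 1"
    using smallest_singular_value[OF X(1) n(3) X(2) sk] unfolding rs_def \<kappa>_def by metis
  have len: "length rs = n3" using rank_t_length[OF X(1) n(3)] by (simp add: rs_def)
  have rmax: "r = Max (set rs)" by (simp add: r_def rs_def rank_ct_def)
  note rb = ridx_bounds[OF rank_t_nonzero[OF X(1) n(3) X(2) sk], folded rs_def, unfolded len rmax[symmetric]]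
  have pos: "N > 0" "nmin > 0" "B > 0" using n by (auto simp: N_def nmin_def B)
  have NB: "N = B * nmin" unfolding N_def B nmin_def by (simp add: max_def min_def)
  have nnB: "1 \<le> real (max n1 n2)" using n by auto
  have "max n1 (max n2 n3) \<le> max n1 n2 * n3"
  proof -
    have "max n1 (max n2 n3) = max (max n1 n2) n3" by (simp add: max.assoc)
    moreover have "a \<le> a * n3" "0 < a \<Longrightarrow> n3 \<le> a * n3" for a using n by simp_all
    moreover have "0 < max n1 n2" using n by simp
    ultimately show ?thesis by (metis max.bounded_iff)
  qed
  then have "2 \<le> max n1 n2 * n3" using n2 by linarith
  then have "2 \<le> B" unfolding B of_nat_mult[symmetric] by (simp only: numeral_le_real_of_nat_iff)
  then have "ln 2 \<le> L" unfolding L by simp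
  then have L23: "2/3 \<le> L" using ln2_ge_two_thirds by linarith
  have "(2::real) \<le> real (max n1 (max n2 n3))" using n2 by (metis of_nat_le_iff of_nat_numeral)
  then have "ln 2 \<le> ell" unfolding ell_def by simp
  then have ell: "2/3 \<le> ell" using ln2_ge_two_thirds by linarith

  note f = skinny_iota[OF X(1) n(3) sk, folded rs_def r_def]
  note u = partial_isometry[OF f(3) finite_ridx] and v = partial_isometry[OF f(4) finite_ridx]
  define P where "P = iota U * adj (iota U)"
  define Q where "Q = iota V * adj (iota V)"
  have P: "proj P" "P \<in> blks n1 n1 n3" "(norm P)\<^sup>2 = real (sum_list rs)"
    using u(5,6) blks_mult[OF iota_blks[OF f(1) n(3)] blks_adj[OF iota_blks[OF f(1) n(3)]] n(3)] by (auto simp: P_def card_ridx)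
  have Q: "proj Q" "Q \<in> blks n2 n2 n3"
    using v(5,6) blks_mult[OF iota_blks[OF f(2) n(3)] blks_adj[OF iota_blks[OF f(2) n(3)]] n(3)] by (auto simp: Q_def)
  have dU: "nrows U = n1" "ncols U = r" "length U = n3" using tensors_dims[OF f(1) n(3)] by auto
  have dV: "nrows V = n2" "ncols V = r" "length V = n3" using tensors_dims[OF f(2) n(3)] by auto
  have c1: "(\<Sum>l<n3. ent P (i, l) (i, l)) \<le> real n3 * (\<mu>0 * real r / real n1)" if "i < n1" for i
    unfolding P_def using \<mu>0 that P(1)
    by (intro incoherent_diag[OF f(1) n(3) that]) (auto simp: tensor_incoherent_def dU P_def)
  have c2: "(\<Sum>l<n3. ent Q (j, l) (j, l)) \<le> real n3 * (\<mu>0 * real r / real n2)" if "j < n2" for j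
    unfolding Q_def using \<mu>0 that Q(1)
    by (intro incoherent_diag[OF f(2) n(3) that]) (auto simp: tensor_incoherent_def dV Q_def)
  define c where "c = \<mu>0 * real r / nmin"
  have cc: "\<mu>0 * real r / real n1 \<le> c" "\<mu>0 * real r / real n2 \<le> c"
    unfolding c_def nmin_def using \<mu>0 n by (auto intro!: divide_left_mono)
  have c0: "0 \<le> c" using \<mu>0 pos by (simp add: c_def)
  have c1': "(\<Sum>l<n3. ent P (i, l) (i, l)) \<le> real n3 * c" if "i < n1" for i
    using order_trans[OF c1[OF that] mult_left_mono[OF cc(1)]] by simp
  have c2': "(\<Sum>l<n3. ent Q (i, l) (i, l)) \<le> real n3 * c" if "i < n2" for i
    using order_trans[OF c2[OF that] mult_left_mono[OF cc(2)]] by simp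
  \<comment> \<open>The total rank is at least 1 and at most the trace that incoherence allows. With
    this the first sample bound makes \<open>m\<close> exceed a multiple of
    \<open>L * max n1 n2\<close>, as the hit count moments require.\<close>
  have w: "1 \<le> \<mu>0 * real r * real n3"
  proof -
    have "real (sum_list rs) = (\<Sum>i<n1. \<Sum>l<n3. ent P (i, l) (i, l))" using norm2_proj_trace[OF P(1,2)] P(3) by simp
    also have "\<dots> \<le> (\<Sum>i<n1. real n3 * (\<mu>0 * real r / real n1))" by (intro sum_mono c1) simp
    also have "\<dots> = \<mu>0 * real r * real n3" using n by simp
    finally show ?thesis using rb(2) by linarith
  qed

  \<comment> \<open>The entry bound from joint incoherence, with the spectral norm written as
    \<open>\<kappa> * \<sigma>\<close>. The \<open>\<sigma>\<close> cancels against the one in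
    \<open>\<rho>\<close>, so that the bound on \<open>m\<close> sees the condition number.\<close>
  define a where "a = \<mu>1 * sqrt (real r / N) * (\<kappa> * \<sigma>)"
  have "0 < \<kappa>" "0 < real r" using \<sigma>(4) rb(1) by simp_all
  then have a: "a > 0" unfolding a_def using \<mu>1(1) pos(1) \<sigma>(1)
    by (intro mult_pos_pos real_sqrt_gt_zero divide_pos_pos) simp_all
  have aX: "\<bar>X ! k $$ (i, j)\<bar> \<le> a" if "i < n1" "j < n2" "k < n3" for i j k
  proof -
    note d = tensors_dims[OF X(1) n(3)]
    let ?E = "{\<bar>X ! k $$ (i, j)\<bar> | i j k. i < nrows X \<and> j < ncols X \<and> k < length X}"
    have "?E = (\<lambda>(i, j, k). \<bar>X ! k $$ (i, j)\<bar>) ` ({..<nrows X} \<times> {..<ncols X} \<times> {..<length X})" by force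
    then have "finite ?E" by simp
    then have "\<bar>X ! k $$ (i, j)\<bar> \<le> max_norm X" unfolding max_norm_def using that d by (intro Max_ge) auto
    also have "max_norm X \<le> a" using \<mu>1(2) d \<sigma>(3) by (simp add: joint_incoherent_def a_def r_def N_def mult.assoc)
    finally show ?thesis .
  qed

  have \<delta>: "0 < \<delta>" "\<delta> \<le> 1/1600" using \<epsilon> by (auto simp: \<delta>_def)
  have \<epsilon>2: "0 < \<epsilon>\<^sup>2" "\<epsilon>\<^sup>2 \<le> 1" using \<epsilon> by (auto intro: power_le_one)
  have I1': "10 ^ 9 * (\<mu>0 * real r * B * L) \<le> \<epsilon>\<^sup>2 * real m"
    using mult_left_mono[OF I1, of "\<epsilon>\<^sup>2"] \<epsilon>2 by (simp add: r_def mult_ac)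
  have Lm: "5/2 * L * real (max n1 n2) \<le> real m"
  proof -
    have h: "0 \<le> L * real (max n1 n2)" using L23 by (intro mult_nonneg_nonneg) auto
    have "5/2 * (L * real (max n1 n2)) \<le> 10 ^ 9 * (L * real (max n1 n2))" by (rule mult_right_mono[OF _ h]) simp
    then have "5/2 * L * real (max n1 n2) \<le> 10 ^ 9 * (L * real (max n1 n2))" by (simp only: mult.assoc)
    also have "\<dots> \<le> 10 ^ 9 * (L * real (max n1 n2) * (\<mu>0 * real r * real n3))"
      using mult_left_mono[OF mult_left_mono[OF w h], of "10 ^ 9"] by simp
    also have "\<dots> = 10 ^ 9 * (\<mu>0 * real r * B * L)" by (simp add: B mult_ac)
    also have "\<dots> \<le> \<epsilon>\<^sup>2 * real m" by (rule I1')
    also have "\<dots> \<le> 1 * real m" using \<epsilon>2 by (intro mult_right_mono) auto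
    finally show ?thesis by simp
  qed
  have "0 < 5/2 * L * real (max n1 n2)" using L23 nnB by simp
  then have m0: "m > 0" using Lm by linarith
  have p': "p = real m / N" by (simp add: p N_def)
  have mN: "real m \<le> N" unfolding N_def using m by (simp only: of_nat_le_iff)
  have p0: "0 < p" "p \<le> 1" using m0 pos mN by (auto simp: p')
  have R: "27 * (100 * L * c * N) \<le> \<delta>\<^sup>2 * real m"
  proof -
    have "27 * (100 * L * c * N) = 2700 * (\<mu>0 * real r * B * L)" using pos by (simp add: c_def NB)
    also have "\<dots> \<le> 10 ^ 9 * (\<mu>0 * real r * B * L) / 160000" using \<mu>0 pos L23 by simp
    also have "\<dots> \<le> \<epsilon>\<^sup>2 * real m / 160000" using I1' by (intro divide_right_mono) auto
    finally show ?thesis by (simp add: \<delta>_def power_divide)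
  qed
  \<comment> \<open>\<open>M\<close> bounds the multiplicities and \<open>mp\<close> is the
    resulting bound of the form after division by \<open>p\<close>; \<open>\<rho>\<close> is then
    the largest radius with \<open>4 * mp * \<rho> \<le> \<delta> * \<sigma>\<close>.\<close>
  define M where "M = 5 * ell"
  define mp where "mp = sqrt (M / p)"
  define \<rho> where "\<rho> = \<delta> * \<sigma> / (4 * mp)"
  define t where "t = a * sqrt (810 * L * (N / real n3 / real (min n1 n2)) * (N / real m))"
  have M1: "1 \<le> M" using ell by (simp add: M_def)
  have "1 \<le> M / p" using M1 p0 by (simp add: le_divide_eq)
  then have mp: "1 \<le> mp" "mp\<^sup>2 = M / p" by (auto simp: mp_def)
  have \<rho>: "0 < \<rho>" "4 * mp * \<rho> = \<delta> * \<sigma>" using \<delta> \<sigma> mp by (auto simp: \<rho>_def)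
  have init: "4 * t * sqrt (real (sum_list rs)) \<le> \<rho>"
  proof -
    \<comment> \<open>\<open>10 ^ 18 * (G * ell\<^sup>2)\<close> is the square of the second sample
      bound with \<open>\<epsilon>\<close> cleared. The constant \<open>1036800\<close> below is
      \<open>16 * 80 * 810\<close>: the squared factor 4, the radius with
      \<open>M = 5 * ell\<close>, and the spectral bound \<open>t\<close>.\<close>
    define G where "G = (\<mu>1 * real r * \<kappa>)\<^sup>2 * nmin * B\<^sup>2 * L"
    have G: "0 \<le> G" using pos L23 by (simp add: G_def)
    have "10 ^ 9 * ((\<mu>1 * real r * \<kappa>) * sqrt nmin * ell * (B * sqrt L)) \<le> \<epsilon> * real m"
      using mult_left_mono[OF I2, of \<epsilon>] \<epsilon> by (simp add: r_def \<kappa>_def nmin_def ell_def mult_ac)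
    then have "(10 ^ 9 * ((\<mu>1 * real r * \<kappa>) * sqrt nmin * ell * (B * sqrt L)))\<^sup>2 \<le> (\<epsilon> * real m)\<^sup>2"
      using \<mu>1 \<sigma> pos ell L23 by (intro power_mono) auto
    moreover have "(10 ^ 9 * ((\<mu>1 * real r * \<kappa>) * sqrt nmin * ell * (B * sqrt L)))\<^sup>2 = 10 ^ 18 * (G * ell\<^sup>2)"
      using pos L23 by (simp add: G_def power_mult_distrib)
    ultimately have mG: "10 ^ 18 * (G * ell\<^sup>2) \<le> (\<epsilon> * real m)\<^sup>2" by simp
    have "ell \<le> 3/2 * ell\<^sup>2" using ell by (simp add: power2_eq_square)
    then have "G * ell \<le> G * (3/2 * ell\<^sup>2)" using G by (rule mult_left_mono)
    then have mG': "1036800 * (G * ell) \<le> (\<delta> * real m)\<^sup>2" using mG mult_nonneg_nonneg[OF G zero_le_power2[of ell]]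
      by (simp add: \<delta>_def power_divide power_mult_distrib)
    have t2: "t\<^sup>2 * real m = 810 * L * real (max n1 n2) * (\<mu>1\<^sup>2 * real r * \<kappa>\<^sup>2 * \<sigma>\<^sup>2)"
    proof -
      have e: "N / real n3 / real (min n1 n2) = real (max n1 n2)" using n unfolding NB B nmin_def by simp
      have "t\<^sup>2 = a\<^sup>2 * (810 * L * real (max n1 n2) * (N / real m))"
        unfolding t_def e using L23 pos m0 by (simp add: power_mult_distrib)
      moreover have "a\<^sup>2 = \<mu>1\<^sup>2 * (real r / N) * (\<kappa>\<^sup>2 * \<sigma>\<^sup>2)" using pos by (simp add: a_def power_mult_distrib)
      ultimately show ?thesis using m0 pos by (simp add: field_simps)
    qed
    have "16 * t\<^sup>2 * real (sum_list rs) \<le> 16 * t\<^sup>2 * (real n3 * real r)"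
      using rb(3) unfolding of_nat_mult[symmetric] by (intro mult_left_mono) (auto simp only: of_nat_le_iff zero_le_power2 zero_le_numeral mult_nonneg_nonneg)
    also have "\<dots> \<le> \<delta>\<^sup>2 * \<sigma>\<^sup>2 * real m / (80 * N * ell)"
    proof -
      have "16 * t\<^sup>2 * (real n3 * real r) * (80 * N * ell) * real m = 1280 * (t\<^sup>2 * real m) * real n3 * real r * N * ell"
        by simp
      also have "\<dots> = 1036800 * (G * ell) * \<sigma>\<^sup>2"
        unfolding t2 G_def NB B by (simp add: power2_eq_square mult_ac)
      also have "\<dots> \<le> (\<delta> * real m)\<^sup>2 * \<sigma>\<^sup>2" using mG' by (intro mult_right_mono) auto
      also have "\<dots> = (\<delta>\<^sup>2 * \<sigma>\<^sup>2 * real m) * real m" by (simp add: power2_eq_square mult_ac)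
      finally have "16 * t\<^sup>2 * (real n3 * real r) * (80 * N * ell) \<le> \<delta>\<^sup>2 * \<sigma>\<^sup>2 * real m" using m0 by simp
      then show ?thesis using pos ell by (subst pos_le_divide_eq) auto
    qed
    also have "\<dots> = \<rho>\<^sup>2"
    proof -
      have "\<rho>\<^sup>2 = \<delta>\<^sup>2 * \<sigma>\<^sup>2 / (16 * (M / p))" by (simp add: \<rho>_def power_divide power_mult_distrib mp)
      then show ?thesis using p0 pos m0 by (simp add: M_def p' field_simps)
    qed
    finally have "(4 * t * sqrt (real (sum_list rs)))\<^sup>2 \<le> \<rho>\<^sup>2" by (simp add: power_mult_distrib)
    then show ?thesis using \<rho>(1) by (simp add: abs_le_square_iff[symmetric])
  qed

  obtain bad where bad: "bad \<subseteq> samples ?I m" "real (card bad) \<le> 12 * (N ^ m / B)"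
    and rip: "\<And>xs Z. xs \<in> samples ?I m - bad \<Longrightarrow> Z \<in> blks n1 n2 n3 \<Longrightarrow> tproj P Q Z = Z \<Longrightarrow>
      \<bar>(Z \<bullet> samp n1 n2 n3 xs Z) / p - Z \<bullet> Z\<bar> \<le> \<delta> * (Z \<bullet> Z)"
    and cnt: "\<And>xs e. xs \<in> samples ?I m - bad \<Longrightarrow> e \<in> ?I \<Longrightarrow> real (count_list xs e) \<le> M"
    and ini: "\<And>xs. xs \<in> samples ?I m - bad \<Longrightarrow> opb ((1 / p) *\<^sub>R samp n1 n2 n3 xs (iota X) - iota X) t"
  proof (rule sampling_events[OF n n2 X(1) a aX P(1,2) Q c0 c1' c2' m0 m N_def B L])
    show "0 < \<delta>" "\<delta> \<le> 1" using \<delta> by auto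
  qed (use Lm R in \<open>auto simp: M_def ell_def t_def p'\<close>)
  have good: "rcg_succeeds rs k1 k2 p X xs" if xs: "xs \<in> samples ?I m - bad" for xs
  proof (rule rcg_setup.rcg_succeeds, unfold_locales)
    show "n3 > 0" "X \<in> tensors n1 n2 n3" "is_skinny_tsvd X U S V" "rs = rank_t X" by (fact n X sk rs_def)+
    show "0 < \<sigma>" "\<And>i k. (i, k) \<in> ridx rs \<Longrightarrow> \<sigma> \<le> dct S ! k $$ (i, i)" by (fact \<sigma>)+
    show "0 < p" "1 \<le> mp" "0 < \<delta>" "\<delta> \<le> 1/1600" "0 \<le> k1" "k1 < 1" "0 \<le> k2" "0 < \<rho>" by (fact p0 mp \<delta> k \<rho>)+
    show "k1 * k2 + 4 * \<delta> * k2 \<le> 1/3"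
    proof -
      have "4 * \<delta> * k2 \<le> 4 * \<epsilon> * k2" using k \<epsilon> by (intro mult_right_mono) (auto simp: \<delta>_def)
      then show ?thesis using k(4) by linarith
    qed
    show "4 * mp * \<rho> \<le> \<delta> * \<sigma>" using \<rho>(2) by simp
    show "\<bar>(Z \<bullet> samp n1 n2 n3 xs Z) / p - Z \<bullet> Z\<bar> \<le> \<delta> * (Z \<bullet> Z)"
      if "Z \<in> blks n1 n2 n3" "tproj (iota U * adj (iota U)) (iota V * adj (iota V)) Z = Z" for Z
      using rip[OF xs that(1)] that(2) by (simp add: P_def Q_def)
    show "Z \<bullet> samp n1 n2 n3 xs Z \<le> p * mp\<^sup>2 * (norm Z)\<^sup>2" for Z
    proof -
      have "Z \<bullet> samp n1 n2 n3 xs Z \<le> M * (norm Z)\<^sup>2"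
        by (rule samp_bound[OF n(3)]) (use xs cnt[OF xs] M1 in \<open>auto simp: samples_def\<close>)
      then show ?thesis using mp(2) p0 by simp
    qed
    show "opb ((1 / p) *\<^sub>R samp n1 n2 n3 xs (iota X) - iota X) t" by (rule ini[OF xs])
    show "4 * t * sqrt (real (sum_list rs)) \<le> \<rho>" by (rule init)
  qed
  let ?E = "{\<Omega>. rcg_succeeds rs k1 k2 p X \<Omega>}"
  have fin: "finite (samples ?I m)" by simp
  have cs: "real (card (samples ?I m)) = N ^ m" by (simp add: card_samples card_idx N_def)
  have "N ^ m - real (card bad) = real (card (samples ?I m - bad))"
    using card_Diff_subset[OF finite_subset[OF bad(1) fin] bad(1)] card_mono[OF fin bad(1)] cs by (simp add: of_nat_diff)
  also have "\<dots> \<le> real (card (samples ?I m \<inter> ?E))"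
    unfolding of_nat_le_iff by (rule card_mono) (use good in auto)
  finally have "N ^ m * (1 - 12 / B) \<le> real (card (samples ?I m \<inter> ?E))" using bad(2) by (simp add: algebra_simps)
  then have "1 - 12 / B \<le> real (card (samples ?I m \<inter> ?E)) / N ^ m" using pos by (simp add: pos_le_divide_eq mult.commute)
  then show ?thesis unfolding prob_uniform_samples[OF n] N_def rs_def .
qed

theorem theorem4p5:
  shows "\<exists>C::real. C > 0 \<and> (\<forall>\<beta>::real. \<beta> > 1 \<longrightarrow> (\<exists>c1 c2::real. c1 > 0 \<and> c2 > 0 \<and>
    (\<forall>(n1::nat) (n2::nat) (n3::nat) (X::tensor) (U::tensor) (S::tensor) (V::tensor)
      (rs::nat list) (r::nat) (\<kappa>::real) (\<mu>0::real) (\<mu>1::real) (n::nat) (nmax::nat) (nmin::nat)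
      (k1::real) (k2::real) (\<epsilon>0::real) (\<gamma>1::real) (\<gamma>2::real) (m::nat) (p::real).
      X \<in> tensors n1 n2 n3 \<longrightarrow> X \<noteq> tzero n1 n2 n3 \<longrightarrow>
      rs = rank_t X \<longrightarrow> r = rank_ct X \<longrightarrow> \<kappa> = condition_number X \<longrightarrow>
      is_skinny_tsvd X U S V \<longrightarrow>
      \<mu>0 > 0 \<longrightarrow> tensor_incoherent \<mu>0 U V \<longrightarrow>
      \<mu>1 > 0 \<longrightarrow> joint_incoherent \<mu>1 X \<longrightarrow>
      n = max n1 (max n2 n3) \<longrightarrow> n \<ge> 2 \<longrightarrow> nmax = max n1 n2 \<longrightarrow> nmin = min n1 n2 \<longrightarrow>
      k1 \<ge> 0 \<longrightarrow> k2 \<ge> 0 \<longrightarrow> 0 < \<epsilon>0 \<longrightarrow> \<epsilon>0 < 1 \<longrightarrow>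
      (1 - 4 * \<epsilon>0) - k1 * (1 + 4 * \<epsilon>0) > 0 \<longrightarrow>
      \<gamma>1 = (18 * \<epsilon>0 - 10 * k1 * \<epsilon>0 * (1 + 4 * \<epsilon>0)) / ((1 - 4 * \<epsilon>0) - k1 * (1 + 4 * \<epsilon>0))
            + (4 * k2 * \<epsilon>0 + k1 * k2) / (1 - 4 * \<epsilon>0) \<longrightarrow>
      \<gamma>2 = (8 * k2 * \<epsilon>0 + 2 * k1 * k2) / (1 - 4 * \<epsilon>0) \<longrightarrow>
      \<gamma>1 + \<gamma>2 < 1 \<longrightarrow>
      m \<le> n1 * n2 * n3 \<longrightarrow> p = real m / (real n1 * real n2 * real n3) \<longrightarrow>
      real m \<ge> C * max (\<mu>0 * real r / \<epsilon>0\<^sup>2 * sqrt (ln (real nmax * real n3)))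
                       (\<mu>1 * real r * (1 + \<epsilon>0) * \<kappa> * sqrt \<beta> / \<epsilon>0 * sqrt (real nmin) * ln (real n))
                 * \<beta> * real nmax * real n3 * sqrt (ln (real nmax * real n3)) \<longrightarrow>
      measure_pmf.prob (uniform_samples m n1 n2 n3) {\<Omega>. rcg_succeeds rs k1 k2 p X \<Omega>}
        \<ge> 1 - c1 * (real nmax * real n3) powr (- c2))))"
proof -
  have main: "measure_pmf.prob (uniform_samples m n1 n2 n3) {\<Omega>. rcg_succeeds (rank_t X) k1 k2 (real m / (real n1 * real n2 * real n3)) X \<Omega>}
      \<ge> 1 - 12 * (real (max n1 n2) * real n3) powr (- 1)"
    if I: "real m \<ge> 10 ^ 9 * max (\<mu>0 * real (rank_ct X) / \<epsilon>\<^sup>2 * sqrt (ln (real (max n1 n2) * real n3)))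
           (\<mu>1 * real (rank_ct X) * (1 + \<epsilon>) * condition_number X * sqrt \<beta> / \<epsilon> * sqrt (real (min n1 n2)) * ln (real (max n1 (max n2 n3))))
           * \<beta> * real (max n1 n2) * real n3 * sqrt (ln (real (max n1 n2) * real n3))"
      and \<gamma>: "(18 * \<epsilon> - 10 * k1 * \<epsilon> * (1 + 4 * \<epsilon>)) / ((1 - 4 * \<epsilon>) - k1 * (1 + 4 * \<epsilon>))
            + (4 * k2 * \<epsilon> + k1 * k2) / (1 - 4 * \<epsilon>) + (8 * k2 * \<epsilon> + 2 * k1 * k2) / (1 - 4 * \<epsilon>) < 1"
      and sk: "is_skinny_tsvd X U S V" and \<beta>: "\<beta> > 1" and X: "X \<in> tensors n1 n2 n3" "X \<noteq> tzero n1 n2 n3"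
      and \<mu>0: "\<mu>0 > 0" "tensor_incoherent \<mu>0 U V" and \<mu>1: "\<mu>1 > 0" "joint_incoherent \<mu>1 X"
      and n: "max n1 (max n2 n3) \<ge> 2" and k: "k1 \<ge> 0" "k2 \<ge> 0" and \<epsilon>: "0 < \<epsilon>" "(1 - 4 * \<epsilon>) - k1 * (1 + 4 * \<epsilon>) > 0"
      and m: "m \<le> n1 * n2 * n3"
    for \<beta> \<mu>0 \<mu>1 k1 k2 \<epsilon> :: real and n1 n2 n3 m and X U S V
  proof -
    note rc = restart_conditions[OF k \<epsilon> \<gamma>]
    note pos = tensor_nonzero_dims[OF X]
    define B where "B = real (max n1 n2) * real n3"
    define L where "L = ln B"
    define x where "x = \<mu>0 * real (rank_ct X) / \<epsilon>\<^sup>2 * sqrt L"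
    define y where "y = \<mu>1 * real (rank_ct X) * condition_number X / \<epsilon> * sqrt (real (min n1 n2)) * ln (real (max n1 (max n2 n3)))"
    have "1 \<le> max n1 n2 * n3" using pos by (simp add: Suc_le_eq)
    then have "real 1 \<le> real (max n1 n2 * n3)" by (simp only: of_nat_le_iff)
    then have B: "1 \<le> B" by (simp only: B_def of_nat_mult of_nat_1)
    then have L: "0 \<le> L" by (simp add: L_def)
    obtain \<sigma> :: real where "1 \<le> condition_number X" using smallest_singular_value[OF X(1) pos(3) X(2) sk] by metis
    moreover have "0 \<le> ln (real (max n1 (max n2 n3)))" using n by (intro ln_ge_zero) linarith
    ultimately have xy: "0 \<le> x" "0 \<le> y" using \<mu>0 \<mu>1 \<epsilon> L by (auto simp: x_def y_def)
    \<comment> \<open>Both \<open>1 + \<epsilon>\<close> and \<open>sqrt \<beta>\<close> are at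
      least 1, so \<open>y\<close> lies below the second entry of the maximum.\<close>
    have "y * 1 * 1 \<le> y * (1 + \<epsilon>) * sqrt \<beta>" using xy \<epsilon> \<beta> by (intro mult_mono) auto
    then have y: "y \<le> \<mu>1 * real (rank_ct X) * (1 + \<epsilon>) * condition_number X * sqrt \<beta> / \<epsilon> * sqrt (real (min n1 n2)) * ln (real (max n1 (max n2 n3)))"
      by (simp add: y_def mult_ac)
    have up: "10 ^ 9 * z * (B * sqrt L) \<le> real m"
      if z: "0 \<le> z" "z \<le> max x (\<mu>1 * real (rank_ct X) * (1 + \<epsilon>) * condition_number X * sqrt \<beta> / \<epsilon> * sqrt (real (min n1 n2)) * ln (real (max n1 (max n2 n3))))" (is "z \<le> ?max") for z
    proof -
      have "10 ^ 9 * z * (B * sqrt L) \<le> 10 ^ 9 * ?max * (B * sqrt L)"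
        using z(2) B L by (intro mult_right_mono mult_left_mono) auto
      also have "\<dots> * 1 \<le> 10 ^ 9 * ?max * (B * sqrt L) * \<beta>"
        using order_trans[OF z] B L \<beta> by (intro mult_left_mono mult_nonneg_nonneg) auto
      also have "\<dots> \<le> real m" using I by (simp only: x_def L_def B_def mult_ac)
      finally show ?thesis by simp
    qed
    have I1: "10 ^ 9 * (\<mu>0 * real (rank_ct X) / \<epsilon>\<^sup>2) * (B * L) \<le> real m"
    proof -
      \<comment> \<open>The root of the logarithm inside the maximum and the one outside combine to
        the full logarithm \<open>L\<close>.\<close>
      have "10 ^ 9 * (\<mu>0 * real (rank_ct X) / \<epsilon>\<^sup>2) * (B * (sqrt L * sqrt L)) = 10 ^ 9 * x * (B * sqrt L)"
        by (simp only: x_def mult_ac)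
      moreover have "sqrt L * sqrt L = L" using L by simp
      ultimately have eq: "10 ^ 9 * (\<mu>0 * real (rank_ct X) / \<epsilon>\<^sup>2) * (B * L) = 10 ^ 9 * x * (B * sqrt L)" by (simp only:)
      show ?thesis unfolding eq by (rule up[OF xy(1) max.cobounded1])
    qed
    have I2: "10 ^ 9 * y * (B * sqrt L) \<le> real m" using up[of y] xy y by (simp add: max.coboundedI2)
    have "1 - 12 / B \<le> measure_pmf.prob (uniform_samples m n1 n2 n3) {\<Omega>. rcg_succeeds (rank_t X) k1 k2 (real m / (real n1 * real n2 * real n3)) X \<Omega>}"
      by (rule success_probability[OF X sk \<mu>0 \<mu>1 n k(1) rc(1) k(2) rc(3) \<epsilon>(1) rc(2) m _ B_def L_def I1 I2[unfolded y_def]]) simp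
    then show ?thesis using B by (simp add: B_def[symmetric] powr_minus_divide)
  qed
  show ?thesis
    \<comment> \<open>The constants are \<open>C = 10 ^ 9\<close>, \<open>c1 = 12\<close> and
      \<open>c2 = 1\<close>, the same for every \<beta>.\<close>
    by (rule exI[of _ "10 ^ 9"], intro conjI allI impI, simp, rule exI[of _ 12], rule exI[of _ 1], intro conjI allI impI, simp, simp,
        hypsubst, rule main) (assumption | linarith)+
qed

end
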